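(* Let $q,\tilde q\in L^2(\mathbb{R}_+)$, and let $f_q,f_{\tilde q}$ be the Schur functions of the corresponding Dirac operators $\mathcal D_q$, $\mathcal D_{\tilde q}$. Then $$c_{1}\|q - \tilde q\|_{L^1_{2A}(\mathbb{R}_+)} \le \|f_{q} - f_{\tilde q}\|_{W^1_{A}(\mathbb{R}_+)}\le c_2\|q - \tilde q\|_{L^1_{2A}(\mathbb{R}_+)}$$ for $c_1=\sqrt{\pi/2}$, $c_2=2\sqrt{2\pi}$ and any $A\ge 12\max\big(\|q\|_{L^2(\mathbb{R}_+)}^2,\|\tilde q\|_{L^2(\mathbb{R}_+)}^2\big)$.
   Context: $\mathbb{R}_+=[0,\infty)$, $\mathbb{C}_+=\{z\in\mathbb{C}:\operatorname{Im} z>0\}$. For a complex-valued $q\in L^2(\mathbb{R}_+)$ put $J=\begin{pmatrix}0&-1\\ 1&0\end{pmatrix}$, $Q=\begin{pmatrix}\operatorname{Im} q&\operatorname{Re} q\\ \operatorname{Re} q&-\operatorname{Im} q\end{pmatrix}$, and let $N(x,z)=\begin{pmatrix}n_{11}&n_{12}\\ n_{21}&n_{22}\end{pmatrix}$ be the (locally absolutely continuous in $x$) solution of $JN'(x,z)+Q(x)N(x,z)=zN(x,z)$, $N(0,z)=\begin{pmatrix}1&0\\ 0&1\end{pmatrix}$, $z\in\mathbb{C}$. The Weyl function of the Dirac operator $\mathcal D_q:X\mapsto JX'+QX$ (with the boundary condition that the second component of $X(0)$ vanishes) is $m_q(z)=\lim_{x\to+\infty}n_{22}(x,z)/n_{21}(x,z)$,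 $\operatorname{Im}z>0$; the limit exists and $m_q$ is analytic from $\mathbb{C}_+$ to $\mathbb{C}_+$. The Schur function $f_q$ of $\mathcal D_q$ is defined by $m_q=i\frac{1+f_q}{1-f_q}$; it is analytic in $\mathbb{C}_+$ with $|f_q|\le1$, and the same letter denotes its nontangential boundary values on $\mathbb{R}$. It is known that for $q\in L^2(\mathbb{R}_+)$ one has $\log(1-|f_q|^2)\in L^1(\mathbb{R})$, so that $f_q\in L^2(\mathbb{R})$ and its Fourier transform $\hat f_q\in L^2(\mathbb{R})$ is well defined, where $\hat f(\xi)=\frac{1}{\sqrt{2\pi}}\int_{\mathbb{R}}f(x)e^{-i\xi x}dx$ for integrable $f$. The norms are $$\|f\|_{W^1_A(\mathbb{R}_+)}=\int_{\mathbb{R}_+}|\hat f(\xi)|e^{-A\xi}\,d\xi,\qquad \|q\|_{L^1_A(\mathbb{R}_+)}=\int_{\mathbb{R}_+}|q(\xi)|e^{-A\xi}\,d\xi.$$ *)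

theory Defs
  imports "HOL-Analysis.Analysis"
begin

section \<open>Function spaces and norms\<close>

text \<open>
  Functions on the half-line are represented by total functions on the reals, of which only the
  values on \<open>{0..}\<close> matter.  \<open>L2_fun M\<close> consists of functions, not of classes modulo null sets.
\<close>

definition L2_fun :: "'a measure \<Rightarrow> ('a \<Rightarrow> complex) set" where
  "L2_fun M = {f. f \<in> borel_measurable M \<and> integrable M (\<lambda>x. (cmod (f x))\<^sup>2)}"

definition L2norm :: "'a measure \<Rightarrow> ('a \<Rightarrow> complex) \<Rightarrow> real" where
  "L2norm M f = sqrt (\<integral>x. (cmod (f x))\<^sup>2 \<partial>M)"

text \<open>The weighted norms take values in \<^typ>\<open>ennreal\<close>, so that divergence is not read as \<open>0\<close>.\<close>

definition L1_weighted_norm :: "real \<Rightarrow> (real \<Rightarrow> complex) \<Rightarrow> ennreal" where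
  "L1_weighted_norm A q =
     (\<integral>\<^sup>+\<xi>. ennreal (cmod (q \<xi>) * exp (- A * \<xi>)) \<partial>lebesgue_on {0..})"


section \<open>The Fourier transform\<close>

definition fourier_L1 :: "(real \<Rightarrow> complex) \<Rightarrow> real \<Rightarrow> complex" where
  "fourier_L1 f \<xi> =
     complex_of_real (1 / sqrt (2 * pi)) *
     (\<integral>x. f x * exp (- \<i> * complex_of_real x * complex_of_real \<xi>) \<partial>lebesgue)"

definition L2_tendsto :: "(nat \<Rightarrow> real \<Rightarrow> complex) \<Rightarrow> (real \<Rightarrow> complex) \<Rightarrow> bool" where
  "L2_tendsto F f \<longleftrightarrow>
     (\<lambda>n. \<integral>\<^sup>+x. ennreal ((cmod (F n x - f x))\<^sup>2) \<partial>lebesgue) \<longlonglongrightarrow> 0"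

text \<open>
  The Fourier transform on \<open>L\<^sup>2\<close> is the \<open>L\<^sup>2\<close>-continuous extension of \<^const>\<open>fourier_L1\<close> from
  \<open>L\<^sup>1 \<inter> L\<^sup>2\<close>.  It is determined up to a null set, so \<open>fourier_L2\<close> picks one representative.
\<close>

definition is_fourier_L2 :: "(real \<Rightarrow> complex) \<Rightarrow> (real \<Rightarrow> complex) \<Rightarrow> bool" where
  "is_fourier_L2 f g \<longleftrightarrow>
     f \<in> L2_fun lebesgue \<and> g \<in> L2_fun lebesgue \<and>
     (\<forall>F. (\<forall>n. integrable lebesgue (F n) \<and> F n \<in> L2_fun lebesgue) \<and> L2_tendsto F f
        \<longrightarrow> L2_tendsto (\<lambda>n. fourier_L1 (F n)) g)"

definition fourier_L2 :: "(real \<Rightarrow> complex) \<Rightarrow> real \<Rightarrow> complex" where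
  "fourier_L2 f = (SOME g. is_fourier_L2 f g)"

definition W1_norm :: "real \<Rightarrow> (real \<Rightarrow> complex) \<Rightarrow> ennreal" where
  "W1_norm A f =
     (\<integral>\<^sup>+\<xi>. ennreal (cmod (fourier_L2 f \<xi>) * exp (- A * \<xi>)) \<partial>lebesgue_on {0..})"


section \<open>The Dirac system and its fundamental solution\<close>

definition absolutely_continuous_on_interval ::
    "real \<Rightarrow> real \<Rightarrow> (real \<Rightarrow> 'a::metric_space) \<Rightarrow> bool" where
  "absolutely_continuous_on_interval a b f \<longleftrightarrow>
     (\<forall>\<epsilon>>0. \<exists>\<delta>>0. \<forall>(n::nat) u v.
        (\<forall>i<n. a \<le> u i \<and> u i \<le> v i \<and> v i \<le> b) \<and>
        disjoint_family_on (\<lambda>i. {u i<..<v i}) {..<n} \<and>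
        (\<Sum>i<n. v i - u i) < \<delta>
        \<longrightarrow> (\<Sum>i<n. dist (f (u i)) (f (v i))) < \<epsilon>)"

definition Jmat :: "complex^2^2" where
  "Jmat = vector [vector [0, -1], vector [1, 0]]"

definition Qmat :: "complex \<Rightarrow> complex^2^2" where
  "Qmat w = vector [vector [complex_of_real (Im w), complex_of_real (Re w)],
                    vector [complex_of_real (Re w), - complex_of_real (Im w)]]"

text \<open>Here \<open>mat z\<close> is \<open>z\<close> times the identity matrix, so \<open>mat z ** N x\<close> is the scalar multiple.\<close>

definition is_dirac_solution ::
    "(real \<Rightarrow> complex) \<Rightarrow> complex \<Rightarrow> (real \<Rightarrow> complex^2^2) \<Rightarrow> bool" where
  "is_dirac_solution q z N \<longleftrightarrow>
     (\<forall>b>0. absolutely_continuous_on_interval 0 b N) \<and>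
     N 0 = mat 1 \<and>
     (AE x in lebesgue_on {0<..}. \<exists>N'. (N has_vector_derivative N') (at x) \<and>
        Jmat ** N' + Qmat (q x) ** N x = mat z ** N x)"

text \<open>The solution is unique on \<open>{0..}\<close>; its values elsewhere are arbitrary and never used.\<close>

definition dirac_solution :: "(real \<Rightarrow> complex) \<Rightarrow> real \<Rightarrow> complex \<Rightarrow> complex^2^2" where
  "dirac_solution q x z = (SOME N. is_dirac_solution q z N) x"


section \<open>Weyl function and Schur function\<close>

definition weyl_function :: "(real \<Rightarrow> complex) \<Rightarrow> complex \<Rightarrow> complex" where
  "weyl_function q z =
     Lim at_top (\<lambda>x. dirac_solution q x z $ 2 $ 2 / dirac_solution q x z $ 2 $ 1)"

definition schur_function :: "(real \<Rightarrow> complex) \<Rightarrow> complex \<Rightarrow> complex" where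
  "schur_function q z = (THE w. w \<noteq> 1 \<and> weyl_function q z = \<i> * (1 + w) / (1 - w))"

definition stolz_angle :: "real \<Rightarrow> real \<Rightarrow> complex set" where
  "stolz_angle \<alpha> t = {z. Im z > 0 \<and> \<bar>Re z - t\<bar> < \<alpha> * Im z}"

text \<open>The value is meaningful at those \<open>t\<close> (almost all, for bounded analytic \<open>f\<close>) where the
  nontangential limit exists.\<close>

definition nontangential_value :: "(complex \<Rightarrow> complex) \<Rightarrow> real \<Rightarrow> complex" where
  "nontangential_value f t =
     (THE w. \<forall>\<alpha>>0. (f \<longlongrightarrow> w) (at (complex_of_real t) within stolz_angle \<alpha> t))"

definition schur_boundary :: "(real \<Rightarrow> complex) \<Rightarrow> real \<Rightarrow> complex" where
  "schur_boundary q = nontangential_value (schur_function q)"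

end

theory Submission
  imports Defs "HOL-Complex_Analysis.Complex_Analysis"
begin

text \<open>
  The idea is that the Schur function is, to first order in the potential, a Fourier integral of the potential, and that
  the weight \<open>exp (- A xi)\<close> makes the remainder small relative to the difference of two potentials.

  With \<open>u = n\<^sub>1\<^sub>1 + \<i> n\<^sub>2\<^sub>1\<close> and \<open>v = n\<^sub>1\<^sub>1 - \<i> n\<^sub>2\<^sub>1\<close> the Dirac system becomes \<open>u' = - \<i> z u - cnj q v\<close>,
  \<open>v' = \<i> z v - q u\<close>.  Cutting the potential off at \<open>X\<close> gives a rational expression \<open>schur_trunc X\<close> in the
  solutions, and the growth of \<open>|u|^2 - |v|^2\<close> shows that these converge exponentially fast to the Schur function
  (\<open>schur_trunc_dist\<close>, \<open>schur_function_eq\<close>).  Choose the solution with \<open>u X = 0\<close> and \<open>v 0 = 1\<close>, so that \<open>u 0\<close> is the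
  truncated Schur function.  The Wronskian of two such solutions for potentials \<open>q\<close> and \<open>q'\<close> yields
  \<open>f - f' = \<integral> (cnj \<Delta> v v' - \<Delta> u u')\<close> with \<open>\<Delta> = q - q'\<close>.  Writing \<open>v = P exp (\<i> z x)\<close> and \<open>u = R exp (\<i> z x)\<close>,
  the leading term is \<open>H z = \<integral> cnj (\<Delta> x) exp (2 \<i> z x)\<close>.

  Errors are measured at \<open>\<i> (A + s)\<close> by the sum of the first normalized Taylor coefficients with radius \<open>s\<close>
  (\<open>taylor_norm\<close>).  This quantity is submultiplicative, it passes through integrals, and \<open>exp (2 \<i> z x)\<close> has size at most
  \<open>exp (- 2 A x)\<close>.  For \<open>A \<ge> 12 \<parallel>q\<parallel>^2\<close> the integral equations for \<open>P\<close> and \<open>R\<close> give \<open>|P - 1| \<le> 1/23\<close> and \<open>|R| \<le> 4/23\<close>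
  in this sense, so \<open>f - f' - H\<close> is at most half of \<open>\<integral> |\<Delta> x| exp (- 2 A x)\<close> (\<open>schur_difference_taylor\<close>).

  To turn this into a statement about the Fourier transform, the Schur function is shown to be of Hardy class, hence the
  Cauchy integral of its square integrable boundary values, hence the Laplace transform of the Fourier transform of these
  values (\<open>schur_H2\<close>, \<open>boundary_function\<close>, \<open>fourier_L2_half_plane\<close>).  Thus \<open>f - f' - H\<close> is the Laplace transform of
  some square integrable \<open>k\<close>.  Its Taylor coefficients at \<open>\<i> (A + s)\<close> are the integrals of \<open>k xi exp (- A xi)\<close> against
  the Poisson weights with parameter \<open>s xi\<close>, and since the Szasz operators built from these weights approximate every
  continuous function as \<open>s\<close> grows, a bound uniform in \<open>s\<close> bounds \<open>\<integral> |k xi| exp (- A xi)\<close>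
  (\<open>L1_norm_by_poisson_weights\<close>).  The triangle inequality then leaves factors between one half and two.
\<close>

abbreviation cof :: "real \<Rightarrow> complex" where "cof \<equiv> complex_of_real"

abbreviation nn_lborel :: "(real \<Rightarrow> ennreal) \<Rightarrow> ennreal" (binder "NN " 10) where "nn_lborel f \<equiv> nn_integral lborel f"

abbreviation (input) seq_limit :: "(nat \<Rightarrow> 'a::topological_space) \<Rightarrow> 'a \<Rightarrow> bool" (infixr "\<leadsto>" 60) where
  "X \<leadsto> L \<equiv> (X \<longlongrightarrow> L) sequentially"

lemmas LINT_cong = Bochner_Integration.integral_cong
lemmas integrable_dominated = Bochner_Integration.integrable_bound
lemmas LINT_nonneg = Bochner_Integration.integral_nonneg
lemmas LINT_diff = Bochner_Integration.integral_diff
lemmas LINT_add = Bochner_Integration.integral_add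
lemmas integrable_plus = Bochner_Integration.integrable_add

section \<open>Absolutely continuous functions and indefinite integrals\<close>

text \<open>The Lebesgue form of the fundamental theorem.  On the exceptional null set the tags of a fine partition are controlled by absolute continuity, on its complement by differentiability.\<close>
lemma has_integral_derivative_absolutely_continuous:
 fixes F :: "real => 'a::banach"
 assumes ab: "a <= b"
 and ac: "absolutely_continuous_on_interval a b F"
 and N: "negligible N"
 and der: "\<And>x. x \<in> {a<..<b} - N ==> (F has_vector_derivative f x) (at x)"
 shows "(f has_integral F b - F a) {a..b}"
proof -
 define N' where "N' = N \<union> {a, b}"
 define g where "g x = (if x \<in> N' then 0 else f x)" for x
 have N': "negligible N'"
 unfolding N'_def using N by (auto intro: negligible_Un)
 have "(g has_integral F b - F a) {a..b}"
 unfolding has_integral_real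
 proof (intro allI impI)
 fix e :: real assume e: "e > 0"
 define e1 where "e1 = e / (2 * (b - a + 1))"
 have e1: "e1 > 0" using e ab by (simp add: e1_def)
 from ac obtain \<delta> where \<delta>: "\<delta> > 0" and
 ac': "\<And>n u v. (\<forall>i<n. a <= u i & u i <= v i & v i <= b) &
 disjoint_family_on (%i. {u i<..<v i}) {..<n} & (\<Sum>i<n. v i - u i) < \<delta>
 ==> (\<Sum>i<(n::nat). dist (F (u i)) (F (v i))) < e / 2"
 unfolding absolutely_continuous_on_interval_def using half_gt_zero[OF e] by blast
 have N'l: "N' \<in> null_sets lebesgue" using N' by (simp add: negligible_iff_null_sets)
 then have N's: "N' \<in> sets lebesgue" by auto
 obtain U where U: "open U" "N' \<subseteq> U" "U - N' \<in> lmeasurable" "emeasure lebesgue (U - N') < ennreal \<delta>"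
 using sets_lebesgue_outer_open[OF N's \<delta>] by blast
 have "emeasure lebesgue U <= emeasure lebesgue (U - N') + emeasure lebesgue N'"
 proof -
 have "U = (U - N') \<union> N'" using U by auto
 then show ?thesis using emeasure_subadditive[of "U - N'" lebesgue N'] U N's
 by (metis fmeasurableD)
 qed
 also have "emeasure lebesgue N' = 0" using N'l by auto
 finally have Um: "emeasure lborel U < ennreal \<delta>" using U by simp
 have ex: "\<exists>d>0. (x \<in> N' --> ball x d \<subseteq> U) & (x \<in> {a<..<b} - N -->
 (\<forall>y. norm (y-x) < d --> norm (F y - F x - (y-x) *\<^sub>R f x) <= e1 * norm (y-x)))" for x
 proof (cases "x \<in> N'")
 case True
 then have "x \<in> U" using U by auto
 then obtain d where "d > 0" "ball x d \<subseteq> U" using U(1) open_contains_ball by blast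
 then show ?thesis using True by (intro exI[of _ d]) (auto simp: N'_def)
 next
 case False
 then show ?thesis
 proof (cases "x \<in> {a<..<b} - N")
 case True
 from der[OF True] e1 obtain d where "d > 0"
 "\<And>y. norm (y-x) < d ==> norm (F y - F x - (y-x) *\<^sub>R f x) <= e1 * norm (y-x)"
 unfolding has_vector_derivative_def has_derivative_at_alt by blast
 then show ?thesis using False by (intro exI[of _ d]) auto
 next
 case False2: False
 then show ?thesis using False by (intro exI[of _ 1]) auto
 qed
 qed
 then obtain d where d: "\<And>x. d x > 0" "\<And>x. x \<in> N' ==> ball x (d x) \<subseteq> U"
 "\<And>x y. [|x \<in> {a<..<b} - N; norm (y-x) < d x|] ==> norm (F y - F x - (y-x) *\<^sub>R f x) <= e1 * norm (y-x)"
 by metis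
 show "\<exists>\<gamma>. gauge \<gamma> & (\<forall>\<D>. \<D> tagged_division_of {a..b} & \<gamma> fine \<D> -->
 norm ((\<Sum>(x, k)\<in>\<D>. measure lborel k *\<^sub>R g x) - (F b - F a)) < e)"
 proof (rule exI, safe)
 show "gauge (%x. ball x (d x))" using d(1) gauge_ball_dependent by blast
 next
 fix p assume p: "p tagged_division_of {a..b}" and fine: "(%x. ball x (d x)) fine p"
 have fin: "finite p" using p by auto
 have telF: "F b - F a = (\<Sum>(x,K)\<in>p. F (Sup K) - F (Inf K))"
 and telx: "b - a = (\<Sum>(x,K)\<in>p. Sup K - Inf K)"
 using additive_tagged_division_1[OF ab p, of F, symmetric] additive_tagged_division_1[OF ab p, of "%x. x", symmetric]
 by this+
 have cell: "\<exists>u v. K = {u..v} & u <= x & x <= v & a <= u & v <= b & K \<subseteq> ball x (d x)" if xK: "(x,K) \<in> p" for x K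
 proof -
 obtain u v where K: "K = cbox u v" using tagged_division_ofD(4)[OF p xK] by blast
 have x: "x \<in> K" "K \<subseteq> {a..b}" using tagged_division_ofD(2,3)[OF p xK] .
 have fK: "K \<subseteq> ball x (d x)" using fine xK unfolding fine_def by blast
 have "u <= x" "x <= v" using x(1) K by auto
 moreover have "u \<in> K" "v \<in> K" using x(1) K by auto
 ultimately show ?thesis using K x fK by (intro exI[of _ u] exI[of _ v]) (auto simp only: cbox_interval atLeastAtMost_iff subset_iff)
 qed
 define p1 where "p1 = {(x,K)\<in>p. x \<in> N'}"
 define p2 where "p2 = {(x,K)\<in>p. x \<notin> N'}"
 have pp: "p = p1 \<union> p2" "p1 \<inter> p2 = {}" "finite p1" "finite p2"
 using fin by (auto simp: p1_def p2_def intro: finite_subset[OF _ fin])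
 let ?T = "%(x,K). measure lborel K *\<^sub>R g x - (F (Sup K) - F (Inf K))"
 have "(\<Sum>(x, k)\<in>p. measure lborel k *\<^sub>R g x) - (F b - F a) = (\<Sum>z\<in>p. ?T z)"
 unfolding telF by (simp add: sum_subtractf split_def)
 also have "\<dots> = (\<Sum>z\<in>p1. ?T z) + (\<Sum>z\<in>p2. ?T z)"
 using pp by (simp add: sum.union_disjoint)
 finally have eq: "(\<Sum>(x, k)\<in>p. measure lborel k *\<^sub>R g x) - (F b - F a) = (\<Sum>z\<in>p1. ?T z) + (\<Sum>z\<in>p2. ?T z)" .
 have b2: "norm (\<Sum>z\<in>p2. ?T z) <= (\<Sum>z\<in>p2. e1 * (case z of (x,K) => Sup K - Inf K))"
 proof (rule sum_norm_le)
 fix z assume z: "z \<in> p2"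
 obtain x K where zx: "z = (x,K)" by force
 then have xp: "(x,K) \<in> p" "x \<notin> N'" using z by (auto simp: p2_def)
 from cell[OF xp(1)] obtain u v where K: "K = {u..v}" "u <= x" "x <= v" "a <= u" "v <= b" "K \<subseteq> ball x (d x)" by blast
 have xin: "x \<in> {a<..<b} - N" using xp K by (auto simp: N'_def)
 have "u \<in> K" "v \<in> K" using K(1-3) by auto
 then have "u \<in> ball x (d x)" "v \<in> ball x (d x)" using K(6) by blast+
 then have nu: "norm (u - x) < d x" "norm (v - x) < d x" by (auto simp: dist_norm norm_minus_commute)
 have "?T z = (F u - F x - (u-x) *\<^sub>R f x) - (F v - F x - (v-x) *\<^sub>R f x)"
 using K xp zx by (simp add: g_def algebra_simps)
 also have "norm \<dots> <= e1 * norm (u-x) + e1 * norm (v-x)"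
 using d(3)[OF xin nu(1)] d(3)[OF xin nu(2)] norm_triangle_ineq4 by (meson add_mono order_trans)
 also have "\<dots> = e1 * (v - u)" using K by (simp add: algebra_simps)
 finally show "norm (?T z) <= e1 * (case z of (x,K) => Sup K - Inf K)" using zx K by simp
 qed
 also have "\<dots> <= (\<Sum>z\<in>p. e1 * (case z of (x,K) => Sup K - Inf K))"
 proof (rule sum_mono2[OF fin])
 fix z assume "z \<in> p - p2"
 moreover obtain x K where zx: "z = (x,K)" by (cases z)
 ultimately have "(x,K) \<in> p" by simp
 from cell[OF this] show "0 <= e1 * (case z of (x,K) => Sup K - Inf K)" using zx e1 by auto
 qed (use pp in auto)
 also have "\<dots> = e1 * (b - a)" by (simp add: telx sum_distrib_left)
 also have "\<dots> < e / 2" using e ab by (simp add: e1_def field_simps)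
 finally have B2: "norm (\<Sum>z\<in>p2. ?T z) < e / 2" .
 obtain h n where h: "bij_betw h {..<n::nat} p1"
 using ex_bij_betw_nat_finite[OF pp(3)] by (auto simp: atLeast0LessThan)
 define u where "u i = Inf (snd (h i))" for i
 define v where "v i = Sup (snd (h i))" for i
 have hp: "h i \<in> p1" if "i < n" for i using h that by (auto simp: bij_betw_def)
 have uv: "a <= u i & u i <= v i & v i <= b & {u i..v i} = snd (h i) & snd (h i) \<subseteq> U" if i: "i < n" for i
 proof -
 obtain x K where zx: "h i = (x,K)" "(x,K) \<in> p" "x \<in> N'" using hp[OF i] by (cases "h i") (auto simp: p1_def)
 from cell[OF this(2)] obtain s t where K: "K = {s..t}" "s <= x" "x <= t" "a <= s" "t <= b" "K \<subseteq> ball x (d x)" by blast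
 then show ?thesis using d(2)[OF zx(3)] zx(1) unfolding u_def v_def by auto
 qed
 have disj: "disjoint_family_on (%i. {u i<..<v i}) {..<n}"
 unfolding disjoint_family_on_def
 proof (intro ballI impI)
 fix i j assume ij: "i \<in> {..<n}" "j \<in> {..<n}" "i \<noteq> j"
 then have "h i \<noteq> h j" using h by (auto simp: bij_betw_def inj_on_def)
 moreover have "h i \<in> p" "h j \<in> p" using hp ij pp by auto
 ultimately have "interior (snd (h i)) \<inter> interior (snd (h j)) = {}"
 using tagged_division_ofD(5)[OF p, of "fst (h i)" "snd (h i)" "fst (h j)" "snd (h j)"] by simp
 moreover have "{u i<..<v i} = interior (snd (h i))" "{u j<..<v j} = interior (snd (h j))"
 using uv[of i] uv[of j] ij interior_atLeastAtMost_real by (metis lessThan_iff)+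
 ultimately show "{u i<..<v i} \<inter> {u j<..<v j} = {}" by simp
 qed
 have "ennreal (\<Sum>i<n. v i - u i) = (\<Sum>i<n. emeasure lborel {u i<..<v i})"
 using uv by (subst sum_ennreal[symmetric]) (auto intro!: sum.cong)
 also have "\<dots> = emeasure lborel (\<Union>i<n. {u i<..<v i})"
 by (rule sum_emeasure) (use disj in auto)
 also have "\<dots> <= emeasure lborel U"
 proof (rule emeasure_mono)
 show "(\<Union>i<n. {u i<..<v i}) \<subseteq> U"
 proof safe
 fix x i assume "i < n" "x \<in> {u i<..<v i}"
 then have "x \<in> {u i..v i}" by auto
 then show "x \<in> U" using uv[OF \<open>i < n\<close>] by auto
 qed
 qed (use U in auto)
 also have "\<dots> < ennreal \<delta>" by (rule Um)
 finally have "(\<Sum>i<n. v i - u i) < \<delta>"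
 by (subst (asm) ennreal_less_iff) (use uv in \<open>auto intro!: sum_nonneg\<close>)
 then have small: "(\<Sum>i<n. dist (F (u i)) (F (v i))) < e / 2"
 using uv disj by (intro ac') auto
 have "norm (\<Sum>z\<in>p1. ?T z) = norm (\<Sum>i<n. ?T (h i))"
 using sum.reindex_bij_betw[OF h, of ?T] by simp
 also have "\<dots> <= (\<Sum>i<n. dist (F (u i)) (F (v i)))"
 proof (rule sum_norm_le)
 fix i assume "i \<in> {..<n}"
 then obtain x K where zx: "h i = (x,K)" "x \<in> N'" using hp[of i] by (cases "h i") (auto simp: p1_def)
 then show "norm (?T (h i)) <= dist (F (u i)) (F (v i))"
 by (simp add: g_def u_def v_def dist_norm norm_minus_commute)
 qed
 finally have "norm (\<Sum>z\<in>p1. ?T z) < e / 2" using small by linarith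
 then show "norm ((\<Sum>(x, k)\<in>p. measure lborel k *\<^sub>R g x) - (F b - F a)) < e"
 unfolding eq using B2 by (intro norm_triangle_lt) linarith
 qed
 qed
 then show ?thesis
 using has_integral_spike[OF N', of "{a..b}" f g] by (auto simp: g_def)
qed

lemma absolutely_continuous_dominated:
 fixes F :: "real => 'a::metric_space" and w :: "real => real"
 assumes w: "set_integrable lborel {a..b} w"
 and dom: "\<And>u v. a <= u ==> u <= v ==> v <= b ==> dist (F u) (F v) <= (LBINT t:{u..v}. w t)"
 shows "absolutely_continuous_on_interval a b F"
proof -
 define W where "W t = indicator {a..b} t * \<bar>w t\<bar>" for t
 have Wint: "integrable lborel W"
 using integrable_abs[OF w[unfolded set_integrable_def]] by (simp add: W_def[abs_def] abs_mult)
 have W0: "W t >= 0" for t by (simp add: W_def)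
 have [measurable]: "W \<in> borel_measurable lborel" using Wint by auto
 show ?thesis unfolding absolutely_continuous_on_interval_def
 proof (intro allI impI)
 fix e :: real assume e: "e > 0"
 have lim: "(%n. LBINT t. indicator {t. W t > real n} t * W t) \<leadsto> (LBINT t::real. 0)"
 proof (rule integral_dominated_convergence[where w = W])
 show "AE t in lborel. (%n. indicator {t. W t > real n} t * W t) \<leadsto> 0"
 proof (rule AE_I2)
 fix t
 obtain m :: nat where m: "W t <= real m" using real_arch_simple by blast
 have "eventually (%n. indicator {t. W t > real n} t * W t = 0) sequentially"
 using eventually_ge_at_top[of m] by eventually_elim (use m in \<open>auto simp: indicator_def\<close>)
 then show "(%n. indicator {t. W t > real n} t * W t) \<leadsto> 0" by (rule tendsto_eventually)
 qed
 qed (use Wint W0 in \<open>auto simp: indicator_def\<close>)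
 then obtain n :: nat where n: "(LBINT t. indicator {t. W t > real n} t * W t) < e / 2"
 using order_tendstoD(2)[OF lim, of "e/2"] e by (auto simp: eventually_sequentially)
 define \<delta> where "\<delta> = e / (2 * (real n + 1))"
 have \<delta>: "\<delta> > 0" using e by (simp add: \<delta>_def)
 show "\<exists>\<delta>>0. \<forall>(n::nat) u v.
 (\<forall>i<n. a <= u i & u i <= v i & v i <= b) &
 disjoint_family_on (%i. {u i<..<v i}) {..<n} &
 (\<Sum>i<n. v i - u i) < \<delta> --> (\<Sum>i<n. dist (F (u i)) (F (v i))) < e"
 proof (intro exI[of _ \<delta>] conjI allI impI \<delta>; elim conjE)
 fix m :: nat and u v :: "nat => real"
 assume uv: "\<forall>i<m. a <= u i & u i <= v i & v i <= b"
 and disj: "disjoint_family_on (%i. {u i<..<v i}) {..<m}" and sm: "(\<Sum>i<m. v i - u i) < \<delta>"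
 let ?S = "\<Union>i<m. {u i<..<v i}"
 have ind: "(\<Sum>i<m. indicator {u i<..<v i} t :: real) <= 1" for t
 proof -
 have "(\<Sum>i<m. indicator {u i<..<v i} t :: real) = indicator (\<Union>i<m. {u i<..<v i}) t"
 using disj by (subst indicator_UN_disjoint) auto
 then show ?thesis by (simp only: indicator_le_1)
 qed
 have "dist (F (u i)) (F (v i)) <= (LBINT t. indicator {u i<..<v i} t * W t)" if i: "i < m" for i
 proof -
 have "dist (F (u i)) (F (v i)) <= (LBINT t:{u i..v i}. w t)" using uv i by (intro dom) auto
 also have "\<dots> = (LBINT t:{u i<..<v i}. w t)"
 unfolding set_lebesgue_integral_def
 proof (rule integral_cong_AE)
 have "set_integrable lborel {u i..v i} w" "set_integrable lborel {u i<..<v i} w"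
 using uv i by (auto intro!: set_integrable_subset[OF w])
 then show "(%t. indicator {u i..v i} t *\<^sub>R w t) \<in> borel_measurable lborel"
 "(%t. indicator {u i<..<v i} t *\<^sub>R w t) \<in> borel_measurable lborel"
 by (auto simp only: set_integrable_def)
 have "AE t in lborel. t \<noteq> u i" "AE t in lborel. t \<noteq> v i" by (rule AE_lborel_singleton)+
 then show "AE t in lborel. indicator {u i..v i} t *\<^sub>R w t = indicator {u i<..<v i} t *\<^sub>R w t"
 by eventually_elim (auto simp: indicator_def)
 qed
 also have "\<dots> <= (LBINT t. indicator {u i<..<v i} t * W t)"
 unfolding set_lebesgue_integral_def
 proof (rule integral_mono)
 have "set_integrable lborel {u i<..<v i} w"
 by (rule set_integrable_subset[OF w]) (use uv i in auto)
 then show "integrable lborel (%t. indicator {u i<..<v i} t *\<^sub>R w t)" by (simp add: set_integrable_def)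
 show "integrable lborel (%t. indicator {u i<..<v i} t * W t)"
 using Wint by (auto intro: integrable_real_mult_indicator simp: mult.commute)
 show "indicator {u i<..<v i} t *\<^sub>R w t <= indicator {u i<..<v i} t * W t" for t
 using uv i by (fastforce simp: W_def indicator_def)
 qed
 finally show ?thesis .
 qed
 then have "(\<Sum>i<m. dist (F (u i)) (F (v i))) <= (\<Sum>i<m. LBINT t. indicator {u i<..<v i} t * W t)"
 by (intro sum_mono) auto
 also have "\<dots> = (LBINT t. (\<Sum>i<m. indicator {u i<..<v i} t * W t))"
 by (rule Bochner_Integration.integral_sum[symmetric]) (use Wint in \<open>auto intro: integrable_real_mult_indicator simp: mult.commute\<close>)
 also have "\<dots> <= (LBINT t. indicator {t. W t > real n} t * W t + (\<Sum>i<m. real n * indicator {u i<..<v i} t))"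
 proof (rule integral_mono)
 fix t
 show "(\<Sum>i<m. indicator {u i<..<v i} t * W t) <= indicator {t. W t > real n} t * W t + (\<Sum>i<m. real n * indicator {u i<..<v i} t)"
 proof (cases "W t > real n")
 case True
 have "(\<Sum>i<m. indicator {u i<..<v i} t * W t) = (\<Sum>i<m. indicator {u i<..<v i} t) * W t" by (simp add: sum_distrib_right)
 also have "\<dots> <= 1 * W t" by (intro mult_right_mono ind W0)
 finally show ?thesis using True by (auto intro: add_increasing2 sum_nonneg)
 next
 case False
 then show ?thesis by (intro add_increasing sum_mono) (auto simp: indicator_def)
 qed
 next
 show "integrable lborel (%t. \<Sum>i<m. indicator {u i<..<v i} t * W t)"
 by (rule Bochner_Integration.integrable_sum)
 (use Wint in \<open>auto intro: integrable_real_mult_indicator simp: mult.commute\<close>)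
 show "integrable lborel (%t. indicator {t. W t > real n} t * W t + (\<Sum>i<m. real n * indicator {u i<..<v i} t))"
 by (intro integrable_plus Bochner_Integration.integrable_sum integrable_mult_right)
 (use Wint uv in \<open>auto intro: integrable_real_mult_indicator simp: mult.commute\<close>)
 qed
 also have "\<dots> = (LBINT t. indicator {t. W t > real n} t * W t) + (\<Sum>i<m. real n * (v i - u i))"
 proof -
 have "integrable lborel (%t. indicator {t. W t > real n} t * W t)"
 using Wint by (auto intro: integrable_real_mult_indicator simp: mult.commute)
 moreover have "integrable lborel (%t. \<Sum>i<m. real n * indicator {u i<..<v i} t)"
 by (intro Bochner_Integration.integrable_sum integrable_mult_right) (use uv in auto)
 moreover have "(LBINT t. (\<Sum>i<m. real n * indicator {u i<..<v i} t)) = (\<Sum>i<m. real n * (v i - u i))"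
 by (subst Bochner_Integration.integral_sum) (use uv in \<open>auto intro!: sum.cong integrable_mult_right\<close>)
 ultimately show ?thesis by simp
 qed
 also have "\<dots> < e / 2 + real n * \<delta>"
 using n sm by (simp add: sum_distrib_left[symmetric] add_less_le_mono mult_left_mono)
 also have "\<dots> <= e" using e by (simp add: \<delta>_def field_simps)
 finally show "(\<Sum>i<m. dist (F (u i)) (F (v i))) < e" .
 qed
 qed
qed

lemma indefinite_integral_has_vector_derivative_AE:
 fixes f :: "real => 'a::euclidean_space"
 assumes f: "\<And>a b. f integrable_on {a..b}"
 obtains N where "negligible N"
 "\<And>a x. a < x ==> x \<notin> N ==> ((%x. integral {a..x} f) has_vector_derivative f x) (at x)"
proof -
 obtain N1 where N1: "negligible N1"
 "\<And>x e. [|x \<notin> N1; 0 < e|] ==> \<exists>d>0. \<forall>h. 0 < h & h < d --> norm (integral {x..x+h} f /\<^sub>R h - f x) < e"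
 using integrable_ccontinuous_explicit[of f] f by (auto simp: cbox_interval)
 have fm: "(%x. f (-x)) integrable_on cbox a b" for a b
 using f[of "-b" "-a"] integrable_reflect[of f "-a" "-b"] by (simp only: cbox_interval minus_minus)
 obtain N2 where N2: "negligible N2"
 "\<And>x e. [|x \<notin> N2; 0 < e|] ==> \<exists>d>0. \<forall>h. 0 < h & h < d --> norm (integral {x..x+h} (%x. f (-x)) /\<^sub>R h - f (-x)) < e"
 using integrable_ccontinuous_explicit[of "%x. f (-x)"] fm by (auto simp: cbox_interval)
 define N where "N = N1 \<union> uminus ` N2"
 have "negligible N"
 unfolding N_def using N1(1) N2(1)
 by (auto intro!: negligible_Un negligible_differentiable_image_negligible derivative_intros)
 moreover have "((%x. integral {a..x} f) has_vector_derivative f x) (at x)" if ax: "a < x" and x: "x \<notin> N" for a x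
 unfolding has_vector_derivative_def has_derivative_at_alt
 proof (intro conjI allI impI bounded_linear_scaleR_left)
 fix e :: real assume e: "e > 0"
 have x12: "x \<notin> N1" "-x \<notin> N2" using x by (auto simp: N_def image_iff)
 obtain d1 where d1: "d1 > 0" "\<And>h. 0 < h ==> h < d1 ==> norm (integral {x..x+h} f /\<^sub>R h - f x) < e" using N1(2)[OF x12(1) e] by auto
 obtain d2 where d2: "d2 > 0" "\<And>h. 0 < h ==> h < d2 ==> norm (integral {-x..-x+h} (%x. f (-x)) /\<^sub>R h - f x) < e" using N2(2)[OF x12(2) e] by auto
 have key: "norm (D - h *\<^sub>R f x) <= e * h" if "0 < h" "norm (D /\<^sub>R h - f x) < e" for D h
 proof -
 have "D - h *\<^sub>R f x = h *\<^sub>R (D /\<^sub>R h - f x)" using that by (simp add: algebra_simps)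
 also have "norm \<dots> = h * norm (D /\<^sub>R h - f x)" using that by simp
 also have "\<dots> <= h * e" using that by (intro mult_left_mono) auto
 finally show ?thesis by (simp add: mult.commute)
 qed
 show "\<exists>d>0. \<forall>y. norm (y - x) < d --> norm (integral {a..y} f - integral {a..x} f - (y - x) *\<^sub>R f x) <= e * norm (y - x)"
 proof (intro exI[of _ "min (min d1 d2) (x - a)"] conjI allI impI)
 show "0 < min (min d1 d2) (x - a)" using d1 d2 ax by auto
 fix y assume y: "norm (y - x) < min (min d1 d2) (x - a)"
 consider "y = x" | "y > x" | "y < x" by linarith
 then show "norm (integral {a..y} f - integral {a..x} f - (y - x) *\<^sub>R f x) <= e * norm (y - x)"
 proof cases
 case 2
 have "integral {a..y} f - integral {a..x} f = integral {x..y} f"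
 using Henstock_Kurzweil_Integration.integral_combine[of a x y f] ax 2 f by (simp add: algebra_simps)
 then show ?thesis using key[of "y - x" "integral {x..y} f"] d1(2)[of "y - x"] 2 y by simp
 next
 case 3
 have "integral {a..x} f - integral {a..y} f = integral {y..x} f"
 using Henstock_Kurzweil_Integration.integral_combine[of a y x f] ax 3 f y by (simp add: algebra_simps)
 moreover have "integral {-x..-y} (%x. f (-x)) = integral {y..x} f" by simp
 ultimately have "norm ((integral {a..x} f - integral {a..y} f) - (x - y) *\<^sub>R f x) <= e * (x - y)"
 using key[of "x - y" "integral {y..x} f"] d2(2)[of "x - y"] 3 y by simp
 moreover have "integral {a..y} f - integral {a..x} f - (y - x) *\<^sub>R f x = - ((integral {a..x} f - integral {a..y} f) - (x - y) *\<^sub>R f x)"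
 by (simp add: algebra_simps)
 ultimately show ?thesis using 3 by (simp only: norm_minus_cancel) simp
 qed simp
 qed
 qed
 ultimately show ?thesis using that by blast
qed

text \<open>calculus of indefinite integrals\<close>

text \<open>An integrable density together with its primitive on \<open>{0..b}\<close>.  Solutions of the differential equations are handled in this integrated form, which has a product rule and does not mention null sets.\<close>
definition indef_int :: "real => (real => complex) => (real => complex) => bool" where
 "indef_int b F f \<longleftrightarrow> set_integrable lborel {0..b} f &
 (\<forall>u v. 0 <= u --> u <= v --> v <= b --> F v - F u = (LBINT t:{u..v}. f t))"

lemma indef_int_integrable:
 assumes "indef_int b F f" "0 <= u" "v <= b"
 shows "set_integrable lborel {u..v} f"
 by (rule set_integrable_subset[of _ "{0..b}"]) (use assms in \<open>auto simp: indef_int_def\<close>)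

lemma indef_intI:
 assumes "set_integrable lborel {0..b} f"
 "\<And>x. 0 <= x ==> x <= b ==> F x = c + (LBINT t:{0..x}. f t)"
 shows "indef_int b F f"
 unfolding indef_int_def
proof (intro conjI allI impI assms(1))
 fix u v :: real assume uv: "0 <= u" "u <= v" "v <= b"
 have i: "set_integrable lborel {x..y} f" if "0 <= x" "y <= b" for x y
 by (rule set_integrable_subset[OF assms(1)]) (use that in auto)
 have "F v - F u = integral {0..v} f - integral {0..u} f"
 using assms(2)[of u] assms(2)[of v] uv set_borel_integral_eq_integral(2)[OF i[of 0 u]] set_borel_integral_eq_integral(2)[OF i[of 0 v]] by simp
 also have "\<dots> = integral {u..v} f"
 using Henstock_Kurzweil_Integration.integral_combine[of 0 u v f] uv set_borel_integral_eq_integral(1)[OF i[of 0 v]] by (simp add: algebra_simps)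
 also have "\<dots> = (LBINT t:{u..v}. f t)" using set_borel_integral_eq_integral(2)[OF i[of u v]] uv by simp
 finally show "F v - F u = (LBINT t:{u..v}. f t)" .
qed

lemma indef_int_dist_le:
 assumes "indef_int b F f" "0 <= u" "u <= v" "v <= b"
 shows "norm (F v - F u) <= (LBINT t:{u..v}. norm (f t))"
proof -
 have "set_integrable lborel {u..v} f"
 using indef_int_integrable[OF assms(1)] assms by auto
 then show ?thesis using assms unfolding indef_int_def by (simp add: set_integral_norm_bound)
qed

lemma indef_int_ac:
 assumes "indef_int b F f"
 shows "absolutely_continuous_on_interval 0 b F"
proof (rule absolutely_continuous_dominated[where w = "%t. norm (f t)"])
 show "set_integrable lborel {0..b} (%t. norm (f t))" using assms by (auto simp: indef_int_def intro: set_integrable_norm)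
 show "dist (F u) (F v) <= (LBINT t:{u..v}. norm (f t))" if "0 <= u" "u <= v" "v <= b" for u v
 using indef_int_dist_le[OF assms that] by (simp add: dist_norm norm_minus_commute)
qed

lemma indef_int_derivative:
 assumes "indef_int b F f"
 obtains N where "negligible N" "\<And>x. 0 < x ==> x < b ==> x \<notin> N ==> (F has_vector_derivative f x) (at x)"
proof -
 define g where "g x = (if x \<in> {0..b} then f x else 0)" for x
 have fi: "f integrable_on {0..b}" using set_borel_integral_eq_integral(1)[of "{0..b}" f] assms by (simp add: indef_int_def)
 have "g integrable_on UNIV" using fi unfolding g_def[abs_def] by (simp only: integrable_restrict_UNIV)
 then have gi: "g integrable_on {x..y}" for x y by (rule integrable_on_subinterval) auto
 then obtain N where N: "negligible N" "\<And>a x. a < x ==> x \<notin> N ==> ((%x. integral {a..x} g) has_vector_derivative g x) (at x)"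
 using indefinite_integral_has_vector_derivative_AE[of g] by metis
 have "(F has_vector_derivative f x) (at x)" if x: "0 < x" "x < b" "x \<notin> N" for x
 proof -
 have "((%x. F 0 + integral {0..x} g) has_vector_derivative g x) (at x)"
 using N(2)[OF x(1,3)] by (auto intro!: derivative_eq_intros)
 moreover have "F 0 + integral {0..y} g = F y" if "y \<in> {0<..<b}" for y
 proof -
 have "F y - F 0 = (LBINT t:{0..y}. f t)" using assms that by (auto simp: indef_int_def)
 also have "\<dots> = integral {0..y} f"
 by (rule set_borel_integral_eq_integral) (use indef_int_integrable[OF assms] that in auto)
 also have "\<dots> = integral {0..y} g" by (rule integral_cong) (use that in \<open>auto simp: g_def\<close>)
 finally show ?thesis by (simp add: algebra_simps)
 qed
 ultimately have "(F has_vector_derivative g x) (at x)"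
 using has_vector_derivative_transform_within_open[of _ "g x" x "{0<..<b}" F] x by auto
 then show ?thesis using x by (simp add: g_def)
 qed
 then show ?thesis using that N(1) by blast
qed

lemma ac_subinterval:
 assumes "absolutely_continuous_on_interval a b F" "a <= a'" "b' <= b"
 shows "absolutely_continuous_on_interval a' b' F"
 unfolding absolutely_continuous_on_interval_def
proof (intro allI impI)
 fix e :: real assume "e > 0"
 then obtain d where "d > 0" and d: "\<And>n u v. (\<forall>i<(n::nat). a <= u i & u i <= v i & v i <= b) &
 disjoint_family_on (%i. {u i<..<v i}) {..<n} & (\<Sum>i<n. v i - u i) < d
 ==> (\<Sum>i<n. dist (F (u i)) (F (v i))) < e"
 using assms(1) unfolding absolutely_continuous_on_interval_def by blast
 then show "\<exists>d>0. \<forall>(n::nat) u v. (\<forall>i<n. a' <= u i & u i <= v i & v i <= b') &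
 disjoint_family_on (%i. {u i<..<v i}) {..<n} & (\<Sum>i<n. v i - u i) < d
 --> (\<Sum>i<n. dist (F (u i)) (F (v i))) < e"
 proof (intro exI[of _ d] conjI allI impI \<open>d > 0\<close>; elim conjE)
 fix n :: nat and u v :: "nat => real"
 assume h: "\<forall>i<n. a' <= u i & u i <= v i & v i <= b'" "disjoint_family_on (%i. {u i<..<v i}) {..<n}"
 "(\<Sum>i<n. v i - u i) < d"
 have "\<forall>i<n. a <= u i & u i <= v i & v i <= b" using h(1) assms(2,3) by force
 then show "(\<Sum>i<n. dist (F (u i)) (F (v i))) < e" using d h(2,3) by blast
 qed
qed

text \<open>Connects the integrated form with absolutely continuous functions that satisfy an equation almost everywhere.\<close>
lemma indef_int_ac_derivative:
 assumes ac: "absolutely_continuous_on_interval 0 b F" and N: "negligible N"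
 and der: "\<And>x. 0 < x ==> x < b ==> x \<notin> N ==> (F has_vector_derivative f x) (at x)"
 and f: "set_integrable lborel {0..b} f"
 shows "indef_int b F f"
 unfolding indef_int_def
proof (intro conjI allI impI f)
 fix u v :: real assume uv: "0 <= u" "u <= v" "v <= b"
 have "(f has_integral F v - F u) {u..v}"
 by (rule has_integral_derivative_absolutely_continuous[OF uv(2) ac_subinterval[OF ac] N der]) (use uv in auto)
 moreover have "set_integrable lborel {u..v} f" by (rule set_integrable_subset[OF f]) (use uv in auto)
 then have "(LBINT t:{u..v}. f t) = integral {u..v} f" by (rule set_borel_integral_eq_integral(2))
 ultimately show "F v - F u = (LBINT t:{u..v}. f t)" by (simp add: integral_unique)
qed

lemma indef_int_continuous:
 assumes "indef_int b F f"
 shows "continuous_on {0..b} F"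
proof -
 have fi: "f integrable_on {0..b}" using set_borel_integral_eq_integral(1)[of "{0..b}" f] assms by (simp add: indef_int_def)
 have "continuous_on {0..b} (%x. F 0 + integral {0..x} f)"
 by (rule continuous_on_add[OF continuous_on_const indefinite_integral_continuous_1[OF fi]])
 moreover have "F x = F 0 + integral {0..x} f" if "x \<in> {0..b}" for x
 proof -
 have "set_integrable lborel {0..x} f" using indef_int_integrable[OF assms] that by auto
 then have "(LBINT t:{0..x}. f t) = integral {0..x} f" by (rule set_borel_integral_eq_integral(2))
 moreover have "F x - F 0 = (LBINT t:{0..x}. f t)" using assms that by (auto simp: indef_int_def)
 ultimately show ?thesis by (simp add: algebra_simps)
 qed
 ultimately show ?thesis using continuous_on_cong[of "{0..b}" "{0..b}" F "%x. F 0 + integral {0..x} f"] by blast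
qed

lemma set_integrable_continuous_mult:
 fixes f g :: "real => complex"
 assumes "continuous_on {a..b} F" "set_integrable lborel {a..b} f"
 shows "set_integrable lborel {a..b} (%x. F x * f x)"
proof -
 have "bounded (F ` {a..b})" using assms(1) compact_continuous_image compact_imp_bounded by blast
 then obtain B where B: "\<And>x. x \<in> {a..b} ==> norm (F x) <= B" unfolding bounded_iff by blast
 have m: "(%x. indicator {a..b} x *\<^sub>R F x) \<in> borel_measurable lborel"
 using borel_measurable_continuous_on_indicator[OF _ assms(1)] by simp
 have "integrable lborel (%x. (indicator {a..b} x *\<^sub>R F x) * (indicator {a..b} x *\<^sub>R f x))"
 proof (rule integrable_dominated[where f = "%x. B *\<^sub>R (indicator {a..b} x *\<^sub>R f x)"])
 show "integrable lborel (%x. B *\<^sub>R (indicator {a..b} x *\<^sub>R f x))" using assms(2) unfolding set_integrable_def by (rule integrable_scaleR_right)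
 show "(%x. indicator {a..b} x *\<^sub>R F x * (indicator {a..b} x *\<^sub>R f x)) \<in> borel_measurable lborel"
 using m assms(2) unfolding set_integrable_def by (intro borel_measurable_times) auto
 show "AE x in lborel. norm (indicator {a..b} x *\<^sub>R F x * (indicator {a..b} x *\<^sub>R f x)) <= norm (B *\<^sub>R (indicator {a..b} x *\<^sub>R f x))"
 using B by (intro AE_I2) (auto simp: indicator_def norm_mult intro!: mult_right_mono order_trans[OF B])
 qed
 then show ?thesis unfolding set_integrable_def by (rule Bochner_Integration.integrable_cong[THEN iffD1, rotated -1]) (auto simp: indicator_def)
qed

lemma indef_int_mult:
 assumes F: "indef_int b F f" and G: "indef_int b G g"
 shows "indef_int b (%x. F x * G x) (%x. F x * g x + f x * G x)"
proof -
 have cF: "continuous_on {0..b} F" and cG: "continuous_on {0..b} G" using F G indef_int_continuous by auto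
 have "bounded (F ` {0..b})" "bounded (G ` {0..b})" using cF cG compact_continuous_image compact_imp_bounded by blast+
 then obtain B1 B2 where B1: "\<And>x. x \<in> {0..b} ==> norm (F x) <= B1" and B2: "\<And>x. x \<in> {0..b} ==> norm (G x) <= B2"
 unfolding bounded_iff by blast
 have fi: "set_integrable lborel {0..b} f" and gi: "set_integrable lborel {0..b} g" using F G by (auto simp: indef_int_def)
 obtain N1 where N1: "negligible N1" "\<And>x. 0 < x ==> x < b ==> x \<notin> N1 ==> (F has_vector_derivative f x) (at x)"
 using indef_int_derivative[OF F] by blast
 obtain N2 where N2: "negligible N2" "\<And>x. 0 < x ==> x < b ==> x \<notin> N2 ==> (G has_vector_derivative g x) (at x)"
 using indef_int_derivative[OF G] by blast
 show ?thesis
 proof (rule indef_int_ac_derivative[where N = "N1 \<union> N2"])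
 show "absolutely_continuous_on_interval 0 b (%x. F x * G x)"
 proof (rule absolutely_continuous_dominated[where w = "%t. B1 * norm (g t) + B2 * norm (f t)"])
 show "set_integrable lborel {0..b} (%t. B1 * norm (g t) + B2 * norm (f t))"
 using fi gi by (intro set_integral_add(1) set_integrable_mult_right set_integrable_norm) auto
 fix u v assume uv: "0 <= u" "u <= v" "v <= b"
 have i: "set_integrable lborel {u..v} f" "set_integrable lborel {u..v} g"
 using indef_int_integrable[OF F] indef_int_integrable[OF G] uv by auto
 have "dist (F u * G u) (F v * G v) = norm (F v * (G v - G u) + (F v - F u) * G u)"
 by (simp add: dist_norm algebra_simps norm_minus_commute)
 also have "\<dots> <= norm (F v) * norm (G v - G u) + norm (G u) * norm (F v - F u)"
 by (metis norm_triangle_ineq norm_mult mult.commute)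
 also have "\<dots> <= B1 * (LBINT t:{u..v}. norm (g t)) + B2 * (LBINT t:{u..v}. norm (f t))"
 using uv B1[of v] B2[of u] indef_int_dist_le[OF F uv] indef_int_dist_le[OF G uv]
 by (intro add_mono mult_mono) (auto intro: order_trans[OF norm_ge_zero])
 also have "\<dots> = (LBINT t:{u..v}. B1 * norm (g t) + B2 * norm (f t))"
 using i by (subst set_integral_add(2)) (auto intro!: set_integrable_norm)
 finally show "dist (F u * G u) (F v * G v) <= (LBINT t:{u..v}. B1 * norm (g t) + B2 * norm (f t))" .
 qed
 show "negligible (N1 \<union> N2)" using N1 N2 by simp
 show "((%x. F x * G x) has_vector_derivative F x * g x + f x * G x) (at x)" if "0 < x" "x < b" "x \<notin> N1 \<union> N2" for x
 using has_vector_derivative_mult[OF N1(2) N2(2)] that by auto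
 show "set_integrable lborel {0..b} (%x. F x * g x + f x * G x)"
 using set_integral_add(1)[OF set_integrable_continuous_mult[OF cF gi] set_integrable_continuous_mult[OF cG fi]]
 by (simp only: mult.commute)
 qed
qed

lemma indef_int_add:
 assumes F: "indef_int b F f" and G: "indef_int b G g"
 shows "indef_int b (%x. F x + G x) (%x. f x + g x)"
 unfolding indef_int_def
proof (intro conjI allI impI)
 have i: "set_integrable lborel {u..v} f" "set_integrable lborel {u..v} g" if "0 <= u" "v <= b" for u v
 using indef_int_integrable[OF F that] indef_int_integrable[OF G that] .
 show "set_integrable lborel {0..b} (%x. f x + g x)" by (intro set_integral_add(1) i) auto
 fix u v :: real assume uv: "0 <= u" "u <= v" "v <= b"
 have "F v - F u = (LBINT t:{u..v}. f t)" "G v - G u = (LBINT t:{u..v}. g t)"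
 using F G uv by (auto simp: indef_int_def)
 then show "F v + G v - (F u + G u) = (LBINT t:{u..v}. f t + g t)"
 using set_integral_add(2)[OF i(1) i(2)] uv by (simp add: algebra_simps)
qed

lemma indef_int_cmult:
 assumes "indef_int b F f"
 shows "indef_int b (%x. c * F x) (%x. c * f x)"
 using assms by (auto simp: indef_int_def right_diff_distrib[symmetric])

lemma indef_int_diff:
 assumes "indef_int b F f" "indef_int b G g"
 shows "indef_int b (%x. F x - G x) (%x. f x - g x)"
 using indef_int_add[OF assms(1) indef_int_cmult[OF assms(2), of "-1"]] by simp

lemma indef_int_cnj:
 assumes "indef_int b F f"
 shows "indef_int b (%x. cnj (F x)) (%x. cnj (f x))"
proof -
 have eq: "(%x. indicator S x *\<^sub>R cnj (f x)) = (%x. cnj (indicator S x *\<^sub>R f x))" for S by auto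
 have "set_integrable lborel {0..b} (%x. cnj (f x))"
 using assms unfolding indef_int_def set_integrable_def eq by (subst integrable_cnj) auto
 moreover have "(LBINT t:S. cnj (f t)) = cnj (LBINT t:S. f t)" for S
 unfolding set_lebesgue_integral_def eq by (rule Bochner_Integration.integral_cnj)
 ultimately show ?thesis using assms unfolding indef_int_def by (auto simp flip: complex_cnj_diff)
qed

lemma indef_int_C1:
 assumes "\<And>x. (F has_vector_derivative f x) (at x)" "continuous_on UNIV f"
 shows "indef_int b F f"
 unfolding indef_int_def
proof (intro conjI allI impI)
 have c: "set_integrable lborel {u..v} f" for u v :: real
 unfolding set_integrable_def by (rule borel_integrable_compact) (use assms(2) in \<open>auto intro: continuous_on_subset\<close>)
 show "set_integrable lborel {0..b} f" by (rule c)
 fix u v :: real assume "u <= v"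
 then have "(f has_integral F v - F u) {u..v}"
 by (rule fundamental_theorem_of_calculus) (use assms in \<open>auto intro: has_vector_derivative_at_within\<close>)
 then show "F v - F u = (LBINT t:{u..v}. f t)" using set_borel_integral_eq_integral(2)[OF c] by (simp add: integral_unique)
qed

lemma indef_int_cong:
 assumes "indef_int b F f" "\<And>x. 0 <= x ==> x <= b ==> F x = G x" "\<And>x. 0 <= x ==> x <= b ==> f x = g x"
 shows "indef_int b G g"
proof -
 have "set_integrable lborel {0..b} g \<longleftrightarrow> set_integrable lborel {0..b} f" unfolding set_integrable_def
 by (rule Bochner_Integration.integrable_cong) (use assms(3) in \<open>auto simp: indicator_def\<close>)
 then have "set_integrable lborel {0..b} g" using assms(1) unfolding indef_int_def by auto
 moreover have "(LBINT t:{u..v}. g t) = (LBINT t:{u..v}. f t)" if "0 <= u" "v <= b" for u v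
 by (rule set_lebesgue_integral_cong) (use assms(3) that in auto)
 ultimately show ?thesis using assms(1,2) by (auto simp: indef_int_def)
qed


section \<open>Integrals that depend analytically on a parameter\<close>

text \<open>Analyticity in the parameter with a dominating function near each point: what is needed for differentiation under the integral sign, because Cauchy's inequality dominates the derivatives as well.\<close>
definition param_dom :: "'a measure => complex set => ('a => complex => complex) => bool" where
 "param_dom M S h \<longleftrightarrow> (\<forall>x\<in>space M. h x holomorphic_on S) & (\<forall>z\<in>S. (%x. h x z) \<in> borel_measurable M) &
 (\<forall>z\<in>S. \<exists>r>0. \<exists>B. cball z r \<subseteq> S & integrable M B & (\<forall>w\<in>cball z r. \<forall>x\<in>space M. norm (h x w) <= B x))"

lemma param_dom_deriv_bound:
 assumes hol: "f holomorphic_on S" and S: "open S" and r: "r > 0" "cball z r \<subseteq> S"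
 and B: "\<And>w. w \<in> cball z r ==> norm (f w) <= B" and w: "w \<in> cball z (r/2)"
 shows "norm (deriv f w) <= B / (r / 2)"
proof -
 have sub: "cball w (r/2) \<subseteq> cball z r"
 using w by (auto simp: dist_norm) (smt (verit) dist_norm dist_triangle dist_commute field_sum_of_halves)
 have "norm ((deriv ^^ 1) f w) <= fact 1 * B / (r/2) ^ 1"
 proof (rule Cauchy_inequality)
 show "f holomorphic_on ball w (r/2)" using holomorphic_on_subset[OF hol] sub r ball_subset_cball by blast
 show "continuous_on (cball w (r/2)) f"
 using holomorphic_on_imp_continuous_on[OF hol] sub r continuous_on_subset by blast
 show "norm (f x) <= B" if "norm (w - x) = r/2" for x
 by (rule B) (use sub that in \<open>auto simp: dist_norm subset_iff\<close>)
 qed (use r in auto)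
 then show ?thesis by simp
qed

lemma param_dom_integrable:
 assumes "param_dom M S h" "z \<in> S"
 shows "integrable M (%x. h x z)"
proof -
 obtain r B where "r > 0" "integrable M B" and B: "\<And>w x. w \<in> cball z r ==> x \<in> space M ==> norm (h x w) <= B x"
 using assms unfolding param_dom_def by metis
 show ?thesis
 by (rule integrable_dominated[OF \<open>integrable M B\<close>])
 (use assms B \<open>r > 0\<close> in \<open>auto simp: param_dom_def intro!: AE_I2 order_trans[OF B abs_ge_self]\<close>)
qed

lemma has_derivative_param_integral:
 assumes pd: "param_dom M S h" and S: "open S" and z: "z \<in> S"
 shows "((%z. \<integral>x. h x z \<partial>M) has_field_derivative (\<integral>x. deriv (h x) z \<partial>M)) (at z)"
 and "(%x. deriv (h x) z) \<in> borel_measurable M"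
proof -
 obtain r B where r: "r > 0" "cball z r \<subseteq> S" "integrable M B" and B: "\<And>w x. w \<in> cball z r ==> x \<in> space M ==> norm (h x w) <= B x"
 using pd z unfolding param_dom_def by metis
 have hol: "h x holomorphic_on S" if "x \<in> space M" for x using pd that by (auto simp: param_dom_def)
 have meas: "(%x. h x w) \<in> borel_measurable M" if "w \<in> S" for w using pd that by (auto simp: param_dom_def)
 have db: "norm (deriv (h x) w) <= B x / (r/2)" if "x \<in> space M" "w \<in> cball z (r/2)" for x w
 using param_dom_deriv_bound[OF hol[OF that(1)] S r(1,2) B] that by blast
 have sub: "cball z (r/2) \<subseteq> S" using r by (auto simp: subset_iff)
 have lip: "norm (h x w - h x z) <= B x / (r/2) * norm (w - z)" if "x \<in> space M" "w \<in> cball z (r/2)" for x w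
 proof (rule field_differentiable_bound[of "cball z (r/2)"])
 show "(h x has_field_derivative deriv (h x) u) (at u within cball z (r/2))" if "u \<in> cball z (r/2)" for u
 using holomorphic_derivI[OF hol S] \<open>x \<in> space M\<close> that sub by (meson has_field_derivative_at_within subsetD)
 qed (use that r db in auto)
 have dlim: "((%w. (h x w - h x z) / (w - z)) \<longlongrightarrow> deriv (h x) z) (at z)" if "x \<in> space M" for x
 using holomorphic_derivI[OF hol[OF that] S z] by (simp add: has_field_derivative_iff)
 show m: "(%x. deriv (h x) z) \<in> borel_measurable M"
 proof (rule borel_measurable_LIMSEQ_metric)
 define X where "X n = z + of_real (r / 2 / real (Suc n))" for n
 have X: "X n \<in> cball z (r/2)" "X n \<noteq> z" for n
 proof -
 have "dist z (X n) = norm (of_real (r / 2 / real (Suc n)) :: complex)"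
 by (simp add: X_def dist_norm norm_minus_commute)
 also have "\<dots> = r / 2 / real (Suc n)" using r by (simp only: norm_of_real) simp
 finally have d: "dist z (X n) = r / 2 / real (Suc n)" .
 moreover have "r / 2 / real (Suc n) <= r / 2 / 1" using r by (intro divide_left_mono) auto
 ultimately show "X n \<in> cball z (r/2)" by simp
 show "X n \<noteq> z" using d r by auto
 qed
 have "(%n. r / 2 / real (Suc n)) \<leadsto> 0" by real_asymp
 then have "X \<leadsto> z + of_real 0" unfolding X_def[abs_def] by (intro tendsto_intros)
 then have Xl: "filterlim X (at z) sequentially" using X by (auto simp: filterlim_at)
 show "(%x. (h x (X n) - h x z) / (X n - z)) \<in> borel_measurable M" for n
 using meas[OF z] meas[OF subsetD[OF sub X(1)[of n]]] by (intro borel_measurable_divide borel_measurable_diff) auto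
 show "(%n. (h x (X n) - h x z) / (X n - z)) \<leadsto> deriv (h x) z" if "x \<in> space M" for x
 using filterlim_compose[OF dlim[OF that] Xl] by simp
 qed
 show "((%z. \<integral>x. h x z \<partial>M) has_field_derivative (\<integral>x. deriv (h x) z \<partial>M)) (at z)"
 unfolding has_field_derivative_iff tendsto_at_iff_sequentially
 proof (intro allI impI)
 fix X assume X1: "\<forall>i. X i \<in> UNIV - {z}" and X2: "X \<leadsto> z"
 have "eventually (%n. X n \<in> ball z (r/2)) sequentially"
 by (rule topological_tendstoD[OF X2]) (use r in auto)
 then obtain n0 where n0: "\<And>n. n >= n0 ==> X n \<in> cball z (r/2)"
 unfolding eventually_sequentially using ball_subset_cball by blast
 have X2': "(%n. X (n + n0)) \<leadsto> z" using X2 by (rule LIMSEQ_ignore_initial_segment)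
 have "(%n. \<integral>x. (h x (X (n+n0)) - h x z) / (X (n+n0) - z) \<partial>M) \<leadsto> (\<integral>x. deriv (h x) z \<partial>M)"
 proof (rule integral_dominated_convergence[where w = "%x. B x / (r/2)"])
 show "integrable M (%x. B x / (r/2))" using r by simp
 show "AE x in M. (%n. (h x (X (n+n0)) - h x z) / (X (n+n0) - z)) \<leadsto> deriv (h x) z"
 proof (rule AE_I2)
 fix x assume "x \<in> space M"
 have "filterlim (%n. X (n + n0)) (at z) sequentially" using X1 X2' by (auto simp: filterlim_at)
 then show "(%n. (h x (X (n+n0)) - h x z) / (X (n+n0) - z)) \<leadsto> deriv (h x) z"
 by (rule filterlim_compose[OF dlim[OF \<open>x \<in> space M\<close>]])
 qed
 show "AE x in M. norm ((h x (X (n+n0)) - h x z) / (X (n+n0) - z)) <= B x / (r/2)" for n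
 proof (rule AE_I2)
 fix x assume "x \<in> space M"
 then show "norm ((h x (X (n+n0)) - h x z) / (X (n+n0) - z)) <= B x / (r/2)"
 using lip[of x "X (n+n0)"] n0[of "n+n0"] X1 by (simp add: norm_divide pos_divide_le_eq)
 qed
 show "(%x. (h x (X (n+n0)) - h x z) / (X (n+n0) - z)) \<in> borel_measurable M" for n
 using meas[OF z] meas[of "X (n+n0)"] n0[of "n+n0"] sub by (intro borel_measurable_divide borel_measurable_diff) auto
 qed (rule m)
 note lim1 = this
 have *: "(\<integral>x. (h x w - h x z) / (w - z) \<partial>M) = ((\<integral>x. h x w \<partial>M) - (\<integral>x. h x z \<partial>M)) / (w - z)" if "w \<in> cball z (r/2)" for w
 using param_dom_integrable[OF pd z] param_dom_integrable[OF pd, of w] subsetD[OF sub that] by simp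
 have "(%n. ((\<integral>x. h x (X (n+n0)) \<partial>M) - (\<integral>x. h x z \<partial>M)) / (X (n+n0) - z)) \<leadsto> (\<integral>x. deriv (h x) z \<partial>M)"
 using lim1 unfolding *[OF n0[OF le_add2]] .
 then show "((%w. ((\<integral>x. h x w \<partial>M) - (\<integral>x. h x z \<partial>M)) / (w - z)) \<circ> X) \<leadsto> (\<integral>x. deriv (h x) z \<partial>M)"
 unfolding o_def by (rule LIMSEQ_offset)
 qed
qed

lemma param_dom_deriv:
 assumes pd: "param_dom M S h" and S: "open S"
 shows "param_dom M S (%x. deriv (h x))"
 unfolding param_dom_def
proof (intro conjI ballI)
 show "deriv (h x) holomorphic_on S" if "x \<in> space M" for x
 using pd that S by (auto simp: param_dom_def intro: holomorphic_deriv)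
 show "(%x. deriv (h x) z) \<in> borel_measurable M" if "z \<in> S" for z
 using has_derivative_param_integral[OF pd S that] by simp
 fix z assume z: "z \<in> S"
 obtain r B where r: "r > 0" "cball z r \<subseteq> S" "integrable M B" and B: "\<And>w x. w \<in> cball z r ==> x \<in> space M ==> norm (h x w) <= B x"
 using pd z unfolding param_dom_def by metis
 show "\<exists>r>0. \<exists>B. cball z r \<subseteq> S & integrable M B & (\<forall>w\<in>cball z r. \<forall>x\<in>space M. norm (deriv (h x) w) <= B x)"
 proof (intro exI[of _ "r/2"] exI[of _ "%x. B x / (r/2)"] conjI ballI)
 fix w x assume w: "w \<in> cball z (r/2)" and x: "x \<in> space M"
 have "h x holomorphic_on S" using pd x by (auto simp: param_dom_def)
 then show "norm (deriv (h x) w) <= B x / (r/2)"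
 by (rule param_dom_deriv_bound[OF _ S r(1,2) _ w]) (rule B[OF _ x])
 qed (use r in \<open>auto simp: subset_iff\<close>)
qed

lemma param_dom_higher_deriv:
 assumes pd: "param_dom M S h" and S: "open S"
 shows "param_dom M S (%x. (deriv ^^ k) (h x))"
 by (induction k) (use pd param_dom_deriv[OF _ S] in auto)

lemma higher_deriv_param_integral:
 assumes pd: "param_dom M S h" and S: "open S" and z: "z \<in> S"
 shows "(deriv ^^ k) (%z. \<integral>x. h x z \<partial>M) z = (\<integral>x. (deriv ^^ k) (h x) z \<partial>M)"
 using z
proof (induction k arbitrary: z)
 case (Suc k)
 have "((%z. \<integral>x. (deriv ^^ k) (h x) z \<partial>M) has_field_derivative (\<integral>x. deriv ((deriv ^^ k) (h x)) z \<partial>M)) (at z)"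
 by (rule has_derivative_param_integral(1)[OF param_dom_higher_deriv[OF pd S] S Suc.prems])
 then have "((deriv ^^ k) (%z. \<integral>x. h x z \<partial>M) has_field_derivative (\<integral>x. deriv ((deriv ^^ k) (h x)) z \<partial>M)) (at z)"
 by (rule has_field_derivative_transform_within_open[OF _ S Suc.prems]) (simp add: Suc.IH)
 then show ?case by (simp add: DERIV_imp_deriv)
qed simp

lemma holomorphic_param_integral:
 assumes pd: "param_dom M S h" and S: "open S"
 shows "(%z. \<integral>x. h x z \<partial>M) holomorphic_on S"
 using has_derivative_param_integral(1)[OF pd S] S by (auto simp: holomorphic_on_open)

text \<open>parameter integrals over [0,x]\<close>

lemma continuous_param_indefinite_integral:
 fixes c :: "real => complex" and a :: "real => complex => complex"
 assumes c: "\<And>X. set_integrable lborel {0..X} c"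
 and a: "continuous_on UNIV (%(x,z). a x z)"
 shows "continuous_on UNIV (%(x,z). LBINT s:{0..x}. c s * a s z)"
 unfolding continuous_on_sequentially
proof (intro allI ballI impI, elim conjE)
 fix X :: "nat => real \<times> complex" and p :: "real \<times> complex" assume lim: "X \<leadsto> p"
 obtain x z where p: "p = (x,z)" by force
 have l1: "(%n. fst (X n)) \<leadsto> x" and l2: "(%n. snd (X n)) \<leadsto> z"
 using tendsto_fst[OF lim] tendsto_snd[OF lim] p by auto
 obtain T where T: "\<And>n. norm (fst (X n)) <= T" using l1 by (metis Bseq_def convergentI convergent_imp_Bseq)
 obtain Z where Z: "\<And>n. norm (snd (X n)) <= Z" using l2 by (metis Bseq_def convergentI convergent_imp_Bseq)
 have "compact ({0..T} \<times> cball (0::complex) Z)" by (intro compact_Times) auto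
 then have "bounded ((%(x,z). a x z) ` ({0..T} \<times> cball (0::complex) Z))"
 using a by (intro compact_imp_bounded compact_continuous_image) (auto intro: continuous_on_subset)
 then obtain B where B: "\<And>s w. 0 <= s ==> s <= T ==> norm w <= Z ==> norm (a s w) <= B"
 by (fastforce simp: bounded_iff)
 have am: "(%s. a s w) \<in> borel_measurable borel" for w
 by (intro borel_measurable_continuous_onI continuous_on_compose2[OF a, where f = "%s. (s, w)", simplified])
 (auto intro!: continuous_intros)
 have m: "(%s. indicator {0..y} s *\<^sub>R (c s * a s w)) \<in> borel_measurable lborel" for y w
 proof -
 have "(%s. (indicator {0..y} s *\<^sub>R c s) * a s w) \<in> borel_measurable lborel"
 using c[of y] am[of w] unfolding set_integrable_def by (intro borel_measurable_times) auto
 then show ?thesis by simp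
 qed
 have "(%n. LBINT s. indicator {0..fst (X n)} s *\<^sub>R (c s * a s (snd (X n)))) \<leadsto> (LBINT s. indicator {0..x} s *\<^sub>R (c s * a s z))"
 proof (rule integral_dominated_convergence[where w = "%s. B * norm (indicator {0..T} s *\<^sub>R c s)"])
 show "integrable lborel (%s. B * norm (indicator {0..T} s *\<^sub>R c s))"
 using c[of T] unfolding set_integrable_def by (intro integrable_mult_right integrable_norm)
 have "AE s in lborel. s \<noteq> x" "AE s in lborel. s \<noteq> 0" by (rule AE_lborel_singleton)+
 then show "AE s in lborel. (%n. indicator {0..fst (X n)} s *\<^sub>R (c s * a s (snd (X n)))) \<leadsto> indicator {0..x} s *\<^sub>R (c s * a s z)"
 proof eventually_elim
 case (elim s)
 have "isCont (%(x,z). a x z) (s,z)" using a by (simp add: continuous_on_eq_continuous_at)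
 then have "(%n. (%(x,z). a x z) (s, snd (X n))) \<leadsto> (%(x,z). a x z) (s,z)"
 by (rule isCont_tendsto_compose) (intro tendsto_intros l2)
 then have al: "(%n. a s (snd (X n))) \<leadsto> a s z" by simp
 have "eventually (%n. (s <= fst (X n)) = (s <= x)) sequentially"
 proof (cases "s < x")
 case True
 show ?thesis using order_tendstoD(1)[OF l1 True] by eventually_elim (use True in auto)
 next
 case False
 then have "x < s" using elim by auto
 from order_tendstoD(2)[OF l1 this] show ?thesis by eventually_elim (use \<open>x < s\<close> in auto)
 qed
 then have ev: "eventually (%n. indicator {0..x} s *\<^sub>R (c s * a s (snd (X n))) = indicator {0..fst (X n)} s *\<^sub>R (c s * a s (snd (X n)))) sequentially"
 by eventually_elim (auto simp: indicator_def)
 have lim': "(%n. indicator {0..x} s *\<^sub>R (c s * a s (snd (X n)))) \<leadsto> indicator {0..x} s *\<^sub>R (c s * a s z)"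
 by (intro tendsto_intros al)
 show ?case by (rule Lim_transform_eventually[OF lim' ev])
 qed
 show "AE s in lborel. norm (indicator {0..fst (X n)} s *\<^sub>R (c s * a s (snd (X n)))) <= B * norm (indicator {0..T} s *\<^sub>R c s)" for n
 proof (rule AE_I2)
 fix s
 show "norm (indicator {0..fst (X n)} s *\<^sub>R (c s * a s (snd (X n)))) <= B * norm (indicator {0..T} s *\<^sub>R c s)"
 proof (cases "s \<in> {0..fst (X n)}")
 case True
 then have sT: "0 <= s" "s <= T" using T[of n] by auto
 then have "norm (a s (snd (X n))) <= B" using B Z by auto
 then show ?thesis using True sT mult_right_mono[of "norm (a s (snd (X n)))" B "norm (c s)"] by (auto simp: norm_mult mult.commute)
 next
 case False
 have "0 <= B" if "0 <= s" "s <= T" using B[of s "snd (X 0)"] that Z[of 0] norm_ge_zero order_trans by blast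
 then show ?thesis using False by (auto simp: indicator_def)
 qed
 qed
 qed (use m in auto)
 then show "((%(x, z). LBINT s:{0..x}. c s * a s z) \<circ> X) \<leadsto> (case p of (x, z) => LBINT s:{0..x}. c s * a s z)"
 by (simp add: p o_def split_def set_lebesgue_integral_def)
qed

lemma param_dom_indefinite:
 fixes c :: "real => complex" and a :: "real => complex => complex"
 assumes c: "set_integrable lborel {u..v} c" and S: "open S"
 and a: "continuous_on ({u..v} \<times> S) (%(x,z). a x z)" and hol: "\<And>s. s \<in> {u..v} ==> a s holomorphic_on S"
 shows "param_dom lborel S (%s z. indicator {u..v} s *\<^sub>R (c s * a s z))"
 unfolding param_dom_def
proof (intro conjI ballI)
 show "(%z. indicator {u..v} s *\<^sub>R (c s * a s z)) holomorphic_on S" for s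
 using hol by (cases "s \<in> {u..v}") (auto intro!: holomorphic_intros)
 fix z assume z: "z \<in> S"
 have "continuous_on {u..v} (%s. a s z)"
 using z by (intro continuous_on_compose2[OF a, where f = "%s. (s, z)", simplified]) (auto intro!: continuous_intros)
 then have "set_integrable lborel {u..v} (%s. a s z * c s)" using set_integrable_continuous_mult c by blast
 then show "(%s. indicator {u..v} s *\<^sub>R (c s * a s z)) \<in> borel_measurable lborel"
 unfolding set_integrable_def by (simp add: mult.commute borel_measurable_integrable)
 obtain r where r: "r > 0" "cball z r \<subseteq> S" using S z open_contains_cball by blast
 have "compact ({u..v} \<times> cball z r)" by (intro compact_Times) auto
 then have "bounded ((%(x,z). a x z) ` ({u..v} \<times> cball z r))"
 using a r by (intro compact_imp_bounded compact_continuous_image) (auto intro: continuous_on_subset)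
 then obtain B where B: "\<And>s w. u <= s ==> s <= v ==> w \<in> cball z r ==> norm (a s w) <= B"
 by (fastforce simp: bounded_iff)
 show "\<exists>r>0. \<exists>B. cball z r \<subseteq> S & integrable lborel B & (\<forall>w\<in>cball z r. \<forall>s\<in>space lborel. norm (indicator {u..v} s *\<^sub>R (c s * a s w)) <= B s)"
 proof (intro exI[of _ r] exI[of _ "%s. B * norm (indicator {u..v} s *\<^sub>R c s)"] conjI ballI r)
 show "integrable lborel (%s. B * norm (indicator {u..v} s *\<^sub>R c s))"
 using c unfolding set_integrable_def by (intro integrable_mult_right integrable_norm)
 fix w s assume w: "w \<in> cball z r"
 show "norm (indicator {u..v} s *\<^sub>R (c s * a s w)) <= B * norm (indicator {u..v} s *\<^sub>R c s)"
 using B[of s w] w mult_right_mono[of "norm (a s w)" B "norm (c s)"] by (auto simp: indicator_def norm_mult mult.commute)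
 qed
qed


section \<open>Solving the Dirac system by Picard iteration\<close>

lemma LINT_exp:
 fixes c :: real
 assumes "a <= b" "c \<noteq> 0"
 shows "set_integrable lborel {a..b} (%s. exp (c * s))" "(LBINT s:{a..b}. exp (c * s)) = (exp (c * b) - exp (c * a)) / c"
proof -
 show i: "set_integrable lborel {a..b} (%s. exp (c * s))"
 unfolding set_integrable_def by (rule borel_integrable_compact) (auto intro!: continuous_intros)
 have "((%s. exp (c * s)) has_integral exp (c * b) / c - exp (c * a) / c) {a..b}"
 using assms by (intro fundamental_theorem_of_calculus)
 (auto intro!: derivative_eq_intros simp: has_real_derivative_iff_has_vector_derivative[symmetric])
 then show "(LBINT s:{a..b}. exp (c * s)) = (exp (c * b) - exp (c * a)) / c"
 using set_borel_integral_eq_integral(2)[OF i] by (simp add: integral_unique diff_divide_distrib)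
qed

locale L2_potential =
 fixes q :: "real => complex"
 assumes q_meas [measurable]: "q \<in> borel_measurable borel"
 and q_sq: "integrable lborel (%x. (cmod (q x))\<^sup>2)"
begin

definition energy :: real where "energy = (LBINT x. (cmod (q x))\<^sup>2)"

lemma energy_nonneg: "energy >= 0" by (simp add: energy_def)

lemma q_sq_set_integrable: "set_integrable lborel {a..b} (%x. (cmod (q x))\<^sup>2)"
 unfolding set_integrable_def by (rule integrable_mult_indicator[OF _ q_sq]) simp

lemma q_set_integrable: "set_integrable lborel {a..b} q"
proof -
 have "set_integrable lborel {a..b} (%_. 1::real)"
 unfolding set_integrable_def by (rule borel_integrable_compact) auto
 then have "set_integrable lborel {a..b} (%x. 1 + (cmod (q x))^2)"
 using q_sq_set_integrable by (rule set_integral_add(1))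
 then show ?thesis
 proof (rule set_integrable_bound)
 have "cmod (q x) <= 1 + (cmod (q x))^2" for x
 using zero_le_power2[of "cmod (q x) - 1"] norm_ge_zero[of "q x"] unfolding power2_diff power_one mult_1_right by linarith
 then show "AE x in lborel. x \<in> {a..b} --> norm (q x) <= norm (1 + (cmod (q x))^2)"
 by (intro AE_I2 impI) (auto intro: order_trans[OF _ abs_ge_self])
 qed (auto simp: set_borel_measurable_def)
qed

lemma cq_set_integrable: "set_integrable lborel {a..b} (%x. cnj (q x))"
proof -
 have "integrable lborel (%x. cnj (indicator {a..b} x *\<^sub>R q x))" using q_set_integrable unfolding set_integrable_def by (rule integrable_cnj)
 then show ?thesis unfolding set_integrable_def by (simp add: mult.commute)
qed

text \<open>The weight \<open>exp (lam Z * x)\<close> makes each Picard step a contraction by the factor one half, uniformly for \<open>norm z \<le> Z\<close>.\<close>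
definition lam :: "real => real" where "lam Z = 8 * Z + 4 * (4 * energy + 1)"

lemma weight_bound:
 assumes "x >= 0" "Z >= 0"
 shows "set_integrable lborel {0..x} (%s. (Z + cmod (q s)) * exp (lam Z * s))"
 "(LBINT s:{0..x}. (Z + cmod (q s)) * exp (lam Z * s)) <= exp (lam Z * x) / 2"
proof -
 define c where "c = 4 * energy + 1"
 have c: "c > 0" using energy_nonneg by (simp add: c_def)
 have l: "lam Z > 0" "lam Z = 8 * Z + 4 * c" using c assms by (auto simp: lam_def c_def)
 let ?g = "%s. (Z + c / 2) * exp (lam Z * s) + (exp (lam Z * x) / (2 * c)) * (cmod (q s))^2"
 have i1: "set_integrable lborel {0..x} (%s. exp (lam Z * s))" using LINT_exp assms l by simp
 have i2: "set_integrable lborel {0..x} (%s. (cmod (q s))\<^sup>2)"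
 by (rule q_sq_set_integrable)
 have ig: "set_integrable lborel {0..x} ?g" using i1 i2 by (intro set_integral_add(1)) auto
 have pt: "(Z + cmod (q s)) * exp (lam Z * s) <= ?g s" if "s \<in> {0..x}" for s
 proof -
 have "0 <= (c - cmod (q s))\<^sup>2" by simp
 then have "2 * cmod (q s) <= (cmod (q s))\<^sup>2 / c + c"
 using c by (simp add: field_simps power2_eq_square)
 then have "cmod (q s) * exp (lam Z * s) <= ((cmod (q s))^2 / c + c) / 2 * exp (lam Z * s)"
 by (intro mult_right_mono) auto
 also have "\<dots> = c / 2 * exp (lam Z * s) + (cmod (q s))^2 / (2 * c) * exp (lam Z * s)" by (simp add: field_simps)
 also have "(cmod (q s))\<^sup>2 / (2 * c) * exp (lam Z * s) <= (cmod (q s))\<^sup>2 / (2 * c) * exp (lam Z * x)"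
 using that l c by (intro mult_left_mono) auto
 finally show ?thesis by (simp add: field_simps)
 qed
 show int: "set_integrable lborel {0..x} (%s. (Z + cmod (q s)) * exp (lam Z * s))"
 proof (rule set_integrable_bound[OF ig])
 show "set_borel_measurable lborel {0..x} (%s. (Z + cmod (q s)) * exp (lam Z * s))"
 unfolding set_borel_measurable_def by measurable
 show "AE s in lborel. s \<in> {0..x} --> norm ((Z + cmod (q s)) * exp (lam Z * s)) <= norm (?g s)"
 using pt assms by (intro AE_I2) (auto simp: abs_mult intro: order_trans[OF _ abs_ge_self])
 qed
 have "(LBINT s:{0..x}. (Z + cmod (q s)) * exp (lam Z * s)) <= (LBINT s:{0..x}. ?g s)"
 by (rule set_integral_mono[OF int ig pt])
 also have "\<dots> = (Z + c / 2) * (LBINT s:{0..x}. exp (lam Z * s)) + (exp (lam Z * x) / (2 * c)) * (LBINT s:{0..x}. (cmod (q s))\<^sup>2)"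
 using i1 i2 by (subst set_integral_add(2)) auto
 also have "\<dots> <= (Z + c / 2) * (exp (lam Z * x) / lam Z) + exp (lam Z * x) / (2 * c) * energy"
 proof (intro add_mono mult_left_mono)
 show "(LBINT s:{0..x}. exp (lam Z * s)) <= exp (lam Z * x) / lam Z"
 using LINT_exp(2)[of 0 x "lam Z"] assms l by (simp add: divide_right_mono)
 show "(LBINT s:{0..x}. (cmod (q s))\<^sup>2) <= energy"
 unfolding energy_def set_lebesgue_integral_def
 by (rule integral_mono) (use q_sq i2 in \<open>auto simp: set_integrable_def indicator_def\<close>)
 qed (use assms c in auto)
 also have "(Z + c / 2) * (exp (lam Z * x) / lam Z) + exp (lam Z * x) / (2 * c) * energy = exp (lam Z * x) * ((Z + c / 2) / lam Z + energy / (2 * c))"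
 by (simp add: field_simps)
 also have "\<dots> <= exp (lam Z * x) * (1/8 + 1/8)"
 proof (intro mult_left_mono add_mono)
 show "(Z + c / 2) / lam Z <= 1/8" using l assms c by (simp add: field_simps)
 show "energy / (2 * c) <= 1/8" using c energy_nonneg by (simp add: field_simps c_def)
 qed auto
 also have "\<dots> <= exp (lam Z * x) / 2" by simp
 finally show "(LBINT s:{0..x}. (Z + cmod (q s)) * exp (lam Z * s)) <= exp (lam Z * x) / 2" .
qed

lemma norm_step: "norm (- \<i> * z * a - b) <= norm z * norm a + norm (b::complex)" "norm (\<i> * z * a - b) <= norm z * norm a + norm b"
 using norm_triangle_ineq4[of "- \<i> * z * a" b] norm_triangle_ineq4[of "\<i> * z * a" b] by (simp_all add: norm_mult)

lemma sol_unique: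
 assumes b: "b >= 0"
 and u: "indef_int b u (%x. - \<i> * z * u x - cnj (q x) * v x)"
 and v: "indef_int b v (%x. \<i> * z * v x - q x * u x)"
 and 0: "u 0 = 0" "v 0 = 0" and x: "x \<in> {0..b}"
 shows "u x = 0" "v x = 0"
proof -
 define L where "L = lam (norm z)"
 have cu: "continuous_on {0..b} u" and cv: "continuous_on {0..b} v" using u v indef_int_continuous by auto
 have "continuous_on {0..b} (%x. exp (- L * x) * (norm (u x) + norm (v x)))"
 by (intro continuous_intros cu cv)
 then obtain p where p: "p \<in> {0..b}" and pmax: "\<And>y. y \<in> {0..b} ==> exp (- L * y) * (norm (u y) + norm (v y)) <= exp (- L * p) * (norm (u p) + norm (v p))"
 using continuous_attains_sup[of "{0..b}" "%x. exp (- L * x) * (norm (u x) + norm (v x))"] b by auto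
 define m where "m = exp (- L * p) * (norm (u p) + norm (v p))"
 have m0: "m >= 0" by (simp add: m_def)
 have dle: "norm (u y) + norm (v y) <= m * exp (L * y)" if "y \<in> {0..b}" for y
 proof -
 have "norm (u y) + norm (v y) = (exp (- L * y) * (norm (u y) + norm (v y))) * exp (L * y)" by (simp add: exp_minus field_simps)
 also have "\<dots> <= m * exp (L * y)" using pmax[OF that] unfolding m_def by (intro mult_right_mono) auto
 finally show ?thesis .
 qed
 have iu: "set_integrable lborel {0..p} (%x. - \<i> * z * u x - cnj (q x) * v x)" and iv: "set_integrable lborel {0..p} (%x. \<i> * z * v x - q x * u x)"
 using indef_int_integrable[OF u, of 0 p] indef_int_integrable[OF v, of 0 p] p by auto
 have W: "set_integrable lborel {0..p} (%s. m * ((norm z + cmod (q s)) * exp (L * s)))"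
 unfolding L_def by (rule set_integrable_mult_right) (use weight_bound(1)[of p "norm z"] p in auto)
 have "norm (u p) + norm (v p) = norm (LBINT t:{0..p}. - \<i> * z * u t - cnj (q t) * v t) + norm (LBINT t:{0..p}. \<i> * z * v t - q t * u t)"
 proof -
 have "u p - u 0 = (LBINT t:{0..p}. - \<i> * z * u t - cnj (q t) * v t)" using u p by (auto simp: indef_int_def)
 moreover have "v p - v 0 = (LBINT t:{0..p}. \<i> * z * v t - q t * u t)" using v p by (auto simp: indef_int_def)
 ultimately show ?thesis using 0 by simp
 qed
 also have "\<dots> <= (LBINT t:{0..p}. norm (- \<i> * z * u t - cnj (q t) * v t)) + (LBINT t:{0..p}. norm (\<i> * z * v t - q t * u t))"
 by (intro add_mono set_integral_norm_bound iu iv)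
 also have "\<dots> = (LBINT t:{0..p}. norm (- \<i> * z * u t - cnj (q t) * v t) + norm (\<i> * z * v t - q t * u t))"
 using iu iv by (subst set_integral_add(2)) (auto intro: set_integrable_norm)
 also have "\<dots> <= (LBINT s:{0..p}. m * ((norm z + cmod (q s)) * exp (L * s)))"
 proof (rule set_integral_mono[OF _ W])
 show "set_integrable lborel {0..p} (%t. norm (- \<i> * z * u t - cnj (q t) * v t) + norm (\<i> * z * v t - q t * u t))"
 using iu iv by (intro set_integral_add(1) set_integrable_norm)
 fix t assume t: "t \<in> {0..p}"
 have "norm (- \<i> * z * u t - cnj (q t) * v t) + norm (\<i> * z * v t - q t * u t) <= (norm z * norm (u t) + norm (q t) * norm (v t)) + (norm z * norm (v t) + norm (q t) * norm (u t))"
 by (intro add_mono order_trans[OF norm_triangle_ineq4]) (auto simp: norm_mult)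
 also have "\<dots> = (norm z + norm (q t)) * (norm (u t) + norm (v t))" by (simp add: algebra_simps)
 also have "\<dots> <= (norm z + norm (q t)) * (m * exp (L * t))" using dle[of t] t p by (intro mult_left_mono) auto
 finally show "norm (- \<i> * z * u t - cnj (q t) * v t) + norm (\<i> * z * v t - q t * u t) <= m * ((norm z + cmod (q t)) * exp (L * t))"
 by (simp add: algebra_simps)
 qed
 also have "\<dots> = m * (LBINT s:{0..p}. (norm z + cmod (q s)) * exp (L * s))" by simp
 also have "\<dots> <= m * (exp (L * p) / 2)" using weight_bound(2)[of p "norm z"] p m0 by (intro mult_left_mono) (auto simp: L_def)
 finally have "m <= m / 2" unfolding m_def by (simp add: exp_minus field_simps)
 then have "m = 0" using m0 by simp
 then have "norm (u x) + norm (v x) <= 0" using dle[OF x] by simp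
 then have "norm (u x) = 0 & norm (v x) = 0" using norm_ge_zero[of "u x"] norm_ge_zero[of "v x"] by linarith
 then show "u x = 0" "v x = 0" by auto
qed

primrec pic :: "complex => complex => nat => (real => complex => complex) \<times> (real => complex => complex)" where
 "pic u0 v0 0 = (%x z. u0, %x z. v0)"
| "pic u0 v0 (Suc n) =
 (%x z. - \<i> * z * (LBINT s:{0..x}. 1 * fst (pic u0 v0 n) s z) - (LBINT s:{0..x}. cnj (q s) * snd (pic u0 v0 n) s z),
 %x z. \<i> * z * (LBINT s:{0..x}. 1 * snd (pic u0 v0 n) s z) - (LBINT s:{0..x}. q s * fst (pic u0 v0 n) s z))"

lemma one_int: "set_integrable lborel {a..b::real} (%_. 1 :: complex)"
 unfolding set_integrable_def by (rule borel_integrable_compact) auto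

lemma pic_continuous:
 "continuous_on UNIV (%(x,z). fst (pic u0 v0 n) x z) & continuous_on UNIV (%(x,z). snd (pic u0 v0 n) x z)"
proof (induction n)
 case 0
 show ?case by (simp add: split_def)
next
 case (Suc n)
 have "continuous_on UNIV (%p. - \<i> * snd p * (case p of (x,z) => LBINT s:{0..x}. 1 * fst (pic u0 v0 n) s z) - (case p of (x,z) => LBINT s:{0..x}. cnj (q s) * snd (pic u0 v0 n) s z))"
 using Suc by (intro continuous_intros continuous_param_indefinite_integral one_int cq_set_integrable) auto
 moreover have "continuous_on UNIV (%p. \<i> * snd p * (case p of (x,z) => LBINT s:{0..x}. 1 * snd (pic u0 v0 n) s z) - (case p of (x,z) => LBINT s:{0..x}. q s * fst (pic u0 v0 n) s z))"
 using Suc by (intro continuous_intros continuous_param_indefinite_integral one_int q_set_integrable) auto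
 ultimately show ?case by (simp add: split_def)
qed

lemma pic_holomorphic:
 "fst (pic u0 v0 n) x holomorphic_on UNIV & snd (pic u0 v0 n) x holomorphic_on UNIV"
proof (induction n arbitrary: x)
 case 0
 show ?case by simp
next
 case (Suc n)
 have *: "(%z. LBINT s:{0..x}. c s * a s z) holomorphic_on UNIV"
 if "set_integrable lborel {0..x} c" "continuous_on UNIV (%(x,z). a x z)" "\<And>s. a s holomorphic_on UNIV" for c a
 unfolding set_lebesgue_integral_def
 by (rule holomorphic_param_integral[OF param_dom_indefinite]) (use that in \<open>auto intro: continuous_on_subset\<close>)
 have c: "continuous_on UNIV (%(x,z). fst (pic u0 v0 n) x z)" "continuous_on UNIV (%(x,z). snd (pic u0 v0 n) x z)"
 using pic_continuous by auto
 have h: "fst (pic u0 v0 n) s holomorphic_on UNIV" "snd (pic u0 v0 n) s holomorphic_on UNIV" for s using Suc by auto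
 show ?case
 using *[OF one_int c(1) h(1)] *[OF one_int c(2) h(2)] *[OF cq_set_integrable c(2) h(2)] *[OF q_set_integrable c(1) h(1)]
 by (auto intro!: holomorphic_intros simp del: mult_1_left)
qed

lemma pic_cont_x: "continuous_on S (%x. fst (pic u0 v0 n) x z)" "continuous_on S (%x. snd (pic u0 v0 n) x z)"
 using pic_continuous[of u0 v0 n]
 by (auto intro!: continuous_on_compose2[where f = "%s. (s, z)" and g = "%(x,z). fst (pic u0 v0 n) x z", simplified]
 continuous_on_compose2[where f = "%s. (s, z)" and g = "%(x,z). snd (pic u0 v0 n) x z", simplified] continuous_intros)

lemma pic_bound:
 assumes z: "norm z <= Z" and x: "x >= 0"
 shows "norm (fst (pic u0 v0 n) x z) + norm (snd (pic u0 v0 n) x z) <= (norm u0 + norm v0) * (1/2)^n * exp (lam Z * x)"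
 using x
proof (induction n arbitrary: x)
 case 0
 have "1 * (norm u0 + norm v0) <= exp (lam Z * x) * (norm u0 + norm v0)"
 using 0 order_trans[OF norm_ge_zero z] energy_nonneg by (intro mult_right_mono) (auto simp: lam_def intro!: mult_nonneg_nonneg add_nonneg_nonneg)
 then show ?case by (simp add: mult.commute)
next
 case (Suc n)
 define C where "C = (norm u0 + norm v0) * (1/2)^n"
 have C0: "C >= 0" by (simp add: C_def)
 have Z0: "Z >= 0" using z norm_ge_zero order_trans by blast
 let ?a = "%s. fst (pic u0 v0 n) s z" and ?b = "%s. snd (pic u0 v0 n) s z"
 have IH: "norm (?a s) + norm (?b s) <= C * exp (lam Z * s)" if "s >= 0" for s using Suc.IH[OF that] by (simp add: C_def)
 have i: "set_integrable lborel {0..x} (%s. 1 * ?a s)" "set_integrable lborel {0..x} (%s. 1 * ?b s)"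
 "set_integrable lborel {0..x} (%s. cnj (q s) * ?b s)" "set_integrable lborel {0..x} (%s. q s * ?a s)"
 using set_integrable_continuous_mult[OF pic_cont_x(1) one_int] set_integrable_continuous_mult[OF pic_cont_x(2) one_int]
 set_integrable_continuous_mult[OF pic_cont_x(2) cq_set_integrable] set_integrable_continuous_mult[OF pic_cont_x(1) q_set_integrable]
 by (simp_all add: mult.commute)
 note n = set_integrable_norm[OF i(1)] set_integrable_norm[OF i(2)] set_integrable_norm[OF i(3)] set_integrable_norm[OF i(4)]
 have W: "set_integrable lborel {0..x} (%s. C * ((Z + cmod (q s)) * exp (lam Z * s)))"
 by (rule set_integrable_mult_right) (use weight_bound(1)[of x Z] Suc.prems Z0 in auto)
 have "norm (fst (pic u0 v0 (Suc n)) x z) + norm (snd (pic u0 v0 (Suc n)) x z) \<le>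
 (norm z * norm (LBINT s:{0..x}. 1 * ?a s) + norm (LBINT s:{0..x}. cnj (q s) * ?b s)) +
 (norm z * norm (LBINT s:{0..x}. 1 * ?b s) + norm (LBINT s:{0..x}. q s * ?a s))"
 unfolding pic.simps fst_conv snd_conv by (intro add_mono norm_step)
 also have "\<dots> <= (Z * (LBINT s:{0..x}. norm (1 * ?a s)) + (LBINT s:{0..x}. norm (cnj (q s) * ?b s))) +
 (Z * (LBINT s:{0..x}. norm (1 * ?b s)) + (LBINT s:{0..x}. norm (q s * ?a s)))"
 by (intro add_mono mult_mono z Z0 set_integral_norm_bound i norm_ge_zero)
 also have "\<dots> = (LBINT s:{0..x}. (Z * norm (1 * ?a s) + norm (cnj (q s) * ?b s)) + (Z * norm (1 * ?b s) + norm (q s * ?a s)))"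
 using n by (subst set_integral_add(2) set_integral_add(1) | intro set_integral_add(1) set_integrable_mult_right | simp)+
 also have "\<dots> <= (LBINT s:{0..x}. C * ((Z + cmod (q s)) * exp (lam Z * s)))"
 proof (rule set_integral_mono[OF _ W])
 show "set_integrable lborel {0..x} (%s. (Z * norm (1 * ?a s) + norm (cnj (q s) * ?b s)) + (Z * norm (1 * ?b s) + norm (q s * ?a s)))"
 using n by (intro set_integral_add(1) set_integrable_mult_right)
 fix s assume "s \<in> {0..x}"
 then have "(Z + norm (q s)) * (norm (?a s) + norm (?b s)) <= (Z + norm (q s)) * (C * exp (lam Z * s))"
 using IH[of s] Z0 by (intro mult_left_mono) auto
 then show "(Z * norm (1 * ?a s) + norm (cnj (q s) * ?b s)) + (Z * norm (1 * ?b s) + norm (q s * ?a s)) <= C * ((Z + cmod (q s)) * exp (lam Z * s))"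
 by (simp add: norm_mult algebra_simps)
 qed
 also have "\<dots> = C * (LBINT s:{0..x}. (Z + cmod (q s)) * exp (lam Z * s))" by simp
 also have "\<dots> <= C * (exp (lam Z * x) / 2)" using weight_bound(2)[of x Z] Suc.prems Z0 C0 by (intro mult_left_mono) auto
 finally show ?case by (simp add: C_def)
qed


definition Usol :: "complex => complex => real => complex => complex" where
 "Usol u0 v0 x z = (\<Sum>n. fst (pic u0 v0 n) x z)"

definition Vsol :: "complex => complex => real => complex => complex" where
 "Vsol u0 v0 x z = (\<Sum>n. snd (pic u0 v0 n) x z)"

lemma pic_bound_unif:
 assumes "norm z <= Z" "0 <= x" "x <= X"
 shows "norm (fst (pic u0 v0 n) x z) <= ((norm u0 + norm v0) * exp (lam Z * X)) * (1/2)^n"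
 and "norm (snd (pic u0 v0 n) x z) <= ((norm u0 + norm v0) * exp (lam Z * X)) * (1/2)^n"
proof -
 have "lam Z >= 0" using order_trans[OF norm_ge_zero assms(1)] energy_nonneg by (simp add: lam_def)
 then have "(norm u0 + norm v0) * (1/2)^n * exp (lam Z * x) <= (norm u0 + norm v0) * (1/2)^n * exp (lam Z * X)"
 using assms by (intro mult_left_mono) (auto intro: mult_left_mono)
 with pic_bound[OF assms(1,2), of u0 v0 n]
 have "norm (fst (pic u0 v0 n) x z) + norm (snd (pic u0 v0 n) x z) <= ((norm u0 + norm v0) * exp (lam Z * X)) * (1/2)^n"
 by (simp add: algebra_simps)
 then show "norm (fst (pic u0 v0 n) x z) <= ((norm u0 + norm v0) * exp (lam Z * X)) * (1/2)^n"
 "norm (snd (pic u0 v0 n) x z) <= ((norm u0 + norm v0) * exp (lam Z * X)) * (1/2)^n"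
 using norm_ge_zero[of "fst (pic u0 v0 n) x z"] norm_ge_zero[of "snd (pic u0 v0 n) x z"] by linarith+
qed

lemma geom_summable: "summable (%n. C * (1/2::real)^n)"
 by (intro summable_mult summable_geometric) auto

lemma sol_uniform_limit:
 assumes "Z >= 0"
 shows "uniform_limit ({0..X} \<times> cball 0 Z) (%n p. \<Sum>i<n. fst (pic u0 v0 i) (fst p) (snd p)) (%p. Usol u0 v0 (fst p) (snd p)) sequentially"
 "uniform_limit ({0..X} \<times> cball 0 Z) (%n p. \<Sum>i<n. snd (pic u0 v0 i) (fst p) (snd p)) (%p. Vsol u0 v0 (fst p) (snd p)) sequentially"
 unfolding Usol_def Vsol_def
 by (rule Weierstrass_m_test[OF _ geom_summable[of "(norm u0 + norm v0) * exp (lam Z * X)"]], use pic_bound_unif[of _ Z _ X] in auto)+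

lemma sol_continuous:
 "continuous_on ({0..X} \<times> UNIV) (%(x,z). Usol u0 v0 x z)"
 "continuous_on ({0..X} \<times> UNIV) (%(x,z). Vsol u0 v0 x z)"
proof -
 have cf: "continuous_on S (%p. fst (pic u0 v0 n) (fst p) (snd p))" "continuous_on S (%p. snd (pic u0 v0 n) (fst p) (snd p))" for S n
 using pic_continuous[of u0 v0 n] by (auto simp: split_def intro: continuous_on_subset)
 have *: "continuous_on ({0..X} \<times> UNIV) G" if G: "\<And>Z. Z >= 0 ==> continuous_on ({0..X} \<times> cball 0 Z) G" for G :: "real \<times> complex => complex"
 unfolding continuous_on_eq_continuous_within
 proof
 fix p assume p: "p \<in> {0..X} \<times> (UNIV :: complex set)"
 define Z where "Z = norm (snd p) + 1"
 have "continuous (at p within {0..X} \<times> cball 0 Z) G"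
 using G[of Z] p by (auto simp: continuous_on_eq_continuous_within Z_def)
 moreover have "at p within {0..X} \<times> cball 0 Z = at p within {0..X} \<times> UNIV"
 by (rule at_within_nhd[of p "UNIV \<times> ball 0 Z"]) (auto simp: Z_def open_Times mem_Times_iff)
 ultimately show "continuous (at p within {0..X} \<times> UNIV) G" by simp
 qed
 show "continuous_on ({0..X} \<times> UNIV) (%(x,z). Usol u0 v0 x z)" unfolding split_def
 by (rule *, rule uniform_limit_theorem[OF _ sol_uniform_limit(1)]) (auto intro!: always_eventually continuous_intros cf)
 show "continuous_on ({0..X} \<times> UNIV) (%(x,z). Vsol u0 v0 x z)" unfolding split_def
 by (rule *, rule uniform_limit_theorem[OF _ sol_uniform_limit(2)]) (auto intro!: always_eventually continuous_intros cf)
qed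

lemma sol_continuous_x: "continuous_on {0..X} (%x. Usol u0 v0 x z)" "continuous_on {0..X} (%x. Vsol u0 v0 x z)"
 by (rule continuous_on_compose2[OF sol_continuous(1)[of X], where f = "%s. (s, z)", simplified]
 continuous_on_compose2[OF sol_continuous(2)[of X], where f = "%s. (s, z)", simplified], auto intro!: continuous_intros)+

lemma sol_holomorphic:
 assumes "x >= 0"
 shows "Usol u0 v0 x holomorphic_on S" "Vsol u0 v0 x holomorphic_on S"
proof -
 have h: "fst (pic u0 v0 n) x holomorphic_on T" "snd (pic u0 v0 n) x holomorphic_on T" for n T
 using pic_holomorphic holomorphic_on_subset by blast+
 have "\<exists>d>0. cball w d \<subseteq> UNIV & uniform_limit (cball w d) (%n z. \<Sum>i<n. fst (pic u0 v0 i) x z) (Usol u0 v0 x) sequentially" for w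
 proof (intro exI[of _ 1] conjI)
 show "uniform_limit (cball w 1) (%n z. \<Sum>i<n. fst (pic u0 v0 i) x z) (Usol u0 v0 x) sequentially"
 unfolding Usol_def
 by (rule Weierstrass_m_test[OF _ geom_summable], rule pic_bound_unif(1)[of _ "norm w + 1" _ x])
 (use assms in \<open>auto simp: dist_norm intro: norm_triangle_le_diff\<close>, smt (verit) norm_minus_commute norm_triangle_ineq2)
 qed auto
 then have "Usol u0 v0 x holomorphic_on UNIV"
 by (rule holomorphic_uniform_sequence[OF open_UNIV, rotated]) (rule holomorphic_on_sum h)+
 then show "Usol u0 v0 x holomorphic_on S" using holomorphic_on_subset by blast
 have "\<exists>d>0. cball w d \<subseteq> UNIV & uniform_limit (cball w d) (%n z. \<Sum>i<n. snd (pic u0 v0 i) x z) (Vsol u0 v0 x) sequentially" for w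
 proof (intro exI[of _ 1] conjI)
 show "uniform_limit (cball w 1) (%n z. \<Sum>i<n. snd (pic u0 v0 i) x z) (Vsol u0 v0 x) sequentially"
 unfolding Vsol_def
 by (rule Weierstrass_m_test[OF _ geom_summable], rule pic_bound_unif(2)[of _ "norm w + 1" _ x])
 (use assms in \<open>auto simp: dist_norm intro: norm_triangle_le_diff\<close>, smt (verit) norm_minus_commute norm_triangle_ineq2)
 qed auto
 then have "Vsol u0 v0 x holomorphic_on UNIV"
 by (rule holomorphic_uniform_sequence[OF open_UNIV, rotated]) (rule holomorphic_on_sum h)+
 then show "Vsol u0 v0 x holomorphic_on S" using holomorphic_on_subset by blast
qed

lemma sums_indefinite:
 fixes a :: "nat => real => complex"
 assumes c: "set_integrable lborel {0..x} c" and a: "\<And>n. continuous_on {0..x} (a n)"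
 and B: "\<And>n s. 0 <= s ==> s <= x ==> norm (a n s) <= B * (1/2)^n" and B0: "B >= 0"
 shows "(%n. LBINT s:{0..x}. c s * a n s) sums (LBINT s:{0..x}. c s * (\<Sum>n. a n s))"
proof -
 have i: "integrable lborel (%s. indicator {0..x} s *\<^sub>R (c s * a n s))" for n
 using set_integrable_continuous_mult[OF a c] by (simp add: set_integrable_def mult.commute)
 have ptb: "norm (indicator {0..x} s *\<^sub>R (c s * a n s)) <= norm (indicator {0..x} s *\<^sub>R c s) * B * (1/2)^n" for n s
 using B[of s n] mult_left_mono[of "norm (a n s)" "B * (1/2)^n" "norm (c s)"] by (auto simp: indicator_def norm_mult)
 have "(%n. LBINT s. indicator {0..x} s *\<^sub>R (c s * a n s)) sums (LBINT s. (\<Sum>n. indicator {0..x} s *\<^sub>R (c s * a n s)))"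
 proof (rule sums_integral[OF i])
 show "AE s in lborel. summable (%n. norm (indicator {0..x} s *\<^sub>R (c s * a n s)))"
 by (intro AE_I2 summable_comparison_test'[OF geom_summable, where N = 0]) (use ptb in simp)
 show "summable (%n. LBINT s. norm (indicator {0..x} s *\<^sub>R (c s * a n s)))"
 proof (rule summable_comparison_test'[OF geom_summable, where N = 0])
 fix n
 have ci: "integrable lborel (%s. norm (indicator {0..x} s *\<^sub>R c s) * B * (1/2)^n)"
 using c unfolding set_integrable_def by (intro integrable_mult_left integrable_norm)
 have "(LBINT s. norm (indicator {0..x} s *\<^sub>R (c s * a n s))) <= (LBINT s. norm (indicator {0..x} s *\<^sub>R c s) * B * (1/2)^n)"
 by (rule integral_mono[OF integrable_norm[OF i] ci ptb])
 also have "\<dots> = ((LBINT s. norm (indicator {0..x} s *\<^sub>R c s)) * B) * (1/2)^n" by simp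
 finally show "norm (LBINT s. norm (indicator {0..x} s *\<^sub>R (c s * a n s))) <= ((LBINT s. norm (indicator {0..x} s *\<^sub>R c s)) * B) * (1/2)^n"
 by simp
 qed
 qed
 moreover have "(\<Sum>n. indicator {0..x} s *\<^sub>R (c s * a n s)) = indicator {0..x} s *\<^sub>R (c s * (\<Sum>n. a n s))" for s
 proof (cases "s \<in> {0..x}")
 case True
 then have "summable (%n. a n s)" by (intro summable_comparison_test'[OF geom_summable[of B], where N = 0]) (use B in auto)
 then show ?thesis using True by (simp add: suminf_mult)
 qed auto
 ultimately show ?thesis by (simp add: set_lebesgue_integral_def)
qed

lemma sol_indef:
 "indef_int X (%x. Usol u0 v0 x z) (%x. - \<i> * z * Usol u0 v0 x z - cnj (q x) * Vsol u0 v0 x z)"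
 "indef_int X (%x. Vsol u0 v0 x z) (%x. \<i> * z * Vsol u0 v0 x z - q x * Usol u0 v0 x z)"
proof -
 let ?U = "%x. Usol u0 v0 x z" and ?V = "%x. Vsol u0 v0 x z"
 have i: "set_integrable lborel {0..x} (%s. 1 * ?U s)" "set_integrable lborel {0..x} (%s. 1 * ?V s)"
 "set_integrable lborel {0..x} (%s. cnj (q s) * ?V s)" "set_integrable lborel {0..x} (%s. q s * ?U s)" for x
 using set_integrable_continuous_mult[OF sol_continuous_x(1) one_int] set_integrable_continuous_mult[OF sol_continuous_x(2) one_int]
 set_integrable_continuous_mult[OF sol_continuous_x(2) cq_set_integrable] set_integrable_continuous_mult[OF sol_continuous_x(1) q_set_integrable]
 by (simp_all add: mult.commute)
 have eq: "?U x = u0 + (LBINT s:{0..x}. - \<i> * z * ?U s - cnj (q s) * ?V s) &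
 ?V x = v0 + (LBINT s:{0..x}. \<i> * z * ?V s - q s * ?U s)" if x: "x >= 0" for x
 proof -
 define B where "B = (norm u0 + norm v0) * exp (lam (norm z) * x)"
 have B: "norm (fst (pic u0 v0 n) s z) <= B * (1/2)^n" "norm (snd (pic u0 v0 n) s z) <= B * (1/2)^n" if "0 <= s" "s <= x" for n s
 using pic_bound_unif[of z "norm z" s x u0 v0 n] that by (auto simp: B_def)
 have B0: "B >= 0" by (simp add: B_def)
 note su = sums_indefinite[where B = B, OF _ _ _ B0]
 have s1: "(%n. LBINT s:{0..x}. 1 * fst (pic u0 v0 n) s z) sums (LBINT s:{0..x}. 1 * ?U s)"
 and s2: "(%n. LBINT s:{0..x}. cnj (q s) * snd (pic u0 v0 n) s z) sums (LBINT s:{0..x}. cnj (q s) * ?V s)"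
 and s3: "(%n. LBINT s:{0..x}. 1 * snd (pic u0 v0 n) s z) sums (LBINT s:{0..x}. 1 * ?V s)"
 and s4: "(%n. LBINT s:{0..x}. q s * fst (pic u0 v0 n) s z) sums (LBINT s:{0..x}. q s * ?U s)"
 unfolding Usol_def Vsol_def
 by (rule su; (rule one_int cq_set_integrable q_set_integrable pic_cont_x B; assumption?))+
 have "(%n. fst (pic u0 v0 (Suc n)) x z) sums (- \<i> * z * (LBINT s:{0..x}. 1 * ?U s) - (LBINT s:{0..x}. cnj (q s) * ?V s))"
 unfolding pic.simps fst_conv by (intro sums_diff sums_mult s1 s2)
 then have "(%n. fst (pic u0 v0 n) x z) sums (- \<i> * z * (LBINT s:{0..x}. 1 * ?U s) - (LBINT s:{0..x}. cnj (q s) * ?V s) + fst (pic u0 v0 0) x z)"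
 by (subst (asm) sums_Suc_iff) simp
 then have U: "?U x = - \<i> * z * (LBINT s:{0..x}. 1 * ?U s) - (LBINT s:{0..x}. cnj (q s) * ?V s) + u0"
 using sums_unique unfolding Usol_def by fastforce
 have "(%n. snd (pic u0 v0 (Suc n)) x z) sums (\<i> * z * (LBINT s:{0..x}. 1 * ?V s) - (LBINT s:{0..x}. q s * ?U s))"
 unfolding pic.simps snd_conv by (intro sums_diff sums_mult s3 s4)
 then have "(%n. snd (pic u0 v0 n) x z) sums (\<i> * z * (LBINT s:{0..x}. 1 * ?V s) - (LBINT s:{0..x}. q s * ?U s) + snd (pic u0 v0 0) x z)"
 by (subst (asm) sums_Suc_iff) simp
 then have V: "?V x = \<i> * z * (LBINT s:{0..x}. 1 * ?V s) - (LBINT s:{0..x}. q s * ?U s) + v0"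
 using sums_unique unfolding Vsol_def by fastforce
 have "(LBINT s:{0..x}. - \<i> * z * ?U s - cnj (q s) * ?V s) = - \<i> * z * (LBINT s:{0..x}. 1 * ?U s) - (LBINT s:{0..x}. cnj (q s) * ?V s)"
 using set_integral_diff(2)[OF set_integrable_mult_right[OF i(1)[of x, unfolded mult_1_left], of "- \<i> * z"] i(3)[of x]]
 by (simp only: set_integral_mult_right mult_1_left)
 moreover have "(LBINT s:{0..x}. \<i> * z * ?V s - q s * ?U s) = \<i> * z * (LBINT s:{0..x}. 1 * ?V s) - (LBINT s:{0..x}. q s * ?U s)"
 using set_integral_diff(2)[OF set_integrable_mult_right[OF i(2)[of x, unfolded mult_1_left], of "\<i> * z"] i(4)[of x]]
 by (simp only: set_integral_mult_right mult_1_left)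
 ultimately show ?thesis using U V by simp
 qed
 have j: "set_integrable lborel {0..X} (%s. - \<i> * z * ?U s - cnj (q s) * ?V s)" "set_integrable lborel {0..X} (%s. \<i> * z * ?V s - q s * ?U s)"
 using set_integral_diff(1)[OF set_integrable_mult_right[OF i(1)[of X, unfolded mult_1_left], of "- \<i> * z"] i(3)[of X]]
 set_integral_diff(1)[OF set_integrable_mult_right[OF i(2)[of X, unfolded mult_1_left], of "\<i> * z"] i(4)[of X]] by this+
 show "indef_int X ?U (%x. - \<i> * z * ?U x - cnj (q x) * ?V x)" by (rule indef_intI[OF j(1)]) (use eq in blast)
 show "indef_int X ?V (%x. \<i> * z * ?V x - q x * ?U x)" by (rule indef_intI[OF j(2)]) (use eq in blast)
qed

lemma sol_0: "Usol u0 v0 0 z = u0" "Vsol u0 v0 0 z = v0"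
proof -
 have z0: "(LBINT s:{0..0::real}. f s) = (0::complex)" for f
 by (simp add: set_borel_integral_eq_integral(2)[symmetric] set_lebesgue_integral_def)
 (rule integral_eq_zero_AE, rule AE_mp[OF AE_lborel_singleton[of 0]], auto)
 have "fst (pic u0 v0 n) 0 z = 0 & snd (pic u0 v0 n) 0 z = 0" if "n \<notin> {0}" for n
 using that z0 by (cases n) auto
 then have "(%n. fst (pic u0 v0 n) 0 z) sums u0" "(%n. snd (pic u0 v0 n) 0 z) sums v0"
 using sums_finite[of "{0}" "%n. fst (pic u0 v0 n) 0 z"] sums_finite[of "{0}" "%n. snd (pic u0 v0 n) 0 z"] by auto
 then show "Usol u0 v0 0 z = u0" "Vsol u0 v0 0 z = v0" by (auto simp: Usol_def Vsol_def sums_unique[symmetric])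
qed

end


section \<open>Energy estimates and the truncated Schur functions\<close>

text \<open>The scalar form of the Dirac system, with \<open>u\<close> and \<open>v\<close> the sum and difference of the first row entry and \<open>\<i>\<close> times the second.\<close>
definition dirac_sol :: "(real => complex) => complex => real => (real => complex) => (real => complex) => bool" where
 "dirac_sol q z b u v \<longleftrightarrow> indef_int b u (%x. - \<i> * z * u x - cnj (q x) * v x) &
 indef_int b v (%x. \<i> * z * v x - q x * u x)"

lemma dirac_sol_lincomb:
 assumes "dirac_sol q z b u v" "dirac_sol q z b u' v'"
 shows "dirac_sol q z b (%x. c * u x + d * u' x) (%x. c * v x + d * v' x)"
proof -
 have "indef_int b (%x. c * u x + d * u' x) (%x. c * (- \<i> * z * u x - cnj (q x) * v x) + d * (- \<i> * z * u' x - cnj (q x) * v' x))"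
 using assms unfolding dirac_sol_def by (intro indef_int_add indef_int_cmult) auto
 moreover have "indef_int b (%x. c * v x + d * v' x) (%x. c * (\<i> * z * v x - q x * u x) + d * (\<i> * z * v' x - q x * u' x))"
 using assms unfolding dirac_sol_def by (intro indef_int_add indef_int_cmult) auto
 ultimately show ?thesis unfolding dirac_sol_def by (auto elim!: indef_int_cong simp: algebra_simps)
qed

lemma dirac_sol_subinterval:
 assumes "dirac_sol q z b u v" "b' <= b"
 shows "dirac_sol q z b' u v"
proof -
 have "indef_int b' F f" if "indef_int b F f" for F f
 using that assms(2) indef_int_integrable[OF that, of 0 b'] by (auto simp: indef_int_def)
 then show ?thesis using assms unfolding dirac_sol_def by blast
qed

text \<open>For equal potentials this is constancy of the Wronskian; for different ones its derivative only sees the difference of the potentials.\<close>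
lemma wronskian:
 assumes "dirac_sol q z b u v" "dirac_sol q' z b u' v'"
 shows "indef_int b (%x. u x * v' x - u' x * v x) (%x. (q x - q' x) * (u x * u' x) - cnj (q x - q' x) * (v x * v' x))"
proof -
 have "indef_int b (%x. u x * v' x - u' x * v x) (%x. (u x * (\<i> * z * v' x - q' x * u' x) + (- \<i> * z * u x - cnj (q x) * v x) * v' x) -
 (u' x * (\<i> * z * v x - q x * u x) + (- \<i> * z * u' x - cnj (q' x) * v' x) * v x))"
 using assms unfolding dirac_sol_def by (intro indef_int_diff indef_int_mult) auto
 then show ?thesis by (rule indef_int_cong) (auto simp: algebra_simps)
qed

text \<open>The derivative of \<open>|u|^2 - |v|^2\<close> is \<open>2 Im z (|u|^2 + |v|^2)\<close>: the potential terms cancel, so the growth does not depend on \<open>q\<close>.\<close>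
lemma energy_mono:
 fixes \<sigma> :: real
 assumes sol: "dirac_sol q z b u v" and y: "Im z >= 0" and \<sigma>: "\<bar>\<sigma>\<bar> <= 1" and st: "0 <= s" "s <= t" "t <= b"
 shows "exp (2 * \<sigma> * Im z * s) * ((norm (u s))^2 - (norm (v s))\<^sup>2) <= exp (2 * \<sigma> * Im z * t) * ((norm (u t))^2 - (norm (v t))\<^sup>2)"
proof -
 let ?y = "Im z"
 define e where "e x = cof (exp (2 * \<sigma> * ?y * x))" for x
 have de: "(e has_vector_derivative cof (2 * \<sigma> * ?y) * e x) (at x)" for x
 unfolding e_def[abs_def] by (auto intro!: derivative_eq_intros has_vector_derivative_of_real simp: has_real_derivative_iff_has_vector_derivative[symmetric])
 have ie: "indef_int b e (%x. cof (2 * \<sigma> * ?y) * e x)"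
 by (rule indef_int_C1[OF de]) (auto simp: e_def intro!: continuous_intros)
 let ?u' = "%x. - \<i> * z * u x - cnj (q x) * v x" and ?v' = "%x. \<i> * z * v x - q x * u x"
 have u: "indef_int b u ?u'" and v: "indef_int b v ?v'" using sol by (auto simp: dirac_sol_def)
 let ?E = "%x. u x * cnj (u x) - v x * cnj (v x)"
 have "indef_int b (%x. e x * ?E x) (%x. e x * ((u x * cnj (?u' x) + ?u' x * cnj (u x)) - (v x * cnj (?v' x) + ?v' x * cnj (v x)))
 + cof (2 * \<sigma> * ?y) * e x * ?E x)"
 by (intro indef_int_mult indef_int_diff ie indef_int_cnj u v)
 then have I: "indef_int b (%x. e x * ?E x) (%x. of_real (exp (2 * \<sigma> * ?y * x) * (2 * ?y * ((norm (u x))^2 + (norm (v x))^2) + 2 * \<sigma> * ?y * ((norm (u x))^2 - (norm (v x))\<^sup>2))))"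
 proof (rule indef_int_cong)
 fix x
 have "(u x * cnj (?u' x) + ?u' x * cnj (u x)) - (v x * cnj (?v' x) + ?v' x * cnj (v x)) = of_real (2 * ?y * ((norm (u x))^2 + (norm (v x))^2))"
 proof -
 have n: "(norm w)\<^sup>2 = Re w * Re w + Im w * Im w" for w :: complex unfolding cmod_power2 by (simp add: power2_eq_square)
 show ?thesis unfolding n by (simp add: complex_eq_iff algebra_simps)
 qed
 moreover have "?E x = of_real ((norm (u x))^2 - (norm (v x))\<^sup>2)"
 by (simp add: complex_norm_square[symmetric])
 ultimately show "e x * ((u x * cnj (?u' x) + ?u' x * cnj (u x)) - (v x * cnj (?v' x) + ?v' x * cnj (v x)))
 + cof (2 * \<sigma> * ?y) * e x * ?E x = of_real (exp (2 * \<sigma> * ?y * x) * (2 * ?y * ((norm (u x))^2 + (norm (v x))^2) + 2 * \<sigma> * ?y * ((norm (u x))^2 - (norm (v x))\<^sup>2)))"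
 unfolding e_def by (simp only: of_real_mult[symmetric] of_real_add[symmetric]) (simp add: algebra_simps)
 qed auto
 define g where "g x = exp (2 * \<sigma> * ?y * x) * (2 * ?y * ((norm (u x))^2 + (norm (v x))^2) + 2 * \<sigma> * ?y * ((norm (u x))^2 - (norm (v x))\<^sup>2))" for x
 have g0: "g x >= 0" for x
 proof -
 have "\<bar>\<sigma> * ((norm (u x))^2 - (norm (v x))\<^sup>2)\<bar> <= 1 * ((norm (u x))^2 + (norm (v x))^2)"
 unfolding abs_mult using \<sigma> by (intro mult_mono) (auto simp: abs_le_iff)
 moreover have "0 <= S + t" if "\<bar>t\<bar> <= 1 * S" for S t :: real using that by linarith
 ultimately have "0 <= ((norm (u x))^2 + (norm (v x))^2) + \<sigma> * ((norm (u x))^2 - (norm (v x))\<^sup>2)" by blast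
 then have "0 <= exp (2 * \<sigma> * ?y * x) * (2 * ?y * (((norm (u x))^2 + (norm (v x))^2) + \<sigma> * ((norm (u x))^2 - (norm (v x))\<^sup>2)))"
 using y by (intro mult_nonneg_nonneg) auto
 then show ?thesis unfolding g_def by (simp only: distrib_left mult.assoc mult.left_commute)
 qed
 have eE: "e x * ?E x = of_real (exp (2 * \<sigma> * ?y * x) * ((norm (u x))^2 - (norm (v x))\<^sup>2))" for x
 by (simp add: complex_norm_square[symmetric] e_def)
 have "e t * ?E t - e s * ?E s = (LBINT x:{s..t}. of_real (g x))"
 using I st unfolding indef_int_def g_def by blast
 also have "\<dots> = of_real (LBINT x:{s..t}. g x)" by (rule set_integral_complex_of_real)
 finally have "cof (exp (2 * \<sigma> * ?y * t) * ((norm (u t))^2 - (norm (v t))\<^sup>2) - exp (2 * \<sigma> * ?y * s) * ((norm (u s))^2 - (norm (v s))\<^sup>2)) = of_real (LBINT x:{s..t}. g x)"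
 unfolding eE by simp
 then have "exp (2 * \<sigma> * ?y * t) * ((norm (u t))^2 - (norm (v t))\<^sup>2) - exp (2 * \<sigma> * ?y * s) * ((norm (u s))^2 - (norm (v s))\<^sup>2) = (LBINT x:{s..t}. g x)"
 by (simp only: of_real_eq_iff)
 also have "\<dots> >= 0" unfolding set_lebesgue_integral_def using g0 by (intro LINT_nonneg) auto
 finally show ?thesis by simp
qed

context L2_potential
begin

abbreviation "al \<equiv> Usol 1 0"
abbreviation "be \<equiv> Vsol 1 0"
abbreviation "ga \<equiv> Usol 0 1"
abbreviation "de \<equiv> Vsol 0 1"

lemma dirac_sol_UV: "dirac_sol q z b (%x. Usol u0 v0 x z) (%x. Vsol u0 v0 x z)"
 unfolding dirac_sol_def using sol_indef by auto

lemma dirac_sol_representation: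
 assumes sol: "dirac_sol q z b u v" and x: "0 <= x" "x <= b"
 shows "u x = u 0 * al x z + v 0 * ga x z" "v x = u 0 * be x z + v 0 * de x z"
proof -
 define p where "p x = u 0 * al x z + v 0 * ga x z" for x
 define r where "r x = u 0 * be x z + v 0 * de x z" for x
 have "dirac_sol q z b p r" unfolding p_def[abs_def] r_def[abs_def] by (intro dirac_sol_lincomb dirac_sol_UV)
 then have d: "dirac_sol q z b (%x. 1 * u x + (-1) * p x) (%x. 1 * v x + (-1) * r x)"
 by (intro dirac_sol_lincomb sol)
 have "1 * u 0 + (-1) * p 0 = 0" "1 * v 0 + (-1) * r 0 = 0" by (auto simp: p_def r_def sol_0)
 then have "1 * u x + (-1) * p x = 0" "1 * v x + (-1) * r x = 0"
 using sol_unique[of b "%x. 1 * u x + (-1) * p x" z "%x. 1 * v x + (-1) * r x" x] d x unfolding dirac_sol_def by auto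
 then have "u x = p x" "v x = r x" by simp_all
 then show "u x = u 0 * al x z + v 0 * ga x z" "v x = u 0 * be x z + v 0 * de x z"
 by (simp_all only: p_def r_def)
qed

lemma det_1:
 assumes "x >= 0"
 shows "al x z * de x z - ga x z * be x z = 1"
proof -
 have "indef_int x (%x. al x z * de x z - ga x z * be x z) (%x. 0)"
 using wronskian[OF dirac_sol_UV[of z x 1 0] dirac_sol_UV[of z x 0 1]] by simp
 then have "(al x z * de x z - ga x z * be x z) - (al 0 z * de 0 z - ga 0 z * be 0 z) = (LBINT t:{0..x}. 0)"
 using assms unfolding indef_int_def by blast
 then show ?thesis by (simp add: sol_0 set_lebesgue_integral_def)
qed

lemma al_be:
 assumes "Im z >= 0" "x >= 0"
 shows "(norm (al x z))\<^sup>2 - (norm (be x z))\<^sup>2 >= exp (2 * Im z * x)"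
proof -
 have "1 <= exp (2 * (-1) * Im z * x) * ((norm (al x z))^2 - (norm (be x z))\<^sup>2)"
 using energy_mono[OF dirac_sol_UV[of z x 1 0] assms(1), of "-1" 0 x] assms by (simp add: sol_0)
 then show ?thesis by (simp add: exp_minus field_simps)
qed

text \<open>the solution that vanishes in the first component at X\<close>

text \<open>The solution that vanishes in its first component at \<open>X\<close>; the potential cut off at \<open>X\<close> continues it to a square integrable one.\<close>
lemma terminal_solution:
 assumes "X >= 0"
 shows "dirac_sol q z X (%x. - ga X z * al x z + al X z * ga x z) (%x. - ga X z * be x z + al X z * de x z)"
 "- ga X z * al X z + al X z * ga X z = 0" "- ga X z * be X z + al X z * de X z = 1"
 "- ga X z * al 0 z + al X z * ga 0 z = - ga X z" "- ga X z * be 0 z + al X z * de 0 z = al X z"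
proof -
 show "dirac_sol q z X (%x. - ga X z * al x z + al X z * ga x z) (%x. - ga X z * be x z + al X z * de x z)"
 by (intro dirac_sol_lincomb dirac_sol_UV)
 show "- ga X z * be X z + al X z * de X z = 1" using det_1[OF assms, of z] by (simp add: algebra_simps)
qed (auto simp: sol_0)

lemma al_ga:
 assumes "Im z >= 0" "x >= 0"
 shows "(norm (al x z))\<^sup>2 - (norm (ga x z))\<^sup>2 >= exp (2 * Im z * x)"
 using energy_mono[OF terminal_solution(1)[OF assms(2)] assms(1), of 1 0 x] assms terminal_solution[OF assms(2), of z]
 by simp

lemma al_nz:
 assumes "Im z >= 0" "x >= 0"
 shows "al x z \<noteq> 0"
proof
 assume "al x z = 0"
 then show False using al_be[OF assms] by (smt (verit) exp_gt_zero norm_zero power_zero_numeral zero_le_power2)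
qed

definition schur_trunc :: "real => complex => complex" where
 "schur_trunc X z = - ga X z / al X z"

lemma al_be_prod:
 assumes "Im z >= 0" "x >= 0"
 shows "norm (al x z) * (norm (al x z) - norm (be x z)) >= exp (2 * Im z * x) / 2" "norm (be x z) < norm (al x z)"
proof -
 let ?a = "norm (al x z)" and ?b = "norm (be x z)"
 have h: "?a\<^sup>2 - ?b\<^sup>2 >= exp (2 * Im z * x)" by (rule al_be[OF assms])
 then have "?b\<^sup>2 < ?a\<^sup>2" using exp_gt_zero[of "2 * Im z * x"] by linarith
 then show lt: "?b < ?a" by (rule power_less_imp_less_base) simp
 have "?a\<^sup>2 - ?b\<^sup>2 = (?a + ?b) * (?a - ?b)" by (simp add: power2_eq_square algebra_simps)
 also have "\<dots> <= (2 * ?a) * (?a - ?b)" using lt by (intro mult_right_mono) auto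
 finally show "?a * (?a - ?b) >= exp (2 * Im z * x) / 2" using h by simp
qed

text \<open>Two truncations are Moebius images of points of the unit disc under the same transfer matrix, whose image disc has radius of order \<open>exp (- 2 Im z X)\<close> by the energy estimate.\<close>
lemma schur_trunc_cauchy:
 assumes y: "Im z >= 0" and X: "0 <= X" "X <= X'"
 shows "norm (schur_trunc X' z - schur_trunc X z) <= 2 * exp (- 2 * Im z * X)"
proof -
 have X': "X' >= 0" using X by auto
 define u where "u = - ga X' z * al X z + al X' z * ga X z"
 define v where "v = - ga X' z * be X z + al X' z * de X z"
 have "exp (2 * Im z * X) * ((norm u)^2 - (norm v)\<^sup>2) <= - exp (2 * Im z * X')"
 using energy_mono[OF terminal_solution(1)[OF X', of z] y, of 1 X X'] X terminal_solution[OF X', of z]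
 by (simp add: u_def v_def)
 then have "exp (2 * Im z * X) * ((norm u)^2 - (norm v)\<^sup>2) < 0" using exp_gt_zero[of "2 * Im z * X'"] by linarith
 then have "(norm u)\<^sup>2 < (norm v)^2" by (simp add: mult_less_0_iff)
 then have uv: "norm u < norm v" by (rule power_less_imp_less_base) simp
 have det: "al X z * de X z - ga X z * be X z = 1" by (rule det_1[OF X(1)])
 have "de X z * u - ga X z * v = - ga X' z * (al X z * de X z - ga X z * be X z)"
 by (simp add: u_def v_def algebra_simps)
 then have e1: "- ga X' z = de X z * u - ga X z * v" using det by simp
 have "- be X z * u + al X z * v = al X' z * (al X z * de X z - ga X z * be X z)"
 by (simp add: u_def v_def algebra_simps)
 then have e2: "al X' z = - be X z * u + al X z * v" using det by simp
 have nz: "al X z \<noteq> 0" "al X' z \<noteq> 0" using al_nz y X X' by auto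
 have "schur_trunc X' z - schur_trunc X z = (- ga X' z * al X z + ga X z * al X' z) / (al X' z * al X z)"
 using nz by (simp add: schur_trunc_def field_simps)
 also have "- ga X' z * al X z + ga X z * al X' z = u" by (simp add: u_def algebra_simps)
 finally have eq: "norm (schur_trunc X' z - schur_trunc X z) = norm u / (norm (al X' z) * norm (al X z))"
 by (simp add: norm_divide norm_mult)
 have "norm (al X z) * norm v - norm (be X z) * norm u <= norm (al X' z)"
 unfolding e2 using norm_triangle_ineq2[of "al X z * v" "be X z * u"] by (simp add: norm_mult algebra_simps)
 moreover have "norm (be X z) * norm u <= norm (be X z) * norm v" using uv by (intro mult_left_mono) auto
 ultimately have "(norm (al X z) - norm (be X z)) * norm v <= norm (al X' z)" by (simp add: algebra_simps)
 then have "norm (al X z) * ((norm (al X z) - norm (be X z)) * norm v) <= norm (al X z) * norm (al X' z)"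
 by (intro mult_left_mono) auto
 then have "norm (al X z) * (norm (al X z) - norm (be X z)) * norm v <= norm (al X' z) * norm (al X z)"
 by (simp only: mult.assoc mult.commute[of "norm (al X' z)"])
 moreover have "(exp (2 * Im z * X) / 2) * norm v <= norm (al X z) * (norm (al X z) - norm (be X z)) * norm v"
 using al_be_prod(1)[OF y X(1)] by (intro mult_right_mono) auto
 ultimately have low: "(exp (2 * Im z * X) / 2) * norm v <= norm (al X' z) * norm (al X z)" by (rule order_trans[rotated])
 have "norm u <= norm v" using uv by simp
 also have "norm v = 2 * exp (- 2 * Im z * X) * ((exp (2 * Im z * X) / 2) * norm v)" by (simp add: exp_minus field_simps)
 also have "\<dots> <= 2 * exp (- 2 * Im z * X) * (norm (al X' z) * norm (al X z))" by (intro mult_left_mono low) auto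
 finally show ?thesis unfolding eq using nz by (simp add: divide_le_eq)
qed

definition schur :: "complex => complex" where
 "schur z = lim (%n. schur_trunc (real n) z)"

lemma exp_decay:
 assumes "y > (0::real)"
 shows "((%X. 2 * exp (- 2 * y * X)) \<longlongrightarrow> 0) at_top"
 using assms by real_asymp

lemma schur_trunc_converges:
 assumes y: "Im z > 0"
 shows "(%n. schur_trunc (real n) z) \<leadsto> schur z"
proof -
 have "Cauchy (%n. schur_trunc (real n) z)"
 proof (rule metric_CauchyI)
 fix e :: real assume e: "e > 0"
 have "eventually (%X. 2 * exp (- 2 * Im z * X) < e / 2) at_top"
 using order_tendstoD(2)[OF exp_decay[OF y], of "e/2"] e by auto
 then obtain X0 where X0: "\<And>X. X >= X0 ==> 2 * exp (- 2 * Im z * X) < e / 2" by (auto simp: eventually_at_top_linorder)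
 obtain M :: nat where M: "real M >= X0" using real_arch_simple by blast
 have "dist (schur_trunc (real m) z) (schur_trunc (real n) z) < e" if "m >= M" "n >= M" for m n
 proof -
 have "dist (schur_trunc (real m) z) (schur_trunc (real M) z) < e / 2" "dist (schur_trunc (real n) z) (schur_trunc (real M) z) < e / 2"
 using schur_trunc_cauchy[of z "real M" "real m"] schur_trunc_cauchy[of z "real M" "real n"] X0[OF M] y that
 by (auto simp: dist_norm)
 then show ?thesis by (rule dist_triangle_half_l)
 qed
 then show "\<exists>M. \<forall>m\<ge>M. \<forall>n\<ge>M. dist (schur_trunc (real m) z) (schur_trunc (real n) z) < e" by blast
 qed
 then show ?thesis unfolding schur_def by (simp add: Cauchy_convergent_iff convergent_LIMSEQ_iff)
qed

lemma schur_trunc_dist: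
 assumes y: "Im z > 0" and X: "X >= 0"
 shows "norm (schur z - schur_trunc X z) <= 2 * exp (- 2 * Im z * X)"
proof (rule Lim_bounded)
 show "(%n. norm (schur_trunc (real n) z - schur_trunc X z)) \<leadsto> norm (schur z - schur_trunc X z)"
 by (intro tendsto_intros schur_trunc_converges y)
 show "\<forall>n\<ge>nat \<lceil>X\<rceil>. norm (schur_trunc (real n) z - schur_trunc X z) <= 2 * exp (- 2 * Im z * X)"
 using y X by (intro allI impI schur_trunc_cauchy) linarith+
qed

lemma schur_trunc_norm:
 assumes "Im z >= 0" "X >= 0"
 shows "(norm (schur_trunc X z))\<^sup>2 <= 1 - 1 / (norm (al X z * exp (\<i> * z * X)))^2" "norm (schur_trunc X z) <= 1"
proof -
 have nz: "norm (al X z) > 0" using al_nz assms by auto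
 have e: "(exp (- (Im z * X)))\<^sup>2 = exp (- (2 * Im z * X))"
 by (simp add: power2_eq_square exp_add[symmetric])
 have "exp (2 * Im z * X) / (norm (al X z))^2 <= ((norm (al X z))^2 - (norm (ga X z))\<^sup>2) / (norm (al X z))^2"
 by (intro divide_right_mono al_ga assms) auto
 also have "\<dots> = 1 - (norm (schur_trunc X z))\<^sup>2" using nz by (simp add: schur_trunc_def norm_divide power_divide field_simps)
 finally have "(norm (schur_trunc X z))\<^sup>2 <= 1 - exp (2 * Im z * X) / (norm (al X z))^2" by simp
 also have "exp (2 * Im z * X) / (norm (al X z))^2 = 1 / (norm (al X z * exp (\<i> * z * X)))^2"
 proof -
 have "norm (exp (\<i> * z * X)) = exp (- (Im z * X))" by simp
 then have "1 / (norm (al X z * exp (\<i> * z * X)))^2 = 1 / ((norm (al X z))^2 * exp (- (2 * Im z * X)))"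
 by (simp only: norm_mult power_mult_distrib e)
 then show ?thesis by (simp add: exp_minus field_simps)
 qed
 finally show *: "(norm (schur_trunc X z))\<^sup>2 <= 1 - 1 / (norm (al X z * exp (\<i> * z * X)))^2" .
 then have "(norm (schur_trunc X z))\<^sup>2 <= 1\<^sup>2" by (smt (verit) divide_nonneg_nonneg one_power2 zero_le_power2)
 then show "norm (schur_trunc X z) <= 1" by (rule power2_le_imp_le) simp
qed

lemma schur_norm:
 assumes "Im z > 0"
 shows "norm (schur z) <= 1"
 by (rule Lim_bounded[OF tendsto_norm[OF schur_trunc_converges[OF assms]], of 0]) (use schur_trunc_norm assms in auto)

lemma schur_trunc_holomorphic:
 assumes "X >= 0" "\<And>z. z \<in> S ==> Im z >= 0"
 shows "schur_trunc X holomorphic_on S"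
 unfolding schur_trunc_def[abs_def] using assms al_nz
 by (intro holomorphic_on_divide holomorphic_on_minus sol_holomorphic) auto

lemma schur_uniform:
 assumes z: "Im z > 0"
 shows "cball z (Im z / 2) \<subseteq> {z. Im z > 0}"
 "uniform_limit (cball z (Im z / 2)) (%n. schur_trunc (real n)) schur sequentially"
proof -
 have im: "Im w >= Im z / 2" if "w \<in> cball z (Im z / 2)" for w
 using that abs_Im_le_cmod[of "z - w"] by (auto simp: dist_norm abs_le_iff)
 then show "cball z (Im z / 2) \<subseteq> {z. Im z > 0}" using z by force
 show "uniform_limit (cball z (Im z / 2)) (%n. schur_trunc (real n)) schur sequentially"
 proof (rule uniform_limitI)
 fix e :: real assume e: "e > 0"
 have "((%n. 2 * exp (- 2 * (Im z / 2) * real n)) \<longlongrightarrow> 0) sequentially"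
 using z by real_asymp
 from order_tendstoD(2)[OF this e]
 show "eventually (%n. \<forall>w\<in>cball z (Im z / 2). dist (schur_trunc (real n) w) (schur w) < e) sequentially"
 proof eventually_elim
 case (elim n)
 show ?case
 proof
 fix w assume w: "w \<in> cball z (Im z / 2)"
 have "dist (schur_trunc (real n) w) (schur w) <= 2 * exp (- 2 * Im w * real n)"
 using schur_trunc_dist[of w "real n"] im[OF w] z by (simp add: dist_norm norm_minus_commute)
 also have "\<dots> <= 2 * exp (- 2 * (Im z / 2) * real n)" using im[OF w] by (simp add: mult_right_mono)
 finally show "dist (schur_trunc (real n) w) (schur w) < e" using elim by simp
 qed
 qed
 qed
qed

lemma open_upper: "open {z. Im z > 0}" by (rule open_halfspace_Im_gt)

lemma schur_holomorphic: "schur holomorphic_on {z. Im z > 0}"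
 by (rule holomorphic_uniform_sequence[OF open_upper schur_trunc_holomorphic[of "real n" for n]])
 (use schur_uniform in \<open>auto intro!: exI[of _ "Im z / 2" for z]\<close>)

definition weyl_ratio :: "real => complex => complex" where
 "weyl_ratio X z = (de X z - ga X z) / (al X z - be X z)"

lemma weyl_ratio_dist:
 assumes "Im z > 0" "X >= 0"
 shows "norm (weyl_ratio X z - schur_trunc X z) <= 2 * exp (- 2 * Im z * X)" "al X z \<noteq> be X z"
proof -
 have nz: "al X z \<noteq> 0" using al_nz assms by auto
 show nz2: "al X z \<noteq> be X z" using al_be_prod(2)[of z X] assms by auto
 have det: "al X z * de X z - ga X z * be X z = 1" by (rule det_1[OF assms(2)])
 have "weyl_ratio X z - schur_trunc X z = (al X z * de X z - ga X z * be X z) / (al X z * (al X z - be X z))"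
 using nz nz2 by (simp add: weyl_ratio_def schur_trunc_def field_simps)
 then have eq: "norm (weyl_ratio X z - schur_trunc X z) = 1 / (norm (al X z) * norm (al X z - be X z))"
 using det by (simp add: norm_divide norm_mult)
 have "exp (2 * Im z * X) / 2 <= norm (al X z) * (norm (al X z) - norm (be X z))" using al_be_prod(1)[of z X] assms by auto
 also have "\<dots> <= norm (al X z) * norm (al X z - be X z)" by (intro mult_left_mono norm_triangle_ineq2) auto
 finally have "1 / (norm (al X z) * norm (al X z - be X z)) <= 1 / (exp (2 * Im z * X) / 2)"
 by (intro divide_left_mono) (use nz nz2 in auto)
 also have "\<dots> = 2 * exp (- 2 * Im z * X)" by (simp add: exp_minus field_simps)
 finally show "norm (weyl_ratio X z - schur_trunc X z) <= 2 * exp (- 2 * Im z * X)" using eq by simp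
qed

lemma weyl_ratio_tendsto:
 assumes "Im z > 0"
 shows "((%X. weyl_ratio X z) \<longlongrightarrow> schur z) at_top"
proof (rule Lim_null[THEN iffD2], rule Lim_null_comparison)
 show "((%X. 2 * (2 * exp (- 2 * Im z * X))) \<longlongrightarrow> 0) at_top" using assms by real_asymp
 show "eventually (%X. norm (weyl_ratio X z - schur z) <= 2 * (2 * exp (- 2 * Im z * X))) at_top"
 using eventually_ge_at_top[of 0]
 proof eventually_elim
 case (elim X)
 have "norm (weyl_ratio X z - schur z) <= norm (weyl_ratio X z - schur_trunc X z) + norm (schur z - schur_trunc X z)"
 by (metis norm_triangle_ineq4 diff_diff_eq2 diff_add_cancel)
 then show ?case using weyl_ratio_dist(1)[OF assms elim] schur_trunc_dist[OF assms elim] by linarith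
 qed
qed

end


section \<open>The matrix system and the Weyl function\<close>

no_notation fps_nth (infixl "$" 75)

lemma ac_imp_continuous_on:
 fixes F :: "real => 'a::metric_space"
 assumes "absolutely_continuous_on_interval a b F"
 shows "continuous_on {a..b} F"
 unfolding continuous_on_iff
proof (intro ballI allI impI)
 fix x e :: real assume x: "x \<in> {a..b}" and e: "e > 0"
 then obtain d where "d > 0" and d: "\<And>n u v. (\<forall>i<(n::nat). a <= u i & u i <= v i & v i <= b) &
 disjoint_family_on (%i. {u i<..<v i}) {..<n} & (\<Sum>i<n. v i - u i) < d
 ==> (\<Sum>i<n. dist (F (u i)) (F (v i))) < e"
 using assms unfolding absolutely_continuous_on_interval_def by blast
 have "dist (F y) (F x) < e" if y: "y \<in> {a..b}" "dist y x < d" for y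
 proof -
 have "(\<Sum>i<(1::nat). dist (F (min x y)) (F (max x y))) < e"
 using d[of 1 "%_. min x y" "%_. max x y"] x y by (auto simp: dist_real_def disjoint_family_on_def min_def max_def split: if_splits)
 then show ?thesis by (auto simp: min_def max_def dist_commute split: if_splits)
 qed
 then show "\<exists>d>0. \<forall>x'\<in>{a..b}. dist x' x < d --> dist (F x') (F x) < e" using \<open>d > 0\<close> by blast
qed

lemma ac_bounded_linear:
 fixes F :: "real => 'a::real_normed_vector" and L :: "'a => 'b::real_normed_vector"
 assumes F: "absolutely_continuous_on_interval a b F" and L: "bounded_linear L"
 shows "absolutely_continuous_on_interval a b (%x. L (F x))"
 unfolding absolutely_continuous_on_interval_def
proof (intro allI impI)
 fix e :: real assume e: "e > 0"
 obtain B where B: "B > 0" "\<And>x. norm (L x) <= norm x * B" using bounded_linear.pos_bounded[OF L] by blast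
 then have "e / B > 0" using e by simp
 then obtain d where "d > 0" and d: "\<And>n u v. (\<forall>i<(n::nat). a <= u i & u i <= v i & v i <= b) &
 disjoint_family_on (%i. {u i<..<v i}) {..<n} & (\<Sum>i<n. v i - u i) < d
 ==> (\<Sum>i<n. dist (F (u i)) (F (v i))) < e / B"
 using F unfolding absolutely_continuous_on_interval_def by blast
 show "\<exists>d>0. \<forall>(n::nat) u v. (\<forall>i<n. a <= u i & u i <= v i & v i <= b) &
 disjoint_family_on (%i. {u i<..<v i}) {..<n} & (\<Sum>i<n. v i - u i) < d
 --> (\<Sum>i<n. dist (L (F (u i))) (L (F (v i)))) < e"
 proof (intro exI[of _ d] conjI allI impI \<open>d > 0\<close>)
 fix n :: nat and u v :: "nat => real"
 assume h: "(\<forall>i<n. a <= u i & u i <= v i & v i <= b) &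
 disjoint_family_on (%i. {u i<..<v i}) {..<n} & (\<Sum>i<n. v i - u i) < d"
 have "(\<Sum>i<n. dist (L (F (u i))) (L (F (v i)))) <= (\<Sum>i<n. dist (F (u i)) (F (v i)) * B)"
 using B by (intro sum_mono) (simp add: dist_norm linear_diff[OF bounded_linear.linear[OF L], symmetric])
 also have "\<dots> = (\<Sum>i<n. dist (F (u i)) (F (v i))) * B" by (simp add: sum_distrib_right)
 also have "\<dots> < e" using d[OF h] B by (simp add: field_simps)
 finally show "(\<Sum>i<n. dist (L (F (u i))) (L (F (v i)))) < e" .
 qed
qed

lemma ac_add:
 fixes F G :: "real => 'a::real_normed_vector"
 assumes F: "absolutely_continuous_on_interval a b F" and G: "absolutely_continuous_on_interval a b G"
 shows "absolutely_continuous_on_interval a b (%x. F x + G x)"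
 unfolding absolutely_continuous_on_interval_def
proof (intro allI impI)
 fix e :: real assume "e > 0"
 then have e: "e / 2 > 0" by simp
 obtain d where "d > 0" and d: "\<And>n u v. (\<forall>i<(n::nat). a <= u i & u i <= v i & v i <= b) &
 disjoint_family_on (%i. {u i<..<v i}) {..<n} & (\<Sum>i<n. v i - u i) < d
 ==> (\<Sum>i<n. dist (F (u i)) (F (v i))) < e / 2"
 using F e unfolding absolutely_continuous_on_interval_def by blast
 obtain d' where "d' > 0" and d': "\<And>n u v. (\<forall>i<(n::nat). a <= u i & u i <= v i & v i <= b) &
 disjoint_family_on (%i. {u i<..<v i}) {..<n} & (\<Sum>i<n. v i - u i) < d'
 ==> (\<Sum>i<n. dist (G (u i)) (G (v i))) < e / 2"
 using G e unfolding absolutely_continuous_on_interval_def by blast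
 show "\<exists>d>0. \<forall>(n::nat) u v. (\<forall>i<n. a <= u i & u i <= v i & v i <= b) &
 disjoint_family_on (%i. {u i<..<v i}) {..<n} & (\<Sum>i<n. v i - u i) < d
 --> (\<Sum>i<n. dist (F (u i) + G (u i)) (F (v i) + G (v i))) < e"
 proof (intro exI[of _ "min d d'"] conjI allI impI)
 fix n :: nat and u v :: "nat => real"
 assume h: "(\<forall>i<n. a <= u i & u i <= v i & v i <= b) &
 disjoint_family_on (%i. {u i<..<v i}) {..<n} & (\<Sum>i<n. v i - u i) < min d d'"
 have "(\<Sum>i<n. dist (F (u i) + G (u i)) (F (v i) + G (v i))) <= (\<Sum>i<n. dist (F (u i)) (F (v i)) + dist (G (u i)) (G (v i)))"
 by (intro sum_mono dist_triangle_add)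
 also have "\<dots> = (\<Sum>i<n. dist (F (u i)) (F (v i))) + (\<Sum>i<n. dist (G (u i)) (G (v i)))" by (rule sum.distrib)
 also have "\<dots> < e" using d[of n u v] d'[of n u v] h by simp
 finally show "(\<Sum>i<n. dist (F (u i) + G (u i)) (F (v i) + G (v i))) < e" .
 qed (use \<open>d > 0\<close> \<open>d' > 0\<close> in auto)
qed

lemma matrix_dirac_iff:
 fixes N' N :: "complex^2^2"
 shows "Jmat ** N' + Qmat w ** N = mat z ** N \<longleftrightarrow>
 (\<forall>j. N' $ 1 $ j + \<i> * N' $ 2 $ j = - \<i> * z * (N $ 1 $ j + \<i> * N $ 2 $ j) - cnj w * (N $ 1 $ j - \<i> * N $ 2 $ j) &
 N' $ 1 $ j - \<i> * N' $ 2 $ j = \<i> * z * (N $ 1 $ j - \<i> * N $ 2 $ j) - w * (N $ 1 $ j + \<i> * N $ 2 $ j))"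
proof -
 have ext: "X = Y \<longleftrightarrow> (\<forall>j. X $ 1 $ j = Y $ 1 $ j & X $ 2 $ j = Y $ 2 $ j)" for X Y :: "complex^2^2"
 unfolding vec_eq_iff forall_2 by blast
 have l: "(Jmat ** N' + Qmat w ** N) $ 1 $ j = - N' $ 2 $ j + Im w * N $ 1 $ j + Re w * N $ 2 $ j"
 "(Jmat ** N' + Qmat w ** N) $ 2 $ j = N' $ 1 $ j + Re w * N $ 1 $ j - Im w * N $ 2 $ j"
 "(mat z ** N) $ 1 $ j = z * N $ 1 $ j" "(mat z ** N) $ 2 $ j = z * N $ 2 $ j" for j
 by (simp_all add: matrix_matrix_mult_def Jmat_def Qmat_def mat_def sum_2)
 have w: "w = Re w + \<i> * Im w" "cnj w = Re w - \<i> * Im w" by (simp_all add: complex_eq_iff)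
 have "(- b + s * n1 + p * n2 = z * n1 & a + p * n1 - s * n2 = z * n2) \<longleftrightarrow>
 (a + \<i> * b = - \<i> * z * (n1 + \<i> * n2) - (p - \<i> * s) * (n1 - \<i> * n2) &
 a - \<i> * b = \<i> * z * (n1 - \<i> * n2) - (p + \<i> * s) * (n1 + \<i> * n2))" for a b n1 n2 p s :: complex
 proof -
 define e1 where "e1 = - b + s * n1 + p * n2 - z * n1"
 define e2 where "e2 = a + p * n1 - s * n2 - z * n2"
 have ii: "\<i> * (\<i> * c) = - c" for c by (simp add: mult.assoc[symmetric])
 have "(a + \<i> * b) - (- \<i> * z * (n1 + \<i> * n2) - (p - \<i> * s) * (n1 - \<i> * n2)) = e2 - \<i> * e1"
 "(a - \<i> * b) - (\<i> * z * (n1 - \<i> * n2) - (p + \<i> * s) * (n1 + \<i> * n2)) = e2 + \<i> * e1"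
 unfolding e1_def e2_def by (simp_all add: algebra_simps ii)
 moreover have "e2 - \<i> * e1 = 0 & e2 + \<i> * e1 = 0 \<longleftrightarrow> e1 = 0 & e2 = 0"
 proof
 assume h: "e2 - \<i> * e1 = 0 & e2 + \<i> * e1 = 0"
 have "2 * \<i> * e1 = (e2 + \<i> * e1) - (e2 - \<i> * e1)" by simp
 then have "e1 = 0" unfolding conjunct1[OF h] conjunct2[OF h] by simp
 then show "e1 = 0 & e2 = 0" using h by simp
 qed auto
 ultimately show ?thesis unfolding e1_def e2_def by (metis eq_iff_diff_eq_0)
 qed
 from this[of "N' $ 2 $ j" "Im w" "N $ 1 $ j" "Re w" "N $ 2 $ j" "N' $ 1 $ j" for j]
 show ?thesis unfolding ext l by (simp only: w(1)[symmetric] w(2)[symmetric])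
qed

lemma AE_lebesgue_on_negligible:
 assumes "AE x in lebesgue_on S. P x" "S \<in> sets lebesgue"
 obtains N where "negligible N" "\<And>x. x \<in> S ==> x \<notin> N ==> P x"
proof -
 have "AE x in lebesgue. x \<in> S --> P x" using assms by (subst (asm) AE_restrict_space_iff) auto
 then obtain N where "N \<in> null_sets lebesgue" "{x \<in> space lebesgue. \<not> (x \<in> S --> P x)} \<subseteq> N"
 unfolding eventually_ae_filter by blast
 then show ?thesis by (intro that[of N]) (auto simp: negligible_iff_null_sets)
qed

lemma negligible_AE_lebesgue_on:
 assumes "negligible N" "\<And>x. x \<in> S ==> x \<notin> N ==> P x" "S \<in> sets lebesgue"
 shows "AE x in lebesgue_on S. P x"
proof -
 have "AE x in lebesgue. x \<notin> N" using assms(1) by (intro AE_not_in) (simp add: negligible_iff_null_sets)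
 then have "AE x in lebesgue. x \<in> S --> P x" by eventually_elim (use assms(2) in auto)
 then show ?thesis using assms(3) by (subst AE_restrict_space_iff) auto
qed

text \<open>Allows to replace the potential by a Borel representative.\<close>
lemma is_dirac_solution_cong_AE:
 assumes "AE x in lebesgue_on {0<..}. q x = q' x"
 shows "is_dirac_solution q z N \<longleftrightarrow> is_dirac_solution q' z N"
proof -
 have "(AE x in lebesgue_on {0<..}. \<exists>N'. (N has_vector_derivative N') (at x) & Jmat ** N' + Qmat (q x) ** N x = mat z ** N x) \<longleftrightarrow>
 (AE x in lebesgue_on {0<..}. \<exists>N'. (N has_vector_derivative N') (at x) & Jmat ** N' + Qmat (q' x) ** N x = mat z ** N x)"
 (is "?A \<longleftrightarrow> ?B")
 proof
 assume ?A then show ?B using assms by eventually_elim simp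
 next
 assume ?B then show ?A using assms by eventually_elim simp
 qed
 then show ?thesis unfolding is_dirac_solution_def by simp
qed

context L2_potential
begin

lemma dirac_sol_of_matrix:
 assumes N: "is_dirac_solution q z N" and b: "b > 0"
 shows "dirac_sol q z b (%x. N x $ 1 $ j + \<i> * N x $ 2 $ j) (%x. N x $ 1 $ j - \<i> * N x $ 2 $ j)"
proof -
 define L where "L s A = A $ 1 $ j + s * A $ 2 $ j" for s :: complex and A :: "complex^2^2"
 have L: "bounded_linear (L s)" for s unfolding L_def[abs_def]
 by (intro bounded_linear_add bounded_linear_compose[OF bounded_linear_mult_right]
 bounded_linear_compose[OF bounded_linear_vec_nth bounded_linear_vec_nth])
 have ac: "absolutely_continuous_on_interval 0 b N" using N b by (auto simp: is_dirac_solution_def)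
 note acL = ac_bounded_linear[OF ac L]
 have c: "continuous_on {0..b} (%x. L s (N x))" for s by (rule ac_imp_continuous_on[OF acL])
 obtain S where S: "negligible S" "\<And>x. x > 0 ==> x \<notin> S ==> \<exists>N'. (N has_vector_derivative N') (at x) &
 Jmat ** N' + Qmat (q x) ** N x = mat z ** N x"
 using AE_lebesgue_on_negligible[where S = "{0<..}" and P = "%x. \<exists>N'. (N has_vector_derivative N') (at x) &
 Jmat ** N' + Qmat (q x) ** N x = mat z ** N x"] N unfolding is_dirac_solution_def by auto
 have "indef_int b (%x. L \<i> (N x)) (%x. - \<i> * z * L \<i> (N x) - cnj (q x) * L (- \<i>) (N x))"
 proof (rule indef_int_ac_derivative[OF acL S(1)])
 fix x assume x: "0 < x" "x < b" "x \<notin> S"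
 then obtain N' where N': "(N has_vector_derivative N') (at x)" "Jmat ** N' + Qmat (q x) ** N x = mat z ** N x" using S(2) by blast
 have "((%x. L \<i> (N x)) has_vector_derivative L \<i> N') (at x)" by (rule bounded_linear.has_vector_derivative[OF L N'(1)])
 then show "((%x. L \<i> (N x)) has_vector_derivative - \<i> * z * L \<i> (N x) - cnj (q x) * L (- \<i>) (N x)) (at x)"
 using N'(2) unfolding matrix_dirac_iff L_def by simp
 next
 show "set_integrable lborel {0..b} (%x. - \<i> * z * L \<i> (N x) - cnj (q x) * L (- \<i>) (N x))"
 using set_integral_diff(1)[OF set_integrable_mult_right[OF set_integrable_continuous_mult[OF c one_int], of "- \<i> * z" \<i>]
 set_integrable_continuous_mult[OF c cq_set_integrable, of "- \<i>"]] by (simp add: mult.commute)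
 qed
 moreover have "indef_int b (%x. L (- \<i>) (N x)) (%x. \<i> * z * L (- \<i>) (N x) - q x * L \<i> (N x))"
 proof (rule indef_int_ac_derivative[OF acL S(1)])
 fix x assume x: "0 < x" "x < b" "x \<notin> S"
 then obtain N' where N': "(N has_vector_derivative N') (at x)" "Jmat ** N' + Qmat (q x) ** N x = mat z ** N x" using S(2) by blast
 have "((%x. L (- \<i>) (N x)) has_vector_derivative L (- \<i>) N') (at x)" by (rule bounded_linear.has_vector_derivative[OF L N'(1)])
 then show "((%x. L (- \<i>) (N x)) has_vector_derivative \<i> * z * L (- \<i>) (N x) - q x * L \<i> (N x)) (at x)"
 using N'(2) unfolding matrix_dirac_iff L_def by simp
 next
 show "set_integrable lborel {0..b} (%x. \<i> * z * L (- \<i>) (N x) - q x * L \<i> (N x))"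
 using set_integral_diff(1)[OF set_integrable_mult_right[OF set_integrable_continuous_mult[OF c one_int], of "\<i> * z" "- \<i>"]
 set_integrable_continuous_mult[OF c q_set_integrable, of \<i>]] by (simp add: mult.commute)
 qed
 ultimately show ?thesis unfolding dirac_sol_def L_def by simp
qed

lemma dirac_solution_exists: "\<exists>N. is_dirac_solution q z N"
proof -
 let ?u = "%x. Usol 1 1 x z" and ?v = "%x. Vsol 1 1 x z" and ?u2 = "%x. Usol \<i> (-\<i>) x z" and ?v2 = "%x. Vsol \<i> (-\<i>) x z"
 define P where "P w = (vector [vector [w / 2, 0], vector [w / (2 * \<i>), 0]] :: complex^2^2)" for w
 define P' where "P' w = (vector [vector [w / 2, 0], vector [- w / (2 * \<i>), 0]] :: complex^2^2)" for w
 define R where "R w = (vector [vector [0, w / 2], vector [0, w / (2 * \<i>)]] :: complex^2^2)" for w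
 define R' where "R' w = (vector [vector [0, w / 2], vector [0, - w / (2 * \<i>)]] :: complex^2^2)" for w
 have lin: "bounded_linear P" "bounded_linear P'" "bounded_linear R" "bounded_linear R'"
 unfolding linear_conv_bounded_linear[symmetric] P_def[abs_def] P'_def[abs_def] R_def[abs_def] R'_def[abs_def]
 by (auto intro!: linearI simp: vec_eq_iff forall_2 field_simps)
 define N where "N x = P (?u x) + P' (?v x) + (R (?u2 x) + R' (?v2 x))" for x
 have s1: "dirac_sol q z b ?u ?v" "dirac_sol q z b ?u2 ?v2" for b by (rule dirac_sol_UV)+
 have ac: "absolutely_continuous_on_interval 0 b N" for b unfolding N_def[abs_def]
 proof -
 have a: "absolutely_continuous_on_interval 0 b ?u" "absolutely_continuous_on_interval 0 b ?v"
 "absolutely_continuous_on_interval 0 b ?u2" "absolutely_continuous_on_interval 0 b ?v2"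
 using s1[of b] indef_int_ac unfolding dirac_sol_def by blast+
 show "absolutely_continuous_on_interval 0 b (%x. P (?u x) + P' (?v x) + (R (?u2 x) + R' (?v2 x)))"
 by (intro ac_add ac_bounded_linear[OF a(1) lin(1)] ac_bounded_linear[OF a(2) lin(2)]
 ac_bounded_linear[OF a(3) lin(3)] ac_bounded_linear[OF a(4) lin(4)])
 qed
 have N0: "N 0 = mat 1"
 by (auto simp: N_def sol_0 P_def P'_def R_def R'_def mat_def vec_eq_iff forall_2)
 have "\<forall>n. \<exists>S. negligible S & (\<forall>x. 0 < x --> x < real n --> x \<notin> S -->
 (?u has_vector_derivative (- \<i> * z * ?u x - cnj (q x) * ?v x)) (at x) & (?v has_vector_derivative (\<i> * z * ?v x - q x * ?u x)) (at x) &
 (?u2 has_vector_derivative (- \<i> * z * ?u2 x - cnj (q x) * ?v2 x)) (at x) & (?v2 has_vector_derivative (\<i> * z * ?v2 x - q x * ?u2 x)) (at x))"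
 proof
 fix n :: nat
 obtain S1 where S1: "negligible S1" "\<And>x. 0 < x ==> x < real n ==> x \<notin> S1 ==> (?u has_vector_derivative (- \<i> * z * ?u x - cnj (q x) * ?v x)) (at x)"
 using indef_int_derivative[OF conjunct1[OF s1(1)[of "real n", unfolded dirac_sol_def]]] by blast
 obtain S2 where S2: "negligible S2" "\<And>x. 0 < x ==> x < real n ==> x \<notin> S2 ==> (?v has_vector_derivative (\<i> * z * ?v x - q x * ?u x)) (at x)"
 using indef_int_derivative[OF conjunct2[OF s1(1)[of "real n", unfolded dirac_sol_def]]] by blast
 obtain S3 where S3: "negligible S3" "\<And>x. 0 < x ==> x < real n ==> x \<notin> S3 ==> (?u2 has_vector_derivative (- \<i> * z * ?u2 x - cnj (q x) * ?v2 x)) (at x)"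
 using indef_int_derivative[OF conjunct1[OF s1(2)[of "real n", unfolded dirac_sol_def]]] by blast
 obtain S4 where S4: "negligible S4" "\<And>x. 0 < x ==> x < real n ==> x \<notin> S4 ==> (?v2 has_vector_derivative (\<i> * z * ?v2 x - q x * ?u2 x)) (at x)"
 using indef_int_derivative[OF conjunct2[OF s1(2)[of "real n", unfolded dirac_sol_def]]] by blast
 show "\<exists>S. negligible S & (\<forall>x. 0 < x --> x < real n --> x \<notin> S -->
 (?u has_vector_derivative (- \<i> * z * ?u x - cnj (q x) * ?v x)) (at x) & (?v has_vector_derivative (\<i> * z * ?v x - q x * ?u x)) (at x) &
 (?u2 has_vector_derivative (- \<i> * z * ?u2 x - cnj (q x) * ?v2 x)) (at x) & (?v2 has_vector_derivative (\<i> * z * ?v2 x - q x * ?u2 x)) (at x))"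
 using S1 S2 S3 S4 by (intro exI[of _ "S1 \<union> S2 \<union> (S3 \<union> S4)"]) (simp add: negligible_Un)
 qed
 then obtain S where S: "\<And>n. negligible (S n)" "\<And>n x. 0 < x ==> x < real n ==> x \<notin> S n ==>
 (?u has_vector_derivative (- \<i> * z * ?u x - cnj (q x) * ?v x)) (at x) & (?v has_vector_derivative (\<i> * z * ?v x - q x * ?u x)) (at x) &
 (?u2 has_vector_derivative (- \<i> * z * ?u2 x - cnj (q x) * ?v2 x)) (at x) & (?v2 has_vector_derivative (\<i> * z * ?v2 x - q x * ?u2 x)) (at x)"
 by metis
 have "AE x in lebesgue_on {0<..}. \<exists>N'. (N has_vector_derivative N') (at x) & Jmat ** N' + Qmat (q x) ** N x = mat z ** N x"
 proof (rule negligible_AE_lebesgue_on)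
 show "negligible (\<Union>n::nat. S n)" by (rule negligible_countable_Union) (use S in auto)
 fix x :: real assume x: "x \<in> {0<..}" "x \<notin> (\<Union>n::nat. S n)"
 obtain n :: nat where "x < real n" using reals_Archimedean2 by blast
 then have d: "(?u has_vector_derivative (- \<i> * z * ?u x - cnj (q x) * ?v x)) (at x)" "(?v has_vector_derivative (\<i> * z * ?v x - q x * ?u x)) (at x)"
 "(?u2 has_vector_derivative (- \<i> * z * ?u2 x - cnj (q x) * ?v2 x)) (at x)" "(?v2 has_vector_derivative (\<i> * z * ?v2 x - q x * ?u2 x)) (at x)"
 using S(2)[of x n] x by auto
 let ?N' = "P (- \<i> * z * ?u x - cnj (q x) * ?v x) + P' (\<i> * z * ?v x - q x * ?u x) + (R (- \<i> * z * ?u2 x - cnj (q x) * ?v2 x) + R' (\<i> * z * ?v2 x - q x * ?u2 x))"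
 have "(N has_vector_derivative ?N') (at x)" unfolding N_def[abs_def]
 by (intro has_vector_derivative_add bounded_linear.has_vector_derivative[OF lin(1) d(1)] bounded_linear.has_vector_derivative[OF lin(2) d(2)]
 bounded_linear.has_vector_derivative[OF lin(3) d(3)] bounded_linear.has_vector_derivative[OF lin(4) d(4)])
 moreover have "Jmat ** ?N' + Qmat (q x) ** N x = mat z ** N x"
 unfolding matrix_dirac_iff by (simp add: forall_2 N_def P_def P'_def R_def R'_def field_simps)
 ultimately show "\<exists>N'. (N has_vector_derivative N') (at x) & Jmat ** N' + Qmat (q x) ** N x = mat z ** N x" by blast
 qed auto
 then show ?thesis unfolding is_dirac_solution_def using ac N0 by blast
qed

lemma dirac_solution_ratio:
 assumes z: "Im z > 0" and x: "x > 0" and w: "weyl_ratio x z \<noteq> 1"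
 shows "dirac_solution q x z $ 2 $ 2 / dirac_solution q x z $ 2 $ 1 = \<i> * (1 + weyl_ratio x z) / (1 - weyl_ratio x z)"
proof -
 define N where "N = (SOME N. is_dirac_solution q z N)"
 have N: "is_dirac_solution q z N" unfolding N_def by (rule someI_ex[OF dirac_solution_exists])
 have N0: "N 0 = mat 1" using N by (simp add: is_dirac_solution_def)
 note r1 = dirac_sol_representation[OF dirac_sol_of_matrix[OF N x, of 1], of x]
 note r2 = dirac_sol_representation[OF dirac_sol_of_matrix[OF N x, of 2], of x]
 have a1: "N x $ 1 $ 1 + \<i> * N x $ 2 $ 1 = al x z + ga x z" "N x $ 1 $ 1 - \<i> * N x $ 2 $ 1 = be x z + de x z"
 using r1 x by (auto simp: N0 mat_def)
 have a2: "N x $ 1 $ 2 + \<i> * N x $ 2 $ 2 = \<i> * (al x z - ga x z)" "N x $ 1 $ 2 - \<i> * N x $ 2 $ 2 = \<i> * (be x z - de x z)"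
 using r2 x by (auto simp: N0 mat_def algebra_simps)
 have "2 * \<i> * N x $ 2 $ 1 = (N x $ 1 $ 1 + \<i> * N x $ 2 $ 1) - (N x $ 1 $ 1 - \<i> * N x $ 2 $ 1)" by simp
 then have n21: "2 * \<i> * N x $ 2 $ 1 = (al x z - be x z) - (de x z - ga x z)" unfolding a1 by simp
 have "2 * \<i> * N x $ 2 $ 2 = (N x $ 1 $ 2 + \<i> * N x $ 2 $ 2) - (N x $ 1 $ 2 - \<i> * N x $ 2 $ 2)" by simp
 then have n22: "2 * \<i> * N x $ 2 $ 2 = \<i> * ((al x z - be x z) + (de x z - ga x z))" unfolding a2 by (simp add: algebra_simps)
 have nz: "al x z - be x z \<noteq> 0" using weyl_ratio_dist(2)[of z x] z x by auto
 define A where "A = al x z - be x z"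
 define B where "B = de x z - ga x z"
 have AB: "A \<noteq> 0" "A \<noteq> B" "weyl_ratio x z = B / A" using nz w by (auto simp: A_def B_def weyl_ratio_def)
 have "N x $ 2 $ 2 / N x $ 2 $ 1 = (2 * \<i> * N x $ 2 $ 2) / (2 * \<i> * N x $ 2 $ 1)" by simp
 also have "\<dots> = \<i> * (A + B) / (A - B)" unfolding n21 n22 A_def B_def by simp
 also have "\<dots> = \<i> * (1 + B / A) / (1 - B / A)" using AB(1,2) by (simp add: field_simps)
 finally show ?thesis by (simp add: dirac_solution_def N_def[symmetric] AB(3))
qed

lemma schur_function_eq:
 assumes z: "Im z > 0" and ne: "schur z \<noteq> 1"
 shows "schur_function q z = schur z"
proof -
 have lim: "((%x. \<i> * (1 + weyl_ratio x z) / (1 - weyl_ratio x z)) \<longlongrightarrow> \<i> * (1 + schur z) / (1 - schur z)) at_top"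
 using ne by (intro tendsto_intros weyl_ratio_tendsto z) auto
 have "eventually (%x. weyl_ratio x z \<noteq> 1) at_top"
 using tendsto_imp_eventually_ne[OF weyl_ratio_tendsto[OF z] ne] .
 then have "eventually (%x. \<i> * (1 + weyl_ratio x z) / (1 - weyl_ratio x z) = dirac_solution q x z $ 2 $ 2 / dirac_solution q x z $ 2 $ 1) at_top"
 using eventually_gt_at_top[of 0] by eventually_elim (use dirac_solution_ratio[OF z] in auto)
 then have "((%x. dirac_solution q x z $ 2 $ 2 / dirac_solution q x z $ 2 $ 1) \<longlongrightarrow> \<i> * (1 + schur z) / (1 - schur z)) at_top"
 by (rule Lim_transform_eventually[OF lim])
 then have "weyl_function q z = \<i> * (1 + schur z) / (1 - schur z)"
 unfolding weyl_function_def by (intro tendsto_Lim) auto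
 moreover have "w = w'" if "w \<noteq> 1" "w' \<noteq> 1" "\<i> * (1 + w) / (1 - w) = \<i> * (1 + w') / (1 - w')" for w w' :: complex
 proof -
 have "(1 + w) * (1 - w') = (1 + w') * (1 - w)" using that by (simp add: frac_eq_eq)
 then show ?thesis by (simp add: algebra_simps)
 qed
 ultimately show ?thesis unfolding schur_function_def using ne by (intro the_equality) auto
qed

end


section \<open>Square integrability of the Schur function\<close>

lemma circle_mean:
 assumes "continuous_on (cball c r) f" "f holomorphic_on ball c r" "r > 0"
 shows "((%t. f (circlepath c r t)) has_integral f c) {0..1}"
proof -
 have "((%u. f u / (u - c)) has_contour_integral (2 * of_real pi * \<i> * f c)) (circlepath c r)"
 using Cauchy_integral_circlepath[OF assms(1,2), of c] assms(3) by simp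
 then have "((%t. f (circlepath c r t) / (circlepath c r t - c) * vector_derivative (circlepath c r) (at t within {0..1})) has_integral (2 * of_real pi * \<i> * f c)) {0..1}"
 unfolding has_contour_integral_def .
 then have "((%t. (2 * of_real pi * \<i>) * f (circlepath c r t)) has_integral (2 * of_real pi * \<i> * f c)) {0..1}"
 proof (rule has_integral_eq[rotated])
 fix t :: real assume t: "t \<in> {0..1}"
 have vd: "vector_derivative (circlepath c r) (at t within {0..1}) = 2 * of_real pi * \<i> * r * exp (2 * of_real pi * \<i> * t)"
 using vector_derivative_circlepath01[of t c r] t by simp
 have "circlepath c r t - c = r * exp (2 * of_real pi * \<i> * t)" by (simp add: circlepath)
 then show "f (circlepath c r t) / (circlepath c r t - c) * vector_derivative (circlepath c r) (at t within {0..1}) = (2 * of_real pi * \<i>) * f (circlepath c r t)"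
 unfolding vd using assms(3) by simp
 qed
 then show ?thesis by (subst (asm) has_integral_cmul_iff[symmetric]) (auto simp: has_integral_mult_right_iff)
qed

lemma nn_kernel_bound:
 fixes y :: real
 assumes y: "y > 0"
 shows "(NN s. ennreal (indicator {0..t} s * exp (- 2 * y * (t - s)))) <= ennreal (1 / (2 * y))"
 "(NN t. ennreal (indicator {s..X} t * exp (- 2 * y * (t - s)))) <= ennreal (1 / (2 * y))"
proof -
 show "(NN s. ennreal (indicator {0..t} s * exp (- 2 * y * (t - s)))) <= ennreal (1 / (2 * y))"
 proof (cases "t >= 0")
 case True
 have "(NN s. ennreal (indicator {0..t} s * exp (- 2 * y * (t - s)))) = (NN s. ennreal (exp (- 2 * y * (t - s))) * indicator {0..t} s)"
 by (intro nn_integral_cong) (auto simp: indicator_def)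
 also have "\<dots> = ennreal (exp (- 2 * y * (t - t)) / (2 * y) - exp (- 2 * y * (t - 0)) / (2 * y))"
 using y True by (intro nn_integral_FTC_Icc) (auto intro!: derivative_eq_intros)
 also have "\<dots> <= ennreal (1 / (2 * y))" using y by (intro ennreal_leI) (auto simp: field_simps)
 finally show ?thesis .
 qed auto
 show "(NN t. ennreal (indicator {s..X} t * exp (- 2 * y * (t - s)))) <= ennreal (1 / (2 * y))"
 proof (cases "s <= X")
 case True
 have "(NN t. ennreal (indicator {s..X} t * exp (- 2 * y * (t - s)))) = (NN t. ennreal (exp (- 2 * y * (t - s))) * indicator {s..X} t)"
 by (intro nn_integral_cong) (auto simp: indicator_def)
 also have "\<dots> = ennreal (- exp (- 2 * y * (X - s)) / (2 * y) - - exp (- 2 * y * (s - s)) / (2 * y))"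
 using y True by (intro nn_integral_FTC_Icc) (auto intro!: derivative_eq_intros)
 also have "\<dots> <= ennreal (1 / (2 * y))" using y by (intro ennreal_leI) (auto simp: field_simps)
 finally show ?thesis .
 qed auto
qed

context L2_potential
begin

lemma nn_energy: "(NN x. ennreal ((cmod (q x))^2)) = ennreal energy"
 unfolding energy_def by (rule nn_integral_eq_integral[OF q_sq]) auto

text \<open>Young's convolution inequality for \<open>|q|\<close> with itself and the one-sided exponential; it makes the iterated integral equations contractive for large \<open>Im z\<close>.\<close>
lemma young_nn:
 fixes y X :: real
 assumes y: "y > 0"
 shows "(NN t. (NN s. ennreal (indicator {0..X} t * indicator {0..t} s * exp (- 2 * y * (t - s)) * cmod (q s) * cmod (q t))))
 <= ennreal (energy / (2 * y))"
proof -
 define K where "K t s = (indicator {0..X} t * indicator {0..t} s * exp (- 2 * y * (t - s)) :: real)" for t s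
 have K_eq: "K t s = (if 0 <= s & s <= t & t <= X then exp (- 2 * y * (t - s)) else 0)" for t s
 by (auto simp: K_def indicator_def)
 have Km[measurable]: "(%(t,s). K t s) \<in> borel_measurable (lborel \<Otimes>\<^sub>M lborel)"
 unfolding K_eq split_def by measurable
 have K0: "K t s >= 0" for t s by (simp add: K_eq)
 have Ks: "(NN s. ennreal (K t s)) <= ennreal (1 / (2 * y))" for t
 proof -
 have "(NN s. ennreal (K t s)) <= (NN s. ennreal (indicator {0..t} s * exp (- 2 * y * (t - s))))"
 by (intro nn_integral_mono ennreal_leI) (auto simp: K_def indicator_def)
 then show ?thesis using nn_kernel_bound(1)[OF y] order_trans by blast
 qed
 have Kt: "(NN t. ennreal (K t s)) <= ennreal (1 / (2 * y))" for s
 proof -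
 have "(NN t. ennreal (K t s)) <= (NN t. ennreal (indicator {s..X} t * exp (- 2 * y * (t - s))))"
 by (intro nn_integral_mono ennreal_leI) (auto simp: K_def indicator_def)
 then show ?thesis using nn_kernel_bound(2)[OF y] order_trans by blast
 qed
 have Km1[measurable]: "(%s. K t s) \<in> borel_measurable lborel" "(%t. K t s) \<in> borel_measurable lborel" for t s
 unfolding K_eq by measurable
 have "(NN t. (NN s. ennreal (K t s * cmod (q s) * cmod (q t))))
 <= (NN t. (NN s. ennreal ((cmod (q t))^2 / 2) * ennreal (K t s) + ennreal ((cmod (q s))^2 / 2) * ennreal (K t s)))"
 proof (intro nn_integral_mono)
 fix t s
 have "2 * (cmod (q s) * cmod (q t)) <= (cmod (q s))\<^sup>2 + (cmod (q t))^2" using sum_squares_bound[of "cmod (q s)" "cmod (q t)"] by simp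
 then have "K t s * (cmod (q s) * cmod (q t)) <= K t s * ((cmod (q t))^2 / 2 + (cmod (q s))^2 / 2)"
 by (intro mult_left_mono K0) auto
 then have "K t s * cmod (q s) * cmod (q t) <= (cmod (q t))\<^sup>2 / 2 * K t s + (cmod (q s))^2 / 2 * K t s"
 by (simp add: algebra_simps)
 then have "ennreal (K t s * cmod (q s) * cmod (q t)) <= ennreal ((cmod (q t))^2 / 2 * K t s + (cmod (q s))^2 / 2 * K t s)"
 by (rule ennreal_leI)
 also have "\<dots> = ennreal ((cmod (q t))^2 / 2 * K t s) + ennreal ((cmod (q s))^2 / 2 * K t s)"
 by (rule ennreal_plus) (use K0 in auto)
 also have "\<dots> = ennreal ((cmod (q t))^2 / 2) * ennreal (K t s) + ennreal ((cmod (q s))^2 / 2) * ennreal (K t s)"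
 by (subst (1 2) ennreal_mult) (use K0 in auto)
 finally show "ennreal (K t s * cmod (q s) * cmod (q t)) <= ennreal ((cmod (q t))^2 / 2) * ennreal (K t s) + ennreal ((cmod (q s))^2 / 2) * ennreal (K t s)" .
 qed
 also have "\<dots> = (NN t. (NN s. ennreal ((cmod (q t))^2 / 2) * ennreal (K t s))) + (NN t. (NN s. ennreal ((cmod (q s))^2 / 2) * ennreal (K t s)))"
 by (subst nn_integral_add[symmetric]) (auto intro!: nn_integral_cong nn_integral_add)
 also have "\<dots> <= ennreal (energy / (4 * y)) + ennreal (energy / (4 * y))"
 proof (rule add_mono)
 have e: "(NN t. ennreal ((cmod (q t))^2 / 2) * ennreal (1 / (2 * y))) = ennreal (energy / (4 * y))"
 proof -
 have "(NN t. ennreal ((cmod (q t))^2 / 2) * ennreal (1 / (2 * y))) = (NN t. ennreal ((cmod (q t))^2) * ennreal (1 / (4 * y)))"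
 using y by (intro nn_integral_cong) (simp add: ennreal_mult[symmetric])
 also have "\<dots> = ennreal energy * ennreal (1 / (4 * y))" by (simp add: nn_integral_multc nn_energy)
 also have "\<dots> = ennreal (energy / (4 * y))" using y energy_nonneg by (simp add: ennreal_mult[symmetric])
 finally show ?thesis .
 qed
 have "(NN t. (NN s. ennreal ((cmod (q t))^2 / 2) * ennreal (K t s))) <= (NN t. ennreal ((cmod (q t))^2 / 2) * ennreal (1 / (2 * y)))"
 proof (intro nn_integral_mono)
 fix t
 have "(NN s. ennreal ((cmod (q t))^2 / 2) * ennreal (K t s)) = ennreal ((cmod (q t))^2 / 2) * (NN s. ennreal (K t s))"
 by (rule nn_integral_cmult) measurable
 also have "\<dots> <= ennreal ((cmod (q t))^2 / 2) * ennreal (1 / (2 * y))" by (intro mult_left_mono Ks) auto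
 finally show "(NN s. ennreal ((cmod (q t))^2 / 2) * ennreal (K t s)) <= ennreal ((cmod (q t))^2 / 2) * ennreal (1 / (2 * y))" .
 qed
 then show "(NN t. (NN s. ennreal ((cmod (q t))^2 / 2) * ennreal (K t s))) <= ennreal (energy / (4 * y))"
 unfolding e .
 have "(NN t. (NN s. ennreal ((cmod (q s))^2 / 2) * ennreal (K t s))) = (NN s. (NN t. ennreal ((cmod (q s))^2 / 2) * ennreal (K t s)))"
 by (rule lborel_pair.Fubini') measurable
 also have "\<dots> <= (NN t. ennreal ((cmod (q t))^2 / 2) * ennreal (1 / (2 * y)))"
 proof (intro nn_integral_mono)
 fix s
 have "(NN t. ennreal ((cmod (q s))^2 / 2) * ennreal (K t s)) = ennreal ((cmod (q s))^2 / 2) * (NN t. ennreal (K t s))"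
 by (rule nn_integral_cmult) measurable
 also have "\<dots> <= ennreal ((cmod (q s))^2 / 2) * ennreal (1 / (2 * y))" by (intro mult_left_mono Kt) auto
 finally show "(NN t. ennreal ((cmod (q s))^2 / 2) * ennreal (K t s)) <= ennreal ((cmod (q s))^2 / 2) * ennreal (1 / (2 * y))" .
 qed
 finally show "(NN t. (NN s. ennreal ((cmod (q s))^2 / 2) * ennreal (K t s))) <= ennreal (energy / (4 * y))"
 unfolding e .
 qed
 also have "\<dots> = ennreal (energy / (2 * y))"
 using y energy_nonneg ennreal_plus[of "energy / (4 * y)" "energy / (4 * y)"] by simp
 finally show ?thesis by (simp add: K_def)
qed

text \<open>bound of the transfer function high up\<close>

lemma al_exp_bound:
 assumes y: "Im z > 0" and \<kappa>: "energy / (2 * Im z) < 1" and X: "X >= 0"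
 shows "norm (al X z * exp (\<i> * z * X)) <= 1 / (1 - energy / (2 * Im z))"
proof -
 let ?y = "Im z"
 define ep where "ep x = exp (\<i> * z * cof x)" for x
 define em where "em x = exp (- \<i> * z * cof x)" for x
 define A where "A x = al x z * ep x" for x
 define B where "B x = be x z * em x" for x
 have d: "(ep has_vector_derivative \<i> * z * ep x) (at x)" "(em has_vector_derivative - \<i> * z * em x) (at x)" for x
 unfolding ep_def[abs_def] em_def[abs_def]
 by (auto intro!: derivative_eq_intros has_vector_derivative_real_field)
 have i: "indef_int X ep (%x. \<i> * z * ep x)" "indef_int X em (%x. - \<i> * z * em x)"
 by (rule indef_int_C1[OF d(1)] indef_int_C1[OF d(2)]; auto simp: ep_def em_def intro!: continuous_intros)+
 note UV = dirac_sol_UV[of z X 1 0, unfolded dirac_sol_def]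
 have iA: "indef_int X A (%x. - cnj (q x) * (be x z * ep x))" unfolding A_def[abs_def]
 by (rule indef_int_cong[OF indef_int_mult[OF conjunct1[OF UV] i(1)]]) (auto simp: algebra_simps)
 have iB: "indef_int X B (%x. - q x * (al x z * em x))" unfolding B_def[abs_def]
 by (rule indef_int_cong[OF indef_int_mult[OF conjunct2[OF UV] i(2)]]) (auto simp: algebra_simps)
 have nep: "norm (ep x) = exp (- ?y * x)" "norm (em x) = exp (?y * x)" for x by (simp_all add: ep_def em_def)
 have cA: "continuous_on {0..X} A" by (rule indef_int_continuous[OF iA])
 then have cn: "continuous_on {0..X} (%x. norm (A x))" by (intro continuous_intros)
 have "{0..X} \<noteq> {}" using X by simp
 then obtain p where p: "p \<in> {0..X}" and pm: "\<And>x. x \<in> {0..X} ==> norm (A x) <= norm (A p)"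
 using continuous_attains_sup[OF compact_Icc _ cn] by blast
 define M where "M = norm (A p)"
 have M0: "M >= 0" by (simp add: M_def)
 let ?K = "%t s. indicator {0..t} s * exp (- 2 * ?y * (t - s)) * cmod (q s)"
 have Bb: "ennreal (norm (be t z * ep t)) <= ennreal M * (NN s. ennreal (?K t s))" if t: "0 <= t" "t <= X" for t
 proof -
 have "B t - B 0 = (LBINT s:{0..t}. - q s * (al s z * em s))" using iB t by (auto simp: indef_int_def)
 then have Beq: "B t = (LBINT s:{0..t}. - q s * (al s z * em s))" by (simp add: B_def sol_0)
 have int: "integrable lborel (%s. indicator {0..t} s *\<^sub>R (- q s * (al s z * em s)))"
 using indef_int_integrable[OF iB, of 0 t] t by (simp add: set_integrable_def)
 have "norm (be t z * ep t) = exp (- 2 * ?y * t) * norm (B t)"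
 by (simp add: B_def norm_mult nep mult.assoc exp_add[symmetric])
 then have "ennreal (norm (be t z * ep t)) = ennreal (exp (- 2 * ?y * t)) * ennreal (norm (B t))" by (simp add: ennreal_mult)
 also have "ennreal (norm (B t)) <= (NN s. ennreal (norm (indicator {0..t} s *\<^sub>R (- q s * (al s z * em s)))))"
 unfolding Beq set_lebesgue_integral_def by (rule integral_norm_bound_ennreal[OF int])
 also have "ennreal (exp (- 2 * ?y * t)) * \<dots> = (NN s. ennreal (exp (- 2 * ?y * t)) * ennreal (norm (indicator {0..t} s *\<^sub>R (- q s * (al s z * em s)))))"
 by (rule nn_integral_cmult[symmetric], rule measurable_compose[OF borel_measurable_integrable[OF integrable_norm[OF int]] measurable_ennreal])
 also have "\<dots> <= (NN s. ennreal M * ennreal (?K t s))"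
 proof (intro nn_integral_mono)
 fix s
 show "ennreal (exp (- 2 * ?y * t)) * ennreal (norm (indicator {0..t} s *\<^sub>R (- q s * (al s z * em s)))) <= ennreal M * ennreal (?K t s)"
 proof (cases "s \<in> {0..t}")
 case True
 have "norm (al s z * em s) = norm (A s) * exp (2 * ?y * s)"
 by (simp add: A_def norm_mult nep mult.assoc exp_add[symmetric])
 also have "\<dots> <= M * exp (2 * ?y * s)" unfolding M_def using True t pm[of s] by (intro mult_right_mono) auto
 finally have "exp (- 2 * ?y * t) * (norm (q s) * norm (al s z * em s)) <= exp (- 2 * ?y * t) * (norm (q s) * (M * exp (2 * ?y * s)))"
 by (intro mult_left_mono) auto
 also have "\<dots> = M * (exp (- 2 * ?y * (t - s)) * cmod (q s))" by (simp add: exp_diff exp_minus field_simps)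
 finally show ?thesis using True M0 by (simp add: ennreal_mult[symmetric] norm_mult ennreal_leI)
 qed auto
 qed
 also have "\<dots> = ennreal M * (NN s. ennreal (?K t s))" by (rule nn_integral_cmult) measurable
 finally show ?thesis by (simp add: mult_left_mono)
 qed
 have "ennreal (norm (A p - A 0)) <= ennreal M * ennreal (energy / (2 * ?y))"
 proof -
 have int: "integrable lborel (%t. indicator {0..p} t *\<^sub>R (- cnj (q t) * (be t z * ep t)))"
 using indef_int_integrable[OF iA, of 0 p] p by (simp add: set_integrable_def)
 have "A p - A 0 = (LBINT t:{0..p}. - cnj (q t) * (be t z * ep t))" using iA p by (auto simp: indef_int_def)
 then have "ennreal (norm (A p - A 0)) <= (NN t. ennreal (norm (indicator {0..p} t *\<^sub>R (- cnj (q t) * (be t z * ep t)))))"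
 unfolding set_lebesgue_integral_def using integral_norm_bound_ennreal[OF int] by simp
 also have "\<dots> <= (NN t. ennreal M * (NN s. ennreal (indicator {0..X} t * indicator {0..t} s * exp (- 2 * ?y * (t - s)) * cmod (q s) * cmod (q t))))"
 proof (intro nn_integral_mono)
 fix t
 show "ennreal (norm (indicator {0..p} t *\<^sub>R (- cnj (q t) * (be t z * ep t)))) <= ennreal M * (NN s. ennreal (indicator {0..X} t * indicator {0..t} s * exp (- 2 * ?y * (t - s)) * cmod (q s) * cmod (q t)))"
 proof (cases "t \<in> {0..p}")
 case True
 then have t: "0 <= t" "t <= X" using p by auto
 have "ennreal (norm (indicator {0..p} t *\<^sub>R (- cnj (q t) * (be t z * ep t)))) = ennreal (norm (be t z * ep t)) * ennreal (cmod (q t))"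
 using True by (simp add: norm_mult ennreal_mult[symmetric] mult.commute)
 also have "\<dots> <= (ennreal M * (NN s. ennreal (?K t s))) * ennreal (cmod (q t))"
 by (intro mult_right_mono Bb t) auto
 also have "\<dots> = ennreal M * ((NN s. ennreal (?K t s)) * ennreal (cmod (q t)))" by (rule mult.assoc)
 also have "(NN s. ennreal (?K t s)) * ennreal (cmod (q t)) = (NN s. ennreal (?K t s) * ennreal (cmod (q t)))"
 by (rule nn_integral_multc[symmetric]) measurable
 also have "\<dots> = (NN s. ennreal (indicator {0..X} t * indicator {0..t} s * exp (- 2 * ?y * (t - s)) * cmod (q s) * cmod (q t)))"
 using t by (intro nn_integral_cong) (simp add: ennreal_mult[symmetric])
 finally show ?thesis .
 qed auto
 qed
 also have "\<dots> = ennreal M * (NN t. (NN s. ennreal (indicator {0..X} t * indicator {0..t} s * exp (- 2 * ?y * (t - s)) * cmod (q s) * cmod (q t))))"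
 proof (rule nn_integral_cmult)
 have "(%(t,s). ennreal ((if 0 <= s & s <= t & t <= X then exp (- 2 * ?y * (t - s)) else 0) * cmod (q s) * cmod (q t))) \<in> borel_measurable (lborel \<Otimes>\<^sub>M lborel)"
 unfolding split_def by measurable
 moreover have "(%(t,s). ennreal ((if 0 <= s & s <= t & t <= X then exp (- 2 * ?y * (t - s)) else 0) * cmod (q s) * cmod (q t))) = (%(t,s). ennreal (indicator {0..X} t * indicator {0..t} s * exp (- 2 * ?y * (t - s)) * cmod (q s) * cmod (q t)))"
 by (auto simp: indicator_def fun_eq_iff)
 ultimately show "(%t. NN s. ennreal (indicator {0..X} t * indicator {0..t} s * exp (- 2 * ?y * (t - s)) * cmod (q s) * cmod (q t))) \<in> borel_measurable lborel"
 using lborel.borel_measurable_nn_integral[of "%t s. ennreal (indicator {0..X} t * indicator {0..t} s * exp (- 2 * ?y * (t - s)) * cmod (q s) * cmod (q t))" lborel] by simp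
 qed
 also have "\<dots> <= ennreal M * ennreal (energy / (2 * ?y))" by (intro mult_left_mono young_nn y) auto
 finally show ?thesis .
 qed
 then have "norm (A p - A 0) <= M * (energy / (2 * ?y))"
 using y M0 energy_nonneg by (simp add: ennreal_mult[symmetric])
 moreover have "M <= norm (A p - A 0) + norm (A 0)" unfolding M_def using norm_triangle_ineq2[of "A p" "A 0"] by linarith
 moreover have "A 0 = 1" by (simp add: A_def ep_def sol_0)
 ultimately have "M * (1 - energy / (2 * ?y)) <= 1" by (simp add: algebra_simps)
 then have "M <= 1 / (1 - energy / (2 * ?y))" using \<kappa> by (simp add: pos_le_divide_eq)
 moreover have "norm (A X) <= M" unfolding M_def using pm X by simp
 ultimately show ?thesis by (simp add: A_def ep_def)
qed


text \<open>Here \<open>1 - |schur_trunc|^2\<close> dominates \<open>|h|^2\<close> for a zero-free holomorphic \<open>h\<close>, and the mean value property of \<open>h\<close> turns the bound at the centre into a bound for the circle mean.\<close>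
lemma schur_trunc_circle:
 fixes \<epsilon> R X :: real
 assumes e: "\<epsilon> > 0" and R: "R > 0" and \<kappa>: "energy / (2 * (\<epsilon> + R)) < 1" and X: "X >= 0"
 shows "(NN t. ennreal (indicator {0..1} t * (norm (schur_trunc X (\<i> * (\<epsilon> + R) + \<i> * circlepath 0 R t)))^2)) <= ennreal (energy / (\<epsilon> + R))"
proof -
 define c where "c = \<i> * cof (\<epsilon> + R)"
 define h where "h w = 1 / (al X (c + \<i> * w) * exp (\<i> * (c + \<i> * w) * X))" for w
 have im: "Im (c + \<i> * w) >= \<epsilon>" if "w \<in> cball 0 R" for w
 using that abs_Re_le_cmod[of w] by (auto simp: c_def)
 have hol: "h holomorphic_on cball 0 R" unfolding h_def
 proof (intro holomorphic_intros)
 show "(%w. al X (c + \<i> * w)) holomorphic_on cball 0 R"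
 proof -
 have "(%w. c + \<i> * w) holomorphic_on cball 0 R" by (intro holomorphic_intros)
 from holomorphic_on_compose[OF this sol_holomorphic(1)[OF X]] show ?thesis by (simp add: o_def)
 qed
 show "al X (c + \<i> * w) * exp (\<i> * (c + \<i> * w) * X) \<noteq> 0" if "w \<in> cball 0 R" for w
 using al_nz[of "c + \<i> * w" X] im[OF that] e X by simp
 qed
 have hm: "((%t. h (circlepath 0 R t)) has_integral h 0) {0..1}"
 by (rule circle_mean) (use hol R holomorphic_on_imp_continuous_on holomorphic_on_subset ball_subset_cball in blast)+
 define g where "g t = 1 - 2 * Re (cnj (h 0) * h (circlepath 0 R t)) + (norm (h 0))^2" for t
 have cp: "circlepath 0 R t \<in> cball 0 R" for t using R by (simp add: circlepath norm_mult)
 have gI: "(g has_integral 1 - 2 * (norm (h 0))^2 + (norm (h 0))^2) {0..1}"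
 proof -
 have "((%t. cnj (h 0) * h (circlepath 0 R t)) has_integral cnj (h 0) * h 0) {0..1}" by (rule has_integral_mult_right[OF hm])
 then have "((%t. Re (cnj (h 0) * h (circlepath 0 R t))) has_integral Re (cnj (h 0) * h 0)) {0..1}"
 by (rule has_integral_Re)
 moreover have "Re (cnj (h 0) * h 0) = (norm (h 0))^2" unfolding cmod_power2 by (simp add: power2_eq_square)
 ultimately have "((%t. Re (cnj (h 0) * h (circlepath 0 R t))) has_integral (norm (h 0))\<^sup>2) {0..1}" by simp
 then have "((%t. 1 - 2 * Re (cnj (h 0) * h (circlepath 0 R t)) + (norm (h 0))^2) has_integral (1 * (1 - 0) - 2 * (norm (h 0))^2 + (norm (h 0))^2 * (1 - 0))) {0..1}"
 using has_integral_const_real[of "1::real" 0 1] has_integral_const_real[of "(norm (h 0))\<^sup>2" 0 1]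
 by (intro has_integral_add has_integral_diff has_integral_mult_right) auto
 then show ?thesis unfolding g_def by simp
 qed
 have fg: "(norm (schur_trunc X (c + \<i> * circlepath 0 R t)))\<^sup>2 <= g t" for t
 proof -
 let ?z = "c + \<i> * circlepath 0 R t" and ?h = "h (circlepath 0 R t)"
 have "(norm (schur_trunc X ?z))\<^sup>2 <= 1 - 1 / (norm (al X ?z * exp (\<i> * ?z * X)))^2"
 using im[OF cp[of t]] e X by (intro schur_trunc_norm) auto
 also have "1 / (norm (al X ?z * exp (\<i> * ?z * X)))^2 = (norm ?h)^2" by (simp add: h_def norm_divide power_divide)
 also have "1 - (norm ?h)\<^sup>2 <= g t"
 proof -
 have "0 <= (norm (?h - h 0))\<^sup>2" by simp
 also have "\<dots> = (norm ?h)^2 - 2 * Re (cnj (h 0) * ?h) + (norm (h 0))^2"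
 unfolding cmod_power2 by (simp add: power2_eq_square algebra_simps)
 finally show ?thesis by (simp add: g_def)
 qed
 finally show ?thesis .
 qed
 have g0: "g t >= 0" for t using fg[of t] order_trans[OF zero_le_power2] by blast
 have cg: "continuous_on {0..1} g" unfolding g_def
 by (intro continuous_intros continuous_on_compose2[OF holomorphic_on_imp_continuous_on[OF hol], where f = "circlepath 0 R"])
 (use cp in \<open>auto simp: circlepath intro!: continuous_intros\<close>)
 have si: "set_integrable lborel {0..1} g" unfolding set_integrable_def by (rule borel_integrable_compact[OF compact_Icc cg])
 have "(NN t. ennreal (indicator {0..1} t * (norm (schur_trunc X (c + \<i> * circlepath 0 R t)))^2)) <= (NN t. ennreal (indicator {0..1} t *\<^sub>R g t))"
 by (intro nn_integral_mono ennreal_leI) (use fg in \<open>auto simp: indicator_def\<close>)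
 also have "\<dots> = ennreal (LBINT t:{0..1}. g t)" unfolding set_lebesgue_integral_def
 by (rule nn_integral_eq_integral) (use si g0 in \<open>auto simp: set_integrable_def indicator_def\<close>)
 also have "(LBINT t:{0..1}. g t) = 1 - (norm (h 0))\<^sup>2"
 using set_borel_integral_eq_integral(2)[OF si] gI by (simp add: integral_unique)
 also have "\<dots> <= energy / (\<epsilon> + R)"
 proof -
 define k where "k = energy / (2 * (\<epsilon> + R))"
 have k: "0 <= k" "k < 1" using \<kappa> energy_nonneg e R by (auto simp: k_def)
 have "norm (al X c * exp (\<i> * c * X)) <= 1 / (1 - energy / (2 * Im c))"
 using \<kappa> e R X by (intro al_exp_bound) (auto simp: c_def)
 then have "norm (al X c * exp (\<i> * c * X)) <= 1 / (1 - k)" by (simp add: c_def k_def)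
 moreover have "norm (al X c * exp (\<i> * c * X)) > 0" using al_nz[of c X] e R X by (auto simp: c_def)
 ultimately have "1 - k <= 1 / norm (al X c * exp (\<i> * c * X))" using k by (simp add: field_simps)
 then have "1 - k <= norm (h 0)" by (simp add: h_def norm_divide)
 then have "(1 - k)\<^sup>2 <= (norm (h 0))\<^sup>2" using k by (intro power_mono) auto
 moreover have "1 - 2 * k <= (1 - k)\<^sup>2" by (simp add: power2_eq_square algebra_simps)
 ultimately have "1 - (norm (h 0))\<^sup>2 <= 2 * k" by linarith
 moreover have "2 * k = energy / (\<epsilon> + R)" using e R by (simp add: k_def field_simps)
 ultimately show ?thesis by simp
 qed
 finally show ?thesis by (simp add: c_def ennreal_leI)
qed

lemma upper_circle_Im:
 assumes "R > 0"
 shows "Im (\<i> * (cof \<epsilon> + cof R) + \<i> * circlepath 0 R t) >= \<epsilon>"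
proof -
 have "norm (circlepath 0 R t) = R" using assms by (simp add: circlepath norm_mult)
 then show ?thesis using abs_Re_le_cmod[of "circlepath 0 R t"] by auto
qed

lemma schur_circle:
 fixes \<epsilon> R :: real
 assumes e: "\<epsilon> > 0" and R: "R > 0" and \<kappa>: "energy / (2 * (\<epsilon> + R)) < 1"
 shows "(NN t. ennreal (indicator {0..1} t * (norm (schur (\<i> * (\<epsilon> + R) + \<i> * circlepath 0 R t)))^2)) <= ennreal (energy / (\<epsilon> + R))"
proof -
 let ?z = "%t. \<i> * (cof \<epsilon> + R) + \<i> * circlepath 0 R t"
 let ?u = "%n t. ennreal (indicator {0..1} t * (norm (schur_trunc (real n) (?z t)))^2)"
 have im: "Im (?z t) > 0" for t using upper_circle_Im[OF R, of \<epsilon> t] e by simp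
 have cz: "continuous_on UNIV ?z" unfolding circlepath by (intro continuous_intros)
 have m: "(%t. schur_trunc (real n) (?z t)) \<in> borel_measurable borel" for n
 proof (rule borel_measurable_continuous_onI, rule continuous_on_compose2[OF _ cz])
 show "continuous_on {z. Im z > 0} (schur_trunc (real n))"
 by (intro holomorphic_on_imp_continuous_on schur_trunc_holomorphic) auto
 qed (use im in auto)
 have "(NN t. ennreal (indicator {0..1} t * (norm (schur (?z t)))^2)) = (NN t. liminf (%n. ?u n t))"
 proof (intro nn_integral_cong lim_imp_Liminf[symmetric])
 show "(%n. ?u n t) \<leadsto> ennreal (indicator {0..1} t * (norm (schur (?z t)))^2)" for t
 by (intro tendsto_intros tendsto_ennrealI schur_trunc_converges im)
 qed auto
 also have "\<dots> <= liminf (%n. NN t. ?u n t)"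
 by (rule nn_integral_liminf) (use m in measurable)
 also have "\<dots> <= liminf (%n::nat. ennreal (energy / (\<epsilon> + R)))"
 using schur_trunc_circle[OF e R \<kappa>] by (intro Liminf_mono always_eventually) simp
 finally show ?thesis by (simp add: Liminf_const)
qed

text \<open>As the radius tends to infinity, circles tangent to the line \<open>Im z = \<epsilon>\<close> open up to that line, and Fatou's lemma gives the bound.\<close>
lemma schur_H2:
 assumes e: "\<epsilon> > 0"
 shows "(NN s. ennreal ((norm (schur (Complex s \<epsilon>)))^2)) <= ennreal (2 * pi * energy)"
proof -
 obtain n0 :: nat where n0: "real n0 > energy" using reals_Archimedean2 by blast
 define R where "R n = real (n + n0 + 1)" for n
 have R: "R n > 0" "energy / (2 * (\<epsilon> + R n)) < 1" for n
 using n0 e energy_nonneg by (auto simp: R_def field_simps)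
 let ?z = "%n t. \<i> * (cof \<epsilon> + R n) + \<i> * circlepath 0 (R n) t"
 have im: "Im (?z n t) > 0" for n t using upper_circle_Im[OF R(1), of \<epsilon> n t] e by simp
 have cz: "continuous_on UNIV (?z n)" for n unfolding circlepath by (intro continuous_intros)
 define f where "f n t = ennreal (indicator {0..1} t * (norm (schur (?z n t)))^2)" for n t
 have m: "(%t. schur (?z n t)) \<in> borel_measurable borel" for n
 by (rule borel_measurable_continuous_onI, rule continuous_on_compose2[OF holomorphic_on_imp_continuous_on[OF schur_holomorphic] cz]) (use im in auto)
 then have fm[measurable]: "f n \<in> borel_measurable borel" for n unfolding f_def[abs_def] by measurable
 have eqz: "?z n (1 / 2 + 1 / (2 * pi * R n) * s) = Complex (R n * sin (s / R n)) (\<epsilon> + R n * (1 - cos (s / R n)))" for n s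
 proof -
 have "2 * of_real pi * \<i> * cof (1 / 2 + 1 / (2 * pi * R n) * s) = \<i> * of_real pi + \<i> * of_real (s / R n)"
 using R(1)[of n] by (simp add: field_simps)
 then have "exp (2 * of_real pi * \<i> * cof (1 / 2 + 1 / (2 * pi * R n) * s)) = - cis (s / R n)"
 by (simp only: exp_add cis_conv_exp) (simp add: exp_Euler mult.commute)
 then have "circlepath 0 (R n) (1 / 2 + 1 / (2 * pi * R n) * s) = - (R n * cis (s / R n))" by (simp add: circlepath)
 then show ?thesis by (simp add: complex_eq_iff algebra_simps)
 qed
 have scale: "(NN s. f n (1 / 2 + 1 / (2 * pi * R n) * s)) <= ennreal (2 * pi * energy)" for n
 proof -
 define c where "c = 1 / (2 * pi * R n)"
 have c: "c > 0" using R by (simp add: c_def)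
 have "ennreal c * (NN s. f n (1 / 2 + c * s)) = (NN t. f n t)"
 using nn_integral_real_affine[OF fm[of n], of c "1/2"] c by simp
 also have "\<dots> <= ennreal (energy / (\<epsilon> + R n))" unfolding f_def using schur_circle[OF e R(1)[of n] R(2)[of n]] by simp
 finally have "ennreal (1 / c) * (ennreal c * (NN s. f n (1 / 2 + c * s))) <= ennreal (1 / c) * ennreal (energy / (\<epsilon> + R n))"
 by (intro mult_left_mono) auto
 moreover have "ennreal (1 / c) * ennreal c = 1" using c by (simp add: ennreal_mult[symmetric])
 ultimately have "(NN s. f n (1 / 2 + c * s)) <= ennreal (1 / c) * ennreal (energy / (\<epsilon> + R n))"
 by (simp add: mult.assoc[symmetric])
 also have "\<dots> = ennreal (1 / c * (energy / (\<epsilon> + R n)))" using c e R[of n] energy_nonneg by (simp add: ennreal_mult[symmetric])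
 also have "\<dots> <= ennreal (2 * pi * energy)"
 proof (rule ennreal_leI)
 have "R n * (energy / (\<epsilon> + R n)) <= energy" using e R[of n] energy_nonneg by (simp add: field_simps)
 then have "(2 * pi) * (R n * (energy / (\<epsilon> + R n))) <= (2 * pi) * energy" by (intro mult_left_mono) auto
 then show "1 / c * (energy / (\<epsilon> + R n)) <= 2 * pi * energy" by (simp add: c_def mult.assoc)
 qed
 finally show ?thesis by (simp add: c_def)
 qed
 have Rlim: "filterlim R at_top sequentially" unfolding R_def
 by (rule filterlim_compose[OF filterlim_real_sequentially]) (auto intro!: filterlim_subseq strict_monoI)
 have lim: "(%n. f n (1 / 2 + 1 / (2 * pi * R n) * s)) \<leadsto> ennreal ((norm (schur (Complex s \<epsilon>)))^2)" for s
 proof -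
 have "((%r::real. r * sin (s / r)) \<longlongrightarrow> s) at_top" "((%r::real. r * (1 - cos (s / r))) \<longlongrightarrow> 0) at_top" by real_asymp+
 then have l: "(%n. R n * sin (s / R n)) \<leadsto> s" "(%n. R n * (1 - cos (s / R n))) \<leadsto> 0"
 using filterlim_compose[OF _ Rlim] by blast+
 have "(%n. Complex (R n * sin (s / R n)) (\<epsilon> + R n * (1 - cos (s / R n)))) \<leadsto> Complex s (\<epsilon> + 0)"
 by (intro tendsto_Complex tendsto_intros l)
 moreover have "isCont schur (Complex s \<epsilon>)"
 using holomorphic_on_imp_continuous_on[OF schur_holomorphic] open_upper e by (simp add: continuous_on_eq_continuous_at)
 ultimately have l1: "(%n. schur (?z n (1 / 2 + 1 / (2 * pi * R n) * s))) \<leadsto> schur (Complex s \<epsilon>)"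
 unfolding eqz by (intro isCont_tendsto_compose[of "Complex s \<epsilon>" schur]) simp_all
 have ev: "eventually (%n. indicator {0..1} (1 / 2 + 1 / (2 * pi * R n) * s) = (1::real)) sequentially"
 proof -
 have "eventually (%n. R n >= \<bar>s\<bar>) sequentially" using Rlim by (simp add: filterlim_at_top)
 then show ?thesis
 proof eventually_elim
 case (elim n)
 have "\<bar>1 / (2 * pi * R n) * s\<bar> = \<bar>s\<bar> / (2 * pi * R n)" using R(1)[of n] by (simp add: abs_mult)
 also have "\<dots> <= R n / (2 * pi * R n)" using elim R(1)[of n] by (intro divide_right_mono) auto
 also have "\<dots> <= 1 / 2" using R(1)[of n] pi_gt3 by (simp add: field_simps)
 finally have "\<bar>1 / (2 * pi * R n) * s\<bar> <= 1 / 2" .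
 moreover have "indicator {0..1} (1 / 2 + t) = (1::real)" if "\<bar>t\<bar> <= 1 / 2" for t :: real
 using that by (auto simp: indicator_def abs_le_iff)
 ultimately show ?case by blast
 qed
 qed
 have "(%n. indicator {0..1} (1 / 2 + 1 / (2 * pi * R n) * s) * (norm (schur (?z n (1 / 2 + 1 / (2 * pi * R n) * s))))^2) \<leadsto> 1 * (norm (schur (Complex s \<epsilon>)))^2"
 by (rule tendsto_mult[OF tendsto_eventually[OF ev] tendsto_power[OF tendsto_norm[OF l1]]])
 then show ?thesis unfolding f_def by (intro tendsto_ennrealI) simp
 qed
 have "(NN s. ennreal ((norm (schur (Complex s \<epsilon>)))^2)) = (NN s. liminf (%n. f n (1 / 2 + 1 / (2 * pi * R n) * s)))"
 using lim by (intro nn_integral_cong lim_imp_Liminf[symmetric]) auto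
 also have "\<dots> <= liminf (%n. NN s. f n (1 / 2 + 1 / (2 * pi * R n) * s))"
 by (rule nn_integral_liminf) measurable
 also have "\<dots> <= liminf (%n::nat. ennreal (2 * pi * energy))"
 using scale by (intro Liminf_mono always_eventually) simp
 finally show ?thesis by (simp add: Liminf_const)
qed

lemma schur_ne_1:
 assumes z: "Im z > 0"
 shows "schur z \<noteq> 1"
proof
 assume eq: "schur z = 1"
 have "schur constant_on {z. Im z > 0}"
 by (rule maximum_modulus_principle[OF schur_holomorphic open_upper _ open_upper order_refl, of z])
 (use z eq schur_norm in \<open>auto intro!: convex_connected convex_halfspace_Im_gt\<close>)
 then have "schur (Complex s 1) = 1" for s using eq z unfolding constant_on_def by force
 then have "(\<integral>\<^sup>+s. 1 \<partial>(lborel::real measure)) <= ennreal (2 * pi * energy)" using schur_H2[of 1] by simp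
 then show False by (simp add: top_unique)
qed

lemma schur_function_eq': "Im z > 0 ==> schur_function q z = schur z"
 using schur_function_eq schur_ne_1 by blast

end


section \<open>Poisson and Cauchy formulas in the upper half-plane\<close>

text \<open>A function decaying quadratically has a primitive, and comparing the real line with \<open>Im z = R\<close> for large \<open>R\<close> shows that the integral vanishes.\<close>
lemma upper_half_plane_integral_zero:
 fixes k :: "complex => complex"
 assumes hol: "k holomorphic_on {z. Im z > - \<eta>}" and \<eta>: "\<eta> > 0"
 and bd: "\<And>w. Im w >= 0 ==> norm w >= rad ==> norm (k w) <= C / (norm w)^2" and C: "C >= 0"
 and int: "integrable lborel (%s. k (cof s))"
 shows "(LBINT s. k (cof s)) = 0"
proof -
 let ?S = "{z. Im z > - \<eta>}"
 have "open ?S" "convex ?S" by (rule open_halfspace_Im_gt convex_halfspace_Im_gt)+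
 then obtain K where K: "\<And>x. x \<in> ?S ==> (K has_field_derivative k x) (at x within ?S)"
 using holomorphic_convex_primitive'[OF \<open>convex ?S\<close> \<open>open ?S\<close> hol] by metis
 have K': "(K has_field_derivative k x) (at x)" if "x \<in> ?S" for x
 using K[OF that] unfolding at_within_open[OF that \<open>open ?S\<close>] .
 have seg: "norm (K a - K b) <= C / T\<^sup>2 * norm (a - b)"
 if T: "T > 0" "T >= rad" and ab: "\<And>w. w \<in> closed_segment a b ==> Im w >= 0 & norm w >= T" for a b T
 proof (rule field_differentiable_bound[of "closed_segment a b"])
 fix w assume w: "w \<in> closed_segment a b"
 show "(K has_field_derivative k w) (at w within closed_segment a b)"
 by (rule has_field_derivative_at_within[OF K']) (use ab[OF w] \<eta> in auto)
 have "norm (k w) <= C / (norm w)^2" using bd[of w] ab[OF w] T by auto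
 also have "\<dots> <= C / T\<^sup>2" using ab[OF w] T C by (intro divide_left_mono power_mono mult_pos_pos) auto
 finally show "norm (k w) <= C / T\<^sup>2" .
 qed auto
 have est: "norm (K (of_real T) - K (of_real (- T))) <= 4 * C / T" if T: "T > 0" "T >= rad" for T :: real
 proof -
 let ?a = "cof T" and ?b = "Complex T T" and ?c = "Complex (- T) T" and ?d = "cof (- T)"
 have im: "T <= norm w" if "\<bar>Re w\<bar> = T \<or> Im w = T" for w
 using that abs_Re_le_cmod[of w] abs_Im_le_cmod[of w] by auto
 have sg: "\<exists>u. 0 <= u & u <= 1 & Re w = (1 - u) * Re a + u * Re b & Im w = (1 - u) * Im a + u * Im b" if w: "w \<in> closed_segment a b" for w a b :: complex
 proof -
 obtain u where "0 <= u" "u <= 1" "w = (1 - u) *\<^sub>R a + u *\<^sub>R b" using w unfolding closed_segment_def by blast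
 then show ?thesis by (intro exI[of _ u]) simp
 qed
 have s1: "Im w >= 0 & norm w >= T" if w: "w \<in> closed_segment ?a ?b" for w
 proof -
 obtain u where u: "0 <= u" "u <= 1" "Re w = (1 - u) * T + u * T" "Im w = u * T" using sg[OF w] by auto
 have "Re w = T" using u(3) by (simp add: algebra_simps)
 then show ?thesis using im[of w] u T by simp
 qed
 have s2: "Im w >= 0 & norm w >= T" if w: "w \<in> closed_segment ?b ?c" for w
 proof -
 obtain u where u: "Im w = (1 - u) * T + u * T" using sg[OF w] by auto
 have "Im w = T" using u by (simp add: algebra_simps)
 then show ?thesis using im[of w] T by simp
 qed
 have s3: "Im w >= 0 & norm w >= T" if w: "w \<in> closed_segment ?c ?d" for w
 proof -
 obtain u where u: "0 <= u" "u <= 1" "Re w = (1 - u) * (- T) + u * (- T)" "Im w = (1 - u) * T" using sg[OF w] by auto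
 have "Re w = - T" using u(3) by (simp add: algebra_simps)
 then show ?thesis using im[of w] u T by simp
 qed
 have n: "norm (?a - ?b) = T" "norm (?b - ?c) = 2 * T" "norm (?c - ?d) = T"
 using T by (auto simp: cmod_def real_sqrt_mult)
 have tri: "norm (x + y + w) <= norm x + norm y + norm w" for x y w :: complex
 using norm_triangle_ineq[of "x + y" w] norm_triangle_ineq[of x y] by linarith
 have "K ?a - K ?d = (K ?a - K ?b) + (K ?b - K ?c) + (K ?c - K ?d)" by simp
 then have "norm (K ?a - K ?d) <= norm (K ?a - K ?b) + norm (K ?b - K ?c) + norm (K ?c - K ?d)"
 using tri by metis
 also have "\<dots> <= C / T\<^sup>2 * T + C / T\<^sup>2 * (2 * T) + C / T\<^sup>2 * T"
 proof (intro add_mono)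
 show "norm (K ?a - K ?b) <= C / T\<^sup>2 * T" using seg[OF T, of ?a ?b] s1 unfolding n by blast
 show "norm (K ?b - K ?c) <= C / T\<^sup>2 * (2 * T)" using seg[OF T, of ?b ?c] s2 unfolding n by blast
 show "norm (K ?c - K ?d) <= C / T\<^sup>2 * T" using seg[OF T, of ?c ?d] s3 unfolding n by blast
 qed
 also have "\<dots> = 4 * C / T" using T by (simp add: power2_eq_square field_simps)
 finally show ?thesis by simp
 qed
 have FTC: "(LBINT s. indicator {- real n..real n} s *\<^sub>R k (cof s)) = K (of_real (real n)) - K (of_real (- real n))" for n :: nat
 proof -
 have "((%s. k (cof s)) has_integral K (of_real (real n)) - K (of_real (- real n))) {- real n..real n}"
 proof (rule fundamental_theorem_of_calculus)
 fix s assume "s \<in> {- real n..real n}"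
 have "(K has_field_derivative k (cof s)) (at (cof s))" using K' \<eta> by simp
 then have "((%s. K (of_real s)) has_vector_derivative k (cof s)) (at s)"
 by (rule has_vector_derivative_real_field)
 then show "((%s. K (of_real s)) has_vector_derivative k (cof s)) (at s within {- real n..real n})"
 by (rule has_vector_derivative_at_within)
 qed simp
 moreover have "set_integrable lborel {- real n..real n} (%s. k (cof s))"
 unfolding set_integrable_def by (rule integrable_mult_indicator[OF _ int]) simp
 ultimately show ?thesis using set_borel_integral_eq_integral(2)[of "{- real n..real n}" "%s. k (cof s)"]
 by (simp add: integral_unique set_lebesgue_integral_def)
 qed
 have "(%n. LBINT s. indicator {- real n..real n} s *\<^sub>R k (cof s)) \<leadsto> (LBINT s. k (cof s))"
 proof (rule integral_dominated_convergence[where w = "%s. norm (k (cof s))"])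
 show "AE s in lborel. (%n. indicator {- real n..real n} s *\<^sub>R k (cof s)) \<leadsto> k (cof s)"
 proof (rule AE_I2)
 fix s :: real
 obtain m :: nat where m: "\<bar>s\<bar> <= real m" using real_arch_simple by blast
 have "eventually (%n. indicator {- real n..real n} s *\<^sub>R k (cof s) = k (cof s)) sequentially"
 using eventually_ge_at_top[of m] by eventually_elim (use m in \<open>auto simp: indicator_def abs_le_iff\<close>)
 then show "(%n. indicator {- real n..real n} s *\<^sub>R k (cof s)) \<leadsto> k (cof s)" by (rule tendsto_eventually)
 qed
 qed (use int in \<open>auto simp: indicator_def intro!: borel_measurable_scaleR borel_measurable_integrable\<close>)
 moreover have "(%n. LBINT s. indicator {- real n..real n} s *\<^sub>R k (cof s)) \<leadsto> 0"
 proof (rule Lim_null_comparison)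
 show "eventually (%n. norm (LBINT s. indicator {- real n..real n} s *\<^sub>R k (cof s)) <= 4 * C / real n) sequentially"
 using eventually_gt_at_top[of 0] eventually_ge_at_top[of "nat \<lceil>rad\<rceil>"]
 proof eventually_elim
 case (elim n)
 have "rad <= real n" using elim by linarith
 then show ?case unfolding FTC using est[of "real n"] elim by simp
 qed
 show "(%n. 4 * C / real n) \<leadsto> 0" by real_asymp
 qed
 ultimately show ?thesis using LIMSEQ_unique by blast
qed

lemma nn_integral_cauchy_density:
 assumes y: "y > 0"
 shows "(NN s. ennreal (y / ((s - x)^2 + y\<^sup>2))) = ennreal pi"
proof -
 have half: "(NN s. ennreal (1 / (1 + s\<^sup>2)) * indicator {0..} s) = ennreal (pi / 2 - arctan 0)"
 proof (rule nn_integral_FTC_atLeast)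
 show "DERIV arctan s :> 1 / (1 + s\<^sup>2)" for s using DERIV_arctan[of s] by (simp add: inverse_eq_divide)
 show "(arctan \<longlongrightarrow> pi / 2) at_top" by (rule tendsto_arctan_at_top)
 qed (auto simp: add_nonneg_nonneg)
 let ?g = "%s::real. ennreal (1 / (1 + s\<^sup>2))"
 have "(NN s. ?g s) = (NN s. ?g s * indicator {0..} s + ?g s * indicator {..<0} s)"
 by (intro nn_integral_cong) (auto simp: indicator_def)
 also have "\<dots> = (NN s. ?g s * indicator {0..} s) + (NN s. ?g s * indicator {..<0} s)"
 by (rule nn_integral_add) auto
 also have "(NN s. ?g s * indicator {..<0} s) = (NN s. ?g s * indicator {0<..} s)"
 by (subst nn_integral_real_affine[where c = "-1" and t = 0]) (auto intro!: nn_integral_cong simp: indicator_def)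
 also have "\<dots> = (NN s. ?g s * indicator {0..} s)"
 by (intro nn_integral_cong_AE) (use AE_lborel_singleton[of 0] in \<open>eventually_elim, auto simp: indicator_def\<close>)
 also have "(NN s. ?g s * indicator {0..} s) + (NN s. ?g s * indicator {0..} s) = ennreal pi"
 unfolding half by (simp add: ennreal_plus[symmetric] del: ennreal_plus)
 finally have one: "(NN s. ?g s) = ennreal pi" .
 have "(NN s. ennreal (y / ((s - x)^2 + y\<^sup>2))) = ennreal y * (NN s. ennreal (y / ((x + y * s - x)^2 + y\<^sup>2)))"
 using y by (subst nn_integral_real_affine[where c = y and t = x]) auto
 also have "\<dots> = (NN s. ennreal y * ennreal (y / ((x + y * s - x)^2 + y\<^sup>2)))"
 by (rule nn_integral_cmult[symmetric]) auto
 also have "\<dots> = (NN s. ?g s)"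
 proof (rule nn_integral_cong)
 fix s
 have "y * (y / ((x + y * s - x)^2 + y\<^sup>2)) = y\<^sup>2 / (y\<^sup>2 * (1 + s\<^sup>2))" by (simp add: power_mult_distrib power2_eq_square algebra_simps)
 also have "\<dots> = 1 / (1 + s\<^sup>2)" using y by simp
 finally show "ennreal y * ennreal (y / ((x + y * s - x)^2 + y\<^sup>2)) = ?g s"
 using y by (subst ennreal_mult[symmetric]) auto
 qed
 finally show ?thesis unfolding one .
qed

lemma cauchy_density:
 fixes x y :: real
 assumes y: "y > 0"
 shows "integrable lborel (%s. y / ((s - x)^2 + y\<^sup>2))" "(LBINT s. y / ((s - x)^2 + y\<^sup>2)) = pi"
proof -
 have 0: "y / ((s - x)^2 + y\<^sup>2) >= 0" for s using y by simp
 show i: "integrable lborel (%s. y / ((s - x)^2 + y\<^sup>2))"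
 by (rule integrableI_nonneg) (use 0 nn_integral_cauchy_density[OF y, of x] in auto)
 have "ennreal (LBINT s. y / ((s - x)^2 + y\<^sup>2)) = ennreal pi"
 using nn_integral_eq_integral[OF i] 0 nn_integral_cauchy_density[OF y, of x] by simp
 then show "(LBINT s. y / ((s - x)^2 + y\<^sup>2)) = pi"
 using 0 by (subst (asm) ennreal_inj) (auto intro!: LINT_nonneg)
qed

lemma norm_diff_ge_half:
 fixes w z :: complex
 assumes "norm w >= 2 * norm z"
 shows "norm (w - z) >= norm w / 2"
 using norm_triangle_ineq2[of w z] assms by linarith

lemma cnj_kernel: "(cof s - z) * (cof s - cnj z) = of_real ((s - Re z)^2 + (Im z)^2)"
 by (simp add: complex_eq_iff power2_eq_square algebra_simps)

lemma poisson_formula: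
 fixes h :: "complex => complex"
 assumes hol: "h holomorphic_on {z. Im z > - \<eta>}" and \<eta>: "\<eta> > 0" and b: "\<And>w. Im w >= 0 ==> norm (h w) <= 1" and z: "Im z > 0"
 shows "(LBINT s. h (cof s) * of_real (Im z / ((s - Re z)^2 + (Im z)^2))) = pi * h z"
 "integrable lborel (%s. h (cof s) * of_real (Im z / ((s - Re z)^2 + (Im z)^2)))"
proof -
 define \<eta>' where "\<eta>' = min \<eta> (Im z)"
 have \<eta>': "\<eta>' > 0" "\<eta>' <= \<eta>" "\<eta>' <= Im z" using \<eta> z by (auto simp: \<eta>'_def)
 let ?S = "{w. Im w > - \<eta>'}"
 let ?P = "%s. Im z / ((s - Re z)^2 + (Im z)^2)"
 have opS: "open ?S" by (rule open_halfspace_Im_gt)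
 have holS: "h holomorphic_on ?S" by (rule holomorphic_on_subset[OF hol]) (use \<eta>' in auto)
 define g where "g w = (if w = z then deriv h z else (h w - h z) / (w - z))" for w
 have "g holomorphic_on ?S" unfolding g_def[abs_def]
 using pole_lemma[OF holS, of z] opS z \<eta>' by (simp add: interior_open)
 then have kh: "(%w. g w / (w - cnj z)) holomorphic_on ?S"
 proof (intro holomorphic_intros)
 show "w - cnj z \<noteq> 0" if "w \<in> ?S" for w using that \<eta>' by (auto simp: complex_eq_iff)
 qed auto
 have keq: "g (cof s) / (of_real s - cnj z) = (h (cof s) * of_real (?P s) - h z * of_real (?P s)) / of_real (Im z)" for s
 proof -
 have "cof s \<noteq> z" using z by (auto simp: complex_eq_iff)
 then have "g (cof s) / (of_real s - cnj z) = (h (of_real s) - h z) / ((of_real s - z) * (of_real s - cnj z))"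
 by (simp add: g_def)
 also have "\<dots> = (h (of_real s) - h z) / of_real ((s - Re z)^2 + (Im z)^2)" by (simp only: cnj_kernel)
 also have "\<dots> = (h (cof s) * of_real (?P s) - h z * of_real (?P s)) / of_real (Im z)"
 proof -
 have "(a - b) / D = (a * (Y / D) - b * (Y / D)) / Y" if "Y \<noteq> 0" for a b D Y :: complex
 using that by (cases "D = 0") (auto simp: field_simps)
 then show ?thesis unfolding of_real_divide using z by simp
 qed
 finally show ?thesis .
 qed
 have hm: "(%s. h (cof s)) \<in> borel_measurable borel"
 by (rule borel_measurable_continuous_onI, rule continuous_on_compose2[OF holomorphic_on_imp_continuous_on[OF hol]]) (use \<eta> in \<open>auto intro!: continuous_intros\<close>)
 have cd: "integrable lborel ?P" "(LBINT s. ?P s) = pi" using cauchy_density[OF z, of "Re z"] by auto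
 show i1: "integrable lborel (%s. h (cof s) * of_real (?P s))"
 proof (rule integrable_dominated[OF cd(1)])
 show "AE s in lborel. norm (h (cof s) * of_real (?P s)) <= norm (?P s)"
 proof (rule AE_I2)
 fix s
 have "norm (h (cof s)) * \<bar>?P s\<bar> <= 1 * \<bar>?P s\<bar>" by (intro mult_right_mono b) auto
 then show "norm (h (cof s) * of_real (?P s)) <= norm (?P s)" by (simp only: norm_mult norm_of_real real_norm_def mult_1_left)
 qed
 qed (use hm in measurable)
 have i2: "integrable lborel (%s. h z * cof (?P s))"
 proof -
 have "integrable lborel (%s. cof (?P s))" using cd(1) by (rule integrable_of_real)
 then show ?thesis by (rule integrable_mult_right)
 qed
 have "(LBINT s. g (cof s) / (of_real s - cnj z)) = 0"
 proof (rule upper_half_plane_integral_zero[OF kh \<eta>'(1), where rad = "2 * norm z + 1" and C = 8])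
 fix w assume w: "Im w >= 0" "norm w >= 2 * norm z + 1"
 then have "norm w > norm z" using norm_ge_zero[of z] by linarith
 then have w0: "norm w > 0" "w \<noteq> z" using norm_ge_zero[of z] by (linarith, blast)
 have n1: "norm (w - z) >= norm w / 2" by (rule norm_diff_ge_half) (use w in auto)
 have n2: "norm (w - cnj z) >= norm w / 2" by (rule norm_diff_ge_half) (use w in auto)
 have "norm (g w / (w - cnj z)) = norm (h w - h z) / (norm (w - z) * norm (w - cnj z))"
 using w0 by (simp add: g_def norm_divide norm_mult)
 also have "\<dots> <= 2 / ((norm w / 2) * (norm w / 2))"
 proof (intro frac_le mult_mono n1 n2)
 have "norm (h w - h z) <= norm (h w) + norm (h z)" by (rule norm_triangle_ineq4)
 then show "norm (h w - h z) <= 2" using b[of w] b[of z] w z by auto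
 qed (use w0 in auto)
 also have "\<dots> = 8 / (norm w)^2" by (simp add: power2_eq_square)
 finally show "norm (g w / (w - cnj z)) <= 8 / (norm w)^2" .
 next
 show "integrable lborel (%s. g (cof s) / (of_real s - cnj z))"
 unfolding keq by (intro Bochner_Integration.integrable_divide Bochner_Integration.integrable_diff i1 i2)
 qed auto
 then have "(LBINT s. h (cof s) * of_real (?P s)) - (LBINT s. h z * cof (?P s)) = 0"
 unfolding keq using i1 i2 z by simp
 moreover have "(LBINT s. h z * cof (?P s)) = h z * of_real pi"
 using cd(2) by (simp only: integral_mult_right_zero integral_complex_of_real)
 ultimately show "(LBINT s. h (cof s) * of_real (?P s)) = pi * h z" by simp
qed

lemma cauchy_formula_conj:
 fixes h :: "complex => complex"
 assumes hol: "h holomorphic_on {z. Im z > - \<eta>}" and \<eta>: "\<eta> > 0" and b: "\<And>w. Im w >= 0 ==> norm (h w) <= 1"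
 and L2: "integrable lborel (%s. (norm (h (cof s)))\<^sup>2)" and z: "Im z > 0"
 shows "(LBINT s. h (cof s) / (of_real s - cnj z)) = 0"
 "integrable lborel (%s. h (cof s) / (of_real s - cnj z))"
 "integrable lborel (%s. h (cof s) / (of_real s - z))"
proof -
 have hm[measurable]: "(%s. h (cof s)) \<in> borel_measurable borel"
 by (rule borel_measurable_continuous_onI, rule continuous_on_compose2[OF holomorphic_on_imp_continuous_on[OF hol]]) (use \<eta> in \<open>auto intro!: continuous_intros\<close>)
 let ?P = "%s. Im z / ((s - Re z)^2 + (Im z)^2)"
 have cd: "integrable lborel ?P" using cauchy_density[OF z, of "Re z"] by auto
 have nn: "norm (of_real s - z) = sqrt ((s - Re z)^2 + (Im z)^2)" "norm (of_real s - cnj z) = sqrt ((s - Re z)^2 + (Im z)^2)" for s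
 by (simp_all add: cmod_def)
 have bnd: "norm a / sqrt ((s - Re z)^2 + (Im z)^2) <= (norm a)\<^sup>2 + ?P s / Im z" for s and a :: complex
 proof -
 define r where "r = 1 / sqrt ((s - Re z)^2 + (Im z)^2)"
 have "r\<^sup>2 = ?P s / Im z" using z by (simp add: r_def power_divide real_sqrt_pow2)
 moreover have "2 * (norm a * r) <= (norm a)\<^sup>2 + r\<^sup>2" using sum_squares_bound[of "norm a" r] by simp
 moreover have "norm a * r >= 0" by (simp add: r_def)
 ultimately have "norm a * r <= (norm a)\<^sup>2 + ?P s / Im z" by linarith
 then show ?thesis by (simp add: r_def)
 qed
 have W: "integrable lborel (%s. (norm (h (cof s)))\<^sup>2 + ?P s / Im z)"
 using L2 cd by (intro integrable_plus Bochner_Integration.integrable_divide)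
 have W0: "0 <= (norm (h (cof s)))\<^sup>2 + ?P s / Im z" for s using z by simp
 show i2: "integrable lborel (%s. h (cof s) / (of_real s - cnj z))"
 by (rule integrable_dominated[OF W]) (use bnd W0 in \<open>auto simp: norm_divide nn intro!: AE_I2\<close>)
 show "integrable lborel (%s. h (cof s) / (of_real s - z))"
 by (rule integrable_dominated[OF W]) (use bnd W0 in \<open>auto simp: norm_divide nn intro!: AE_I2\<close>)
 define m where "m n w = 1 / (1 - \<i> * of_real (1 / real (Suc n)) * w)" for n w
 have mb: "norm (m n w) <= 1" "w \<noteq> 0 ==> norm (m n w) <= real (Suc n) / norm w" "1 - \<i> * of_real (1 / real (Suc n)) * w \<noteq> 0" if "Im w >= 0" for n w
 proof -
 define d where "d = 1 / real (Suc n)"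
 have d: "d > 0" by (simp add: d_def)
 have re: "Re (1 - \<i> * of_real d * w) = 1 + d * Im w" "Im (1 - \<i> * of_real d * w) = - d * Re w" by simp_all
 have n1: "norm (1 - \<i> * of_real d * w) >= 1"
 using complex_Re_le_cmod[of "1 - \<i> * of_real d * w"] re d that by (simp add: order_trans[rotated])
 have "d * norm w <= norm (1 - \<i> * of_real d * w)"
 proof (rule power2_le_imp_le)
 have "(d * norm w)\<^sup>2 = d\<^sup>2 * ((Re w)^2 + (Im w)^2)" unfolding power_mult_distrib cmod_power2 ..
 also have "\<dots> <= (1 + d * Im w)\<^sup>2 + (- d * Re w)^2" using d that by (simp add: power2_eq_square algebra_simps)
 also have "\<dots> = (norm (1 - \<i> * of_real d * w))^2" unfolding cmod_power2 re ..
 finally show "(d * norm w)\<^sup>2 <= (norm (1 - \<i> * of_real d * w))\<^sup>2" .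
 qed simp
 moreover have "norm (m n w) = 1 / norm (1 - \<i> * of_real d * w)" unfolding m_def d_def[symmetric] by (simp add: norm_divide)
 moreover have "1 / N <= real (Suc n) / norm w" if "w \<noteq> 0" "d * norm w <= N" for N
 proof -
 have "d * norm w > 0" using that d by simp
 moreover from this have "N > 0" using that by linarith
 ultimately have "1 / N <= 1 / (d * norm w)" using that d by (intro divide_left_mono mult_pos_pos) auto
 then show ?thesis by (simp add: d_def)
 qed
 ultimately show "norm (m n w) <= real (Suc n) / norm w" if "w \<noteq> 0" using that by metis
 show "1 - \<i> * of_real (1 / real (Suc n)) * w \<noteq> 0" using n1 unfolding d_def[symmetric] by auto
 show "norm (m n w) <= 1" using n1 unfolding m_def d_def[symmetric] by (simp add: norm_divide divide_le_eq_1)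
 qed
 have mm[measurable]: "(%s. m n (cof s)) \<in> borel_measurable borel" for n
 unfolding m_def by measurable
 have zero: "(LBINT s. h (cof s) / (of_real s - cnj z) * m n (of_real s)) = 0" for n
 proof -
 define \<eta>' where "\<eta>' = min (min \<eta> (Im z)) (1 / 2)"
 have \<eta>': "\<eta>' > 0" "\<eta>' <= \<eta>" "\<eta>' <= Im z" "\<eta>' <= 1 / 2" using \<eta> z by (auto simp: \<eta>'_def)
 show ?thesis
 proof (rule upper_half_plane_integral_zero[where \<eta> = \<eta>' and rad = "2 * norm z + 1" and C = "2 * real (Suc n)"])
 show "(%w. h w / (w - cnj z) * m n w) holomorphic_on {w. Im w > - \<eta>'}" unfolding m_def
 proof (intro holomorphic_intros holomorphic_on_subset[OF hol])
 show "w - cnj z \<noteq> 0" if "w \<in> {w. Im w > - \<eta>'}" for w using that \<eta>' by (auto simp: complex_eq_iff)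
 show "1 - \<i> * of_real (1 / real (Suc n)) * w \<noteq> 0" if w: "w \<in> {w. Im w > - \<eta>'}" for w
 proof -
 define d where "d = 1 / real (Suc n)"
 have d: "0 < d" "d <= 1" by (auto simp: d_def)
 have "d * Im w >= - 1 / 2"
 proof (cases "Im w >= 0")
 case True
 then have "d * Im w >= 0" using d by simp
 then show ?thesis by linarith
 next
 case False
 then have "1 * Im w <= d * Im w" using d by (intro mult_right_mono_neg) auto
 then show ?thesis using w \<eta>' by simp
 qed
 then have "Re (1 - \<i> * of_real d * w) > 0" by simp
 then have "Re (1 - \<i> * of_real (1 / real (Suc n)) * w) > 0" unfolding d_def .
 then show ?thesis by (metis less_irrefl zero_complex.simps(1))
 qed
 qed (use \<eta>' in auto)
 fix w assume w: "Im w >= 0" "norm w >= 2 * norm z + 1"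
 then have w0: "norm w > 0" using norm_ge_zero[of z] by linarith
 have n2: "norm (w - cnj z) >= norm w / 2" by (rule norm_diff_ge_half) (use w in auto)
 have "norm (h w / (w - cnj z) * m n w) = norm (h w) / norm (w - cnj z) * norm (m n w)" by (simp add: norm_mult norm_divide)
 also have "\<dots> <= 1 / (norm w / 2) * (real (Suc n) / norm w)"
 by (intro mult_mono frac_le b mb(2) n2) (use w w0 in auto)
 also have "\<dots> = 2 * real (Suc n) / (norm w)^2" by (simp add: power2_eq_square)
 finally show "norm (h w / (w - cnj z) * m n w) <= 2 * real (Suc n) / (norm w)^2" .
 next
 show "integrable lborel (%s. h (cof s) / (of_real s - cnj z) * m n (of_real s))"
 proof (rule integrable_dominated[OF i2])
 show "AE s in lborel. norm (h (cof s) / (of_real s - cnj z) * m n (of_real s)) <= norm (h (cof s) / (of_real s - cnj z))"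
 unfolding norm_mult using mb(1) by (intro AE_I2 mult_left_le) auto
 qed measurable
 qed (use \<eta>' in auto)
 qed
 have "(%n. LBINT s. h (cof s) / (of_real s - cnj z) * m n (of_real s)) \<leadsto> (LBINT s. h (cof s) / (of_real s - cnj z))"
 proof (rule integral_dominated_convergence[where w = "%s. norm (h (cof s) / (of_real s - cnj z))"])
 show "AE s in lborel. (%n. h (cof s) / (of_real s - cnj z) * m n (of_real s)) \<leadsto> h (cof s) / (of_real s - cnj z)"
 proof (rule AE_I2)
 fix s :: real
 have "(%n. 1 / real (Suc n)) \<leadsto> 0" by real_asymp
 then have "(%n. h (cof s) / (of_real s - cnj z) * (1 / (1 - \<i> * of_real (1 / real (Suc n)) * of_real s))) \<leadsto> h (cof s) / (of_real s - cnj z) * (1 / (1 - \<i> * of_real 0 * of_real s))"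
 by (intro tendsto_intros) auto
 then show "(%n. h (cof s) / (of_real s - cnj z) * m n (of_real s)) \<leadsto> h (cof s) / (of_real s - cnj z)"
 by (simp add: m_def)
 qed
 show "AE s in lborel. norm (h (cof s) / (of_real s - cnj z) * m n (of_real s)) <= norm (h (cof s) / (of_real s - cnj z))" for n
 unfolding norm_mult using mb(1) by (intro AE_I2 mult_left_le) auto
 qed (use i2 in \<open>auto intro: integrable_norm\<close>)
 then show "(LBINT s. h (cof s) / (of_real s - cnj z)) = 0"
 unfolding zero using LIMSEQ_unique tendsto_const by blast
qed

lemma cauchy_formula:
 fixes h :: "complex => complex"
 assumes hol: "h holomorphic_on {z. Im z > - \<eta>}" and \<eta>: "\<eta> > 0" and b: "\<And>w. Im w >= 0 ==> norm (h w) <= 1"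
 and L2: "integrable lborel (%s. (norm (h (cof s)))\<^sup>2)" and z: "Im z > 0"
 shows "(LBINT s. h (cof s) / (of_real s - z)) = 2 * pi * \<i> * h z"
proof -
 let ?P = "%s. Im z / ((s - Re z)^2 + (Im z)^2)"
 have "h (cof s) / (of_real s - z) = h (cof s) / (of_real s - cnj z) + 2 * \<i> * (h (cof s) * of_real (?P s))" for s
 proof -
 have nz: "cof s - z \<noteq> 0" "cof s - cnj z \<noteq> 0" using z by (auto simp: complex_eq_iff)
 have "1 / (of_real s - z) - 1 / (of_real s - cnj z) = (z - cnj z) / ((of_real s - z) * (of_real s - cnj z))"
 using nz by (simp add: field_simps)
 also have "\<dots> = (2 * \<i> * Im z) / of_real ((s - Re z)^2 + (Im z)^2)"
 by (simp only: cnj_kernel complex_diff_cnj) (simp add: mult.commute)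
 finally have "1 / (of_real s - z) = 1 / (of_real s - cnj z) + 2 * \<i> * of_real (?P s)" by (simp add: algebra_simps)
 then have "h (cof s) * (1 / (of_real s - z)) = h (cof s) * (1 / (of_real s - cnj z)) + h (cof s) * (2 * \<i> * of_real (?P s))"
 by (simp only: distrib_left)
 then show ?thesis by (simp add: mult.left_commute)
 qed
 then have "(LBINT s. h (cof s) / (of_real s - z)) = (LBINT s. h (cof s) / (of_real s - cnj z) + 2 * \<i> * (h (cof s) * of_real (?P s)))"
 by presburger
 also have "\<dots> = (LBINT s. h (cof s) / (of_real s - cnj z)) + 2 * \<i> * (LBINT s. h (cof s) * of_real (?P s))"
 by (subst LINT_add[OF cauchy_formula_conj(2)[OF hol \<eta> b L2 z] integrable_mult_right[OF poisson_formula(2)[OF hol \<eta> b z]]])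
 (simp_all only: integral_mult_right_zero)
 also have "\<dots> = 2 * pi * \<i> * h z" using cauchy_formula_conj(1)[OF hol \<eta> b L2 z] poisson_formula(1)[OF hol \<eta> b z] by simp
 finally show ?thesis .
qed


section \<open>Boundary values of bounded functions of Hardy class\<close>

lemma ennreal_tendsto_0I:
 fixes f :: "'a => ennreal"
 assumes "\<And>e. e > 0 ==> eventually (%n. f n <= ennreal e) F"
 shows "(f \<longlongrightarrow> 0) F"
proof (rule order_tendstoI)
 fix a :: ennreal assume a: "0 < a"
 obtain e where e: "e > 0" "ennreal e < a"
 proof (cases a)
 case (real r)
 then show ?thesis using a that[of "r / 2"] by (auto simp: ennreal_less_iff)
 next
 case top
 then show ?thesis using that[of 1] by auto
 qed
 show "eventually (%n. f n < a) F" using assms[OF e(1)] by eventually_elim (use e in auto)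
qed auto

lemma integrable_indicator_Icc: "integrable lborel (indicator {x..y::real} :: real => real)"
 by (rule integrable_real_indicator) (auto simp: emeasure_lborel_Icc_eq)

text \<open>Completeness of the space of square integrable functions, with an almost everywhere convergent subsequence.\<close>
lemma riesz_fischer:
 fixes F :: "nat => 'a => complex"
 assumes [measurable]: "\<And>n. F n \<in> borel_measurable M"
 and cauchy: "\<And>e. e > 0 ==> \<exists>N. \<forall>m\<ge>N. \<forall>n\<ge>N. (\<integral>\<^sup>+x. ennreal ((norm (F m x - F n x))^2) \<partial>M) <= ennreal e"
 obtains g r where "g \<in> borel_measurable M" "strict_mono (r :: nat => nat)" "AE x in M. (%k. F (r k) x) \<leadsto> g x"
 "(%n. \<integral>\<^sup>+x. ennreal ((norm (F n x - g x))^2) \<partial>M) \<leadsto> 0"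
proof -
 have "\<forall>k. \<exists>N. \<forall>m\<ge>N. \<forall>n\<ge>N. (\<integral>\<^sup>+x. ennreal ((norm (F m x - F n x))^2) \<partial>M) <= ennreal ((1/4)^k)"
 using cauchy by auto
 then obtain N where N: "\<And>k m n. m >= N k ==> n >= N k ==> (\<integral>\<^sup>+x. ennreal ((norm (F m x - F n x))^2) \<partial>M) <= ennreal ((1/4)^k)"
 by metis
 define r where "r k = (\<Sum>j\<le>k. N j) + k" for k
 have rm: "strict_mono r" unfolding strict_mono_Suc_iff by (simp add: r_def)
 have rN: "r k >= N k" for k unfolding r_def using member_le_sum[of k "{..k}" N] by simp
 define D where "D k x = norm (F (r (Suc k)) x - F (r k) x)" for k x
 have [measurable]: "D k \<in> borel_measurable M" for k unfolding D_def by measurable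
 have Dk: "(\<integral>\<^sup>+x. ennreal ((D k x)^2) \<partial>M) <= ennreal ((1/4)^k)" for k
 unfolding D_def using rN[of k] strict_monoD[OF rm, of k "Suc k"] by (intro N) auto
 have "(\<integral>\<^sup>+x. (\<Sum>k. ennreal (2^k * (D k x)^2)) \<partial>M) = (\<Sum>k. \<integral>\<^sup>+x. ennreal (2^k * (D k x)^2) \<partial>M)"
 by (rule nn_integral_suminf) measurable
 also have "\<dots> <= (\<Sum>k. ennreal ((1/2)^k))"
 proof (intro suminf_le summableI)
 fix k
 have "(\<integral>\<^sup>+x. ennreal (2^k * (D k x)^2) \<partial>M) = ennreal (2^k) * (\<integral>\<^sup>+x. ennreal ((D k x)^2) \<partial>M)"
 by (simp add: ennreal_mult nn_integral_cmult)
 also have "\<dots> <= ennreal (2^k) * ennreal ((1/4)^k)" by (intro mult_left_mono Dk) auto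
 also have "\<dots> = ennreal ((1/2)^k)" by (subst ennreal_mult[symmetric]) (auto simp: power_mult_distrib[symmetric])
 finally show "(\<integral>\<^sup>+x. ennreal (2^k * (D k x)^2) \<partial>M) <= ennreal ((1/2)^k)" .
 qed
 also have "(\<Sum>k. ennreal ((1/2)^k)) = ennreal (\<Sum>k. (1/2)^k)"
 by (intro suminf_ennreal2) (auto intro: summable_geometric)
 finally have fin: "(\<integral>\<^sup>+x. (\<Sum>k. ennreal (2^k * (D k x)^2)) \<partial>M) \<noteq> \<infinity>" by (auto simp: top_unique)
 have "AE x in M. (\<Sum>k. ennreal (2^k * (D k x)^2)) \<noteq> \<infinity>" by (rule nn_integral_PInf_AE[OF _ fin]) measurable
 then have conv: "AE x in M. convergent (%k. F (r k) x)"
 proof eventually_elim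
 case (elim x)
 have s1: "summable (%k. 2^k * (D k x)^2)"
 by (rule summable_suminf_not_top) (use elim in auto)
 have s2: "summable (%k. 2^k * (D k x)^2 + (1/2)^k)" by (intro summable_add s1 summable_geometric) auto
 have "summable (%k. norm (F (r (Suc k)) x - F (r k) x))"
 proof (rule summable_comparison_test'[OF s2, where N = 0])
 fix k :: nat
 have "0 <= (2^k * D k x - 1)\<^sup>2" by simp
 then have "2 * (2^k * D k x) <= (2^k)\<^sup>2 * (D k x)^2 + 1" unfolding power2_diff by (simp add: power_mult_distrib)
 then have "(1/2)^k * (2 * (2^k * D k x)) <= (1/2)^k * ((2^k)^2 * (D k x)^2 + 1)" by (intro mult_left_mono) auto
 then have "2 * D k x <= 2^k * (D k x)^2 + (1/2)^k" by (simp add: power_one_over power2_eq_square field_simps)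
 moreover have "D k x >= 0" by (simp add: D_def)
 ultimately have "D k x <= 2^k * (D k x)^2 + (1/2)^k" by linarith
 then show "norm (norm (F (r (Suc k)) x - F (r k) x)) <= 2^k * (D k x)^2 + (1/2)^k" by (simp add: D_def)
 qed
 then have "summable (%k. F (r (Suc k)) x - F (r k) x)" by (rule summable_norm_cancel)
 then have "convergent (%n. \<Sum>k<n. F (r (Suc k)) x - F (r k) x)" by (simp add: summable_iff_convergent)
 then have "convergent (%n. F (r n) x - F (r 0) x)" unfolding sum_lessThan_telescope[of "%k. F (r k) x"] .
 then show ?case by (simp add: convergent_diff_const_right_iff)
 qed
 define g where "g x = lim (%k. F (r k) x)" for x
 have gm[measurable]: "g \<in> borel_measurable M" unfolding g_def[abs_def] by measurable
 have gl: "AE x in M. (%k. F (r k) x) \<leadsto> g x"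
 using conv by eventually_elim (simp add: g_def convergent_LIMSEQ_iff)
 have "(%n. \<integral>\<^sup>+x. ennreal ((norm (F n x - g x))^2) \<partial>M) \<leadsto> 0"
 proof (rule ennreal_tendsto_0I)
 fix e :: real assume e: "e > 0"
 obtain K where K: "\<And>m n. m >= K ==> n >= K ==> (\<integral>\<^sup>+x. ennreal ((norm (F m x - F n x))^2) \<partial>M) <= ennreal (e / 2)"
 using cauchy[of "e/2"] e by auto
 show "eventually (%n. (\<integral>\<^sup>+x. ennreal ((norm (F n x - g x))^2) \<partial>M) <= ennreal e) sequentially"
 using eventually_ge_at_top[of K]
 proof eventually_elim
 case (elim n)
 have "(\<integral>\<^sup>+x. ennreal ((norm (F n x - g x))^2) \<partial>M) = (\<integral>\<^sup>+x. liminf (%k. ennreal ((norm (F n x - F (r k) x))^2)) \<partial>M)"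
 proof (rule nn_integral_cong_AE)
 show "AE x in M. ennreal ((norm (F n x - g x))^2) = liminf (%k. ennreal ((norm (F n x - F (r k) x))^2))"
 using gl
 proof eventually_elim
 case (elim x)
 have "(%k. ennreal ((norm (F n x - F (r k) x))^2)) \<leadsto> ennreal ((norm (F n x - g x))^2)"
 by (intro tendsto_ennrealI tendsto_intros elim)
 then show ?case by (intro lim_imp_Liminf[symmetric]) auto
 qed
 qed
 also have "\<dots> <= liminf (%k. \<integral>\<^sup>+x. ennreal ((norm (F n x - F (r k) x))^2) \<partial>M)"
 by (rule nn_integral_liminf) measurable
 also have "\<dots> <= liminf (%k::nat. ennreal (e / 2))"
 proof (rule Liminf_mono)
 show "eventually (%k. (\<integral>\<^sup>+x. ennreal ((norm (F n x - F (r k) x))^2) \<partial>M) <= ennreal (e / 2)) sequentially"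
 using eventually_ge_at_top[of K]
 proof eventually_elim
 case (elim k)
 then show ?case using K[of n "r k"] \<open>K <= n\<close> seq_suble[OF rm, of k] by auto
 qed
 qed
 also have "\<dots> = ennreal (e / 2)" by (simp add: Liminf_const)
 also have "\<dots> <= ennreal e" using e by (intro ennreal_leI) simp
 finally show ?case .
 qed
 qed
 with that[OF gm rm gl] show ?thesis by blast
qed

lemma L2_weak_limit:
 fixes F :: "nat => 'a => complex"
 assumes [measurable]: "\<And>n. F n \<in> borel_measurable M" "g \<in> borel_measurable M" "\<kappa> \<in> borel_measurable M"
 and lim: "(%n. \<integral>\<^sup>+x. ennreal ((norm (F n x - g x))^2) \<partial>M) \<leadsto> 0"
 and \<kappa>: "(\<integral>\<^sup>+x. ennreal ((norm (\<kappa> x))^2) \<partial>M) < \<infinity>"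
 and int: "\<And>n. integrable M (%x. F n x * \<kappa> x)" "integrable M (%x. g x * \<kappa> x)"
 shows "(%n. \<integral>x. F n x * \<kappa> x \<partial>M) \<leadsto> (\<integral>x. g x * \<kappa> x \<partial>M)"
proof (rule Lim_null[THEN iffD2], rule tendsto_norm_zero_cancel)
 let ?I = "%n. norm ((\<integral>x. F n x * \<kappa> x \<partial>M) - (\<integral>x. g x * \<kappa> x \<partial>M))"
 have bnd: "(ennreal (?I n))\<^sup>2 <= (\<integral>\<^sup>+x. ennreal ((norm (F n x - g x))^2) \<partial>M) * (\<integral>\<^sup>+x. ennreal ((norm (\<kappa> x))^2) \<partial>M)" for n
 proof -
 have "(\<integral>x. F n x * \<kappa> x \<partial>M) - (\<integral>x. g x * \<kappa> x \<partial>M) = (\<integral>x. F n x * \<kappa> x - g x * \<kappa> x \<partial>M)"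
 by (rule LINT_diff[symmetric]) (rule int)+
 then have "ennreal (?I n) <= (\<integral>\<^sup>+x. ennreal (norm (F n x * \<kappa> x - g x * \<kappa> x)) \<partial>M)"
 using integral_norm_bound_ennreal[OF Bochner_Integration.integrable_diff[OF int(1)[of n] int(2)]] by simp
 also have "\<dots> = (\<integral>\<^sup>+x. ennreal (norm (F n x - g x)) * ennreal (norm (\<kappa> x)) \<partial>M)"
 by (intro nn_integral_cong) (simp add: ennreal_mult[symmetric] norm_mult[symmetric] left_diff_distrib)
 finally have "(ennreal (?I n))\<^sup>2 <= (\<integral>\<^sup>+x. ennreal (norm (F n x - g x)) * ennreal (norm (\<kappa> x)) \<partial>M)\<^sup>2"
 by (rule power_mono) simp
 also have "\<dots> <= (\<integral>\<^sup>+x. (ennreal (norm (F n x - g x)))\<^sup>2 \<partial>M) * (\<integral>\<^sup>+x. (ennreal (norm (\<kappa> x)))\<^sup>2 \<partial>M)"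
 by (rule Cauchy_Schwarz_nn_integral) measurable
 finally show ?thesis by (simp add: ennreal_power)
 qed
 have "(%n. (\<integral>\<^sup>+x. ennreal ((norm (F n x - g x))^2) \<partial>M) * (\<integral>\<^sup>+x. ennreal ((norm (\<kappa> x))^2) \<partial>M)) \<leadsto> 0 * (\<integral>\<^sup>+x. ennreal ((norm (\<kappa> x))^2) \<partial>M)"
 by (rule tendsto_mult_ennreal[OF lim tendsto_const]) (use \<kappa> in auto)
 then have l0: "(%n. (\<integral>\<^sup>+x. ennreal ((norm (F n x - g x))^2) \<partial>M) * (\<integral>\<^sup>+x. ennreal ((norm (\<kappa> x))^2) \<partial>M)) \<leadsto> 0" by simp
 have "(%n. (ennreal (?I n))\<^sup>2) \<leadsto> 0"
 by (rule tendsto_sandwich[OF _ _ tendsto_const l0]) (use bnd in auto)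
 then have "(%n. ennreal ((?I n)^2)) \<leadsto> ennreal 0" by (simp add: ennreal_power)
 then have "(%n. (?I n)\<^sup>2) \<leadsto> 0" by (subst (asm) tendsto_ennreal_iff) auto
 then have "(%n. sqrt ((?I n)^2)) \<leadsto> sqrt 0" by (rule tendsto_real_sqrt)
 then show "(%n. ?I n) \<leadsto> 0" by simp
qed

text \<open>The Poisson kernel is a probability density, so the square of a Poisson average is at most the average of the square.\<close>
lemma poisson_contraction:
 fixes h :: "complex => complex"
 assumes hol: "h holomorphic_on {z. Im z > - \<eta>}" and \<eta>: "\<eta> > 0" and b: "\<And>w. Im w >= 0 ==> norm (h w) <= 1" and T: "T > 0"
 shows "(NN x. ennreal ((norm (h (Complex x T)))^2)) <= (NN s. ennreal ((norm (h (cof s)))^2))"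
proof -
 let ?P = "%x s. T / ((s - x)^2 + T\<^sup>2)"
 have P0: "?P x s >= 0" for x s using T by simp
 have hm[measurable]: "(%s. h (cof s)) \<in> borel_measurable borel"
 by (rule borel_measurable_continuous_onI, rule continuous_on_compose2[OF holomorphic_on_imp_continuous_on[OF hol]]) (use \<eta> in \<open>auto intro!: continuous_intros\<close>)
 have pt: "ennreal ((norm (h (Complex x T)))^2) <= (NN s. ennreal ((norm (h (cof s)))^2) * ennreal (1 / pi * ?P x s))" for x
 proof -
 define c where "c = h (Complex x T)"
 have pf: "(LBINT s. h (cof s) * of_real (?P x s)) = pi * c" "integrable lborel (%s. h (cof s) * of_real (?P x s))"
 using poisson_formula[OF hol \<eta> b, of "Complex x T"] T by (auto simp: c_def)
 have cd: "integrable lborel (?P x)" "(LBINT s. ?P x s) = pi" using cauchy_density[OF T, of x] by auto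
 have i1: "integrable lborel (%s. (norm (h (cof s)))\<^sup>2 * ?P x s)"
 proof (rule integrable_dominated[OF cd(1)])
 show "AE s in lborel. norm ((norm (h (cof s)))^2 * ?P x s) <= norm (?P x s)"
 proof (rule AE_I2)
 fix s
 have "(norm (h (cof s)))\<^sup>2 <= 1" using b[of "cof s"] by (simp add: power_le_one)
 then have "(norm (h (cof s)))\<^sup>2 * ?P x s <= 1 * ?P x s" by (rule mult_right_mono) (rule P0)
 then show "norm ((norm (h (cof s)))^2 * ?P x s) <= norm (?P x s)" by (simp only: real_norm_def abs_mult abs_of_nonneg[OF P0] abs_of_nonneg[OF zero_le_power2] mult_1_left)
 qed
 qed measurable
 have i2: "integrable lborel (%s. Re (cnj c * (h (cof s) * of_real (?P x s))))"
 by (rule integrable_Re[OF integrable_mult_right[OF pf(2)]])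
 have "0 <= (LBINT s. (norm (h (cof s) - c))\<^sup>2 * ?P x s)"
 by (intro LINT_nonneg mult_nonneg_nonneg P0 zero_le_power2)
 also have "\<dots> = (LBINT s. (norm (h (cof s)))\<^sup>2 * ?P x s - 2 * Re (cnj c * (h (cof s) * of_real (?P x s))) + (norm c)^2 * ?P x s)"
 proof (rule LINT_cong[OF refl])
 fix s
 have e: "(norm (a - c))\<^sup>2 = (norm a)^2 - 2 * Re (cnj c * a) + (norm c)^2" for a
 unfolding cmod_power2 by (simp add: power2_eq_square algebra_simps)
 have "Re (cnj c * (a * of_real p)) = Re (cnj c * a) * p" for a p by (simp add: algebra_simps)
 then show "(norm (h (cof s) - c))\<^sup>2 * ?P x s = (norm (h (cof s)))^2 * ?P x s - 2 * Re (cnj c * (h (cof s) * of_real (?P x s))) + (norm c)^2 * ?P x s"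
 unfolding e by (simp only: left_diff_distrib distrib_right mult.assoc)
 qed
 also have "\<dots> = (LBINT s. (norm (h (cof s)))\<^sup>2 * ?P x s) - 2 * (LBINT s. Re (cnj c * (h (cof s) * of_real (?P x s)))) + (norm c)^2 * (LBINT s. ?P x s)"
 proof -
 have "(LBINT s. (A s - 2 * B s) + d * D s) = (LBINT s. A s) - 2 * (LBINT s. B s) + d * (LBINT s. D s)"
 if "integrable lborel A" "integrable lborel B" "integrable lborel D" for A B D :: "real => real" and d
 using that by simp
 from this[OF i1 i2 cd(1)] show ?thesis .
 qed
 also have "(LBINT s. Re (cnj c * (h (cof s) * of_real (?P x s)))) = Re (cnj c * (pi * c))"
 using integral_Re[OF integrable_mult_right[OF pf(2), of "cnj c"]] pf(1) by (simp only: integral_mult_right_zero)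
 also have "Re (cnj c * (pi * c)) = pi * (norm c)^2" unfolding cmod_power2 by (simp add: power2_eq_square algebra_simps)
 finally have "(norm c)\<^sup>2 * pi <= (LBINT s. (norm (h (cof s)))\<^sup>2 * ?P x s)" using cd(2) by (simp add: mult.commute[of pi])
 then have "(norm c)\<^sup>2 <= (LBINT s. (norm (h (cof s)))\<^sup>2 * ?P x s) / pi" by (simp add: field_simps)
 also have "\<dots> = (LBINT s. (norm (h (cof s)))\<^sup>2 * ?P x s / pi)" by (rule integral_divide_zero[symmetric])
 finally have "ennreal ((norm c)^2) <= ennreal (LBINT s. (norm (h (cof s)))\<^sup>2 * ?P x s / pi)" by (rule ennreal_leI)
 also have "\<dots> = (NN s. ennreal ((norm (h (cof s)))^2 * ?P x s / pi))"
 proof (rule nn_integral_eq_integral[symmetric])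
 show "AE s in lborel. 0 <= (norm (h (cof s)))\<^sup>2 * ?P x s / pi"
 by (intro AE_I2 divide_nonneg_nonneg mult_nonneg_nonneg P0 zero_le_power2 pi_ge_zero)
 qed (rule integrable_divide_zero[OF i1])
 also have "\<dots> = (NN s. ennreal ((norm (h (cof s)))^2) * ennreal (1 / pi * ?P x s))"
 proof (rule nn_integral_cong)
 fix s
 have "ennreal (a * b / pi) = ennreal a * ennreal (1 / pi * b)" if "a >= 0" "b >= 0" for a b
 using that by (subst ennreal_mult[symmetric]) auto
 from this[OF _ P0] show "ennreal ((norm (h (cof s)))^2 * ?P x s / pi) = ennreal ((norm (h (cof s)))^2) * ennreal (1 / pi * ?P x s)"
 by (simp only: zero_le_power2)
 qed
 finally show ?thesis by (simp only: c_def)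
 qed
 have "(NN x. ennreal ((norm (h (Complex x T)))^2)) <= (NN x. (NN s. ennreal ((norm (h (cof s)))^2) * ennreal (1 / pi * ?P x s)))"
 by (intro nn_integral_mono pt)
 also have "\<dots> = (NN s. (NN x. ennreal ((norm (h (cof s)))^2) * ennreal (1 / pi * ?P x s)))"
 by (rule lborel_pair.Fubini') measurable
 also have "\<dots> = (NN s. ennreal ((norm (h (cof s)))^2))"
 proof (rule nn_integral_cong)
 fix s
 have "(NN x. ennreal (1 / pi * ?P x s)) = (NN x. ennreal (1 / pi) * ennreal (T / ((x - s)^2 + T\<^sup>2)))"
 using P0 by (intro nn_integral_cong) (subst ennreal_mult[symmetric], auto simp: power2_commute)
 also have "\<dots> = ennreal (1 / pi) * ennreal pi" by (subst nn_integral_cmult) (auto simp: nn_integral_cauchy_density[OF T])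
 also have "\<dots> = 1" by (subst ennreal_mult[symmetric]) auto
 finally have "(NN x. ennreal (1 / pi * ?P x s)) = 1" .
 then show "(NN x. ennreal ((norm (h (cof s)))^2) * ennreal (1 / pi * ?P x s)) = ennreal ((norm (h (cof s)))^2)"
 by (subst nn_integral_cmult) auto
 qed
 finally show ?thesis .
qed


text \<open>Lebesgue's differentiation theorem, applied to \<open>|b - r|\<close> for all \<open>r\<close> in a countable dense set.\<close>
lemma lebesgue_point_AE:
 fixes b :: "real => complex"
 assumes [measurable]: "b \<in> borel_measurable borel" and b1: "\<And>s. norm (b s) <= 1"
 shows "AE t in lebesgue. ((%r. (LBINT s:{t-r..t+r}. norm (b s - b t)) / r) \<longlongrightarrow> 0) (at_right 0)"
proof -
 obtain D :: "complex set" where D: "countable D" "\<And>X. open X ==> X \<noteq> {} ==> \<exists>d\<in>D. d \<in> X"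
 using countable_dense_exists by metis
 define fc where "fc c s = norm (b s - c)" for c s
 have fi: "set_integrable lborel {x..y} (fc c)" for c x y
 unfolding set_integrable_def
 proof (rule integrable_dominated)
 show "integrable lborel (%s. (1 + norm c) * indicator {x..y} s)" by (rule integrable_mult_right[OF integrable_indicator_Icc])
 have "norm (b s - c) <= 1 + norm c" for s using norm_triangle_ineq4[of "b s" c] b1[of s] by linarith
 then show "AE s in lborel. norm (indicator {x..y} s *\<^sub>R fc c s) <= norm ((1 + norm c) * indicator {x..y} s)"
 by (intro AE_I2) (auto simp: indicator_def fc_def abs_of_nonneg)
 qed (auto simp: fc_def)
 have fI: "fc c integrable_on {x..y}" "(LBINT s:{x..y}. fc c s) = integral {x..y} (fc c)" for c x y
 using set_borel_integral_eq_integral[OF fi] by auto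
 have "\<exists>N. negligible N & (\<forall>a x. a < x --> x \<notin> N --> ((%x. integral {a..x} (fc c)) has_vector_derivative fc c x) (at x))" for c
 using indefinite_integral_has_vector_derivative_AE[OF fI(1)] by metis
 then obtain N where N: "\<And>c. negligible (N c)" "\<And>c a x. a < x ==> x \<notin> N c ==> ((%x. integral {a..x} (fc c)) has_vector_derivative fc c x) (at x)"
 by metis
 have "AE t in lebesgue. t \<notin> N c" for c using N(1)[of c] by (intro AE_not_in) (simp add: negligible_iff_null_sets)
 then have "AE t in lebesgue. \<forall>c\<in>D. t \<notin> N c" by (subst AE_ball_countable[OF D(1)]) auto
 then show ?thesis
 proof eventually_elim
 case (elim t)
 show ?case
 proof (rule tendstoI)
 fix e :: real assume e: "e > 0"
 obtain c where c: "c \<in> D" "c \<in> ball (b t) (e / 8)" using D(2)[of "ball (b t) (e / 8)"] e by auto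
 then have ct: "norm (b t - c) < e / 8" by (simp add: dist_norm)
 define G where "G x = integral {t - 1..x} (fc c)" for x
 have "(G has_vector_derivative fc c t) (at t)" unfolding G_def[abs_def] by (rule N(2)) (use elim c in auto)
 then obtain d where d: "d > 0" "\<And>y. norm (y - t) < d ==> norm (G y - G t - (y - t) *\<^sub>R fc c t) <= (e / 8) * norm (y - t)"
 unfolding has_vector_derivative_def has_derivative_at_alt using e by (metis divide_pos_pos zero_less_numeral)
 have "eventually (%r. r \<in> {0<..<min d 1}) (at_right (0::real))"
 using d(1) by (intro eventually_at_right_real) auto
 then show "eventually (%r. dist ((LBINT s:{t-r..t+r}. norm (b s - b t)) / r) 0 < e) (at_right 0)"
 proof eventually_elim
 case (elim r)
 then have r: "0 < r" "r < d" "r < 1" by auto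
 have "G (t + r) - G (t - r) = integral {t - r..t + r} (fc c)"
 unfolding G_def using Henstock_Kurzweil_Integration.integral_combine[of "t - 1" "t - r" "t + r" "fc c"] r fI(1) by simp
 moreover have "G (t + r) - G t - r * fc c t <= (e / 8) * r"
 proof (rule abs_le_D1)
 show "\<bar>G (t + r) - G t - r * fc c t\<bar> <= (e / 8) * r" using d(2)[of "t + r"] r by simp
 qed
 moreover have "- (G (t - r) - G t + r * fc c t) <= (e / 8) * r"
 proof (rule abs_le_D2)
 show "\<bar>G (t - r) - G t + r * fc c t\<bar> <= (e / 8) * r" using d(2)[of "t - r"] r by simp
 qed
 ultimately have I1: "(LBINT s:{t-r..t+r}. fc c s) <= 2 * r * fc c t + 2 * ((e / 8) * r)" unfolding fI(2) by (simp add: algebra_simps)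
 have ci: "set_integrable lborel {t-r..t+r} (%_. norm (b t - c))"
 unfolding set_integrable_def by (rule borel_integrable_compact) auto
 have "(LBINT s:{t-r..t+r}. norm (b s - b t)) <= (LBINT s:{t-r..t+r}. fc c s + norm (b t - c))"
 proof (rule set_integral_mono)
 show "set_integrable lborel {t-r..t+r} (%s. norm (b s - b t))" using fi[of "t-r" "t+r" "b t"] unfolding fc_def[abs_def] .
 show "set_integrable lborel {t-r..t+r} (%s. fc c s + norm (b t - c))" by (intro set_integral_add(1) fi ci)
 show "norm (b s - b t) <= fc c s + norm (b t - c)" for s
 unfolding fc_def using norm_triangle_ineq4[of "b s - c" "b t - c"] by simp
 qed
 also have "\<dots> = (LBINT s:{t-r..t+r}. fc c s) + (LBINT s:{t-r..t+r}. norm (b t - c))"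
 by (rule set_integral_add(2)[OF fi ci])
 also have "(LBINT s:{t-r..t+r}. norm (b t - c)) = 2 * r * norm (b t - c)"
 using r by (simp add: set_lebesgue_integral_def)
 also have "(LBINT s:{t-r..t+r}. fc c s) + 2 * r * norm (b t - c) <= (2 * r * fc c t + 2 * ((e / 8) * r)) + 2 * r * norm (b t - c)"
 using I1 by simp
 also have "\<dots> = r * (4 * norm (b t - c) + e / 4)" by (simp add: fc_def algebra_simps)
 also have "\<dots> < r * e" using ct r e by (intro mult_strict_left_mono) auto
 finally have lt: "(LBINT s:{t-r..t+r}. norm (b s - b t)) < r * e" .
 have "0 <= (LBINT s:{t-r..t+r}. norm (b s - b t))"
 unfolding set_lebesgue_integral_def by (intro LINT_nonneg) auto
 then show ?case using lt r by (simp add: field_simps)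
 qed
 qed
 qed
qed

text \<open>Poisson kernel as a superposition of centred intervals\<close>

text \<open>Writes the Poisson kernel as a superposition of indicators of symmetric intervals, so that Poisson averages are controlled by averages over intervals.\<close>
lemma poisson_layer_cake:
 fixes y u :: real
 assumes y: "y > 0"
 shows "ennreal (y / (u\<^sup>2 + y\<^sup>2)) = (NN \<rho>. ennreal (2 * \<rho> / (1 + \<rho>\<^sup>2)^2 / y) * indicator {\<bar>u\<bar> / y..} \<rho>)"
proof -
 have "(NN \<rho>. ennreal (2 * \<rho> / (1 + \<rho>\<^sup>2)^2 / y) * indicator {\<bar>u\<bar> / y..} \<rho>) = ennreal (0 - (- 1 / (1 + (\<bar>u\<bar> / y)^2) / y))"
 proof (rule nn_integral_FTC_atLeast)
 fix \<rho> assume \<rho>: "\<bar>u\<bar> / y <= \<rho>"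
 have p: "1 + \<rho>\<^sup>2 \<noteq> 0" using zero_le_power2[of \<rho>] by linarith
 show "DERIV (%\<rho>. - 1 / (1 + \<rho>\<^sup>2) / y) \<rho> :> 2 * \<rho> / (1 + \<rho>\<^sup>2)^2 / y"
 using p y by (auto intro!: derivative_eq_intros simp: power2_eq_square)
 have "0 <= \<rho>" using \<rho> y by (meson abs_ge_zero divide_nonneg_pos order_trans)
 then show "0 <= 2 * \<rho> / (1 + \<rho>\<^sup>2)^2 / y" using y by simp
 next
 show "((%\<rho>. - 1 / (1 + \<rho>\<^sup>2) / y) \<longlongrightarrow> 0) at_top" using y by real_asymp
 qed auto
 also have "0 - (- 1 / (1 + (\<bar>u\<bar> / y)^2) / y) = y / (u\<^sup>2 + y\<^sup>2)"
 proof -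
 have "1 + (\<bar>u\<bar> / y)^2 = (u\<^sup>2 + y\<^sup>2) / y\<^sup>2" using y by (simp add: power_divide field_simps)
 then show ?thesis using y by (simp add: power2_eq_square)
 qed
 finally show ?thesis by simp
qed

lemma poisson_average_tendsto:
 fixes w :: "real => real" and Y :: "nat => real"
 assumes [measurable]: "w \<in> borel_measurable borel" and w: "\<And>s. 0 <= w s" "\<And>s. w s <= 2"
 and lp: "((%r. (LBINT s:{t-r..t+r}. w s) / r) \<longlongrightarrow> 0) (at_right 0)"
 and Y: "\<And>n. Y n > 0" "Y \<leadsto> 0"
 shows "(%n. NN s. ennreal (w s * (Y n / ((s - t)^2 + (Y n)^2)))) \<leadsto> 0"
proof -
 define V where "V r = (LBINT s:{t-r..t+r}. w s)" for r
 have wi: "integrable lborel (%s. indicator {t-r..t+r} s *\<^sub>R w s)" for r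
 proof (rule integrable_dominated)
 show "integrable lborel (%s. 2 * indicator {t-r..t+r} s :: real)" by (rule integrable_mult_right[OF integrable_indicator_Icc])
 qed (use w in \<open>auto simp: indicator_def\<close>)
 have V0: "V r >= 0" for r unfolding V_def set_lebesgue_integral_def using w by (intro LINT_nonneg) auto
 have V4: "V r <= 4 * r" if "r >= 0" for r
 proof -
 have "V r <= (LBINT s. 2 * indicator {t-r..t+r} s)" unfolding V_def set_lebesgue_integral_def
 by (rule integral_mono[OF wi integrable_mult_right[OF integrable_indicator_Icc]]) (use w in \<open>auto simp: indicator_def\<close>)
 also have "\<dots> = 4 * r" using that by simp
 finally show ?thesis .
 qed
 have Vnn: "(NN s. ennreal (w s) * indicator {t-r..t+r} s) = ennreal (V r)" for r
 proof -
 have "(NN s. ennreal (w s) * indicator {t-r..t+r} s) = (NN s. ennreal (indicator {t-r..t+r} s *\<^sub>R w s))"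
 by (intro nn_integral_cong) (auto simp: indicator_def)
 also have "\<dots> = ennreal (V r)" unfolding V_def set_lebesgue_integral_def by (rule nn_integral_eq_integral[OF wi]) (use w in auto)
 finally show ?thesis .
 qed
 define k where "k \<rho> = (if \<rho> > 0 then 2 * \<rho> / (1 + \<rho>\<^sup>2)^2 else 0)" for \<rho> :: real
 have k0: "k \<rho> >= 0" for \<rho> by (simp add: k_def)
 have km[measurable]: "k \<in> borel_measurable borel" unfolding k_def[abs_def] by measurable
 have eq: "(NN s. ennreal (w s * (y / ((s - t)^2 + y\<^sup>2)))) = (NN \<rho>. ennreal (k \<rho> * (V (y * \<rho>) / y)))" if y: "y > 0" for y
 proof -
 have "(NN s. ennreal (w s * (y / ((s - t)^2 + y\<^sup>2)))) = (NN s. (NN \<rho>. ennreal (w s) * (if \<bar>s - t\<bar> <= y * \<rho> then ennreal (k \<rho> / y) else 0)))"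
 proof (rule nn_integral_cong)
 fix s
 have "ennreal (w s * (y / ((s - t)^2 + y\<^sup>2))) = ennreal (w s) * ennreal (y / ((s - t)^2 + y\<^sup>2))"
 using w y by (subst ennreal_mult) auto
 also have "ennreal (y / ((s - t)^2 + y\<^sup>2)) = (NN \<rho>. (if \<bar>s - t\<bar> <= y * \<rho> then ennreal (k \<rho> / y) else 0))"
 unfolding poisson_layer_cake[OF y]
 proof (rule nn_integral_cong)
 fix \<rho> :: real
 have "\<rho> > 0 \<or> \<rho> = 0 \<or> \<not> \<bar>s - t\<bar> <= y * \<rho>" using y by (smt (verit) mult_pos_neg)
 then show "ennreal (2 * \<rho> / (1 + \<rho>\<^sup>2)^2 / y) * indicator {\<bar>s - t\<bar> / y..} \<rho> = (if \<bar>s - t\<bar> <= y * \<rho> then ennreal (k \<rho> / y) else 0)"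
 using y by (auto simp: indicator_def k_def pos_divide_le_eq mult.commute)
 qed
 also have "ennreal (w s) * \<dots> = (NN \<rho>. ennreal (w s) * (if \<bar>s - t\<bar> <= y * \<rho> then ennreal (k \<rho> / y) else 0))"
 by (rule nn_integral_cmult[symmetric]) measurable
 finally show "ennreal (w s * (y / ((s - t)^2 + y\<^sup>2))) = (NN \<rho>. ennreal (w s) * (if \<bar>s - t\<bar> <= y * \<rho> then ennreal (k \<rho> / y) else 0))" .
 qed
 also have "\<dots> = (NN \<rho>. (NN s. ennreal (w s) * (if \<bar>s - t\<bar> <= y * \<rho> then ennreal (k \<rho> / y) else 0)))"
 by (rule lborel_pair.Fubini') measurable
 also have "\<dots> = (NN \<rho>. ennreal (k \<rho> * (V (y * \<rho>) / y)))"
 proof (rule nn_integral_cong)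
 fix \<rho> :: real
 have "(NN s. ennreal (w s) * (if \<bar>s - t\<bar> <= y * \<rho> then ennreal (k \<rho> / y) else 0)) = (NN s. ennreal (k \<rho> / y) * (ennreal (w s) * indicator {t - y * \<rho>..t + y * \<rho>} s))"
 by (intro nn_integral_cong) (auto simp: indicator_def abs_le_iff mult.commute)
 also have "\<dots> = ennreal (k \<rho> / y) * ennreal (V (y * \<rho>))" by (subst nn_integral_cmult) (auto simp: Vnn)
 also have "\<dots> = ennreal (k \<rho> * (V (y * \<rho>) / y))" using k0 V0 y by (subst ennreal_mult[symmetric]) auto
 finally show "(NN s. ennreal (w s) * (if \<bar>s - t\<bar> <= y * \<rho> then ennreal (k \<rho> / y) else 0)) = ennreal (k \<rho> * (V (y * \<rho>) / y))" .
 qed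
 finally show ?thesis .
 qed
 have Vm[measurable]: "V \<in> borel_measurable borel"
 proof -
 have "(%r. NN s. ennreal (w s) * (if \<bar>s - t\<bar> <= r then 1 else 0)) \<in> borel_measurable borel" by measurable
 moreover have "(NN s. ennreal (w s) * (if \<bar>s - t\<bar> <= r then 1 else 0)) = ennreal (V r)" for r
 unfolding Vnn[symmetric] by (intro nn_integral_cong) (auto simp: indicator_def abs_le_iff)
 ultimately have "(%r. enn2real (ennreal (V r))) \<in> borel_measurable borel" by simp
 then show ?thesis using V0 by simp
 qed
 have "(%n. NN \<rho>. ennreal (k \<rho> * (V (Y n * \<rho>) / Y n))) \<leadsto> (\<integral>\<^sup>+\<rho>. 0 \<partial>(lborel::real measure))"
 proof (rule nn_integral_dominated_convergence[where w = "%\<rho>. ennreal (8 * (1 / (\<rho>\<^sup>2 + 1)))"])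
 show "AE \<rho> in lborel. ennreal (k \<rho> * (V (Y n * \<rho>) / Y n)) <= ennreal (8 * (1 / (\<rho>\<^sup>2 + 1)))" for n
 proof (intro AE_I2 ennreal_leI)
 fix \<rho> :: real
 show "k \<rho> * (V (Y n * \<rho>) / Y n) <= 8 * (1 / (\<rho>\<^sup>2 + 1))"
 proof (cases "\<rho> > 0")
 case True
 have p: "1 + \<rho>\<^sup>2 > 0" by (simp add: add_pos_nonneg)
 have "V (Y n * \<rho>) / Y n <= 4 * (Y n * \<rho>) / Y n" using V4[of "Y n * \<rho>"] True Y(1)[of n] by (intro divide_right_mono) auto
 also have "\<dots> = 4 * \<rho>" using Y(1)[of n] by simp
 finally have "k \<rho> * (V (Y n * \<rho>) / Y n) <= k \<rho> * (4 * \<rho>)" by (intro mult_left_mono k0)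
 also have "\<dots> = 8 * (\<rho>\<^sup>2 / (1 + \<rho>\<^sup>2)^2)" using True by (simp add: k_def power2_eq_square)
 also have "\<rho>\<^sup>2 / (1 + \<rho>\<^sup>2)^2 <= (1 + \<rho>\<^sup>2) / (1 + \<rho>\<^sup>2)^2" by (intro divide_right_mono) auto
 also have "(1 + \<rho>\<^sup>2) / (1 + \<rho>\<^sup>2)^2 = 1 / (\<rho>\<^sup>2 + 1)" using p by (simp add: power2_eq_square add.commute)
 finally show ?thesis by simp
 next
 case False
 then show ?thesis by (simp add: k_def)
 qed
 qed
 have "(NN \<rho>. ennreal (8 * (1 / (\<rho>\<^sup>2 + 1)))) = (NN \<rho>. 8 * ennreal (1 / ((\<rho> - 0)^2 + 1\<^sup>2)))"
 proof (rule nn_integral_cong)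
 fix \<rho> :: real
 have "ennreal (8 * (1 / (\<rho>\<^sup>2 + 1))) = ennreal 8 * ennreal (1 / (\<rho>\<^sup>2 + 1))" by (rule ennreal_mult) auto
 also have "\<dots> = 8 * ennreal (1 / ((\<rho> - 0)^2 + 1\<^sup>2))" by simp
 finally show "ennreal (8 * (1 / (\<rho>\<^sup>2 + 1))) = 8 * ennreal (1 / ((\<rho> - 0)^2 + 1\<^sup>2))" .
 qed
 also have "\<dots> = 8 * ennreal pi" by (subst nn_integral_cmult) (auto simp: nn_integral_cauchy_density[of 1 0, simplified])
 also have "\<dots> < \<infinity>" by (simp add: ennreal_mult_less_top)
 finally show "(NN \<rho>. ennreal (8 * (1 / (\<rho>\<^sup>2 + 1)))) < \<infinity>" .
 show "AE \<rho> in lborel. (%n. ennreal (k \<rho> * (V (Y n * \<rho>) / Y n))) \<leadsto> 0"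
 proof (rule AE_I2)
 fix \<rho> :: real
 show "(%n. ennreal (k \<rho> * (V (Y n * \<rho>) / Y n))) \<leadsto> 0"
 proof (cases "\<rho> > 0")
 case True
 have "(%n. Y n * \<rho>) \<leadsto> 0 * \<rho>" by (intro tendsto_intros Y)
 moreover have "\<forall>n. Y n * \<rho> \<in> {0<..} & Y n * \<rho> \<noteq> 0"
 proof
 fix n
 have "Y n * \<rho> > 0" using True Y(1)[of n] by simp
 then show "Y n * \<rho> \<in> {0<..} & Y n * \<rho> \<noteq> 0" by auto
 qed
 ultimately have "filterlim (%n. Y n * \<rho>) (at_right 0) sequentially"
 unfolding filterlim_at by simp
 from filterlim_compose[OF lp[folded V_def] this]
 have "(%n. k \<rho> * \<rho> * (V (Y n * \<rho>) / (Y n * \<rho>))) \<leadsto> k \<rho> * \<rho> * 0" by (intro tendsto_intros)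
 moreover have "k \<rho> * \<rho> * (V (Y n * \<rho>) / (Y n * \<rho>)) = k \<rho> * (V (Y n * \<rho>) / Y n)" for n
 using True by simp
 ultimately have "(%n. k \<rho> * (V (Y n * \<rho>) / Y n)) \<leadsto> 0" by simp
 from tendsto_ennrealI[OF this] show ?thesis by simp
 next
 case False
 then show ?thesis by (simp add: k_def)
 qed
 qed
 qed measurable
 moreover have "(NN (\<rho>::real). 0) = 0" by (rule nn_integral_0_iff_AE[THEN iffD2]) auto
 ultimately show ?thesis unfolding eq[OF Y(1)] by (simp only:)
qed


locale hardy_function =
 fixes f :: "complex => complex" and C :: real
 assumes hol: "f holomorphic_on {z. Im z > 0}"
 and bounded: "\<And>z. Im z > 0 ==> norm (f z) <= 1"
 and H2: "\<And>e. e > 0 ==> (NN s. ennreal ((norm (f (Complex s e)))^2)) <= ennreal C"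
 and C0: "C >= 0"
begin

lemma shift_holomorphic:
 assumes "a > 0"
 shows "(%w. f (w + \<i> * cof a)) holomorphic_on {z. Im z > - a}"
proof -
 have "(%w. w + \<i> * cof a) holomorphic_on {z. Im z > - a}" by (intro holomorphic_intros)
 moreover have "(%w. w + \<i> * cof a) ` {z. Im z > - a} \<subseteq> {z. Im z > 0}" by auto
 ultimately show ?thesis using holomorphic_on_compose_gen[OF _ hol] by (simp add: o_def)
qed

lemma isCont_f: "Im z > 0 ==> isCont f z"
 using holomorphic_on_imp_continuous_on[OF hol] open_halfspace_Im_gt[of 0] by (simp add: continuous_on_eq_continuous_at)

lemma line_measurable [measurable]:
 assumes "e > 0"
 shows "(%s. f (Complex s e)) \<in> borel_measurable borel"
proof (rule borel_measurable_continuous_onI, rule continuous_on_compose2[OF holomorphic_on_imp_continuous_on[OF hol]])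
 have "Complex s e = of_real s + \<i> * of_real e" for s by (simp add: complex_eq_iff)
 then show "continuous_on UNIV (%s. Complex s e)" by (auto intro!: continuous_intros)
qed (use assms in auto)

definition F :: "nat => real => complex" where "F n s = f (Complex s (1 / real (Suc n)))"

lemma F_measurable [measurable]: "F n \<in> borel_measurable borel"
 unfolding F_def[abs_def] by (rule line_measurable) simp

text \<open>The identity \<open>|a - b|^2 + |a + b|^2 = 2 |a|^2 + 2 |b|^2\<close> with the midpoint compared by the Poisson contraction: the norms on lines increase to a limit as the line approaches the boundary, which forces the functions together.\<close>
lemma F_cauchy:
 assumes e: "e > 0"
 shows "\<exists>N. \<forall>m\<ge>N. \<forall>n\<ge>N. (NN x. ennreal ((norm (F m x - F n x))^2)) <= ennreal e"
proof (rule ccontr)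
 assume "\<not> ?thesis"
 then have "\<forall>k. \<exists>m n. m >= k & n >= k & ennreal e < (NN x. ennreal ((norm (F m x - F n x))^2))"
 by (metis linorder_not_le)
 then obtain m n where mn: "\<And>k. m k >= k" "\<And>k. n k >= k" "\<And>k. ennreal e < (NN x. ennreal ((norm (F (m k) x - F (n k) x))^2))"
 by metis
 define I where "I T = (NN s. ennreal ((norm (f (Complex s T)))^2))" for T
 define L where "L = (SUP T\<in>{0<..}. I T)"
 have "L <= ennreal C" unfolding L_def I_def by (rule SUP_least) (use H2 in auto)
 then obtain l where l: "l >= 0" "L = ennreal l" by (cases L) (auto simp: top_unique)
 have IL: "I T <= L" if "T > 0" for T unfolding L_def by (rule SUP_upper) (use that in auto)
 have IF: "(NN x. ennreal ((norm (F j x))^2)) <= L" for j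
 using IL[of "1 / real (Suc j)"] by (simp add: I_def F_def)
 define S where "S k = (NN x. ennreal ((norm (F (m k) x + F (n k) x))^2))" for k
 have par: "ennreal e + S k <= ennreal (4 * l)" for k
 proof -
 have "ennreal e + S k <= (NN x. ennreal ((norm (F (m k) x - F (n k) x))^2)) + S k"
 using mn(3)[of k] by (intro add_right_mono) auto
 also have "\<dots> = (NN x. ennreal ((norm (F (m k) x - F (n k) x))^2) + ennreal ((norm (F (m k) x + F (n k) x))^2))"
 unfolding S_def by (rule nn_integral_add[symmetric]) measurable
 also have "\<dots> = (NN x. 2 * ennreal ((norm (F (m k) x))^2) + 2 * ennreal ((norm (F (n k) x))^2))"
 proof (rule nn_integral_cong)
 fix x
 have "ennreal ((norm (a - b))^2) + ennreal ((norm (a + b))^2) = ennreal 2 * ennreal ((norm a)^2) + ennreal 2 * ennreal ((norm b)^2)" for a b :: complex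
 proof -
 have "ennreal ((norm (a - b))^2) + ennreal ((norm (a + b))^2) = ennreal ((norm (a - b))^2 + (norm (a + b))^2)"
 by (rule ennreal_plus[symmetric]) auto
 also have "\<dots> = ennreal (2 * (norm a)^2 + 2 * (norm b)^2)"
 unfolding cmod_power2 by (simp add: power2_eq_square algebra_simps)
 also have "\<dots> = ennreal (2 * (norm a)^2) + ennreal (2 * (norm b)^2)" by (rule ennreal_plus) auto
 also have "\<dots> = ennreal 2 * ennreal ((norm a)^2) + ennreal 2 * ennreal ((norm b)^2)"
 by (intro arg_cong2[where f = "(+)"] ennreal_mult) auto
 finally show ?thesis .
 qed
 from this[of "F (m k) x" "F (n k) x"] show "ennreal ((norm (F (m k) x - F (n k) x))^2) + ennreal ((norm (F (m k) x + F (n k) x))^2) = 2 * ennreal ((norm (F (m k) x))^2) + 2 * ennreal ((norm (F (n k) x))^2)"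
 by simp
 qed
 also have "\<dots> = 2 * (NN x. ennreal ((norm (F (m k) x))^2)) + 2 * (NN x. ennreal ((norm (F (n k) x))^2))"
 by (simp add: nn_integral_add nn_integral_cmult)
 also have "\<dots> <= 2 * L + 2 * L" by (intro add_mono mult_left_mono IF) auto
 also have "\<dots> = ennreal 2 * ennreal l + ennreal 2 * ennreal l" by (simp add: l(2))
 also have "\<dots> = ennreal (4 * l)" using l(1) by (simp add: ennreal_mult[symmetric] ennreal_plus[symmetric] del: ennreal_plus ennreal_numeral)
 finally show ?thesis .
 qed
 have Sk: "S k <= ennreal (4 * l - e)" for k
 using par[of k] e l(1) by (cases "S k") (auto simp flip: ennreal_plus simp: top_unique ennreal_le_iff intro!: ennreal_leI)
 have el: "e <= 4 * l"
 proof -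
 have "ennreal e <= ennreal e + S 0" by simp
 also have "\<dots> <= ennreal (4 * l)" by (rule par)
 finally show ?thesis using l by (subst (asm) ennreal_le_iff) auto
 qed
 have "I T <= ennreal (l - e / 4)" if T: "T > 0" for T
 proof -
 let ?a = "%k. 1 / real (Suc (m k))" and ?b = "%k. 1 / real (Suc (n k))"
 define h where "h k w = (f (w + \<i> * cof (?a k)) + f (w + \<i> * cof (?b k))) / 2" for k w
 have hk: "(NN x. ennreal ((norm (h k (Complex x T)))^2)) <= ennreal (l - e / 4)" for k
 proof -
 define \<eta> where "\<eta> = min (?a k) (?b k)"
 have "h k holomorphic_on {z. Im z > - \<eta>}" unfolding h_def[abs_def]
 by (intro holomorphic_intros holomorphic_on_subset[OF shift_holomorphic]) (auto simp: \<eta>_def)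
 moreover have "\<eta> > 0" by (simp add: \<eta>_def)
 moreover have "norm (h k w) <= 1" if "Im w >= 0" for w
 proof -
 have "norm (f (w + \<i> * cof (?a k))) <= 1" "norm (f (w + \<i> * cof (?b k))) <= 1"
 using that by (auto intro!: bounded add_nonneg_pos)
 then have "norm (f (w + \<i> * cof (?a k)) + f (w + \<i> * cof (?b k))) <= 2"
 by (metis norm_triangle_le add_mono one_add_one)
 then show ?thesis unfolding h_def norm_divide by simp
 qed
 ultimately have "(NN x. ennreal ((norm (h k (Complex x T)))^2)) <= (NN s. ennreal ((norm (h k (cof s)))^2))"
 by (rule poisson_contraction[OF _ _ _ T])
 also have "\<dots> = (NN s. ennreal (1 / 4) * ennreal ((norm (F (m k) s + F (n k) s))^2))"
 proof (rule nn_integral_cong)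
 fix s
 have hkF: "h k (cof s) = (F (m k) s + F (n k) s) / 2"
 proof -
 have "cof s + \<i> * cof r = Complex s r" for r by (simp add: complex_eq_iff)
 then show ?thesis unfolding h_def F_def by (simp only:)
 qed
 then have "(norm (h k (cof s)))\<^sup>2 = 1 / 4 * (norm (F (m k) s + F (n k) s))^2" unfolding hkF by (simp add: norm_divide power_divide)
 then show "ennreal ((norm (h k (cof s)))^2) = ennreal (1 / 4) * ennreal ((norm (F (m k) s + F (n k) s))^2)"
 by (simp only: ennreal_mult zero_le_power2 zero_le_divide_1_iff zero_le_numeral)
 qed
 also have "\<dots> = ennreal (1 / 4) * S k" unfolding S_def by (rule nn_integral_cmult) measurable
 also have "\<dots> <= ennreal (1 / 4) * ennreal (4 * l - e)" by (intro mult_left_mono Sk) auto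
 also have "\<dots> = ennreal (l - e / 4)" using el by (subst ennreal_mult[symmetric]) (auto simp: algebra_simps)
 finally show ?thesis .
 qed
 have "I T = (NN x. liminf (%k. ennreal ((norm (h k (Complex x T)))^2)))" unfolding I_def
 proof (intro nn_integral_cong lim_imp_Liminf[symmetric] tendsto_ennrealI tendsto_power tendsto_norm)
 fix x
 have z: "(%k. 1 / real (Suc (j k))) \<leadsto> 0" if "\<And>k. j k >= k" for j :: "nat => nat"
 proof (rule tendsto_sandwich[OF _ _ tendsto_const])
 show "(%k. 1 / real (Suc k)) \<leadsto> 0" by real_asymp
 qed (use that in \<open>auto intro!: always_eventually divide_left_mono\<close>)
 have c: "(%k. f (Complex x T + \<i> * cof (1 / real (Suc (j k))))) \<leadsto> f (Complex x T)" if "\<And>k. j k >= k" for j :: "nat => nat"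
 proof (rule isCont_tendsto_compose[OF isCont_f])
 have "(%k. Complex x T + \<i> * cof (1 / real (Suc (j k)))) \<leadsto> Complex x T + \<i> * cof 0"
 by (intro tendsto_intros z that)
 then show "(%k. Complex x T + \<i> * cof (1 / real (Suc (j k)))) \<leadsto> Complex x T" by simp
 qed (use T in auto)
 have "(%k. h k (Complex x T)) \<leadsto> (f (Complex x T) + f (Complex x T)) / 2"
 unfolding h_def by (intro tendsto_intros c mn) auto
 then show "(%k. h k (Complex x T)) \<leadsto> f (Complex x T)" by simp
 qed auto
 also have "\<dots> <= liminf (%k. NN x. ennreal ((norm (h k (Complex x T)))^2))"
 proof (rule nn_integral_liminf)
 fix k
 have "(%x. f (Complex x T + \<i> * cof r)) \<in> borel_measurable borel" if "r > 0" for r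
 proof -
 have "Complex x T + \<i> * cof r = Complex x (T + r)" for x by (simp add: complex_eq_iff)
 then show ?thesis using line_measurable[of "T + r"] T that by simp
 qed
 from this[of "?a k"] this[of "?b k"]
 have "(%x. h k (Complex x T)) \<in> borel_measurable borel" unfolding h_def by (intro borel_measurable_divide borel_measurable_add) auto
 then show "(%x. ennreal ((norm (h k (Complex x T)))^2)) \<in> borel_measurable lborel" by measurable
 qed
 also have "\<dots> <= liminf (%k::nat. ennreal (l - e / 4))" using hk by (intro Liminf_mono always_eventually) simp
 finally show ?thesis by (simp add: Liminf_const)
 qed
 then have "L <= ennreal (l - e / 4)" unfolding L_def by (intro SUP_least) auto
 then show False using l el e by (auto simp: ennreal_le_iff)
qed

text \<open>The limit on the real line reproduces the function by the Poisson integral, and at its Lebesgue points the Poisson integral converges nontangentially.\<close>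
theorem boundary_function:
 obtains b where "b \<in> borel_measurable borel" "\<And>s. norm (b s) <= 1" "integrable lborel (%s. (norm (b s))\<^sup>2)"
 "AE t in lebesgue. \<forall>\<alpha>>0. (f \<longlongrightarrow> b t) (at (cof t) within stolz_angle \<alpha> t)"
 "\<And>z. Im z > 0 ==> (LBINT s. b s / (of_real s - z)) = 2 * pi * \<i> * f z"
 "\<And>z. Im z > 0 ==> integrable lborel (%s. b s / (of_real s - z))"
proof -
 obtain g r where gm: "g \<in> borel_measurable lborel" and r: "strict_mono (r :: nat => nat)" and gl: "AE x in lborel. (%k. F (r k) x) \<leadsto> g x"
 and gL2: "(%n. NN x. ennreal ((norm (F n x - g x))^2)) \<leadsto> 0"
 using riesz_fischer[of F lborel] F_cauchy F_measurable by auto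
 define b where "b s = (if norm (g s) <= 1 then g s else 0)" for s
 have [measurable]: "g \<in> borel_measurable borel" using gm by simp
 have bm[measurable]: "b \<in> borel_measurable borel" unfolding b_def[abs_def] by measurable
 have b1: "norm (b s) <= 1" for s by (simp add: b_def)
 have F1: "norm (F n s) <= 1" for n s unfolding F_def by (rule bounded) simp
 have bg: "AE s in lborel. b s = g s" using gl
 proof eventually_elim
 case (elim s)
 have "norm (g s) <= 1" by (rule Lim_bounded[OF tendsto_norm[OF elim], of 0]) (use F1 in auto)
 then show ?case by (simp add: b_def)
 qed
 have bl: "AE s in lborel. (%k. F (r k) s) \<leadsto> b s" using gl bg by eventually_elim simp
 have bL2: "(%n. NN x. ennreal ((norm (F n x - b x))^2)) \<leadsto> 0"
 proof -
 have "(NN x. ennreal ((norm (F n x - b x))^2)) = (NN x. ennreal ((norm (F n x - g x))^2))" for n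
 by (rule nn_integral_cong_AE) (use bg in eventually_elim, simp)
 then show ?thesis using gL2 by simp
 qed
 have FI: "(NN s. ennreal ((norm (F n s))^2)) <= ennreal C" for n unfolding F_def by (rule H2) simp
 have bI: "(NN s. ennreal ((norm (b s))^2)) <= ennreal C"
 proof -
 have "(NN s. ennreal ((norm (b s))^2)) = (NN s. liminf (%k. ennreal ((norm (F (r k) s))^2)))"
 proof (rule nn_integral_cong_AE)
 show "AE s in lborel. ennreal ((norm (b s))^2) = liminf (%k. ennreal ((norm (F (r k) s))^2))" using bl
 proof eventually_elim
 case (elim s)
 show ?case by (rule lim_imp_Liminf[symmetric]) (auto intro!: tendsto_ennrealI tendsto_intros elim)
 qed
 qed
 also have "\<dots> <= liminf (%k. NN s. ennreal ((norm (F (r k) s))^2))" by (rule nn_integral_liminf) measurable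
 also have "\<dots> <= liminf (%k::nat. ennreal C)" using FI by (intro Liminf_mono always_eventually) simp
 finally show ?thesis by (simp add: Liminf_const)
 qed
 have L2int: "integrable lborel (%s. (norm (u s))\<^sup>2)" if [measurable]: "u \<in> borel_measurable borel" and "(NN s. ennreal ((norm (u s))^2)) <= ennreal C" for u :: "real => complex"
 by (rule integrableI_nonneg) (use that(2) in \<open>auto intro: le_less_trans\<close>)
 have b2: "integrable lborel (%s. (norm (b s))\<^sup>2)" using L2int[OF bm bI] .
 have F2: "integrable lborel (%s. (norm (F n s))\<^sup>2)" for n using L2int[OF F_measurable FI] .
 define h where "h n w = f (w + \<i> * cof (1 / real (Suc n)))" for n w
 have hh: "h n holomorphic_on {z. Im z > - (1 / real (Suc n))}" "1 / real (Suc n) > 0" "\<And>w. Im w >= 0 ==> norm (h n w) <= 1" for n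
 unfolding h_def by (rule shift_holomorphic, simp, simp) (auto intro!: bounded add_nonneg_pos)
 have hF: "h n (cof s) = F n s" for n s
 proof -
 have "cof s + \<i> * cof q = Complex s q" for q by (simp add: complex_eq_iff)
 then show ?thesis unfolding h_def F_def by (simp only:)
 qed
 have hl: "(%n. h n z) \<leadsto> f z" if z: "Im z > 0" for z
 proof -
 have "(%n. 1 / real (Suc n)) \<leadsto> 0" by real_asymp
 then have "(%n. z + \<i> * cof (1 / real (Suc n))) \<leadsto> z + \<i> * cof 0" by (intro tendsto_intros)
 then show ?thesis unfolding h_def by (intro isCont_tendsto_compose[OF isCont_f[OF z]]) simp
 qed
 have poisson: "(LBINT s. b s * of_real (Im z / ((s - Re z)^2 + (Im z)^2))) = pi * f z" if z: "Im z > 0" for z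
 proof -
 let ?P = "%s. Im z / ((s - Re z)^2 + (Im z)^2)"
 have P0: "?P s >= 0" for s using z by simp
 have "(%k. LBINT s. F (r k) s * of_real (?P s)) \<leadsto> (LBINT s. b s * of_real (?P s))"
 proof (rule integral_dominated_convergence[where w = ?P])
 show "integrable lborel ?P" by (rule cauchy_density(1)[OF z])
 show "AE s in lborel. (%k. F (r k) s * of_real (?P s)) \<leadsto> b s * of_real (?P s)"
 using bl by eventually_elim (intro tendsto_intros)
 show "AE s in lborel. norm (F (r k) s * of_real (?P s)) <= ?P s" for k
 proof (rule AE_I2)
 fix s
 have "norm (F (r k) s) * ?P s <= 1 * ?P s" by (rule mult_right_mono[OF F1 P0])
 then show "norm (F (r k) s * of_real (?P s)) <= ?P s" by (simp only: norm_mult norm_of_real abs_of_nonneg[OF P0] mult_1_left)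
 qed
 qed measurable
 moreover have "(LBINT s. F (r k) s * of_real (?P s)) = pi * h (r k) z" for k
 using poisson_formula(1)[OF hh(1) hh(2) hh(3) z, of "r k"] by (simp only: hF)
 ultimately have "(%k. pi * h (r k) z) \<leadsto> (LBINT s. b s * of_real (?P s))" by simp
 moreover have "(%k. cof pi * h (r k) z) \<leadsto> pi * f z"
 using LIMSEQ_subseq_LIMSEQ[OF hl[OF z] r] by (intro tendsto_intros) (simp add: o_def)
 ultimately show ?thesis using LIMSEQ_unique by blast
 qed
 have k2: "integrable lborel (%s. (norm (1 / (cof s - z)))\<^sup>2)" if z: "Im z > 0" for z
 proof -
 have "(norm (1 / (cof s - z)))\<^sup>2 = (Im z / ((s - Re z)^2 + (Im z)^2)) / Im z" for s
 using z by (simp add: norm_divide power_divide cmod_power2)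
 then have "(%s. (norm (1 / (cof s - z)))\<^sup>2) = (%s. (Im z / ((s - Re z)^2 + (Im z)^2)) / Im z)" by (rule ext)
 then show ?thesis using Bochner_Integration.integrable_divide[OF cauchy_density(1)[OF z, of "Re z"], of "Im z"] by (simp only:)
 qed
 have bk: "integrable lborel (%s. u s * (1 / (cof s - z)))"
 if [measurable]: "u \<in> borel_measurable borel" and u: "integrable lborel (%s. (norm (u s))\<^sup>2)" and z: "Im z > 0" for u z
 proof (rule integrable_dominated[OF integrable_plus[OF u k2[OF z]]])
 show "AE s in lborel. norm (u s * (1 / (cof s - z))) <= norm ((norm (u s))^2 + (norm (1 / (cof s - z)))^2)"
 proof (rule AE_I2)
 fix s
 have "2 * (norm a * norm b) <= (norm a)\<^sup>2 + (norm b)^2" for a b :: complex using sum_squares_bound[of "norm a" "norm b"] by simp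
 moreover have "norm a * norm b >= 0" for a b :: complex by simp
 ultimately have "norm (a * b) <= norm ((norm a)^2 + (norm b)^2)" for a b :: complex
 unfolding norm_mult by (smt (verit) real_norm_def)
 then show "norm (u s * (1 / (cof s - z))) <= norm ((norm (u s))^2 + (norm (1 / (cof s - z)))^2)" .
 qed
 qed measurable
 have cauchy: "(LBINT s. b s / (of_real s - z)) = 2 * pi * \<i> * f z" if z: "Im z > 0" for z
 proof -
 have "(%n. LBINT s. F n s * (1 / (of_real s - z))) \<leadsto> (LBINT s. b s * (1 / (of_real s - z)))"
 proof (rule L2_weak_limit[OF _ _ _ bL2])
 show "(NN s. ennreal ((norm (1 / (cof s - z)))^2)) < \<infinity>"
 using nn_integral_eq_integral[OF k2[OF z]] by simp
 qed (use bk[OF bm b2 z] bk[OF F_measurable F2 z] in auto)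
 moreover have "(LBINT s. F n s * (1 / (of_real s - z))) = 2 * pi * \<i> * h n z" for n
 proof -
 have "integrable lborel (%s. (norm (h n (cof s)))\<^sup>2)" unfolding hF by (rule F2)
 from cauchy_formula[OF hh(1) hh(2) hh(3) this z] show ?thesis unfolding hF by simp
 qed
 ultimately have "(%n. 2 * pi * \<i> * h n z) \<leadsto> (LBINT s. b s * (1 / (of_real s - z)))" by simp
 moreover have "(%n. 2 * pi * \<i> * h n z) \<leadsto> 2 * pi * \<i> * f z" by (intro tendsto_intros hl z)
 ultimately have "(LBINT s. b s * (1 / (of_real s - z))) = 2 * pi * \<i> * f z" using LIMSEQ_unique by blast
 then show ?thesis by simp
 qed
 have nt: "AE t in lebesgue. \<forall>\<alpha>>0. (f \<longlongrightarrow> b t) (at (cof t) within stolz_angle \<alpha> t)"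
 using lebesgue_point_AE[OF bm b1]
 proof eventually_elim
 case (elim t)
 show ?case
 proof (intro allI impI)
 fix \<alpha> :: real assume \<alpha>: "\<alpha> > 0"
 define K where "K = 2 + 2 * \<alpha>\<^sup>2"
 have K: "K > 0" by (simp add: K_def add_pos_nonneg)
 define w where "w s = norm (b s - b t)" for s
 have wm[measurable]: "w \<in> borel_measurable borel" unfolding w_def[abs_def] by measurable
 have w: "0 <= w s" "w s <= 2" for s using norm_triangle_ineq4[of "b s" "b t"] b1[of s] b1[of t] by (auto simp: w_def)
 show "(f \<longlongrightarrow> b t) (at (cof t) within stolz_angle \<alpha> t)"
 unfolding tendsto_at_iff_sequentially
 proof (intro allI impI)
 fix X assume X: "\<forall>i. X i \<in> stolz_angle \<alpha> t - {cof t}" and Xl: "X \<leadsto> cof t"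
 define Y where "Y n = Im (X n)" for n
 have Y: "Y n > 0" "\<bar>Re (X n) - t\<bar> < \<alpha> * Y n" for n using X by (auto simp: stolz_angle_def Y_def)
 have Yl: "Y \<leadsto> 0" unfolding Y_def[abs_def] using tendsto_Im[OF Xl] by simp
 define A where "A n = (NN s. ennreal (w s * (Y n / ((s - t)^2 + (Y n)^2))))" for n
 have Al: "A \<leadsto> 0" unfolding A_def[abs_def]
 by (rule poisson_average_tendsto[OF wm w _ Y(1) Yl]) (use elim in \<open>simp add: w_def\<close>)
 have main: "ennreal (norm (f (X n) - b t)) <= ennreal (K / pi) * A n" for n
 proof -
 let ?P = "%s. Y n / ((s - Re (X n))^2 + (Y n)^2)" and ?Q = "%s. Y n / ((s - t)^2 + (Y n)^2)"
 have P0: "?P s >= 0" for s using Y(1)[of n] by simp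
 have Pi: "integrable lborel ?P" "(LBINT s. ?P s) = pi" using cauchy_density[OF Y(1), of n "Re (X n)"] by auto
 have ci: "integrable lborel (%s. c * cof (?P s))" for c
 proof -
 have "integrable lborel (%s. cof (?P s))" using Pi(1) by (rule integrable_of_real)
 then show ?thesis by (rule integrable_mult_right)
 qed
 have bi: "integrable lborel (%s. b s * cof (?P s))"
 proof (rule integrable_dominated[OF Pi(1)])
 show "AE s in lborel. norm (b s * cof (?P s)) <= norm (?P s)"
 unfolding norm_mult norm_of_real real_norm_def using b1 by (intro AE_I2 mult_left_le_one_le) auto
 qed measurable
 have "pi * (f (X n) - b t) = (LBINT s. b s * of_real (?P s)) - (LBINT s. b t * cof (?P s))"
 using poisson[of "X n"] Y(1)[of n] Pi(2) unfolding Y_def[symmetric] by (simp only: integral_mult_right_zero integral_complex_of_real) (simp add: right_diff_distrib mult.commute)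
 also have "\<dots> = (LBINT s. b s * of_real (?P s) - b t * cof (?P s))"
 by (rule LINT_diff[symmetric, OF bi ci])
 finally have eq: "pi * (f (X n) - b t) = (LBINT s. b s * of_real (?P s) - b t * cof (?P s))" .
 have "ennreal (norm (cof pi * (f (X n) - b t))) <= (NN s. ennreal (norm (b s * of_real (?P s) - b t * cof (?P s))))"
 unfolding eq by (rule integral_norm_bound_ennreal[OF Bochner_Integration.integrable_diff[OF bi ci]])
 also have "\<dots> <= (NN s. ennreal K * ennreal (w s * ?Q s))"
 proof (rule nn_integral_mono)
 fix s
 have d1: "(s - Re (X n))\<^sup>2 + (Y n)^2 > 0" and d2: "(s - t)\<^sup>2 + (Y n)^2 > 0" using Y(1)[of n] by (auto intro: add_nonneg_pos)
 have "(Re (X n) - t)\<^sup>2 <= (\<alpha> * Y n)\<^sup>2" using Y(2)[of n] by (simp add: abs_le_square_iff[symmetric])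
 moreover have "(s - t)\<^sup>2 <= 2 * (s - Re (X n))^2 + 2 * (Re (X n) - t)^2"
 proof -
 have "(p + q)\<^sup>2 <= 2 * p\<^sup>2 + 2 * q\<^sup>2" for p q :: real using zero_le_power2[of "p - q"] by (simp add: power2_eq_square algebra_simps)
 from this[of "s - Re (X n)" "Re (X n) - t"] show ?thesis by simp
 qed
 moreover have "K * ((s - Re (X n))^2 + (Y n)^2) = 2 * (s - Re (X n))^2 + 2 * \<alpha>\<^sup>2 * (s - Re (X n))^2 + 2 * (Y n)^2 + 2 * (\<alpha> * Y n)^2"
 by (simp add: K_def power_mult_distrib algebra_simps)
 moreover have "0 <= 2 * \<alpha>\<^sup>2 * (s - Re (X n))^2" "0 <= (Y n)\<^sup>2" by auto
 ultimately have "(s - t)\<^sup>2 + (Y n)^2 <= K * ((s - Re (X n))^2 + (Y n)^2)" by linarith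
 then have "1 / (K * ((s - Re (X n))^2 + (Y n)^2)) <= 1 / ((s - t)^2 + (Y n)^2)" using d1 d2 K by (intro divide_left_mono) auto
 then have "K * Y n * (1 / (K * ((s - Re (X n))^2 + (Y n)^2))) <= K * Y n * (1 / ((s - t)^2 + (Y n)^2))"
 using K Y(1)[of n] by (intro mult_left_mono) auto
 then have PQ: "?P s <= K * ?Q s" using K by simp
 have "norm (b s * of_real (?P s) - b t * cof (?P s)) = w s * ?P s"
 unfolding left_diff_distrib[symmetric] norm_mult norm_of_real abs_of_nonneg[OF P0] w_def ..
 also have "\<dots> <= w s * (K * ?Q s)" by (rule mult_left_mono[OF PQ w(1)])
 also have "\<dots> = K * (w s * ?Q s)" by simp
 finally have "ennreal (norm (b s * of_real (?P s) - b t * cof (?P s))) <= ennreal (K * (w s * ?Q s))" by (rule ennreal_leI)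
 also have "\<dots> = ennreal K * ennreal (w s * ?Q s)" by (rule ennreal_mult) (use K w Y(1)[of n] in auto)
 finally show "ennreal (norm (b s * of_real (?P s) - b t * cof (?P s))) <= ennreal K * ennreal (w s * ?Q s)" .
 qed
 also have "\<dots> = ennreal K * A n" unfolding A_def by (rule nn_integral_cmult) measurable
 finally have "ennreal (pi * norm (f (X n) - b t)) <= ennreal K * A n" by (simp add: norm_mult)
 then have "ennreal (1 / pi) * ennreal (pi * norm (f (X n) - b t)) <= ennreal (1 / pi) * (ennreal K * A n)" by (intro mult_left_mono) auto
 moreover have "ennreal (1 / pi) * ennreal (pi * norm (f (X n) - b t)) = ennreal (norm (f (X n) - b t))" by (subst ennreal_mult[symmetric]) auto
 moreover have "ennreal (1 / pi) * (ennreal K * A n) = ennreal (K / pi) * A n" using K by (subst mult.assoc[symmetric], subst ennreal_mult[symmetric]) auto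
 ultimately show ?thesis by simp
 qed
 have "(%n. ennreal (K / pi) * A n) \<leadsto> ennreal (K / pi) * 0" by (rule tendsto_mult_ennreal[OF tendsto_const Al]) auto
 then have l0: "(%n. ennreal (K / pi) * A n) \<leadsto> 0" by simp
 have "(%n. ennreal (norm (f (X n) - b t))) \<leadsto> 0"
 by (rule tendsto_sandwich[OF _ _ tendsto_const l0]) (use main in auto)
 then have "(%n. ennreal (norm (f (X n) - b t))) \<leadsto> ennreal 0" by simp
 then have "(%n. norm (f (X n) - b t)) \<leadsto> 0" by (subst (asm) tendsto_ennreal_iff) auto
 then show "(f \<circ> X) \<leadsto> b t" unfolding o_def by (rule LIM_zero_cancel[OF tendsto_norm_zero_cancel])
 qed
 qed
 qed
 have bk': "integrable lborel (%s. b s / (of_real s - z))" if "Im z > 0" for z using bk[OF bm b2 that] by simp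
 show ?thesis by (rule that[OF bm b1 b2 nt cauchy bk'])
qed

end


section \<open>The Fourier transform of square integrable functions\<close>

lemma nn_L2_triangle:
 fixes F G H :: "'a => complex"
 assumes [measurable]: "F \<in> borel_measurable M" "G \<in> borel_measurable M" "H \<in> borel_measurable M"
 shows "(\<integral>\<^sup>+x. ennreal ((norm (F x - H x))^2) \<partial>M) <= 2 * (\<integral>\<^sup>+x. ennreal ((norm (F x - G x))^2) \<partial>M) + 2 * (\<integral>\<^sup>+x. ennreal ((norm (G x - H x))^2) \<partial>M)"
proof -
 have "ennreal ((norm (a - c))^2) <= 2 * ennreal ((norm (a - b))^2) + 2 * ennreal ((norm (b - c))^2)" for a b c :: complex
 proof -
 have "norm (a - c) <= norm (a - b) + norm (b - c)" using norm_triangle_ineq[of "a - b" "b - c"] by simp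
 then have "(norm (a - c))\<^sup>2 <= (norm (a - b) + norm (b - c))\<^sup>2" by (rule power_mono) simp
 also have "\<dots> <= 2 * (norm (a - b))^2 + 2 * (norm (b - c))^2"
 using sum_squares_bound[of "norm (a - b)" "norm (b - c)"] by (simp add: power2_sum)
 finally have "ennreal ((norm (a - c))^2) <= ennreal (2 * (norm (a - b))^2 + 2 * (norm (b - c))^2)" by (rule ennreal_leI)
 also have "\<dots> = ennreal 2 * ennreal ((norm (a - b))^2) + ennreal 2 * ennreal ((norm (b - c))^2)"
 by (subst ennreal_plus) (simp_all only: ennreal_mult zero_le_power2 zero_le_numeral mult_nonneg_nonneg)
 finally show ?thesis by simp
 qed
 then have "(\<integral>\<^sup>+x. ennreal ((norm (F x - H x))^2) \<partial>M) <= (\<integral>\<^sup>+x. 2 * ennreal ((norm (F x - G x))^2) + 2 * ennreal ((norm (G x - H x))^2) \<partial>M)"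
 by (intro nn_integral_mono)
 also have "\<dots> = 2 * (\<integral>\<^sup>+x. ennreal ((norm (F x - G x))^2) \<partial>M) + 2 * (\<integral>\<^sup>+x. ennreal ((norm (G x - H x))^2) \<partial>M)"
 by (simp add: nn_integral_add nn_integral_cmult)
 finally show ?thesis .
qed

lemma lebesgue_borel_representative:
 fixes f :: "real => complex"
 assumes "f \<in> borel_measurable lebesgue"
 obtains g where "g \<in> borel_measurable borel" "AE x in lborel. f x = g x"
proof -
 have "(%x. Re (f x)) \<in> borel_measurable (completion lborel)" "(%x. Im (f x)) \<in> borel_measurable (completion lborel)"
 using assms by measurable
 from this[THEN completion_ex_borel_measurable_real] obtain r i where
 [measurable]: "r \<in> borel_measurable lborel" "i \<in> borel_measurable lborel" and
 ae: "AE x in lborel. Re (f x) = r x" "AE x in lborel. Im (f x) = i x" by blast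
 show thesis
 proof (rule that)
 show "(%x. cof (r x) + \<i> * cof (i x)) \<in> borel_measurable borel"
 using \<open>r \<in> _\<close> \<open>i \<in> _\<close> unfolding measurable_lborel1 by measurable
 show "AE x in lborel. f x = cof (r x) + \<i> * cof (i x)"
 using ae by eventually_elim (simp add: complex_eq_iff)
 qed
qed

lemma norm_fourier_kernel [simp]: "norm (exp (- \<i> * cof x * cof xi)) = 1"
 by (simp add: norm_exp_eq_Re)

lemma fourier_L1_borel:
 assumes [measurable]: "F \<in> borel_measurable borel"
 shows "fourier_L1 F xi = cof (1 / sqrt (2 * pi)) * (LBINT x. F x * exp (- \<i> * cof x * cof xi))"
 unfolding fourier_L1_def by (subst integral_completion) auto

lemma fourier_L1_cong_AE:
 assumes "AE x in lborel. F x = G x" "F \<in> borel_measurable lebesgue" "G \<in> borel_measurable borel"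
 shows "fourier_L1 F xi = fourier_L1 G xi"
proof -
 let ?k = "%x. exp (- \<i> * cof x * cof xi)"
 have k: "?k \<in> borel_measurable lebesgue" by (rule measurable_completion) measurable
 have g: "G \<in> borel_measurable lebesgue" using assms(3) by (intro measurable_completion) simp
 have "(LINT x|lebesgue. F x * ?k x) = (LINT x|lebesgue. G x * ?k x)"
 proof (rule integral_cong_AE)
 show "(%x. F x * ?k x) \<in> borel_measurable lebesgue" by (rule borel_measurable_times[OF assms(2) k])
 show "(%x. G x * ?k x) \<in> borel_measurable lebesgue" by (rule borel_measurable_times[OF g k])
 show "AE x in lebesgue. F x * ?k x = G x * ?k x" using AE_completion[OF assms(1)] by (rule eventually_mono) (simp only:)
 qed
 then show ?thesis unfolding fourier_L1_def by (simp only:)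
qed

lemma fourier_L1_measurable [measurable]:
 assumes [measurable]: "F \<in> borel_measurable borel"
 shows "fourier_L1 F \<in> borel_measurable borel"
 unfolding fourier_L1_borel[OF assms, abs_def] by measurable

lemma integrable_times_fourier_kernel:
 assumes F: "integrable lborel F"
 shows "integrable lborel (%x. F x * exp (- \<i> * cof x * cof xi))"
proof (rule integrable_dominated[OF F])
 have [measurable]: "F \<in> borel_measurable borel" using F by auto
 show "(%x. F x * exp (- \<i> * cof x * cof xi)) \<in> borel_measurable lborel" by measurable
qed (simp add: norm_mult)

lemma fourier_L1_bound:
 assumes F: "integrable lborel F"
 shows "norm (fourier_L1 F xi) <= (LBINT x. norm (F x))"
proof -
 have [measurable]: "F \<in> borel_measurable borel" using F by auto
 have "norm (LBINT x. F x * exp (- \<i> * cof x * cof xi)) <= (LBINT x. norm (F x * exp (- \<i> * cof x * cof xi)))"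
 by (rule integral_norm_bound)
 also have "\<dots> = (LBINT x. norm (F x))" by (simp only: norm_mult norm_fourier_kernel mult_1_right)
 finally have b: "norm (LBINT x. F x * exp (- \<i> * cof x * cof xi)) <= (LBINT x. norm (F x))" .
 have "1 / sqrt (2 * pi) <= 1" using pi_gt3 by (simp add: real_le_rsqrt)
 then have "norm (cof (1 / sqrt (2 * pi))) <= 1" by (simp only: norm_of_real) simp
 then have "norm (fourier_L1 F xi) <= 1 * (LBINT x. norm (F x))"
 unfolding fourier_L1_borel[OF \<open>F \<in> borel_measurable borel\<close>] norm_mult using b by (intro mult_mono) auto
 then show ?thesis by simp
qed

lemma integrable_fourier_times:
 assumes F: "integrable lborel F" and G: "integrable lborel G"
 shows "integrable lborel (%xi. fourier_L1 F xi * G xi)"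
proof (rule integrable_dominated[OF integrable_mult_right[OF G, of "cof (LBINT x. norm (F x))"]])
 have [measurable]: "F \<in> borel_measurable borel" "G \<in> borel_measurable borel" using F G by auto
 show "(%xi. fourier_L1 F xi * G xi) \<in> borel_measurable lborel" by measurable
 show "AE xi in lborel. norm (fourier_L1 F xi * G xi) <= norm (cof (LBINT x. norm (F x)) * G xi)"
 unfolding norm_mult norm_of_real using fourier_L1_bound[OF F]
 by (intro AE_I2 mult_right_mono order.trans[OF fourier_L1_bound[OF F]]) auto
qed

text \<open>By Fubini's theorem; all facts about the Fourier transform below come from this formula.\<close>
lemma fourier_multiplication_formula:
 assumes F: "integrable lborel F" and G: "integrable lborel G"
 shows "(LBINT xi. fourier_L1 F xi * G xi) = (LBINT x. F x * fourier_L1 G x)"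
proof -
 have [measurable]: "F \<in> borel_measurable borel" "G \<in> borel_measurable borel" using F G by auto
 let ?c = "cof (1 / sqrt (2 * pi))"
 let ?K = "%x xi. F x * G xi * exp (- \<i> * cof x * cof xi)"
 have "integrable (lborel \<Otimes>\<^sub>M lborel) (case_prod ?K)"
 proof (rule lborel_pair.Fubini_integrable)
 show "case_prod ?K \<in> borel_measurable (lborel \<Otimes>\<^sub>M lborel)" by measurable
 have "(LBINT xi. norm (case_prod ?K (x, xi))) = norm (F x) * (LBINT xi. norm (G xi))" for x
 by (simp only: case_prod_conv norm_mult norm_fourier_kernel mult_1_right integral_mult_right_zero)
 then show "integrable lborel (%x. LBINT xi. norm (case_prod ?K (x, xi)))"
 using integrable_mult_left[OF integrable_norm[OF F]] by (simp only:)
 show "AE x in lborel. integrable lborel (%xi. case_prod ?K (x, xi))"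
 proof (rule AE_I2)
 fix x
 have "integrable lborel (%xi. F x * (G xi * exp (- \<i> * cof xi * cof x)))"
 by (rule integrable_mult_right[OF integrable_times_fourier_kernel[OF G]])
 then show "integrable lborel (%xi. case_prod ?K (x, xi))" by (simp add: mult_ac)
 qed
 qed
 note fub = lborel_pair.Fubini_integral[OF this]
 have "(LBINT xi. fourier_L1 F xi * G xi) = (LBINT xi. ?c * (LBINT x. ?K x xi))"
 proof (rule LINT_cong[OF refl])
 fix xi
 have "(LBINT x. ?K x xi) = (LBINT x. G xi * (F x * exp (- \<i> * cof x * cof xi)))"
 by (intro LINT_cong) (simp_all add: mult_ac)
 then have k: "(LBINT x. ?K x xi) = G xi * (LBINT x. F x * exp (- \<i> * cof x * cof xi))"
 by (simp only: integral_mult_right_zero)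
 show "fourier_L1 F xi * G xi = ?c * (LBINT x. ?K x xi)"
 unfolding fourier_L1_borel[OF \<open>F \<in> _\<close>] k by (simp only: mult_ac)
 qed
 also have "\<dots> = ?c * (LBINT xi. LBINT x. ?K x xi)" by (rule integral_mult_right_zero)
 also have "\<dots> = ?c * (LBINT x. LBINT xi. ?K x xi)" by (simp only: fub)
 also have "\<dots> = (LBINT x. ?c * (LBINT xi. ?K x xi))" by (rule integral_mult_right_zero[symmetric])
 also have "\<dots> = (LBINT x. F x * fourier_L1 G x)"
 proof (rule LINT_cong[OF refl])
 fix x
 have "(LBINT xi. ?K x xi) = (LBINT xi. F x * (G xi * exp (- \<i> * cof xi * cof x)))"
 by (intro LINT_cong) (simp_all add: mult_ac)
 then have k: "(LBINT xi. ?K x xi) = F x * (LBINT xi. G xi * exp (- \<i> * cof xi * cof x))"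
 by (simp only: integral_mult_right_zero)
 show "?c * (LBINT xi. ?K x xi) = F x * fourier_L1 G x"
 unfolding fourier_L1_borel[OF \<open>G \<in> _\<close>] k by (simp only: mult_ac)
 qed
 finally show ?thesis .
qed

lemma nn_integral_exp_half_line:
 fixes a :: real assumes a: "a > 0"
 shows "(NN xi. ennreal (indicator {0..} xi * exp (- a * xi))) = ennreal (1 / a)"
proof -
 have "(NN xi. ennreal (exp (- a * xi)) * indicator {0..} xi) = ennreal (0 - (- (exp (- a * 0) / a)))"
 proof (rule nn_integral_FTC_atLeast[where F = "%xi. - (exp (- a * xi) / a)"])
 show "((%xi. - (exp (- a * xi) / a)) has_real_derivative exp (- a * x)) (at x)" for x
 using a by (auto intro!: derivative_eq_intros)
 show "((%xi. - (exp (- a * xi) / a)) \<longlongrightarrow> 0) at_top" using a by real_asymp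
 qed auto
 moreover have "(NN xi. ennreal (indicator {0..} xi * exp (- a * xi))) = (NN xi. ennreal (exp (- a * xi)) * indicator {0..} xi)"
 by (intro nn_integral_cong) (auto simp: indicator_def)
 ultimately show ?thesis by simp
qed

lemma integrable_exp_half_line:
 fixes c :: complex assumes c: "Re c > 0"
 shows "integrable lborel (%xi. indicator {0..} xi *\<^sub>R exp (- c * cof xi))"
proof (rule integrableI_bounded)
 have "ennreal (norm (indicator {0..} xi *\<^sub>R exp (- c * cof xi))) = ennreal (indicator {0..} xi * exp (- Re c * xi))" for xi :: real
 by (simp add: norm_exp_eq_Re)
 then show "(NN xi. ennreal (norm (indicator {0..} xi *\<^sub>R exp (- c * cof xi)))) < \<infinity>"
 using nn_integral_exp_half_line[OF c] by (simp only: ) simp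
qed measurable

lemma LINT_exp_half_line:
 fixes c :: complex assumes c: "Re c > 0"
 shows "(LBINT xi. indicator {0..} xi *\<^sub>R exp (- c * cof xi)) = 1 / c"
proof -
 have i0: "integrable lborel (%xi. indicator {0<..} xi *\<^sub>R exp (- c * cof xi))"
 by (rule integrable_dominated[OF integrable_exp_half_line[OF c]]) (auto simp: indicator_def)
 have "(LBINT xi=ereal 0..\<infinity>. exp (- c * cof xi)) = 0 - (- (1 / c))"
 proof (rule interval_integral_FTC_integrable[where F = "%xi. - (exp (- c * cof xi) / c)"])
 show "((%xi. - (exp (- c * cof xi) / c)) has_vector_derivative exp (- c * cof x)) (at x)" for x
 proof -
 have "((%w. - (exp (- c * w) / c)) has_field_derivative exp (- c * cof x)) (at (cof x))"
 using c by (auto intro!: derivative_eq_intros)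
 then show ?thesis by (rule has_vector_derivative_real_field)
 qed
 show "isCont (%xi. exp (- c * cof xi)) x" for x by (intro continuous_intros)
 show "set_integrable lborel (einterval (ereal 0) \<infinity>) (%xi. exp (- c * cof xi))"
 using i0 by (simp add: set_integrable_def)
 have "isCont (%xi. - (exp (- c * cof xi) / c)) 0" using c by (intro continuous_intros) auto
 then have "((%xi. - (exp (- c * cof xi) / c)) \<longlongrightarrow> - (1 / c)) (at_right 0)"
 unfolding isCont_def by (auto intro: tendsto_within_subset)
 then show "(((%xi. - (exp (- c * cof xi) / c)) \<circ> real_of_ereal) \<longlongrightarrow> - (1 / c)) (at_right (ereal 0))"
 by (simp only: ereal_tendsto_simps)
 have "((%xi. - (exp (- c * cof xi) / c)) \<longlongrightarrow> 0) at_top"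
 proof (rule tendsto_norm_zero_cancel)
 have "((%xi. exp (- Re c * xi) / norm c) \<longlongrightarrow> 0) at_top"
 proof -
 have "((%xi. exp (- a * xi) / b) \<longlongrightarrow> 0) at_top" if "a > 0" "b > 0" for a b :: real using that by real_asymp
 moreover have "norm c > 0" using c by auto
 ultimately show ?thesis using c by blast
 qed
 then show "((%xi. norm (- (exp (- c * cof xi) / c))) \<longlongrightarrow> 0) at_top" by (simp add: norm_divide norm_exp_eq_Re)
 qed
 then show "(((%xi. - (exp (- c * cof xi) / c)) \<circ> real_of_ereal) \<longlongrightarrow> 0) (at_left \<infinity>)"
 by (simp only: ereal_tendsto_simps)
 qed auto
 then have "(LBINT xi. indicator {0<..} xi *\<^sub>R exp (- c * cof xi)) = 1 / c"
 unfolding interval_integral_to_infinity_eq set_lebesgue_integral_def by simp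
 moreover have "(LBINT xi. indicator {0<..} xi *\<^sub>R exp (- c * cof xi)) = (LBINT xi. indicator {0..} xi *\<^sub>R exp (- c * cof xi))"
 by (rule integral_cong_AE) (use AE_lborel_singleton[of "0::real"] in \<open>auto elim!: eventually_mono simp: indicator_def\<close>)
 ultimately show ?thesis by simp
qed

lemma two_sided_exponential:
 fixes e u :: real assumes e: "e > 0"
 shows "integrable lborel (%xi. cof (exp (- e * \<bar>xi\<bar>)))"
 "(LBINT xi. cof (exp (- e * \<bar>xi\<bar>)) * exp (\<i> * cof u * cof xi)) = cof (2 * (e / (u\<^sup>2 + e\<^sup>2)))"
proof -
 define h where "h r xi = (indicator {0..} xi *\<^sub>R exp (- (cof e - \<i> * cof r) * cof xi) :: complex)" for r xi :: real
 have hi: "integrable lborel (h r)" and hv: "(LBINT xi. h r xi) = 1 / (cof e - \<i> * cof r)" for r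
 unfolding h_def using integrable_exp_half_line[of "cof e - \<i> * cof r"] LINT_exp_half_line[of "cof e - \<i> * cof r"] e by simp_all
 have hi': "integrable lborel (%xi. h r (- xi))" for r
 using lborel_integrable_real_affine[OF hi[of r], of "-1" 0] by simp
 have hv': "(LBINT xi. h r (- xi)) = 1 / (cof e - \<i> * cof r)" for r
 using lborel_integral_real_affine[of "-1" "h r" 0] hv by simp
 have "cof (exp (- e * \<bar>xi\<bar>)) * exp (\<i> * cof u * cof xi) = h u xi + h (- u) (- xi)" if "xi \<noteq> 0" for u xi
 proof (cases "xi > 0")
 case True
 then show ?thesis by (simp add: h_def indicator_def exp_of_real[symmetric] exp_add[symmetric] algebra_simps)
 next
 case False
 with that have "xi < 0" by simp
 then show ?thesis by (simp add: h_def indicator_def exp_of_real[symmetric] exp_add[symmetric] algebra_simps)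
 qed
 then have ae: "AE xi in lborel. cof (exp (- e * \<bar>xi\<bar>)) * exp (\<i> * cof u * cof xi) = h u xi + h (- u) (- xi)" for u
 using AE_lborel_singleton[of 0] by (auto elim!: eventually_mono)
 have m: "(%xi. cof (exp (- e * \<bar>xi\<bar>)) * exp (\<i> * cof u * cof xi)) \<in> borel_measurable lborel"
 "(%xi. h u xi + h (- u) (- xi)) \<in> borel_measurable lborel" for u
 unfolding h_def by measurable
 have "integrable lborel (%xi. h 0 xi + h (- 0) (- xi))" by (intro integrable_plus hi hi')
 then show "integrable lborel (%xi. cof (exp (- e * \<bar>xi\<bar>)))"
 using integrable_cong_AE[OF m(1) m(2) ae, of 0] by simp
 have "(LBINT xi. cof (exp (- e * \<bar>xi\<bar>)) * exp (\<i> * cof u * cof xi)) = (LBINT xi. h u xi + h (- u) (- xi))"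
 by (rule integral_cong_AE[OF m ae])
 also have "\<dots> = 1 / (cof e - \<i> * cof u) + 1 / (cof e - \<i> * cof (- u))"
 by (simp only: LINT_add[OF hi hi'] hv hv')
 also have "\<dots> = cof (2 * (e / (u\<^sup>2 + e\<^sup>2)))"
 proof -
 have nz: "cof e - \<i> * cof u \<noteq> 0" "cof e + \<i> * cof u \<noteq> 0" using e by (auto simp: complex_eq_iff)
 have p: "(cof e - \<i> * cof u) * (cof e + \<i> * cof u) = cof (u\<^sup>2 + e\<^sup>2)"
 by (simp add: complex_eq_iff power2_eq_square)
 have "1 / (cof e - \<i> * cof u) + 1 / (cof e + \<i> * cof u) = 2 * cof e / ((cof e - \<i> * cof u) * (cof e + \<i> * cof u))"
 using nz by (simp add: add_divide_eq_iff divide_add_eq_iff)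
 then show ?thesis unfolding p by simp
 qed
 finally show "(LBINT xi. cof (exp (- e * \<bar>xi\<bar>)) * exp (\<i> * cof u * cof xi)) = cof (2 * (e / (u\<^sup>2 + e\<^sup>2)))" .
qed

text \<open>The multiplication formula, used twice, turns the damped square integral into a double integral against the Poisson kernel, which the inequality of the means bounds by the square integral of \<open>F\<close>.\<close>
lemma plancherel_inequality_damped:
 assumes F: "integrable lborel F" and e: "e > 0"
 shows "(NN xi. ennreal (exp (- e * \<bar>xi\<bar>) * (norm (fourier_L1 F xi))^2)) <= (NN x. ennreal ((norm (F x))^2))"
proof -
 have Fm[measurable]: "F \<in> borel_measurable borel" using F by auto
 let ?c = "cof (1 / sqrt (2 * pi))"
 have cc: "?c * ?c = cof (1 / (2 * pi))" by (simp flip: of_real_mult)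
 define w where "w xi = cof (exp (- e * \<bar>xi\<bar>))" for xi
 have wi: "integrable lborel w" unfolding w_def by (rule two_sided_exponential(1)[OF e])
 have [measurable]: "w \<in> borel_measurable borel" using wi by auto
 define G where "G xi = cnj (fourier_L1 F xi * w xi)" for xi
 have Gi: "integrable lborel G" unfolding G_def complex_integrable_cnj by (rule integrable_fourier_times[OF F wi])
 have [measurable]: "G \<in> borel_measurable borel" using Gi by auto
 have Ghat: "fourier_L1 G x = cnj (LBINT y. F y * cof (1 / pi * (e / ((y - x)^2 + e\<^sup>2))))" for x
 proof -
 define H where "H xi = ?c * (w xi * exp (\<i> * cof x * cof xi))" for xi
 have [measurable]: "H \<in> borel_measurable borel" unfolding H_def by measurable
 have Hi: "integrable lborel H"
 by (rule integrable_dominated[OF integrable_mult_right[OF wi, of ?c]]) (auto simp: H_def norm_mult norm_divide norm_exp_eq_Re)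
 have "fourier_L1 G x = ?c * (LBINT xi. cnj (fourier_L1 F xi * (w xi * exp (\<i> * cof x * cof xi))))"
 unfolding fourier_L1_borel[OF \<open>G \<in> _\<close>] G_def by (simp add: exp_cnj mult_ac)
 also have "\<dots> = cnj (?c * (LBINT xi. fourier_L1 F xi * (w xi * exp (\<i> * cof x * cof xi))))"
 by (simp only: Bochner_Integration.integral_cnj complex_cnj_mult[of ?c] complex_cnj_complex_of_real)
 also have "?c * (LBINT xi. fourier_L1 F xi * (w xi * exp (\<i> * cof x * cof xi))) = (LBINT xi. fourier_L1 F xi * H xi)"
 unfolding integral_mult_right_zero[symmetric] H_def by (intro LINT_cong) (simp_all only: mult_ac)
 also have "\<dots> = (LBINT y. F y * fourier_L1 H y)" by (rule fourier_multiplication_formula[OF F Hi])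
 also have "\<dots> = (LBINT y. F y * cof (1 / pi * (e / ((y - x)^2 + e\<^sup>2))))"
 proof (rule LINT_cong[OF refl])
 fix y
 have "fourier_L1 H y = ?c * (LBINT xi. ?c * (w xi * exp (\<i> * cof (x - y) * cof xi)))"
 unfolding fourier_L1_borel[OF \<open>H \<in> _\<close>] H_def by (simp add: exp_add[symmetric] mult.assoc algebra_simps)
 also have "\<dots> = (?c * ?c) * (LBINT xi. w xi * exp (\<i> * cof (x - y) * cof xi))"
 by (simp only: integral_mult_right_zero mult.assoc)
 also have "\<dots> = cof (1 / (2 * pi)) * cof (2 * (e / ((x - y)^2 + e\<^sup>2)))"
 unfolding cc w_def two_sided_exponential(2)[OF e] ..
 also have "\<dots> = cof (1 / pi * (e / ((y - x)^2 + e\<^sup>2)))"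
 unfolding of_real_mult[symmetric] power2_commute[of x y] by (rule arg_cong[where f = cof]) simp
 finally show "F y * fourier_L1 H y = F y * cof (1 / pi * (e / ((y - x)^2 + e\<^sup>2)))" by (simp only:)
 qed
 finally show ?thesis .
 qed
 define p where "p x y = 1 / pi * (e / ((y - x)^2 + e\<^sup>2))" for x y
 have p0: "p x y >= 0" for x y unfolding p_def using e by simp
 have [measurable]: "case_prod p \<in> borel_measurable (borel \<Otimes>\<^sub>M borel)" unfolding p_def by measurable
 have psym: "p x y = p y x" for x y by (simp add: p_def power2_commute)
 have pint: "(NN y. ennreal (p x y)) = 1" for x
 proof -
 have "(NN y. ennreal (p x y)) = (NN y. ennreal (1 / pi) * ennreal (e / ((y - x)^2 + e\<^sup>2)))"
 unfolding p_def using e by (intro nn_integral_cong ennreal_mult) auto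
 also have "\<dots> = ennreal (1 / pi) * ennreal pi" by (subst nn_integral_cmult) (auto simp: nn_integral_cauchy_density[OF e])
 also have "\<dots> = 1" by (subst ennreal_mult[symmetric]) auto
 finally show ?thesis .
 qed
 let ?S = "(NN x. ennreal ((norm (F x))^2))"
 have "(NN xi. ennreal (exp (- e * \<bar>xi\<bar>) * (norm (fourier_L1 F xi))^2)) = ennreal (norm (LBINT xi. fourier_L1 F xi * G xi))"
 proof -
 have eq: "fourier_L1 F xi * G xi = cof (exp (- e * \<bar>xi\<bar>) * (norm (fourier_L1 F xi))^2)" for xi
 unfolding G_def w_def of_real_mult complex_norm_square complex_cnj_mult complex_cnj_complex_of_real by (simp only: mult_ac)
 have i: "integrable lborel (%xi. exp (- e * \<bar>xi\<bar>) * (norm (fourier_L1 F xi))^2)"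
 using integrable_fourier_times[OF F Gi] unfolding eq complex_of_real_integrable_eq .
 show ?thesis unfolding eq integral_complex_of_real norm_of_real
 by (subst nn_integral_eq_integral[OF i]) (auto simp: abs_of_nonneg)
 qed
 also have "\<dots> = ennreal (norm (LBINT x. F x * fourier_L1 G x))" by (simp only: fourier_multiplication_formula[OF F Gi])
 also have "\<dots> <= (NN x. ennreal (norm (F x * fourier_L1 G x)))"
 proof (rule integral_norm_bound_ennreal)
 show "integrable lborel (%x. F x * fourier_L1 G x)" using integrable_fourier_times[OF Gi F] by (simp only: mult.commute)
 qed
 also have "\<dots> <= (NN x. (NN y. (ennreal ((norm (F x))^2 / 2) + ennreal ((norm (F y))^2 / 2)) * ennreal (p x y)))"
 proof (rule nn_integral_mono)
 fix x
 have "ennreal (norm (fourier_L1 G x)) <= (NN y. ennreal (norm (F y * cof (p x y))))"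
 unfolding Ghat p_def[symmetric] complex_mod_cnj
 proof (cases "integrable lborel (%y. F y * cof (p x y))")
 case True then show "ennreal (norm (LBINT y. F y * cof (p x y))) <= (NN y. ennreal (norm (F y * cof (p x y))))"
 by (rule integral_norm_bound_ennreal)
 qed (simp add: not_integrable_integral_eq)
 then have "ennreal (norm (F x * fourier_L1 G x)) <= ennreal (norm (F x)) * (NN y. ennreal (norm (F y * cof (p x y))))"
 by (subst norm_mult, subst ennreal_mult) (auto intro: mult_left_mono)
 also have "\<dots> = (NN y. ennreal (norm (F x)) * ennreal (norm (F y * cof (p x y))))"
 by (rule nn_integral_cmult[symmetric]) measurable
 also have "\<dots> <= (NN y. (ennreal ((norm (F x))^2 / 2) + ennreal ((norm (F y))^2 / 2)) * ennreal (p x y))"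
 proof (rule nn_integral_mono)
 fix y
 have "ennreal (norm (F x)) * ennreal (norm (F y * cof (p x y))) = ennreal (norm (F x) * norm (F y) * p x y)"
 using p0[of x y] by (simp add: norm_mult mult.assoc flip: ennreal_mult)
 also have "\<dots> <= ennreal (((norm (F x))^2 / 2 + (norm (F y))^2 / 2) * p x y)"
 using sum_squares_bound[of "norm (F x)" "norm (F y)"] by (intro ennreal_leI mult_right_mono p0) simp
 also have "\<dots> = (ennreal ((norm (F x))^2 / 2) + ennreal ((norm (F y))^2 / 2)) * ennreal (p x y)"
 by (subst ennreal_plus[symmetric]) (auto simp: ennreal_mult p0)
 finally show "ennreal (norm (F x)) * ennreal (norm (F y * cof (p x y))) <= (ennreal ((norm (F x))^2 / 2) + ennreal ((norm (F y))^2 / 2)) * ennreal (p x y)" .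
 qed
 finally show "ennreal (norm (F x * fourier_L1 G x)) <= (NN y. (ennreal ((norm (F x))^2 / 2) + ennreal ((norm (F y))^2 / 2)) * ennreal (p x y))" .
 qed
 also have "\<dots> = (NN x. (NN y. ennreal ((norm (F x))^2 / 2) * ennreal (p x y))) + (NN x. (NN y. ennreal ((norm (F y))^2 / 2) * ennreal (p x y)))"
 unfolding distrib_right by (simp add: nn_integral_add)
 also have "(NN x. (NN y. ennreal ((norm (F y))^2 / 2) * ennreal (p x y))) = (NN y. (NN x. ennreal ((norm (F y))^2 / 2) * ennreal (p y x)))"
 proof -
 have "(NN x. (NN y. ennreal ((norm (F y))^2 / 2) * ennreal (p x y))) = (NN y. (NN x. ennreal ((norm (F y))^2 / 2) * ennreal (p x y)))"
 by (rule lborel_pair.Fubini') measurable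
 also have "\<dots> = (NN y. (NN x. ennreal ((norm (F y))^2 / 2) * ennreal (p y x)))"
 by (intro nn_integral_cong, subst psym, rule refl)
 finally show ?thesis .
 qed
 also have "(NN x. (NN y. ennreal ((norm (F x))^2 / 2) * ennreal (p x y))) + \<dots> = ?S"
 proof -
 have "(NN y. ennreal ((norm (F x))^2 / 2) * ennreal (p x y)) = ennreal ((norm (F x))^2 / 2)" for x
 by (subst nn_integral_cmult) (auto simp: pint)
 then show ?thesis
 proof (simp only:)
 have "ennreal ((norm (F x))^2 / 2) + ennreal ((norm (F x))^2 / 2) = ennreal ((norm (F x))^2)" for x
 by (subst ennreal_plus[symmetric]) auto
 then show "(NN x. ennreal ((norm (F x))^2 / 2)) + (NN x. ennreal ((norm (F x))^2 / 2)) = ?S"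
 by (subst nn_integral_add[symmetric]) auto
 qed
 qed
 finally show ?thesis .
qed

lemma plancherel_inequality:
 assumes F: "integrable lborel F"
 shows "(NN xi. ennreal ((norm (fourier_L1 F xi))^2)) <= (NN x. ennreal ((norm (F x))^2))"
proof -
 have Fm[measurable]: "F \<in> borel_measurable borel" using F by auto
 let ?e = "%n. 1 / real (Suc n)"
 have "(NN xi. ennreal ((norm (fourier_L1 F xi))^2)) = (NN xi. liminf (%n. ennreal (exp (- ?e n * \<bar>xi\<bar>) * (norm (fourier_L1 F xi))^2)))"
 proof (intro nn_integral_cong lim_imp_Liminf[symmetric] tendsto_ennrealI)
 fix xi
 have "?e \<leadsto> 0" by real_asymp
 then have "(%n. exp (- ?e n * \<bar>xi\<bar>) * (norm (fourier_L1 F xi))^2) \<leadsto> exp (- 0 * \<bar>xi\<bar>) * (norm (fourier_L1 F xi))^2" by (intro tendsto_intros)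
 then show "(%n. exp (- ?e n * \<bar>xi\<bar>) * (norm (fourier_L1 F xi))^2) \<leadsto> (norm (fourier_L1 F xi))\<^sup>2" by simp
 qed simp
 also have "\<dots> <= liminf (%n. NN xi. ennreal (exp (- ?e n * \<bar>xi\<bar>) * (norm (fourier_L1 F xi))^2))"
 by (rule nn_integral_liminf) measurable
 also have "\<dots> <= (NN x. ennreal ((norm (F x))^2))"
 proof (rule Liminf_le)
 show "\<forall>\<^sub>F n in sequentially. (NN xi. ennreal (exp (- ?e n * \<bar>xi\<bar>) * (norm (fourier_L1 F xi))^2)) <= (NN x. ennreal ((norm (F x))^2))"
 by (intro always_eventually allI plancherel_inequality_damped[OF F]) simp
 qed simp
 finally show ?thesis .
qed


definition truncate :: "(real => complex) => nat => real => complex" where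
 "truncate f n x = indicator {- real n..real n} x *\<^sub>R f x"

lemma truncate_measurable [measurable]: "f \<in> borel_measurable borel ==> truncate f n \<in> borel_measurable borel"
 unfolding truncate_def[abs_def] by measurable

lemma truncate_integrable:
 assumes [measurable]: "f \<in> borel_measurable borel" and f: "integrable lborel (%x. (norm (f x))\<^sup>2)"
 shows "integrable lborel (truncate f n)" "integrable lborel (%x. (norm (truncate f n x))\<^sup>2)"
proof -
 have i: "integrable lborel (%x. indicator {- real n..real n} x + (norm (f x))^2)"
 by (intro integrable_plus f integrable_indicator_Icc)
 have t: "t <= \<bar>1 + t\<^sup>2\<bar>" for t :: real
 proof -
 have "2 * t <= t\<^sup>2 + 1" using sum_squares_bound[of t 1] by simp
 then show ?thesis using zero_le_power2[of t] by linarith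
 qed
 have "norm (truncate f n x) <= norm (indicator {- real n..real n} x + (norm (f x))^2)" for x
 using t[of "norm (f x)"] by (cases "x \<in> {- real n..real n}") (simp_all add: truncate_def)
 then show "integrable lborel (truncate f n)" by (intro integrable_dominated[OF i] AE_I2) simp_all
 have "norm ((norm (truncate f n x))^2) <= norm ((norm (f x))^2)" for x
 by (cases "x \<in> {- real n..real n}") (simp_all add: truncate_def)
 then show "integrable lborel (%x. (norm (truncate f n x))\<^sup>2)"
 by (intro integrable_dominated[OF f] AE_I2) simp_all
qed

lemma truncate_tendsto:
 assumes [measurable]: "f \<in> borel_measurable borel" and f: "integrable lborel (%x. (norm (f x))\<^sup>2)"
 shows "(%n. NN x. ennreal ((norm (truncate f n x - f x))^2)) \<leadsto> 0"
proof -
 have "(%n. NN x. ennreal ((norm (truncate f n x - f x))^2)) \<leadsto> (NN (x::real). 0)"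
 proof (rule nn_integral_dominated_convergence[where w = "%x. ennreal ((norm (f x))^2)"])
 show "(NN x. ennreal ((norm (f x))^2)) < \<infinity>" using f unfolding integrable_iff_bounded by simp
 show "AE x in lborel. ennreal ((norm (truncate f n x - f x))^2) <= ennreal ((norm (f x))^2)" for n
 by (auto simp: truncate_def indicator_def)
 show "AE x in lborel. (%n. ennreal ((norm (truncate f n x - f x))^2)) \<leadsto> 0"
 proof (rule AE_I2)
 fix x
 have "\<forall>\<^sub>F n in sequentially. \<bar>x\<bar> <= real n" by real_asymp
 then have "\<forall>\<^sub>F n in sequentially. ennreal ((norm (truncate f n x - f x))^2) = 0"
 by eventually_elim (auto simp: truncate_def indicator_def abs_le_iff)
 then show "(%n. ennreal ((norm (truncate f n x - f x))^2)) \<leadsto> 0" by (rule tendsto_eventually)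
 qed
 qed measurable
 then show ?thesis by simp
qed

lemma fourier_L1_diff:
 assumes F: "integrable lborel F" and G: "integrable lborel G"
 shows "fourier_L1 F xi - fourier_L1 G xi = fourier_L1 (%x. F x - G x) xi"
proof -
 have [measurable]: "F \<in> borel_measurable borel" "G \<in> borel_measurable borel" using F G by auto
 have FG: "(%x. F x - G x) \<in> borel_measurable borel" by measurable
 show ?thesis
 unfolding fourier_L1_borel[OF \<open>F \<in> _\<close>] fourier_L1_borel[OF \<open>G \<in> _\<close>] fourier_L1_borel[OF FG] left_diff_distrib
 LINT_diff[OF integrable_times_fourier_kernel[OF F] integrable_times_fourier_kernel[OF G]]
 by (rule right_diff_distrib[symmetric])
qed

lemma plancherel_diff:
 assumes F: "integrable lborel F" and G: "integrable lborel G"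
 shows "(NN xi. ennreal ((norm (fourier_L1 F xi - fourier_L1 G xi))^2)) <= (NN x. ennreal ((norm (F x - G x))^2))"
 unfolding fourier_L1_diff[OF F G] by (rule plancherel_inequality[OF Bochner_Integration.integrable_diff[OF F G]])

lemma fourier_half_line_kernel:
 fixes z :: complex
 assumes z: "Im z > 0"
 shows "integrable lborel (%xi. indicator {0..} xi *\<^sub>R exp (\<i> * z * cof xi))"
 "fourier_L1 (%xi. indicator {0..} xi *\<^sub>R exp (\<i> * z * cof xi)) t = cof (1 / sqrt (2 * pi)) * (1 / (\<i> * (cof t - z)))"
proof -
 show "integrable lborel (%xi. indicator {0..} xi *\<^sub>R exp (\<i> * z * cof xi))"
 using integrable_exp_half_line[of "- \<i> * z"] z by simp
 have "(LBINT xi. indicator {0..} xi *\<^sub>R exp (\<i> * z * cof xi) * exp (- \<i> * cof xi * cof t))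
 = (LBINT xi. indicator {0..} xi *\<^sub>R exp (- (\<i> * (cof t - z)) * cof xi))"
 proof (intro LINT_cong refl)
 fix xi :: real
 have "exp (- (\<i> * (cof t - z)) * cof xi) = exp (\<i> * z * cof xi) * exp (- \<i> * cof xi * cof t)"
 unfolding exp_add[symmetric] by (rule arg_cong[where f = exp]) (simp add: algebra_simps)
 then show "indicator {0..} xi *\<^sub>R exp (\<i> * z * cof xi) * exp (- \<i> * cof xi * cof t) = indicator {0..} xi *\<^sub>R exp (- (\<i> * (cof t - z)) * cof xi)"
 by (simp only: mult_scaleR_left)
 qed
 also have "\<dots> = 1 / (\<i> * (cof t - z))" by (rule LINT_exp_half_line) (use z in simp)
 finally show "fourier_L1 (%xi. indicator {0..} xi *\<^sub>R exp (\<i> * z * cof xi)) t = cof (1 / sqrt (2 * pi)) * (1 / (\<i> * (cof t - z)))"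
 by (subst fourier_L1_borel) auto
qed

lemma cauchy_kernel_L2:
 assumes z: "Im z > 0"
 shows "(NN t. ennreal ((norm (c * (1 / (\<i> * (cof t - z)))))^2)) < \<infinity>"
proof -
 have "ennreal ((norm (c * (1 / (\<i> * (cof t - z)))))^2) = ennreal ((norm c)^2 / Im z) * ennreal (Im z / ((t - Re z)^2 + (Im z)^2))" for t
 proof -
 have "(norm (cof t - z))\<^sup>2 = (t - Re z)^2 + (Im z)^2" by (simp add: cmod_power2)
 then show ?thesis using z by (subst ennreal_mult[symmetric]) (simp_all add: norm_mult norm_divide power_divide power_mult_distrib)
 qed
 then show ?thesis using z by (simp add: nn_integral_cmult nn_integral_cauchy_density ennreal_mult_less_top)
qed

lemma L2_product_integrable:
 fixes a b :: "'a => complex"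
 assumes [measurable]: "a \<in> borel_measurable M" "b \<in> borel_measurable M"
 and fin: "(\<integral>\<^sup>+x. ennreal ((norm (a x))^2) \<partial>M) < \<infinity>" "(\<integral>\<^sup>+x. ennreal ((norm (b x))^2) \<partial>M) < \<infinity>"
 shows "integrable M (%x. a x * b x)"
proof (rule integrable_dominated)
 show "integrable M (%x. (norm (a x))\<^sup>2 + (norm (b x))^2)" using fin by (intro integrable_plus integrableI_nonneg) auto
 have "norm (a x * b x) <= norm ((norm (a x))^2 + (norm (b x))^2)" for x
 proof -
 have "norm (a x) * norm (b x) >= 0" by simp
 then show ?thesis using sum_squares_bound[of "norm (a x)" "norm (b x)"] by (simp only: norm_mult real_norm_def abs_of_nonneg add_nonneg_nonneg zero_le_power2)
 qed
 then show "AE x in M. norm (a x * b x) <= norm ((norm (a x))^2 + (norm (b x))^2)" by simp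
qed measurable

context
 fixes f f0 :: "real => complex"
 assumes f0[measurable]: "f0 \<in> borel_measurable borel" and f0i: "integrable lborel (%x. (norm (f0 x))\<^sup>2)"
 and ff0: "AE x in lborel. f x = f0 x"
begin

lemma f_L2: "f \<in> L2_fun lebesgue"
proof -
 have m0: "f0 \<in> borel_measurable lebesgue" using measurable_completion[of f0 lborel borel] f0 by simp
 have ae: "AE x in lebesgue. f0 x = f x" using AE_completion[OF ff0] by eventually_elim simp
 have [measurable]: "f \<in> borel_measurable lebesgue" by (rule borel_measurable_AE[OF m0 ae])
 have "integrable lebesgue (%x. (norm (f0 x))\<^sup>2)" using f0i by (subst integrable_completion) auto
 moreover have "(integrable lebesgue (%x. (norm (f0 x))\<^sup>2)) = (integrable lebesgue (%x. (norm (f x))\<^sup>2))"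
 using ae m0 by (intro integrable_cong_AE) (auto elim: eventually_mono)
 ultimately show ?thesis by (simp add: L2_fun_def)
qed

lemma truncate_L2_fun: "integrable lebesgue (truncate f0 n)" "truncate f0 n \<in> L2_fun lebesgue"
proof -
 have [measurable]: "truncate f0 n \<in> borel_measurable lebesgue" using measurable_completion[of "truncate f0 n" lborel borel] by simp
 show "integrable lebesgue (truncate f0 n)" using truncate_integrable(1)[OF f0 f0i] by (subst integrable_completion) auto
 have "integrable lebesgue (%x. (norm (truncate f0 n x))\<^sup>2)" using truncate_integrable(2)[OF f0 f0i] by (subst integrable_completion) auto
 then show "truncate f0 n \<in> L2_fun lebesgue" by (simp add: L2_fun_def)
qed

lemma truncate_L2_tendsto: "L2_tendsto (truncate f0) f"
proof -
 have "(\<integral>\<^sup>+x. ennreal ((norm (truncate f0 n x - f x))^2) \<partial>lebesgue) = (NN x. ennreal ((norm (truncate f0 n x - f0 x))^2))" for n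
 unfolding nn_integral_completion by (rule nn_integral_cong_AE) (use ff0 in \<open>auto elim: eventually_mono\<close>)
 then show ?thesis unfolding L2_tendsto_def using truncate_tendsto[OF f0 f0i] by simp
qed

text \<open>The transforms of the truncations form a Cauchy sequence by Plancherel's inequality, and the same inequality makes the limit the same for every other approximating sequence.\<close>
lemma fourier_L2_exists: "\<exists>g. is_fourier_L2 f g"
proof -
 let ?T = "truncate f0" and ?G = "%n. fourier_L1 (truncate f0 n)"
 let ?r = "%n. (NN x. ennreal ((norm (?T n x - f0 x))^2))"
 note Ti = truncate_integrable(1)[OF f0 f0i]
 note r0 = truncate_tendsto[OF f0 f0i]
 have cauchy: "\<exists>N. \<forall>m\<ge>N. \<forall>n\<ge>N. (NN x. ennreal ((norm (?G m x - ?G n x))^2)) <= ennreal e" if e: "e > 0" for e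
 proof -
 have "\<forall>\<^sub>F n in sequentially. ?r n < ennreal (e / 4)" using order_tendstoD(2)[OF r0, of "ennreal (e / 4)"] e by simp
 then obtain N where N: "\<And>n. n >= N ==> ?r n < ennreal (e / 4)" unfolding eventually_sequentially by blast
 have "(NN x. ennreal ((norm (?G m x - ?G n x))^2)) <= ennreal e" if "m >= N" "n >= N" for m n
 proof -
 have "(NN x. ennreal ((norm (?G m x - ?G n x))^2)) <= (NN x. ennreal ((norm (?T m x - ?T n x))^2))" by (rule plancherel_diff[OF Ti Ti])
 also have "\<dots> <= 2 * ?r m + 2 * (NN x. ennreal ((norm (f0 x - ?T n x))^2))" by (rule nn_L2_triangle) measurable
 also have "\<dots> = 2 * ?r m + 2 * ?r n" by (simp only: norm_minus_commute)
 also have "\<dots> <= 2 * ennreal (e / 4) + 2 * ennreal (e / 4)" using N[OF that(1)] N[OF that(2)] by (intro add_mono mult_left_mono) auto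
 also have "\<dots> = ennreal (2 * (e / 4) + 2 * (e / 4))"
 proof -
 have "2 * ennreal (e / 4) = ennreal (2 * (e / 4))" using e ennreal_mult[of 2 "e / 4"] by simp
 then show ?thesis using e by (simp only: ennreal_plus[symmetric])
 qed
 also have "2 * (e / 4) + 2 * (e / 4) = e" by simp
 finally show ?thesis .
 qed
 then show ?thesis by blast
 qed
 have "\<exists>g. g \<in> borel_measurable lborel & (%n. NN x. ennreal ((norm (?G n x - g x))^2)) \<leadsto> 0"
 by (rule riesz_fischer[of ?G lborel]) (use cauchy in \<open>auto simp: fourier_L1_measurable\<close>)
 then obtain g where gm: "g \<in> borel_measurable lborel" and gl: "(%n. NN x. ennreal ((norm (?G n x - g x))^2)) \<leadsto> 0" by blast
 have [measurable]: "g \<in> borel_measurable borel" using gm by simp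
 have gfin: "(NN x. ennreal ((norm (g x))^2)) < \<infinity>"
 proof -
 have "\<forall>\<^sub>F n in sequentially. (NN x. ennreal ((norm (?G n x - g x))^2)) < ennreal 1" using order_tendstoD(2)[OF gl, of "ennreal 1"] by simp
 then obtain n where n: "(NN x. ennreal ((norm (?G n x - g x))^2)) < ennreal 1" by (auto simp: eventually_sequentially)
 have "(NN x. ennreal ((norm (?G n x))^2)) <= (NN x. ennreal ((norm (?T n x))^2))" by (rule plancherel_inequality[OF Ti])
 also have "\<dots> < \<infinity>" using truncate_integrable(2)[OF f0 f0i, of n] unfolding integrable_iff_bounded by simp
 finally have 1: "(NN x. ennreal ((norm (?G n x))^2)) < \<infinity>" .
 have "(NN x. ennreal ((norm (g x))^2)) = (NN x. ennreal ((norm (g x - 0))^2))" by simp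
 also have "\<dots> <= 2 * (NN x. ennreal ((norm (g x - ?G n x))^2)) + 2 * (NN x. ennreal ((norm (?G n x - 0))^2))"
 by (rule nn_L2_triangle) measurable
 also have "\<dots> < \<infinity>"
 proof -
 have "2 * a + 2 * b < (\<infinity>::ennreal)" if "a < \<infinity>" "b < \<infinity>" for a b using that by (simp add: ennreal_mult_less_top)
 moreover have "(NN x. ennreal ((norm (g x - ?G n x))^2)) < \<infinity>"
 using order.strict_trans[OF n ennreal_less_top] by (simp only: norm_minus_commute infinity_ennreal_def)
 ultimately show ?thesis using 1 by (simp only: diff_zero)
 qed
 finally show ?thesis .
 qed
 have "g \<in> L2_fun lebesgue"
 proof -
 have [measurable]: "g \<in> borel_measurable lebesgue" using measurable_completion[OF gm] .
 have "integrable lborel (%x. (norm (g x))\<^sup>2)" using gfin unfolding integrable_iff_bounded by simp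
 then show ?thesis unfolding L2_fun_def using measurable_completion[OF gm] by (subst (asm) integrable_completion[symmetric]) auto
 qed
 moreover have "L2_tendsto (%n. fourier_L1 (F n)) g" if Fi: "\<And>n. integrable lebesgue (F n)" and Ff: "L2_tendsto F f" for F
 proof -
 have Fm: "F n \<in> borel_measurable lebesgue" for n using Fi[of n] by auto
 have "\<forall>n. \<exists>h. h \<in> borel_measurable borel & (AE x in lborel. F n x = h x)"
 using lebesgue_borel_representative[OF Fm] by metis
 then obtain H where Hm[measurable]: "\<And>n. H n \<in> borel_measurable borel" and FH: "\<And>n. AE x in lborel. F n x = H n x" by metis
 have Hi: "integrable lborel (H n)" for n
 proof -
 have Hml[measurable]: "H n \<in> borel_measurable lebesgue" using measurable_completion[of "H n" lborel borel] by simp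
 have "integrable lebesgue (H n)" using Fi[of n] integrable_cong_AE[OF Fm[of n] Hml AE_completion[OF FH[of n]]] by simp
 then show ?thesis by (subst (asm) integrable_completion) auto
 qed
 have eq: "fourier_L1 (F n) = fourier_L1 (H n)" for n by (rule ext, rule fourier_L1_cong_AE[OF FH Fm Hm])
 let ?d = "%n. \<integral>\<^sup>+x. ennreal ((norm (F n x - f x))^2) \<partial>lebesgue"
 have d: "?d n = (NN x. ennreal ((norm (H n x - f0 x))^2))" for n
 unfolding nn_integral_completion by (rule nn_integral_cong_AE) (use ff0 FH[of n] in \<open>eventually_elim, simp\<close>)
 let ?u = "%n. 2 * (2 * ?d n + 2 * ?r n) + 2 * (NN x. ennreal ((norm (?G n x - g x))^2))"
 have ub: "(\<integral>\<^sup>+x. ennreal ((norm (fourier_L1 (F n) x - g x))^2) \<partial>lebesgue) <= ?u n" for n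
 proof -
 have "(\<integral>\<^sup>+x. ennreal ((norm (fourier_L1 (F n) x - g x))^2) \<partial>lebesgue) = (NN x. ennreal ((norm (fourier_L1 (H n) x - g x))^2))"
 by (simp only: eq nn_integral_completion)
 also have "\<dots> <= 2 * (NN x. ennreal ((norm (fourier_L1 (H n) x - ?G n x))^2)) + 2 * (NN x. ennreal ((norm (?G n x - g x))^2))"
 by (rule nn_L2_triangle) measurable
 also have "\<dots> <= 2 * (2 * ?d n + 2 * ?r n) + 2 * (NN x. ennreal ((norm (?G n x - g x))^2))"
 proof (intro add_right_mono mult_left_mono)
 have "(NN x. ennreal ((norm (fourier_L1 (H n) x - ?G n x))^2)) <= (NN x. ennreal ((norm (H n x - ?T n x))^2))" by (rule plancherel_diff[OF Hi Ti])
 also have "\<dots> <= 2 * (NN x. ennreal ((norm (H n x - f0 x))^2)) + 2 * (NN x. ennreal ((norm (f0 x - ?T n x))^2))"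
 by (rule nn_L2_triangle) measurable
 also have "\<dots> = 2 * ?d n + 2 * ?r n" by (simp only: norm_minus_commute[of "f0 _"] d)
 finally show "(NN x. ennreal ((norm (fourier_L1 (H n) x - ?G n x))^2)) <= 2 * ?d n + 2 * ?r n" .
 qed simp
 finally show ?thesis .
 qed
 have u0: "?u \<leadsto> 0"
 proof -
 have "(%n. 2 * (2 * a n + 2 * b n) + 2 * c n :: ennreal) \<leadsto> 0" if a: "a \<leadsto> 0" and b: "b \<leadsto> 0" and c: "c \<leadsto> 0" for a b c
 proof -
 have 2: "(2::ennreal) < top" by simp
 note m = ennreal_tendsto_cmult[OF 2]
 have "(%n. 2 * (2 * a n + 2 * b n) + 2 * c n :: ennreal) \<leadsto> 2 * (2 * 0 + 2 * 0) + 2 * 0"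
 by (rule tendsto_add[OF m[OF tendsto_add[OF m[OF a] m[OF b]]] m[OF c]])
 then show ?thesis by simp
 qed
 from this[OF Ff[unfolded L2_tendsto_def] r0 gl] show ?thesis .
 qed
 show ?thesis unfolding L2_tendsto_def
 by (rule tendsto_sandwich[OF always_eventually[OF allI[OF zero_le]] always_eventually[OF allI[OF ub]] tendsto_const u0])
 qed
 ultimately show ?thesis unfolding is_fourier_L2_def using f_L2 by blast
qed

lemma is_fourier_L2_fourier_L2: "is_fourier_L2 f (fourier_L2 f)"
 unfolding fourier_L2_def using fourier_L2_exists by (rule someI_ex)

text \<open>The multiplication formula with the one-sided exponential, whose transform is the Cauchy kernel, passed to the limit from truncations.\<close>
theorem fourier_L2_half_plane:
 obtains g where "g \<in> borel_measurable borel" "(NN xi. ennreal ((norm (g xi))^2)) < \<infinity>" "AE xi in lborel. fourier_L2 f xi = g xi"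
 "\<And>z. Im z > 0 ==> (LBINT xi. g xi * (indicator {0..} xi *\<^sub>R exp (\<i> * z * cof xi))) = cof (1 / sqrt (2 * pi)) * (LBINT t. f0 t * (1 / (\<i> * (cof t - z))))"
proof -
 let ?T = "truncate f0" and ?c = "cof (1 / sqrt (2 * pi))"
 note Ti = truncate_integrable(1)[OF f0 f0i]
 have g2: "fourier_L2 f \<in> L2_fun lebesgue" and gl: "L2_tendsto (%n. fourier_L1 (?T n)) (fourier_L2 f)"
 using is_fourier_L2_fourier_L2 truncate_L2_fun truncate_L2_tendsto unfolding is_fourier_L2_def by blast+
 obtain g where gm[measurable]: "g \<in> borel_measurable borel" and ae: "AE x in lborel. fourier_L2 f x = g x"
 using lebesgue_borel_representative[of "fourier_L2 f"] g2 by (auto simp: L2_fun_def)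
 have gfin: "(NN xi. ennreal ((norm (g xi))^2)) < \<infinity>"
 proof -
 have "(NN xi. ennreal ((norm (g xi))^2)) = (\<integral>\<^sup>+xi. ennreal ((norm (fourier_L2 f xi))^2) \<partial>lebesgue)"
 unfolding nn_integral_completion by (rule nn_integral_cong_AE) (use ae in \<open>auto elim: eventually_mono\<close>)
 also have "\<dots> < \<infinity>" using g2 by (simp add: L2_fun_def integrable_iff_bounded)
 finally show ?thesis .
 qed
 have gl': "(%n. NN x. ennreal ((norm (fourier_L1 (?T n) x - g x))^2)) \<leadsto> 0"
 proof -
 have "(\<integral>\<^sup>+x. ennreal ((norm (fourier_L1 (?T n) x - fourier_L2 f x))^2) \<partial>lebesgue) = (NN x. ennreal ((norm (fourier_L1 (?T n) x - g x))^2))" for n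
 unfolding nn_integral_completion by (rule nn_integral_cong_AE) (use ae in \<open>auto elim: eventually_mono\<close>)
 then show ?thesis using gl unfolding L2_tendsto_def by (simp only:)
 qed
 show thesis
 proof (rule that[OF gm gfin ae])
 fix z :: complex assume z: "Im z > 0"
 define k where "k xi = indicator {0..} xi *\<^sub>R exp (\<i> * z * cof xi)" for xi
 note ki = fourier_half_line_kernel(1)[OF z, folded k_def] and kh = fourier_half_line_kernel(2)[OF z, folded k_def]
 have [measurable]: "k \<in> borel_measurable borel" using ki by auto
 have k2: "(NN xi. ennreal ((norm (k xi))^2)) < \<infinity>"
 proof -
 have "ennreal ((norm (k xi))^2) <= ennreal (norm (k xi))" for xi
 proof (rule ennreal_leI)
 have "norm (k xi) <= 1" using z by (auto simp: k_def indicator_def norm_exp_eq_Re)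
 then show "(norm (k xi))\<^sup>2 <= norm (k xi)" by (simp add: power2_eq_square mult_left_le)
 qed
 then have "(NN xi. ennreal ((norm (k xi))^2)) <= (NN xi. ennreal (norm (k xi)))" by (intro nn_integral_mono)
 also have "\<dots> < \<infinity>" using ki unfolding integrable_iff_bounded by simp
 finally show ?thesis .
 qed
 have f0fin: "(NN x. ennreal ((norm (f0 x))^2)) < \<infinity>" using f0i unfolding integrable_iff_bounded by simp
 have Tfin: "(NN x. ennreal ((norm (?T n x))^2)) < \<infinity>" for n
 using truncate_integrable(2)[OF f0 f0i, of n] unfolding integrable_iff_bounded by simp
 have L: "(%n. LBINT xi. fourier_L1 (?T n) xi * k xi) \<leadsto> (LBINT xi. g xi * k xi)"
 proof (rule L2_weak_limit[OF _ _ _ gl' k2])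
 show "integrable lborel (%x. fourier_L1 (?T n) x * k x)" for n by (rule integrable_fourier_times[OF Ti ki])
 show "integrable lborel (%x. g x * k x)" by (rule L2_product_integrable[OF _ _ gfin k2]) measurable
 qed measurable
 have km: "fourier_L1 k \<in> borel_measurable lborel" by simp
 have kh2: "(NN t. ennreal ((norm (fourier_L1 k t))^2)) < \<infinity>" unfolding kh by (rule cauchy_kernel_L2[OF z])
 have R: "(%n. LBINT x. ?T n x * fourier_L1 k x) \<leadsto> (LBINT x. f0 x * fourier_L1 k x)"
 proof (rule L2_weak_limit[OF _ _ _ truncate_tendsto[OF f0 f0i] kh2])
 show "integrable lborel (%x. ?T n x * fourier_L1 k x)" for n by (rule L2_product_integrable[OF _ km Tfin kh2]) measurable
 show "integrable lborel (%x. f0 x * fourier_L1 k x)" by (rule L2_product_integrable[OF _ km f0fin kh2]) measurable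
 qed measurable
 have "(LBINT xi. g xi * k xi) = (LBINT x. f0 x * fourier_L1 k x)"
 using LIMSEQ_unique[OF L] R unfolding fourier_multiplication_formula[OF Ti ki] by blast
 also have "\<dots> = (LBINT x. ?c * (f0 x * (1 / (\<i> * (cof x - z)))))" unfolding kh by (simp only: mult_ac)
 also have "\<dots> = ?c * (LBINT x. f0 x * (1 / (\<i> * (cof x - z))))" by (rule integral_mult_right_zero)
 finally show "(LBINT xi. g xi * (indicator {0..} xi *\<^sub>R exp (\<i> * z * cof xi))) = ?c * (LBINT x. f0 x * (1 / (\<i> * (cof x - z))))"
 unfolding k_def .
 qed
qed

end


section \<open>Recovering an integral norm from Taylor coefficients\<close>

definition poisson_weight :: "nat => real => real" where
 "poisson_weight j x = exp (- x) * x ^ j / fact j"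

lemma poisson_weight_nonneg: "x >= 0 ==> poisson_weight j x >= 0"
 by (simp add: poisson_weight_def)

lemma poisson_weight_measurable [measurable]: "poisson_weight j \<in> borel_measurable borel"
 unfolding poisson_weight_def[abs_def] by measurable

text \<open>Total mass, mean and second moment of the Poisson distribution with mean \<open>x\<close>.\<close>
lemma poisson_weight_moments:
 shows "(%j. poisson_weight j x) sums 1"
 and "(%j. real j * poisson_weight j x) sums x"
 and "(%j. (real j)\<^sup>2 * poisson_weight j x) sums (x\<^sup>2 + x)"
proof -
 have "(%j. exp (- x) * (x ^ j /\<^sub>R fact j)) sums (exp (- x) * exp x)" by (intro sums_mult exp_converges)
 then show 0: "(%j. poisson_weight j x) sums 1"
 by (simp add: poisson_weight_def exp_minus_inverse[of "- x", simplified] divide_inverse mult_ac exp_add[symmetric])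
 have S: "real (Suc j) * poisson_weight (Suc j) x = x * poisson_weight j x" for j
 proof -
 have "(fact (Suc j) :: real) = real (Suc j) * fact j" by simp
 then show ?thesis unfolding poisson_weight_def by (simp only: power_Suc) (simp add: field_simps del: of_nat_Suc)
 qed
 have "(%j. real (Suc j) * poisson_weight (Suc j) x) sums (x * 1)" unfolding S by (intro sums_mult 0)
 from sums_Suc[OF this] show 1: "(%j. real j * poisson_weight j x) sums x" by simp
 have "(real (Suc j))\<^sup>2 * poisson_weight (Suc j) x = x * (real j * poisson_weight j x) + x * poisson_weight j x" for j
 proof -
 have "(real (Suc j))\<^sup>2 * poisson_weight (Suc j) x = real (Suc j) * (real (Suc j) * poisson_weight (Suc j) x)" by (simp only: power2_eq_square mult.assoc)
 then show ?thesis unfolding S by (simp add: algebra_simps)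
 qed
 moreover have "(%j. x * (real j * poisson_weight j x) + x * poisson_weight j x) sums (x * x + x * 1)" by (intro sums_add sums_mult 0 1)
 ultimately have "(%j. (real (Suc j))\<^sup>2 * poisson_weight (Suc j) x) sums (x * x + x * 1)" by simp
 from sums_Suc[OF this] show "(%j. (real j)\<^sup>2 * poisson_weight j x) sums (x\<^sup>2 + x)" by (simp add: power2_eq_square)
qed

lemma szasz_summable:
 fixes \<phi> :: "real => complex"
 assumes "\<And>y. norm (\<phi> y) <= 1" "x >= 0"
 shows "summable (%j. cof (poisson_weight j x) * \<phi> (real j / s))"
 "norm (\<Sum>j\<le>K. cof (poisson_weight j x) * \<phi> (real j / s)) <= 1"
proof -
 note p = poisson_weight_moments(1)[of x] and p0 = poisson_weight_nonneg[OF assms(2)]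
 have b: "norm (cof (poisson_weight j x) * \<phi> (real j / s)) <= poisson_weight j x" for j
 unfolding norm_mult norm_of_real using p0[of j] assms(1)[of "real j / s"] by (simp add: mult_left_le)
 show "summable (%j. cof (poisson_weight j x) * \<phi> (real j / s))"
 by (rule summable_comparison_test'[OF sums_summable[OF p]]) (rule b)
 have "norm (\<Sum>j\<le>K. cof (poisson_weight j x) * \<phi> (real j / s)) <= (\<Sum>j\<le>K. poisson_weight j x)" by (intro sum_norm_le b)
 also have "\<dots> <= (\<Sum>j. poisson_weight j x)" by (rule sum_le_suminf[OF sums_summable[OF p]]) (use p0 in auto)
 also have "\<dots> = 1" using p by (rule sums_unique[symmetric])
 finally show "norm (\<Sum>j\<le>K. cof (poisson_weight j x) * \<phi> (real j / s)) <= 1" .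
qed

text \<open>Chebyshev's argument: the rescaled Poisson distribution has mean \<open>xi\<close> and variance \<open>xi / s\<close>, and \<open>\<phi>\<close> varies by at most \<open>e + C (y - xi)^2\<close>.\<close>
lemma szasz_tendsto:
 fixes \<phi> :: "real => complex"
 assumes c: "isCont \<phi> xi" and b: "\<And>y. norm (\<phi> y) <= 1" and xi: "xi >= 0"
 shows "(%n. \<Sum>j. cof (poisson_weight j (real (Suc n) * xi)) * \<phi> (real j / real (Suc n))) \<leadsto> \<phi> xi"
proof (rule LIMSEQ_I)
 fix r :: real assume r: "r > 0"
 define e where "e = r / 2"
 have e: "e > 0" using r by (simp add: e_def)
 obtain d where d: "d > 0" "\<And>y. dist y xi < d ==> dist (\<phi> y) (\<phi> xi) < e"
 using c e unfolding continuous_at_eps_delta by blast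
 define C where "C = 2 / d\<^sup>2"
 have C0: "C >= 0" by (simp add: C_def)
 have maj: "norm (\<phi> y - \<phi> xi) <= e + C * (y - xi)^2" for y
 proof (cases "dist y xi < d")
 case True
 then show ?thesis using d(2)[OF True] C0 by (simp add: dist_norm add_increasing2 less_imp_le)
 next
 case False
 then have "d\<^sup>2 <= \<bar>y - xi\<bar>\<^sup>2" using d(1) by (intro power_mono) (auto simp: dist_real_def)
 then have "C * d\<^sup>2 <= C * (y - xi)^2" using C0 by (intro mult_left_mono) auto
 then have "2 <= C * (y - xi)^2" using d(1) by (simp add: C_def)
 moreover have "norm (\<phi> y - \<phi> xi) <= 2" using norm_triangle_ineq4[of "\<phi> y" "\<phi> xi"] b[of y] b[of xi] by linarith
 ultimately show ?thesis using e by linarith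
 qed
 have main: "norm ((\<Sum>j. cof (poisson_weight j (s * xi)) * \<phi> (real j / s)) - \<phi> xi) <= e + C * xi / s" if s: "s > 0" for s
 proof -
 have sxi: "s * xi >= 0" using s xi by simp
 let ?p = "%j. poisson_weight j (s * xi)"
 note m = poisson_weight_moments[of "s * xi"] and p0 = poisson_weight_nonneg[OF sxi]
 have "(%j. (e + C * xi\<^sup>2) * ?p j - (2 * C * xi / s) * (real j * ?p j) + (C / s\<^sup>2) * ((real j)^2 * ?p j)) sums
 ((e + C * xi\<^sup>2) * 1 - (2 * C * xi / s) * (s * xi) + (C / s\<^sup>2) * ((s * xi)^2 + s * xi))"
 by (intro sums_add sums_diff sums_mult m)
 moreover have "(e + C * xi\<^sup>2) * ?p j - (2 * C * xi / s) * (real j * ?p j) + (C / s\<^sup>2) * ((real j)^2 * ?p j) = ?p j * (e + C * (real j / s - xi)^2)" for j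
 using s by (simp add: power2_eq_square field_simps)
 moreover have "(e + C * xi\<^sup>2) * 1 - (2 * C * xi / s) * (s * xi) + (C / s\<^sup>2) * ((s * xi)^2 + s * xi) = e + C * xi / s"
 using s by (simp add: power2_eq_square field_simps)
 ultimately have var: "(%j. ?p j * (e + C * (real j / s - xi)^2)) sums (e + C * xi / s)" by (simp only:)
 have "(%j. cof (?p j) * \<phi> xi) sums (cof 1 * \<phi> xi)" by (intro sums_mult2 sums_of_real m)
 then have "(%j. cof (?p j) * \<phi> (real j / s) - cof (?p j) * \<phi> xi) sums ((\<Sum>j. cof (?p j) * \<phi> (real j / s)) - \<phi> xi)"
 by (intro sums_diff summable_sums szasz_summable b sxi) simp
 then have eq: "(%j. cof (?p j) * (\<phi> (real j / s) - \<phi> xi)) sums ((\<Sum>j. cof (?p j) * \<phi> (real j / s)) - \<phi> xi)"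
 by (simp only: right_diff_distrib)
 have nb: "norm (cof (?p j) * (\<phi> (real j / s) - \<phi> xi)) <= ?p j * (e + C * (real j / s - xi)^2)" for j
 unfolding norm_mult norm_of_real using p0[of j] maj[of "real j / s"] by (simp add: mult_left_mono)
 have "norm (\<Sum>j. cof (?p j) * (\<phi> (real j / s) - \<phi> xi)) <= (\<Sum>j. ?p j * (e + C * (real j / s - xi)^2))"
 by (rule norm_suminf_le[OF nb sums_summable[OF var]])
 then show ?thesis using sums_unique[OF eq] sums_unique[OF var] by simp
 qed
 have "(%n. e + C * xi / real (Suc n)) \<leadsto> e" by real_asymp
 then have "\<forall>\<^sub>F n in sequentially. e + C * xi / real (Suc n) < r" by (rule order_tendstoD(2)) (use r in \<open>simp add: e_def\<close>)
 then obtain N where N: "\<And>n. n >= N ==> e + C * xi / real (Suc n) < r" unfolding eventually_sequentially by blast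
 show "\<exists>N. \<forall>n\<ge>N. norm ((\<Sum>j. cof (poisson_weight j (real (Suc n) * xi)) * \<phi> (real j / real (Suc n))) - \<phi> xi) < r"
 proof (intro exI allI impI)
 fix n assume "n >= N"
 show "norm ((\<Sum>j. cof (poisson_weight j (real (Suc n) * xi)) * \<phi> (real j / real (Suc n))) - \<phi> xi) < r"
 by (rule le_less_trans[OF main N[OF \<open>n >= N\<close>]]) simp
 qed
qed

text \<open>The conjugate sign of \<open>w\<close> is an almost everywhere limit of continuous functions, which stay such after projection to the unit disc.\<close>
lemma L1_norm_by_continuous_duality:
 fixes w :: "real => complex"
 assumes w: "integrable lborel w"
 and bd: "\<And>\<phi>. continuous_on UNIV \<phi> ==> (\<And>y. norm (\<phi> y) <= 1) ==> norm (LBINT xi. w xi * \<phi> xi) <= C"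
 shows "(NN xi. ennreal (norm (w xi))) <= ennreal C"
proof -
 have [measurable]: "w \<in> borel_measurable borel" using w by auto
 define \<sigma> where "\<sigma> x = cnj (sgn (w x))" for x
 have "cnj \<in> borel_measurable borel" by (rule borel_measurable_continuous_onI) (intro continuous_intros)
 from measurable_compose[OF _ this, of "%x. sgn (w x)" borel]
 have [measurable]: "\<sigma> \<in> borel_measurable borel" unfolding \<sigma>_def sgn_div_norm by simp
 have \<sigma>1: "norm (\<sigma> x) <= 1" for x by (simp add: \<sigma>_def norm_sgn)
 have ws: "w x * \<sigma> x = cof (norm (w x))" for x
 proof (cases "w x = 0")
 case False
 have "w x * cnj (w x) = cof (norm (w x)) * cof (norm (w x))"
 by (simp only: complex_norm_square[symmetric] power2_eq_square of_real_mult)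
 then show ?thesis using False by (simp add: \<sigma>_def sgn_eq)
 qed (simp add: \<sigma>_def)
 have "\<sigma> measurable_on UNIV"
 by (rule lebesgue_measurable_imp_measurable_on) (auto intro!: measurable_completion)
 then obtain N g where N: "negligible N" and gc: "\<And>n. continuous_on UNIV (g n)" and gl: "\<And>x. x \<notin> N ==> (%n. g n x) \<leadsto> \<sigma> x"
 unfolding measurable_on_def by force
 define \<phi> where "\<phi> n x = g n x / cof (max 1 (norm (g n x)))" for n x
 have mpos: "max 1 (norm (g n x)) > 0" for n x by (simp add: less_max_iff_disj)
 have \<phi>c: "continuous_on UNIV (\<phi> n)" for n
 unfolding \<phi>_def by (intro continuous_intros gc) (use mpos in \<open>metis of_real_eq_0_iff less_irrefl\<close>)
 have \<phi>1: "norm (\<phi> n x) <= 1" for n x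
 unfolding \<phi>_def norm_divide norm_of_real using mpos[of n x] by (simp add: divide_le_eq)
 have \<phi>m[measurable]: "\<phi> n \<in> borel_measurable borel" for n by (rule borel_measurable_continuous_onI[OF \<phi>c])
 have \<phi>l: "(%n. \<phi> n x) \<leadsto> \<sigma> x" if "x \<notin> N" for x
 proof -
 have "(%n. \<phi> n x) \<leadsto> \<sigma> x / cof (max 1 (norm (\<sigma> x)))"
 unfolding \<phi>_def by (intro tendsto_intros gl that) (use \<sigma>1[of x] in \<open>simp add: max_def\<close>)
 then show ?thesis using \<sigma>1[of x] by (simp add: max_absorb1)
 qed
 have aeN: "AE x in lborel. x \<notin> N"
 proof -
 have "N \<in> null_sets lebesgue" using N by (simp add: negligible_iff_null_sets)
 then have "AE x in lebesgue. x \<notin> N" by (rule AE_not_in)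
 then show ?thesis by (simp only: AE_completion_iff)
 qed
 have "(%n. LBINT xi. w xi * \<phi> n xi) \<leadsto> (LBINT xi. w xi * \<sigma> xi)"
 proof (rule integral_dominated_convergence[where w = "%x. norm (w x)"])
 show "integrable lborel (%x. norm (w x))" using w by simp
 show "AE x in lborel. (%n. w x * \<phi> n x) \<leadsto> w x * \<sigma> x" using aeN by eventually_elim (intro tendsto_intros \<phi>l)
 show "AE x in lborel. norm (w x * \<phi> n x) <= norm (w x)" for n unfolding norm_mult using \<phi>1[of n] by (intro AE_I2 mult_left_le) auto
 qed measurable
 then have "(%n. norm (LBINT xi. w xi * \<phi> n xi)) \<leadsto> norm (LBINT xi. w xi * \<sigma> xi)" by (rule tendsto_norm)
 then have "norm (LBINT xi. w xi * \<sigma> xi) <= C" by (rule Lim_bounded) (use bd[OF \<phi>c \<phi>1] in auto)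
 moreover have "(LBINT xi. w xi * \<sigma> xi) = cof (LBINT xi. norm (w xi))" unfolding ws by (rule integral_complex_of_real)
 ultimately have "(LBINT xi. norm (w xi)) <= C" by (simp only: norm_of_real)
 then have "ennreal (LBINT xi. norm (w xi)) <= ennreal C" by (rule ennreal_leI)
 then show ?thesis using nn_integral_eq_integral[OF integrable_norm[OF w]] by simp
qed

text \<open>Sums of the hypothesis against values of a continuous function are integrals of \<open>w\<close> against its Szasz operator.\<close>
lemma L1_norm_by_poisson_weights:
 fixes w :: "real => complex"
 assumes w: "integrable lborel w" and supp: "\<And>xi. xi < 0 ==> w xi = 0"
 and bd: "\<And>s K. s > 0 ==> (\<Sum>j\<le>K. norm (LBINT xi. w xi * cof (poisson_weight j (s * xi)))) <= C"
 shows "(NN xi. ennreal (norm (w xi))) <= ennreal C"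
proof (rule L1_norm_by_continuous_duality[OF w])
 fix \<phi> :: "real => complex" assume c: "continuous_on UNIV \<phi>" and b: "\<And>y. norm (\<phi> y) <= 1"
 have wm[measurable]: "w \<in> borel_measurable borel" using w by auto
 have \<phi>m[measurable]: "\<phi> \<in> borel_measurable borel" by (rule borel_measurable_continuous_onI[OF c])
 have wi: "integrable lborel (%x. norm (w x))" using w by simp
 let ?B = "%K s xi. \<Sum>j\<le>K. cof (poisson_weight j (s * xi)) * \<phi> (real j / s)"
 let ?Bi = "%s xi. \<Sum>j. cof (poisson_weight j (s * xi)) * \<phi> (real j / s)"
 have lim: "(%K. ?B K s xi) \<leadsto> ?Bi s xi" if "s > 0" "xi >= 0" for s xi
 by (rule summable_LIMSEQ'[OF szasz_summable(1)[OF b]]) (use that in simp)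
 have Bi1: "norm (?Bi s xi) <= 1" if "s > 0" "xi >= 0" for s xi
 by (rule Lim_bounded[OF tendsto_norm[OF lim[OF that]], of 0]) (use szasz_summable(2)[where \<phi> = \<phi>, OF b] that in auto)
 have Bm: "(%xi. w xi * ?B K s xi) \<in> borel_measurable lborel" for K s by measurable
 have Bim: "(%xi. w xi * ?Bi s xi) \<in> borel_measurable lborel" for s by measurable
 have step: "norm (LBINT xi. w xi * ?Bi s xi) <= C" if s: "s > 0" for s
 proof -
 have pi: "integrable lborel (%xi. w xi * cof (poisson_weight j (s * xi)))" for j
 proof (rule integrable_dominated[OF w])
 have "norm (w xi * cof (poisson_weight j (s * xi))) <= norm (w xi)" for xi
 proof (cases "xi < 0")
 case False
 then have x: "s * xi >= 0" using s by simp
 have "poisson_weight j (s * xi) <= (\<Sum>j. poisson_weight j (s * xi))"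
 using sum_le_suminf[OF sums_summable[OF poisson_weight_moments(1)], of "{j}" "s * xi"] poisson_weight_nonneg[OF x] by simp
 also have "\<dots> = 1" by (rule sums_unique[OF poisson_weight_moments(1), symmetric])
 finally show ?thesis unfolding norm_mult norm_of_real using poisson_weight_nonneg[OF x, of j] by (intro mult_left_le) auto
 qed (simp add: supp)
 then show "AE xi in lborel. norm (w xi * cof (poisson_weight j (s * xi))) <= norm (w xi)" by simp
 qed measurable
 have fin: "norm (LBINT xi. w xi * ?B K s xi) <= C" for K
 proof -
 have "(LBINT xi. w xi * ?B K s xi) = (LBINT xi. (\<Sum>j\<le>K. w xi * cof (poisson_weight j (s * xi)) * \<phi> (real j / s)))"
 by (simp only: sum_distrib_left mult.assoc)
 also have "\<dots> = (\<Sum>j\<le>K. (LBINT xi. w xi * cof (poisson_weight j (s * xi)) * \<phi> (real j / s)))"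
 by (rule Bochner_Integration.integral_sum) (rule integrable_mult_left[OF pi])
 also have "\<dots> = (\<Sum>j\<le>K. (LBINT xi. w xi * cof (poisson_weight j (s * xi))) * \<phi> (real j / s))"
 by (simp only: integral_mult_left_zero)
 also have "norm (\<Sum>j\<le>K. (LBINT xi. w xi * cof (poisson_weight j (s * xi))) * \<phi> (real j / s)) <= (\<Sum>j\<le>K. norm (LBINT xi. w xi * cof (poisson_weight j (s * xi))))"
 by (rule sum_norm_le) (simp add: norm_mult mult_left_le b)
 also have "\<dots> <= C" by (rule bd[OF s])
 finally show ?thesis .
 qed
 have "(%K. LBINT xi. w xi * ?B K s xi) \<leadsto> (LBINT xi. w xi * ?Bi s xi)"
 proof (rule integral_dominated_convergence[OF Bim Bm wi])
 show "AE xi in lborel. (%K. w xi * ?B K s xi) \<leadsto> w xi * ?Bi s xi"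
 proof (rule AE_I2)
 fix xi show "(%K. w xi * ?B K s xi) \<leadsto> w xi * ?Bi s xi"
 by (cases "xi < 0") (simp_all add: supp tendsto_mult_left lim s)
 qed
 show "AE xi in lborel. norm (w xi * ?B K s xi) <= norm (w xi)" for K
 proof (rule AE_I2)
 fix xi show "norm (w xi * ?B K s xi) <= norm (w xi)"
 proof (cases "xi < 0")
 case False
 then have "s * xi >= 0" using s by simp
 then show ?thesis unfolding norm_mult by (intro mult_left_le szasz_summable(2) b) auto
 qed (simp add: supp)
 qed
 qed
 from Lim_bounded[OF tendsto_norm[OF this], of 0 C] show ?thesis using fin by blast
 qed
 have "(%n. LBINT xi. w xi * ?Bi (real (Suc n)) xi) \<leadsto> (LBINT xi. w xi * \<phi> xi)"
 proof (rule integral_dominated_convergence[OF _ Bim wi])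
 show "AE xi in lborel. (%n. w xi * ?Bi (real (Suc n)) xi) \<leadsto> w xi * \<phi> xi"
 proof (rule AE_I2)
 fix xi
 have "isCont \<phi> xi" using c by (simp add: continuous_on_eq_continuous_at)
 from szasz_tendsto[OF this b]
 show "(%n. w xi * ?Bi (real (Suc n)) xi) \<leadsto> w xi * \<phi> xi"
 by (cases "xi < 0") (simp_all only: supp mult_zero_left tendsto_const tendsto_mult_left not_less)
 qed
 show "AE xi in lborel. norm (w xi * ?Bi (real (Suc n)) xi) <= norm (w xi)" for n
 proof (rule AE_I2)
 fix xi show "norm (w xi * ?Bi (real (Suc n)) xi) <= norm (w xi)"
 proof (cases "xi < 0")
 case False
 then show ?thesis unfolding norm_mult by (intro mult_left_le Bi1) auto
 qed (simp add: supp)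
 qed
 qed measurable
 from Lim_bounded[OF tendsto_norm[OF this], of 0 C] show "norm (LBINT xi. w xi * \<phi> xi) <= C" using step by simp
qed

text \<open>The norm of a truncated power series at \<open>z\<close> with radius \<open>s\<close>; it is kept finite so that no convergence has to be discussed.\<close>
definition taylor_norm :: "real => nat => complex => (complex => complex) => real" where
 "taylor_norm s K z F = (\<Sum>k\<le>K. s ^ k / fact k * cmod ((deriv ^^ k) F z))"

context
 fixes s :: real and K :: nat and S :: "complex set" and z :: complex
 assumes s: "s >= 0" and S: "open S" and z: "z \<in> S"
begin

abbreviation "TN \<equiv> taylor_norm s K z"

lemma taylor_norm_nonneg: "TN F >= 0"
 unfolding taylor_norm_def by (intro sum_nonneg mult_nonneg_nonneg divide_nonneg_nonneg zero_le_power s) auto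

lemma taylor_norm_add:
 assumes "F holomorphic_on S" "G holomorphic_on S"
 shows "TN (%w. F w + G w) <= TN F + TN G"
 unfolding taylor_norm_def sum.distrib[symmetric] higher_deriv_add[OF assms S z] distrib_left[symmetric]
 by (intro sum_mono mult_left_mono norm_triangle_ineq divide_nonneg_nonneg zero_le_power s) auto

lemma taylor_norm_cmult:
 assumes "F holomorphic_on S"
 shows "TN (%w. c * F w) = cmod c * TN F"
 unfolding taylor_norm_def higher_deriv_cmult[OF assms z S] norm_mult sum_distrib_left by (simp only: mult_ac)

lemma taylor_norm_cong:
 assumes "F holomorphic_on S" "\<And>w. w \<in> S ==> F w = G w"
 shows "TN F = TN G"
proof -
 have "G holomorphic_on S" using assms by (simp cong: holomorphic_cong)
 then have "(deriv ^^ k) F z = (deriv ^^ k) G z" for k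
 by (rule higher_deriv_transform_within_open[OF assms(1) _ S z assms(2)])
 then show ?thesis unfolding taylor_norm_def by simp
qed

lemma taylor_norm_const: "TN (%w. c) = cmod c"
proof -
 have "TN (%w. c) = (\<Sum>k\<le>K. if k = 0 then cmod c else 0)"
 unfolding taylor_norm_def by (intro sum.cong) auto
 then show ?thesis by simp
qed

text \<open>The coefficients of a product are a Cauchy product, and the truncated Cauchy product sums over part of the square.\<close>
lemma taylor_norm_mult:
 assumes F: "F holomorphic_on S" and G: "G holomorphic_on S"
 shows "TN (%w. F w * G w) <= TN F * TN G"
proof -
 let ?a = "%k. s ^ k / fact k * cmod ((deriv ^^ k) F z)" and ?b = "%k. s ^ k / fact k * cmod ((deriv ^^ k) G z)"
 have a0: "?a k >= 0" and b0: "?b k >= 0" for k using s by auto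
 have "TN (%w. F w * G w) <= (\<Sum>k\<le>K. \<Sum>i\<le>k. ?a i * ?b (k - i))"
 unfolding taylor_norm_def
 proof (rule sum_mono)
 fix k
 have "cmod ((deriv ^^ k) (%w. F w * G w) z) <= (\<Sum>i=0..k. cmod (of_nat (k choose i) * (deriv ^^ i) F z * (deriv ^^ (k - i)) G z))"
 unfolding higher_deriv_mult[OF F G S z] by (rule norm_sum)
 then have "s ^ k / fact k * cmod ((deriv ^^ k) (%w. F w * G w) z) <= s ^ k / fact k * (\<Sum>i=0..k. cmod (of_nat (k choose i) * (deriv ^^ i) F z * (deriv ^^ (k - i)) G z))"
 using s by (intro mult_left_mono) auto
 also have "\<dots> = (\<Sum>i\<le>k. ?a i * ?b (k - i))"
 unfolding sum_distrib_left atLeast0AtMost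
 proof (rule sum.cong[OF refl])
 fix i assume "i \<in> {..k}"
 then have ik: "i <= k" by simp
 have bin: "real (k choose i) / fact k = 1 / (fact i * fact (k - i))" using binomial_fact[OF ik, where ?'a = real] by simp
 have pw: "s ^ k = s ^ i * s ^ (k - i)" using ik by (simp flip: power_add)
 have "s ^ k / fact k * (real (k choose i) * x * y) = s ^ k * (real (k choose i) / fact k) * x * y" for x y by simp
 also have "\<dots> x y = s ^ i / fact i * x * (s ^ (k - i) / fact (k - i) * y)" for x y unfolding bin pw by simp
 finally have "s ^ k / fact k * (real (k choose i) * x * y) = s ^ i / fact i * x * (s ^ (k - i) / fact (k - i) * y)" for x y .
 then show "s ^ k / fact k * cmod (of_nat (k choose i) * (deriv ^^ i) F z * (deriv ^^ (k - i)) G z) = ?a i * ?b (k - i)"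
 unfolding norm_mult norm_of_nat .
 qed
 finally show "s ^ k / fact k * cmod ((deriv ^^ k) (%w. F w * G w) z) <= (\<Sum>i\<le>k. ?a i * ?b (k - i))" .
 qed
 also have "\<dots> = (\<Sum>(i,j)\<in>{(i,j). i + j <= K}. ?a i * ?b j)" by (rule sum.triangle_reindex_eq[symmetric])
 also have "\<dots> <= (\<Sum>(i,j)\<in>{..K}\<times>{..K}. ?a i * ?b j)"
 proof (rule sum_mono2)
 show "0 <= (case p of (i,j) => ?a i * ?b j)" for p by (cases p) (simp only: case_prod_conv, intro mult_nonneg_nonneg a0 b0)
 qed auto
 also have "\<dots> = TN F * TN G" unfolding taylor_norm_def sum_product sum.cartesian_product ..
 finally show ?thesis .
qed

lemma taylor_norm_exp:
 assumes x: "x >= 0"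
 shows "TN (%w. exp (2 * \<i> * w * cof x)) <= exp (- 2 * (Im z - s) * x)"
proof -
 have d: "(deriv ^^ k) (%w. exp (2 * \<i> * w * cof x)) = (%w. (2 * \<i> * cof x) ^ k * exp (2 * \<i> * w * cof x))" for k
 proof (induction k)
 case (Suc k)
 have "((%w. (2 * \<i> * cof x) ^ k * exp (2 * \<i> * w * cof x)) has_field_derivative (2 * \<i> * cof x) ^ Suc k * exp (2 * \<i> * w * cof x)) (at w)" for w
 by (auto intro!: derivative_eq_intros)
 then show ?case by (auto simp: Suc.IH DERIV_imp_deriv)
 qed simp
 have "TN (%w. exp (2 * \<i> * w * cof x)) = (\<Sum>k\<le>K. ((2 * x * s) ^ k /\<^sub>R fact k) * exp (- 2 * Im z * x))"
 unfolding taylor_norm_def d using x by (intro sum.cong refl) (simp add: norm_mult norm_power norm_exp_eq_Re power_mult_distrib divide_inverse mult_ac)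
 also have "\<dots> = (\<Sum>k\<le>K. (2 * x * s) ^ k /\<^sub>R fact k) * exp (- 2 * Im z * x)" by (rule sum_distrib_right[symmetric])
 also have "\<dots> <= exp (2 * x * s) * exp (- 2 * Im z * x)"
 proof (rule mult_right_mono)
 have "(\<Sum>k\<le>K. (2 * x * s) ^ k /\<^sub>R fact k) <= (\<Sum>k. (2 * x * s) ^ k /\<^sub>R fact k)"
 by (rule sum_le_suminf[OF sums_summable[OF exp_converges]]) (use x s in auto)
 then show "(\<Sum>k\<le>K. (2 * x * s) ^ k /\<^sub>R fact k) <= exp (2 * x * s)" by (simp only: exp_def)
 qed simp
 also have "\<dots> = exp (- 2 * (Im z - s) * x)" unfolding exp_add[symmetric] by (simp add: algebra_simps)
 finally show ?thesis .
qed

lemma taylor_norm_integral: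
 assumes h: "param_dom M S h"
 shows "ennreal (TN (%w. \<integral>x. h x w \<partial>M)) <= (\<integral>\<^sup>+x. ennreal (TN (h x)) \<partial>M)"
proof -
 have i: "integrable M (%x. (deriv ^^ k) (h x) z)" for k by (rule param_dom_integrable[OF param_dom_higher_deriv[OF h S] z])
 have [measurable]: "(%x. (deriv ^^ k) (h x) z) \<in> borel_measurable M" for k using i by auto
 have c0: "s ^ k / fact k >= 0" for k using s by simp
 have eq: "ennreal (\<Sum>k\<le>K. s ^ k / fact k * d k) = (\<Sum>k\<le>K. ennreal (s ^ k / fact k) * ennreal (d k))" if "\<And>k. d k >= 0" for d
 unfolding ennreal_mult[OF c0 that, symmetric] by (rule sum_ennreal[symmetric]) (intro mult_nonneg_nonneg c0 that)
 have "ennreal (TN (%w. \<integral>x. h x w \<partial>M)) = (\<Sum>k\<le>K. ennreal (s ^ k / fact k) * ennreal (cmod (\<integral>x. (deriv ^^ k) (h x) z \<partial>M)))"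
 unfolding taylor_norm_def higher_deriv_param_integral[OF h S z] by (rule eq) simp
 also have "\<dots> <= (\<Sum>k\<le>K. ennreal (s ^ k / fact k) * (\<integral>\<^sup>+x. ennreal (cmod ((deriv ^^ k) (h x) z)) \<partial>M))"
 by (intro sum_mono mult_left_mono integral_norm_bound_ennreal i) auto
 also have "\<dots> = (\<integral>\<^sup>+x. (\<Sum>k\<le>K. ennreal (s ^ k / fact k) * ennreal (cmod ((deriv ^^ k) (h x) z))) \<partial>M)"
 by (subst nn_integral_sum) (auto simp: nn_integral_cmult)
 also have "\<dots> = (\<integral>\<^sup>+x. ennreal (TN (h x)) \<partial>M)"
 unfolding taylor_norm_def by (intro nn_integral_cong eq[symmetric]) simp
 finally show ?thesis .
qed

lemma taylor_norm_bounded: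
 assumes r: "r > 0" "cball z r \<subseteq> S" and hol: "\<And>x. x \<in> I ==> F x holomorphic_on S"
 and B: "\<And>x w. x \<in> I ==> w \<in> cball z r ==> norm (F x w) <= B" and x: "x \<in> I"
 shows "TN (F x) <= (\<Sum>k\<le>K. s ^ k / fact k * (fact k * B / r ^ k))"
 unfolding taylor_norm_def
proof (intro sum_mono mult_left_mono)
 fix k
 show "cmod ((deriv ^^ k) (F x) z) <= fact k * B / r ^ k"
 proof (rule Cauchy_inequality)
 show "F x holomorphic_on ball z r" using hol[OF x] r ball_subset_cball by (blast intro: holomorphic_on_subset)
 show "continuous_on (cball z r) (F x)" using hol[OF x] r by (blast intro: holomorphic_on_subset holomorphic_on_imp_continuous_on)
 show "norm (F x w) <= B" if "norm (z - w) = r" for w using that by (intro B x) (simp add: dist_norm)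
 qed (rule r)
qed (use s in auto)

lemma taylor_norm_limit:
 assumes hol: "\<And>n. F n holomorphic_on S"
 and r: "r > 0" "cball z r \<subseteq> S" and ul: "uniform_limit (cball z r) F G sequentially"
 and b: "\<And>n. TN (F n) <= c n" and c: "c \<leadsto> C"
 shows "TN G <= C"
proof (rule LIMSEQ_le[OF _ c])
 show "(%n. TN (F n)) \<leadsto> TN G"
 unfolding taylor_norm_def
 proof (intro tendsto_intros)
 fix k
 show "(%n. (deriv ^^ k) (F n) z) \<leadsto> (deriv ^^ k) G z"
 proof (rule higher_deriv_complex_uniform_limit)
 show "uniform_limit (ball z r) F G sequentially" using ul by (rule uniform_limit_on_subset) (rule ball_subset_cball)
 show "\<forall>\<^sub>F n in sequentially. F n holomorphic_on ball z r"
 using hol r ball_subset_cball by (intro always_eventually allI) (blast intro: holomorphic_on_subset)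
 qed (use r in auto)
 qed
qed (use b in auto)

end


section \<open>The difference of two Schur functions\<close>

abbreviation upper :: "complex set" where "upper \<equiv> {z. Im z > 0}"

lemma open_upper_half_plane: "open upper"
 by (rule open_halfspace_Im_gt)

lemma half_line_exponential_L2:
 fixes a :: real assumes a: "a > 0"
 shows "(NN xi. ennreal ((norm (cof (indicator {0..} xi * exp (- a * xi))))^2)) < \<infinity>"
proof -
 have "(norm (cof (indicator {0..} xi * exp (- a * xi))))\<^sup>2 = indicator {0..} xi * exp (- (2 * a) * xi)" for xi :: real
 by (simp add: indicator_def power2_eq_square exp_add[symmetric] norm_mult)
 then show ?thesis using nn_integral_exp_half_line[of "2 * a"] a by simp
qed

lemma half_line_weight_integrable:
 fixes k :: "real => complex"
 assumes [measurable]: "k \<in> borel_measurable borel" and k2: "(NN xi. ennreal ((norm (k xi))^2)) < \<infinity>" and a: "a > 0"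
 shows "integrable lborel (%xi. k xi * cof (indicator {0..} xi * exp (- a * xi)))"
 by (rule L2_product_integrable[OF _ _ k2 half_line_exponential_L2[OF a]]) measurable

lemma param_dom_half_line:
 fixes k :: "real => complex"
 assumes [measurable]: "k \<in> borel_measurable borel" and k2: "(NN xi. ennreal ((norm (k xi))^2)) < \<infinity>"
 and supp: "\<And>xi. xi < 0 ==> k xi = 0" and c: "c > 0"
 shows "param_dom lborel upper (%xi w. k xi * exp (\<i> * w * cof (c * xi)))"
 unfolding param_dom_def
proof (intro conjI ballI)
 show "(%w. k xi * exp (\<i> * w * cof (c * xi))) holomorphic_on upper" for xi by (intro holomorphic_intros)
 show "(%xi. k xi * exp (\<i> * w * cof (c * xi))) \<in> borel_measurable lborel" for w by measurable
 fix z assume "z \<in> upper"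
 then have z: "Im z > 0" by simp
 have im: "Im w >= Im z / 2" if "w \<in> cball z (Im z / 2)" for w
 using that abs_Im_le_cmod[of "z - w"] by (auto simp: dist_norm abs_le_iff)
 let ?B = "%xi. norm (k xi * cof (indicator {0..} xi * exp (- (Im z / 2 * c) * xi)))"
 show "\<exists>r>0. \<exists>B. cball z r \<subseteq> upper & integrable lborel B & (\<forall>w\<in>cball z r. \<forall>xi\<in>space lborel. norm (k xi * exp (\<i> * w * cof (c * xi))) <= B xi)"
 proof (intro exI[of _ "Im z / 2"] exI[of _ ?B] conjI ballI)
 show "cball z (Im z / 2) \<subseteq> upper" using im z by force
 show "integrable lborel ?B" by (intro integrable_norm half_line_weight_integrable assms(1) k2) (use z c in simp)
 fix w xi assume w: "w \<in> cball z (Im z / 2)"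
 show "norm (k xi * exp (\<i> * w * cof (c * xi))) <= ?B xi"
 proof (cases "xi < 0")
 case False
 then have "Im z / 2 * (c * xi) <= Im w * (c * xi)" using im[OF w] c by (intro mult_right_mono) auto
 then have "exp (- (Im w * (c * xi))) <= exp (- (Im z / 2 * c) * xi)" by (simp add: mult.assoc)
 then have "norm (k xi) * exp (- (Im w * (c * xi))) <= norm (k xi) * exp (- (Im z / 2 * c) * xi)" by (intro mult_left_mono) auto
 then show ?thesis using False by (simp only: norm_mult norm_exp_eq_Re norm_of_real) (simp add: abs_of_nonneg)
 qed (simp add: supp)
 qed (use z in simp)
qed

context L2_potential
begin

text \<open>The components of the terminal solution with the oscillation of \<open>v\<close> removed; \<open>P\<close> is close to one and \<open>R\<close> close to zero.\<close>
definition P_trunc :: "real => real => complex => complex" where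
 "P_trunc X x z = (schur_trunc X z * be x z + de x z) * exp (- \<i> * z * cof x)"

definition R_trunc :: "real => real => complex => complex" where
 "R_trunc X x z = (schur_trunc X z * al x z + ga x z) * exp (- \<i> * z * cof x)"

lemma normalized_terminal_solution:
 assumes X: "X >= 0" and z: "Im z > 0"
 shows "dirac_sol q z X (%x. schur_trunc X z * al x z + ga x z) (%x. schur_trunc X z * be x z + de x z)"
 "schur_trunc X z * al X z + ga X z = 0"
 "schur_trunc X z * al 0 z + ga 0 z = schur_trunc X z" "schur_trunc X z * be 0 z + de 0 z = 1"
proof -
 have "dirac_sol q z X (%x. schur_trunc X z * al x z + 1 * ga x z) (%x. schur_trunc X z * be x z + 1 * de x z)"
 by (intro dirac_sol_lincomb dirac_sol_UV)
 then show "dirac_sol q z X (%x. schur_trunc X z * al x z + ga x z) (%x. schur_trunc X z * be x z + de x z)" by simp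
 show "schur_trunc X z * al X z + ga X z = 0" using al_nz[of z X] X z by (simp add: schur_trunc_def)
qed (simp_all add: sol_0)

lemma PR_holomorphic:
 assumes "X >= 0" "x >= 0"
 shows "P_trunc X x holomorphic_on upper" "R_trunc X x holomorphic_on upper"
proof -
 have t: "schur_trunc X holomorphic_on upper" using assms by (intro schur_trunc_holomorphic) auto
 show "P_trunc X x holomorphic_on upper" "R_trunc X x holomorphic_on upper"
 unfolding P_trunc_def[abs_def] R_trunc_def[abs_def] by (intro holomorphic_intros t sol_holomorphic assms)+
qed

lemma PR_continuous:
 assumes X: "X >= 0"
 shows "continuous_on ({0..X} \<times> upper) (%(x,z). P_trunc X x z)" "continuous_on ({0..X} \<times> upper) (%(x,z). R_trunc X x z)"
proof -
 have t: "continuous_on upper (schur_trunc X)" using X by (intro holomorphic_on_imp_continuous_on schur_trunc_holomorphic) auto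
 have ts: "continuous_on ({0..X} \<times> upper) (%p. schur_trunc X (snd p))"
 by (rule continuous_on_compose2[OF t continuous_on_snd[OF continuous_on_id]]) auto
 have U: "continuous_on ({0..X} \<times> upper) (%p. Usol a b (fst p) (snd p))" and V: "continuous_on ({0..X} \<times> upper) (%p. Vsol a b (fst p) (snd p))" for a b
 by (rule continuous_on_subset[OF sol_continuous(1)[unfolded split_def]] continuous_on_subset[OF sol_continuous(2)[unfolded split_def]], auto)+
 show "continuous_on ({0..X} \<times> upper) (%(x,z). P_trunc X x z)" "continuous_on ({0..X} \<times> upper) (%(x,z). R_trunc X x z)"
 unfolding P_trunc_def R_trunc_def split_def by (intro continuous_intros ts U V)+
qed

lemma exp_indef:
 fixes c :: complex
 shows "indef_int b (%x. exp (c * cof x)) (%x. c * exp (c * cof x))"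
proof (rule indef_int_C1)
 fix x :: real
 have "((%w. exp (c * w)) has_field_derivative c * exp (c * cof x)) (at (cof x))"
 by (auto intro!: derivative_eq_intros)
 then show "((%x. exp (c * cof x)) has_vector_derivative c * exp (c * cof x)) (at x)"
 by (rule has_vector_derivative_real_field)
qed (intro continuous_intros)

lemma P_equation:
 assumes X: "X >= 0" and z: "Im z > 0" and x: "0 <= x" "x <= X"
 shows "P_trunc X x z - 1 = (LBINT t:{0..x}. (- q t) * R_trunc X t z)"
proof -
 let ?u = "%x. schur_trunc X z * al x z + ga x z" and ?v = "%x. schur_trunc X z * be x z + de x z"
 let ?e = "%x. exp (- \<i> * z * cof x)"
 have v: "indef_int X ?v (%x. \<i> * z * ?v x - q x * ?u x)"
 using normalized_terminal_solution(1)[OF X z] unfolding dirac_sol_def by blast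
 have "indef_int X (%x. ?v x * ?e x) (%x. ?v x * (- \<i> * z * ?e x) + (\<i> * z * ?v x - q x * ?u x) * ?e x)"
 by (rule indef_int_mult[OF v exp_indef])
 then have "indef_int X (%x. P_trunc X x z) (%x. (- q x) * R_trunc X x z)"
 
 proof (rule indef_int_cong)
 fix x
 have "v * (- ii * w * e) + (ii * w * v - a * u) * e = (- a) * (u * e)" for v ii w e a u :: complex by (simp add: algebra_simps)
 then show "?v x * (- \<i> * z * ?e x) + (\<i> * z * ?v x - q x * ?u x) * ?e x = (- q x) * R_trunc X x z" unfolding R_trunc_def .
 qed (simp add: P_trunc_def)
 then have "P_trunc X x z - P_trunc X 0 z = (LBINT t:{0..x}. (- q t) * R_trunc X t z)" using x unfolding indef_int_def by blast
 moreover have "P_trunc X 0 z = 1" unfolding P_trunc_def normalized_terminal_solution(4)[OF X z] by simp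
 ultimately show ?thesis by simp
qed

lemma R_equation:
 assumes X: "X >= 0" and z: "Im z > 0" and x: "0 <= x" "x <= X"
 shows "R_trunc X x z = (LBINT t:{x..X}. cnj (q t) * (exp (2 * \<i> * z * cof (t - x)) * P_trunc X t z))"
proof -
 let ?u = "%x. schur_trunc X z * al x z + ga x z" and ?v = "%x. schur_trunc X z * be x z + de x z"
 let ?e = "%x. exp (\<i> * z * cof x)" and ?c = "exp (- 2 * \<i> * z * cof x)"
 have u: "indef_int X ?u (%x. - \<i> * z * ?u x - cnj (q x) * ?v x)"
 using normalized_terminal_solution(1)[OF X z] unfolding dirac_sol_def by blast
 have "indef_int X (%t. (- ?c) * (?u t * ?e t)) (%t. (- ?c) * (?u t * (\<i> * z * ?e t) + (- \<i> * z * ?u t - cnj (q t) * ?v t) * ?e t))"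
 by (intro indef_int_cmult indef_int_mult u exp_indef)
 then have I: "indef_int X (%t. (- ?c) * (?u t * ?e t)) (%t. cnj (q t) * (exp (2 * \<i> * z * cof (t - x)) * P_trunc X t z))"
 proof (rule indef_int_cong)
 fix t
 have "exp (2 * \<i> * z * cof (t - x)) * exp (- \<i> * z * cof t) = ?c * ?e t"
 unfolding exp_add[symmetric] by (rule arg_cong[where f = exp]) (simp add: algebra_simps)
 moreover have "a * (e1 * (v * e2)) = a * (v * g)" if "e1 * e2 = g" for a e1 e2 v g :: complex
 using that by (simp add: mult.left_commute)
 ultimately have "cnj (q t) * (exp (2 * \<i> * z * cof (t - x)) * P_trunc X t z) = cnj (q t) * (?v t * (?c * ?e t))"
 unfolding P_trunc_def by blast
 also have "\<dots> = (- ?c) * (?u t * (\<i> * z * ?e t) + (- \<i> * z * ?u t - cnj (q t) * ?v t) * ?e t)"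
 proof -
 have "a * (v * (c * e)) = (- c) * (u * (ii * w * e) + (- ii * w * u - a * v) * e)" for a v c e u ii w :: complex
 by (simp add: algebra_simps)
 then show ?thesis .
 qed
 finally show "(- ?c) * (?u t * (\<i> * z * ?e t) + (- \<i> * z * ?u t - cnj (q t) * ?v t) * ?e t) = cnj (q t) * (exp (2 * \<i> * z * cof (t - x)) * P_trunc X t z)" by (rule sym)
 qed simp
 have "(- ?c) * (?u X * ?e X) - (- ?c) * (?u x * ?e x) = (LBINT t:{x..X}. cnj (q t) * (exp (2 * \<i> * z * cof (t - x)) * P_trunc X t z))"
 using I x unfolding indef_int_def by blast
 moreover have "?u x * (?c * ?e x) = R_trunc X x z"
 proof -
 have "?c * ?e x = exp (- \<i> * z * cof x)"
 unfolding exp_add[symmetric] by (rule arg_cong[where f = exp]) (simp add: algebra_simps)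
 then show ?thesis unfolding R_trunc_def by (simp only:)
 qed
 moreover have "r = l" if "(- c) * (uX * eX) - (- c) * (u * e) = l" "u * (c * e) = r" "uX = 0" for c u e l r uX eX :: complex
 using that by (simp add: mult.left_commute)
 ultimately show ?thesis using normalized_terminal_solution(2)[OF X z] by blast
qed

context
 fixes A s :: real and K :: nat
 assumes A: "A > 0" and s: "s > 0" and small: "12 * energy <= A"
begin

abbreviation (input) "z0 \<equiv> Complex 0 (A + s)"
abbreviation (input) "TNs \<equiv> taylor_norm s K (Complex 0 (A + s))"

lemma z0_upper: "z0 \<in> upper" using A s by simp

lemmas TNset = less_imp_le[OF s] open_upper_half_plane z0_upper

lemma TN_exp: "x >= 0 ==> TNs (%w. exp (2 * \<i> * w * cof x)) <= exp (- 2 * A * x)"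
 using taylor_norm_exp[OF TNset, of x K] by simp

lemma TN_set_integral:
 fixes c :: "real => complex" and a :: "real => complex => complex"
 assumes c: "set_integrable lborel {l..r} c" and a: "continuous_on ({l..r} \<times> upper) (%(x,z). a x z)"
 and hol: "\<And>t. t \<in> {l..r} ==> a t holomorphic_on upper" and b: "\<And>t. t \<in> {l..r} ==> TNs (a t) <= b t"
 shows "ennreal (TNs (%w. LBINT t:{l..r}. c t * a t w)) <= (NN t. ennreal (indicator {l..r} t * (cmod (c t) * b t)))"
proof -
 have "ennreal (TNs (%w. LBINT t:{l..r}. c t * a t w)) <= (NN t. ennreal (TNs (%w. indicator {l..r} t *\<^sub>R (c t * a t w))))"
 unfolding set_lebesgue_integral_def by (rule taylor_norm_integral[OF TNset param_dom_indefinite[OF c open_upper_half_plane a hol]])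
 also have "\<dots> <= (NN t. ennreal (indicator {l..r} t * (cmod (c t) * b t)))"
 proof (intro nn_integral_mono ennreal_leI)
 fix t
 show "TNs (%w. indicator {l..r} t *\<^sub>R (c t * a t w)) <= indicator {l..r} t * (cmod (c t) * b t)"
 proof (cases "t \<in> {l..r}")
 case True
 have "TNs (%w. c t * a t w) = cmod (c t) * TNs (a t)" by (rule taylor_norm_cmult[OF TNset hol[OF True]])
 then show ?thesis using True b[OF True] by (simp add: mult_left_mono)
 next
 case False
 then show ?thesis using taylor_norm_const[OF TNset, of K 0] by simp
 qed
 qed
 finally show ?thesis .
qed

text \<open>By the inequality of the means with parameter \<open>A / 2\<close>: the bound is \<open>1 / 16 + energy / A\<close>, at most \<open>7 / 48\<close>.\<close>
lemma tail_weight: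
 "(NN t. ennreal (indicator {x..X} t * (cmod (q t) * exp (- 2 * A * (t - x))))) <= ennreal (1/6)"
proof -
 have E: "energy / A <= 1 / 12" using small A by (simp add: field_simps)
 have "indicator {x..X} t * (cmod (q t) * exp (- 2 * A * (t - x))) <= A / 4 * (indicator {x..} t * exp (- (4 * A) * (t - x))) + 1 / A * (cmod (q t))^2" for t
 proof (cases "t \<in> {x..X}")
 case True
 have am: "b * a <= A / 4 * a\<^sup>2 + 1 / A * b\<^sup>2" for a b
 proof -
 have "0 <= (A * a / 2 - b)\<^sup>2 / A" using A by simp
 also have "\<dots> = A / 4 * a\<^sup>2 + 1 / A * b\<^sup>2 - b * a" using A by (simp add: power2_eq_square field_simps)
 finally show ?thesis by simp
 qed
 have "(exp (- 2 * A * (t - x)))\<^sup>2 = exp (- (4 * A) * (t - x))" by (simp add: power2_eq_square exp_add[symmetric])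
 then show ?thesis using am[of "cmod (q t)" "exp (- 2 * A * (t - x))"] True by (simp only:) simp
 qed (use A in simp)
 then have "(NN t. ennreal (indicator {x..X} t * (cmod (q t) * exp (- 2 * A * (t - x)))))
 <= (NN t. ennreal (A / 4) * ennreal (indicator {x..} t * exp (- (4 * A) * (t - x))) + ennreal (1 / A) * ennreal ((cmod (q t))^2))"
 using A by (intro nn_integral_mono) (simp only: ennreal_mult[symmetric] ennreal_plus[symmetric] ennreal_leI divide_nonneg_pos zero_le_power2 mult_nonneg_nonneg indicator_pos_le exp_ge_zero zero_le_one less_imp_le zero_less_numeral)
 also have "\<dots> = ennreal (A / 4) * (NN t. ennreal (indicator {x..} t * exp (- (4 * A) * (t - x)))) + ennreal (1 / A) * ennreal energy"
 by (subst nn_integral_add) (simp_all add: nn_integral_cmult nn_energy)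
 also have "(NN t. ennreal (indicator {x..} t * exp (- (4 * A) * (t - x)))) = ennreal (1 / (4 * A))"
 proof -
 have "(NN t. ennreal (indicator {x..} t * exp (- (4 * A) * (t - x)))) = (NN xi. ennreal (indicator {x..} (x + 1 * xi) * exp (- (4 * A) * (x + 1 * xi - x))))"
 by (subst nn_integral_real_affine[where c = 1 and t = x]) auto
 also have "\<dots> = (NN xi. ennreal (indicator {0..} xi * exp (- (4 * A) * xi)))"
 by (intro nn_integral_cong) (simp add: indicator_def)
 finally show ?thesis using nn_integral_exp_half_line[of "4 * A"] A by simp
 qed
 also have "ennreal (A / 4) * ennreal (1 / (4 * A)) + ennreal (1 / A) * ennreal energy = ennreal (1 / 16 + energy / A)"
 using A energy_nonneg by (simp add: ennreal_mult[symmetric] ennreal_plus[symmetric] del: ennreal_plus)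
 also have "\<dots> <= ennreal (1 / 6)" using E by (intro ennreal_leI) simp
 finally show ?thesis .
qed

text \<open>One round through both integral equations gains the factor \<open>energy / (2 A) \<le> 1 / 24\<close>.\<close>
lemma PR_taylor_step:
 assumes X: "X >= 0" and B: "\<And>t. t \<in> {0..X} ==> TNs (P_trunc X t) <= B" "B >= 0"
 shows "x \<in> {0..X} ==> ennreal (TNs (R_trunc X x)) <= ennreal B * (NN t. ennreal (indicator {x..X} t * (cmod (q t) * exp (- 2 * A * (t - x)))))"
 and "x \<in> {0..X} ==> TNs (%w. P_trunc X x w - 1) <= B / 24"
proof -
 have R: "ennreal (TNs (R_trunc X x)) <= ennreal B * (NN t. ennreal (indicator {x..X} t * (cmod (q t) * exp (- 2 * A * (t - x)))))" if x: "x \<in> {0..X}" for x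
 proof -
 let ?a = "%t w. exp (2 * \<i> * w * cof (t - x)) * P_trunc X t w"
 have eh: "(%w. exp (2 * \<i> * w * cof y)) holomorphic_on upper" for y by (intro holomorphic_intros)
 have "TNs (R_trunc X x) = TNs (%w. LBINT t:{x..X}. cnj (q t) * ?a t w)"
 by (rule taylor_norm_cong[OF TNset PR_holomorphic(2)]) (use x R_equation X in auto)
 moreover have "ennreal (TNs (%w. LBINT t:{x..X}. cnj (q t) * ?a t w)) <= (NN t. ennreal (indicator {x..X} t * (cmod (cnj (q t)) * (exp (- 2 * A * (t - x)) * B))))"
 proof (rule TN_set_integral[OF cq_set_integrable])
 show "continuous_on ({x..X} \<times> upper) (%(t,w). ?a t w)"
 proof -
 have "continuous_on ({x..X} \<times> upper) (%(x,z). P_trunc X x z)" using PR_continuous(1)[OF X] x by (auto intro: continuous_on_subset)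
 then have "continuous_on ({x..X} \<times> upper) (%p. P_trunc X (fst p) (snd p))" by (simp only: split_def)
 then show ?thesis unfolding split_def by (intro continuous_intros)
 qed
 fix t assume t: "t \<in> {x..X}"
 then have t': "t \<in> {0..X}" using x by auto
 have Ph: "P_trunc X t holomorphic_on upper" using PR_holomorphic(1)[OF X] t' by auto
 show "?a t holomorphic_on upper" by (intro holomorphic_on_mult eh Ph)
 have "TNs (?a t) <= TNs (%w. exp (2 * \<i> * w * cof (t - x))) * TNs (P_trunc X t)" by (rule taylor_norm_mult[OF TNset eh Ph])
 also have "\<dots> <= exp (- 2 * A * (t - x)) * B" using t by (intro mult_mono TN_exp B(1)[OF t'] taylor_norm_nonneg[OF TNset]) auto
 finally show "TNs (?a t) <= exp (- 2 * A * (t - x)) * B" .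
 qed
 moreover have "(NN t. ennreal (indicator {x..X} t * (cmod (cnj (q t)) * (exp (- 2 * A * (t - x)) * B)))) = ennreal B * (NN t. ennreal (indicator {x..X} t * (cmod (q t) * exp (- 2 * A * (t - x)))))"
 proof -
 have "ennreal (i * (cmod (cnj (q t)) * (e * B))) = ennreal B * ennreal (i * (cmod (q t) * e))" if "i >= 0" "e >= 0" for i e t
 using that B(2) by (subst ennreal_mult[symmetric]) (simp_all add: mult_ac)
 then have "(NN t. ennreal (indicator {x..X} t * (cmod (cnj (q t)) * (exp (- 2 * A * (t - x)) * B)))) = (NN t. ennreal B * ennreal (indicator {x..X} t * (cmod (q t) * exp (- 2 * A * (t - x)))))"
 by (intro nn_integral_cong) (simp only: indicator_pos_le exp_ge_zero)
 also have "\<dots> = ennreal B * (NN t. ennreal (indicator {x..X} t * (cmod (q t) * exp (- 2 * A * (t - x)))))" by (rule nn_integral_cmult) measurable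
 finally show ?thesis .
 qed
 ultimately show ?thesis by (simp only:)
 qed
 then show "x \<in> {0..X} ==> ennreal (TNs (R_trunc X x)) <= ennreal B * (NN t. ennreal (indicator {x..X} t * (cmod (q t) * exp (- 2 * A * (t - x)))))" .
 assume x: "x \<in> {0..X}"
 let ?k = "%t u. indicator {0..X} u * indicator {0..u} t * exp (- 2 * A * (u - t)) * cmod (q t) * cmod (q u) :: real"
 have k_if: "?k t u = (if 0 <= t & t <= u & u <= X then exp (- 2 * A * (u - t)) * cmod (q t) * cmod (q u) else 0)" for t u
 by (auto simp: indicator_def)
 have km1: "(%(t, u). ennreal (?k t u)) \<in> borel_measurable (lborel \<Otimes>\<^sub>M lborel)" unfolding k_if by measurable
 have km2: "(%(u, t). ennreal (?k t u)) \<in> borel_measurable (lborel \<Otimes>\<^sub>M lborel)" unfolding k_if by measurable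
 have "TNs (%w. P_trunc X x w - 1) = TNs (%w. LBINT t:{0..x}. (- q t) * R_trunc X t w)"
 proof (rule taylor_norm_cong[OF TNset])
 show "(%w. P_trunc X x w - 1) holomorphic_on upper" by (intro holomorphic_intros PR_holomorphic X) (use x in auto)
 qed (use x X P_equation in auto)
 then have "ennreal (TNs (%w. P_trunc X x w - 1)) = ennreal (TNs (%w. LBINT t:{0..x}. (- q t) * R_trunc X t w))" by (rule arg_cong)
 also have "ennreal (TNs (%w. LBINT t:{0..x}. (- q t) * R_trunc X t w)) <= (NN t. ennreal (indicator {0..x} t * (cmod (- q t) * TNs (R_trunc X t))))"
 proof (rule TN_set_integral)
 show "set_integrable lborel {0..x} (%t. - q t)" using q_set_integrable[of 0 x] by (simp add: set_integrable_def)
 show "continuous_on ({0..x} \<times> upper) (%(x,z). R_trunc X x z)" using PR_continuous(2)[OF X] x by (auto intro: continuous_on_subset)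
 qed (use PR_holomorphic(2)[OF X] in auto)
 also have "\<dots> <= (NN t. ennreal B * (NN u. ennreal (?k t u)))"
 proof (rule nn_integral_mono)
 fix t
 show "ennreal (indicator {0..x} t * (cmod (- q t) * TNs (R_trunc X t))) <= ennreal B * (NN u. ennreal (?k t u))"
 proof (cases "t \<in> {0..x}")
 case True
 then have t: "t \<in> {0..X}" using x by auto
 have "ennreal (indicator {0..x} t * (cmod (- q t) * TNs (R_trunc X t))) = ennreal (cmod (q t)) * ennreal (TNs (R_trunc X t))"
 using True taylor_norm_nonneg[OF TNset] by (simp add: ennreal_mult)
 also have "\<dots> <= ennreal (cmod (q t)) * (ennreal B * (NN u. ennreal (indicator {t..X} u * (cmod (q u) * exp (- 2 * A * (u - t))))))"
 by (intro mult_left_mono R[OF t]) simp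
 also have "\<dots> = ennreal B * (ennreal (cmod (q t)) * (NN u. ennreal (indicator {t..X} u * (cmod (q u) * exp (- 2 * A * (u - t))))))" by (simp only: mult_ac)
 also have "ennreal (cmod (q t)) * (NN u. ennreal (indicator {t..X} u * (cmod (q u) * exp (- 2 * A * (u - t))))) = (NN u. ennreal (cmod (q t)) * ennreal (indicator {t..X} u * (cmod (q u) * exp (- 2 * A * (u - t)))))"
 by (rule nn_integral_cmult[symmetric]) measurable
 also have "\<dots> = (NN u. ennreal (?k t u))"
 proof (rule nn_integral_cong)
 fix u
 show "ennreal (cmod (q t)) * ennreal (indicator {t..X} u * (cmod (q u) * exp (- 2 * A * (u - t)))) = ennreal (?k t u)"
 using t by (subst ennreal_mult[symmetric]) (auto simp: indicator_def)
 qed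
 finally show ?thesis .
 qed simp
 qed
 also have "\<dots> = ennreal B * (NN t. (NN u. ennreal (?k t u)))" by (rule nn_integral_cmult[OF lborel.borel_measurable_nn_integral[OF km1]])
 also have "(NN t. (NN u. ennreal (?k t u))) = (NN u. (NN t. ennreal (?k t u)))" by (rule lborel_pair.Fubini'[OF km2])
 also have "ennreal B * (NN u. (NN t. ennreal (?k t u))) <= ennreal B * ennreal (energy / (2 * A))"
 by (rule mult_left_mono[OF young_nn[OF A]]) simp
 also have "\<dots> = ennreal (B * (energy / (2 * A)))" using B(2) A energy_nonneg by (intro ennreal_mult[symmetric]) auto
 also have "\<dots> <= ennreal (B * (1 / 24))"
 proof (rule ennreal_leI[OF mult_left_mono[OF _ B(2)]])
 show "energy / (2 * A) <= 1 / 24" using small A by (simp add: pos_divide_le_eq)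
 qed
 finally have "ennreal (TNs (%w. P_trunc X x w - 1)) <= ennreal (B * (1 / 24))" .
 moreover have "B * (1 / 24) >= 0" using B(2) by simp
 ultimately have "TNs (%w. P_trunc X x w - 1) <= B * (1 / 24)" by (simp only: ennreal_le_iff)
 then show "TNs (%w. P_trunc X x w - 1) <= B / 24" by (simp only: times_divide_eq_right mult_1_right)
qed

text \<open>The supremum \<open>M\<close> of the sizes of \<open>P\<close> is finite by Cauchy's inequality, so \<open>M \<le> 1 + M / 24\<close> gives \<open>M \<le> 24 / 23\<close>.\<close>
lemma PR_taylor_bounds:
 assumes X: "X >= 0" and x: "x \<in> {0..X}"
 shows "TNs (%w. P_trunc X x w - 1) <= 1/23" "TNs (R_trunc X x) <= 4/23"
proof -
 let ?p = "%t. TNs (P_trunc X t)"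
 have split: "?p t <= 1 + TNs (%w. P_trunc X t w - 1)" if t: "t \<in> {0..X}" for t
 proof -
 have "?p t = TNs (%w. 1 + (P_trunc X t w - 1))" by simp
 also have "\<dots> <= TNs (%w. 1) + TNs (%w. P_trunc X t w - 1)"
 by (rule taylor_norm_add[OF TNset]) (use t in \<open>auto intro!: holomorphic_intros PR_holomorphic X\<close>)
 finally show ?thesis using taylor_norm_const[OF TNset, of K 1] by simp
 qed
 have bdd: "\<exists>B0. \<forall>t\<in>{0..X}. ?p t <= B0"
 proof -
 let ?r = "(A + s) / 2"
 have r: "?r > 0" "cball z0 ?r \<subseteq> upper"
 proof -
 show "?r > 0" using A s by simp
 show "cball z0 ?r \<subseteq> upper"
 proof
 fix w assume "w \<in> cball z0 ?r"
 then have "\<bar>Im (z0 - w)\<bar> <= ?r" using abs_Im_le_cmod[of "z0 - w"] by (simp add: dist_norm)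
 then have "Im (z0 - w) <= ?r" by (rule order.trans[OF abs_ge_self])
 then show "w \<in> upper" using A s by simp
 qed
 qed
 have "continuous_on ({0..X} \<times> cball z0 ?r) (%(x,z). P_trunc X x z)" by (rule continuous_on_subset[OF PR_continuous(1)[OF X]]) (use r in auto)
 then have "compact ((%(x,z). P_trunc X x z) ` ({0..X} \<times> cball z0 ?r))" by (rule compact_continuous_image) (intro compact_Times compact_Icc compact_cball)
 then have "bounded ((%(x,z). P_trunc X x z) ` ({0..X} \<times> cball z0 ?r))" by (rule compact_imp_bounded)
 from this[unfolded bounded_iff] obtain C where C: "\<forall>y\<in>(%(x,z). P_trunc X x z) ` ({0..X} \<times> cball z0 ?r). norm y <= C" ..
 show ?thesis
 proof (intro exI ballI)
 fix t assume t: "t \<in> {0..X}"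
 show "?p t <= (\<Sum>k\<le>K. s ^ k / fact k * (fact k * C / ?r ^ k))"
 proof (rule taylor_norm_bounded[OF TNset r, where I = "{0..X}" and F = "P_trunc X"])
 show "norm (P_trunc X x w) <= C" if "x \<in> {0..X}" "w \<in> cball z0 ?r" for x w
 proof -
 have "(%(x,z). P_trunc X x z) (x, w) \<in> (%(x,z). P_trunc X x z) ` ({0..X} \<times> cball z0 ?r)" by (rule imageI, rule SigmaI[OF that])
 from bspec[OF C this] show ?thesis by (simp only: case_prod_conv)
 qed
 qed (use PR_holomorphic(1)[OF X] t in auto)
 qed
 qed
 define M where "M = Sup (?p ` {0..X})"
 have ba: "bdd_above (?p ` {0..X})" using bdd by (auto simp: bdd_above_def)
 have pM: "?p t <= M" if "t \<in> {0..X}" for t unfolding M_def by (rule cSUP_upper[OF that ba])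
 have M0: "M >= 0" using pM[OF x] taylor_norm_nonneg[OF TNset, of K "P_trunc X x"] by linarith
 have "M <= 1 + M / 24" unfolding M_def
 proof (rule cSUP_least)
 show "{0..X} \<noteq> {}" using X by simp
 show "?p t <= 1 + Sup (?p ` {0..X}) / 24" if "t \<in> {0..X}" for t
 using split[OF that] PR_taylor_step(2)[OF X pM M0 that] unfolding M_def by linarith
 qed
 then have M: "M <= 24/23" by simp
 show "TNs (%w. P_trunc X x w - 1) <= 1/23" using PR_taylor_step(2)[OF X pM M0 x] M by linarith
 have "ennreal (TNs (R_trunc X x)) <= ennreal M * ennreal (1/6)"
 by (rule order.trans[OF PR_taylor_step(1)[OF X pM M0 x] mult_left_mono[OF tail_weight zero_le]])
 also have "\<dots> = ennreal (M * (1/6))" using M0 by (intro ennreal_mult[symmetric]) auto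
 also have "\<dots> <= ennreal (4/23)" using M by (intro ennreal_leI) simp
 finally show "TNs (R_trunc X x) <= 4/23" by (simp add: ennreal_le_iff)
qed

end

end


text \<open>The remainder consists of \<open>P P' - 1\<close>, of size at most \<open>47 / 529\<close>, of \<open>R R'\<close>, of size at most \<open>16 / 529\<close>, and of the part of the leading term beyond the truncation, which disappears in the limit.  The sum \<open>63 / 529\<close> is below one half.\<close>
theorem schur_difference_taylor:
 fixes q q' :: "real => complex" and A s :: real and K :: nat
 assumes q: "L2_potential q" and q': "L2_potential q'"
 and A: "A > 0" and s: "s > 0" and small: "12 * L2_potential.energy q <= A" "12 * L2_potential.energy q' <= A"
 and supp: "\<And>x. x < 0 ==> q x - q' x = 0"
 shows "taylor_norm s K (Complex 0 (A + s))
 (%z. L2_potential.schur q z - L2_potential.schur q' z - (LBINT x. cnj (q x - q' x) * exp (2 * \<i> * z * cof x)))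
 <= (LBINT x. cmod (q x - q' x) * exp (- 2 * A * x)) / 2"
proof -
 interpret a: L2_potential q by (rule q)
 interpret b: L2_potential q' by (rule q')
 let ?N = "taylor_norm s K (Complex 0 (A + s))"
 have zu: "Complex 0 (A + s) \<in> upper" using A s by simp
 note TNset = less_imp_le[OF s] open_upper_half_plane zu
 note N_exp = a.TN_exp[OF A s small(1)]
 note N_set = a.TN_set_integral[OF A s small(1)]
 define \<Delta> where "\<Delta> x = q x - q' x" for x
 have \<Delta>m[measurable]: "\<Delta> \<in> borel_measurable borel" using a.q_meas b.q_meas unfolding \<Delta>_def[abs_def] by measurable
 have \<Delta>0: "\<Delta> x = 0" if "x < 0" for x using supp[OF that] by (simp add: \<Delta>_def)
 have \<Delta>2: "(NN x. ennreal ((norm (cnj (\<Delta> x)))^2)) < \<infinity>"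
 proof -
 have "(NN x. ennreal ((norm (q x - q' x))^2)) <= 2 * (NN x. ennreal ((norm (q x - 0))^2)) + 2 * (NN x. ennreal ((norm (0 - q' x))^2))"
 by (rule nn_L2_triangle) measurable
 also have "\<dots> < \<infinity>" by (simp add: a.nn_energy b.nn_energy ennreal_mult_less_top)
 finally show ?thesis unfolding \<Delta>_def complex_mod_cnj .
 qed
 have c\<Delta>m[measurable]: "(%x. cnj (\<Delta> x)) \<in> borel_measurable borel"
 proof -
 have "cnj \<in> borel_measurable borel" by (rule borel_measurable_continuous_onI) (intro continuous_intros)
 from measurable_compose[OF \<Delta>m this] show ?thesis .
 qed
 have c\<Delta>i: "set_integrable lborel {l..r} (%x. cnj (\<Delta> x))" and \<Delta>i: "set_integrable lborel {l..r} \<Delta>" for l r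
 using set_integral_diff(1)[OF a.cq_set_integrable b.cq_set_integrable] set_integral_diff(1)[OF a.q_set_integrable b.q_set_integrable] by (simp_all add: \<Delta>_def[abs_def])
 define E where "E z x = exp (2 * \<i> * z * cof x)" for z x
 have Eh: "(%w. E w x) holomorphic_on upper" for x unfolding E_def by (intro holomorphic_intros)
 define w where "w x = cmod (\<Delta> x) * exp (- 2 * A * x)" for x
 have wi: "integrable lborel w"
 proof -
 have "integrable lborel (%x. norm (cnj (\<Delta> x) * cof (indicator {0..} x * exp (- (2 * A) * x))))"
 by (intro integrable_norm half_line_weight_integrable c\<Delta>m \<Delta>2) (use A in simp)
 moreover have "norm (cnj (\<Delta> x) * cof (indicator {0..} x * exp (- (2 * A) * x))) = w x" for x
 using \<Delta>0[of x] by (cases "x < 0") (simp_all add: w_def norm_mult)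
 ultimately show ?thesis by simp
 qed
 have w0: "w x >= 0" for x by (simp add: w_def)
 have E_alt: "E z x = exp (\<i> * z * cof (2 * x))" for z x
 unfolding E_def by (rule arg_cong[where f = exp]) simp
 have pd: "param_dom lborel upper (%x z. (indicator S x *\<^sub>R (c * cnj (\<Delta> x))) * E z x)" if [measurable]: "S \<in> sets borel" and c: "cmod c = 1" for S c
 proof -
 have "(NN x. ennreal ((norm (indicator S x *\<^sub>R (c * cnj (\<Delta> x))))^2)) <= (NN x. ennreal ((norm (cnj (\<Delta> x)))^2))"
 by (intro nn_integral_mono ennreal_leI power_mono) (auto simp: indicator_def norm_mult c)
 from this \<Delta>2 have fin: "(NN x. ennreal ((norm (indicator S x *\<^sub>R (c * cnj (\<Delta> x))))^2)) < \<infinity>" by (rule le_less_trans)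
 show ?thesis unfolding E_alt
 proof (rule param_dom_half_line[OF _ fin])
 show "(%x. indicator S x *\<^sub>R (c * cnj (\<Delta> x))) \<in> borel_measurable borel" by measurable
 qed (simp_all add: \<Delta>0)
 qed
 have pd1: "param_dom lborel upper (%x z. (indicator S x *\<^sub>R cnj (\<Delta> x)) * E z x)" if "S \<in> sets borel" for S
 using pd[OF that, of 1] by simp
 define H where "H z = (LBINT x. cnj (\<Delta> x) * E z x)" for z
 have H_hol: "H holomorphic_on upper"
 using holomorphic_param_integral[OF pd1[of UNIV] open_upper_half_plane] unfolding H_def[abs_def] by simp
 define F where "F n z = a.schur_trunc (real n) z - b.schur_trunc (real n) z - H z" for n z
 define tl where "tl n = (LBINT x. indicator {real n<..} x * w x)" for n
 have F_hol: "F n holomorphic_on upper" for n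
 unfolding F_def[abs_def] by (intro holomorphic_intros a.schur_trunc_holomorphic b.schur_trunc_holomorphic H_hol) auto
 have FN: "?N (F n) <= (LBINT x. w x) / 2 + tl n" for n
 proof -
 let ?X = "real n"
 have X: "?X >= 0" by simp
 let ?P = "a.P_trunc ?X" and ?P' = "b.P_trunc ?X" and ?R = "a.R_trunc ?X" and ?R' = "b.R_trunc ?X"
 define f1 where "f1 x z = (?P x z * ?P' x z - 1) * E z x" for x z
 define f2 where "f2 x z = ?R x z * ?R' x z * E z x" for x z
 define I1 where "I1 z = (LBINT x:{0..?X}. cnj (\<Delta> x) * f1 x z)" for z
 define I2 where "I2 z = (LBINT x:{0..?X}. - \<Delta> x * f2 x z)" for z
 define I3 where "I3 z = (LBINT x. (indicator {?X<..} x *\<^sub>R (- 1 * cnj (\<Delta> x))) * E z x)" for z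
 have cont: "continuous_on ({0..?X} \<times> upper) (%p. E (snd p) (fst p))" unfolding E_def by (intro continuous_intros)
 note cs = a.PR_continuous[OF X, unfolded split_def] b.PR_continuous[OF X, unfolded split_def]
 have c1: "continuous_on ({0..?X} \<times> upper) (%(x,z). f1 x z)" and c2: "continuous_on ({0..?X} \<times> upper) (%(x,z). f2 x z)"
 unfolding f1_def f2_def split_def by (intro continuous_intros cs cont)+
 have hs: "?P x holomorphic_on upper" "?P' x holomorphic_on upper" "?R x holomorphic_on upper" "?R' x holomorphic_on upper" if "x \<in> {0..?X}" for x
 using a.PR_holomorphic[OF X, of x] b.PR_holomorphic[OF X, of x] that by auto
 have h1: "f1 x holomorphic_on upper" and h2: "f2 x holomorphic_on upper" if "x \<in> {0..?X}" for x
 unfolding f1_def[abs_def] f2_def[abs_def] by (intro holomorphic_intros hs[OF that] Eh)+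
 have split: "F n z = I1 z + I2 z + I3 z" if z: "z \<in> upper" for z
 proof -
 have z': "Im z > 0" using z by simp
 let ?u = "%x. a.schur_trunc ?X z * a.al x z + a.ga x z" and ?v = "%x. a.schur_trunc ?X z * a.be x z + a.de x z"
 let ?u' = "%x. b.schur_trunc ?X z * b.al x z + b.ga x z" and ?v' = "%x. b.schur_trunc ?X z * b.be x z + b.de x z"
 note na = a.normalized_terminal_solution[OF X z'] and nb = b.normalized_terminal_solution[OF X z']
 have "indef_int ?X (%x. ?u x * ?v' x - ?u' x * ?v x) (%x. (q x - q' x) * (?u x * ?u' x) - cnj (q x - q' x) * (?v x * ?v' x))"
 by (rule wronskian[OF na(1) nb(1)])
 then have wr: "(?u ?X * ?v' ?X - ?u' ?X * ?v ?X) - (?u 0 * ?v' 0 - ?u' 0 * ?v 0) = (LBINT x:{0..?X}. (q x - q' x) * (?u x * ?u' x) - cnj (q x - q' x) * (?v x * ?v' x))"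
 unfolding indef_int_def using X by blast
 have g1: "f - f' = - L" if "(a1 * b1 - a2 * b2) - (u0 * v0' - u0' * v0) = L" "a1 = 0" "a2 = 0" "u0 = f" "u0' = f'" "v0 = 1" "v0' = 1"
 for f f' L a1 b1 a2 b2 u0 v0 u0' v0' :: complex using that by auto
 have W: "a.schur_trunc ?X z - b.schur_trunc ?X z = - (LBINT x:{0..?X}. \<Delta> x * (?u x * ?u' x) - cnj (\<Delta> x) * (?v x * ?v' x))"
 unfolding \<Delta>_def by (rule g1[OF wr na(2) nb(2) na(3) nb(3) na(4) nb(4)])
 have EE: "exp (- \<i> * z * cof x) * exp (- \<i> * z * cof x) * E z x = 1" for x
 proof -
 have "- \<i> * z * cof x + - \<i> * z * cof x + 2 * \<i> * z * cof x = 0" by (simp add: algebra_simps)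
 then show ?thesis unfolding E_def exp_add[symmetric] by (simp only: exp_zero)
 qed
 have uu: "?u x * ?u' x = f2 x z" and vv: "?v x * ?v' x = f1 x z + E z x" for x
 proof -
 have k: "(c * e) * (d * e) * g = c * d" if "e * e * g = 1" for c d e g :: complex
 proof -
 have "(c * e) * (d * e) * g = c * d * (e * e * g)" by (simp only: mult_ac)
 then show ?thesis using that by simp
 qed
 show "?u x * ?u' x = f2 x z" unfolding f2_def a.R_trunc_def b.R_trunc_def k[OF EE] ..
 show "?v x * ?v' x = f1 x z + E z x" unfolding f1_def a.P_trunc_def b.P_trunc_def left_diff_distrib k[OF EE] by simp
 qed
 have sc: "set_integrable lborel {0..?X} (%x. g x * h x)" if "set_integrable lborel {0..?X} g" "continuous_on {0..?X} h" for g h :: "real => complex"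
 using set_integrable_continuous_mult[OF that(2) that(1)] by (simp only: mult.commute)
 have fix_z: "continuous_on {0..?X} (%x. f x z)" if "continuous_on ({0..?X} \<times> upper) (%(x,z). f x z)" for f :: "real => complex => complex"
 proof -
 have c: "continuous_on {0..?X} (%x. (x, z))" by (intro continuous_intros)
 have m: "(%x. (x, z)) ` {0..?X} \<subseteq> {0..?X} \<times> upper" using z by auto
 show ?thesis using continuous_on_compose2[OF that c m] by (simp only: case_prod_conv)
 qed
 have Ec: "continuous_on {0..?X} (%x. E z x)" unfolding E_def by (intro continuous_intros)
 note i1 = sc[OF c\<Delta>i fix_z[OF c1]] and i2 = sc[OF \<Delta>i fix_z[OF c2]] and i3 = sc[OF c\<Delta>i Ec]
 have "(LBINT x:{0..?X}. \<Delta> x * (?u x * ?u' x) - cnj (\<Delta> x) * (?v x * ?v' x)) = (LBINT x:{0..?X}. \<Delta> x * f2 x z - (cnj (\<Delta> x) * f1 x z + cnj (\<Delta> x) * E z x))"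
 by (simp only: uu vv) (simp only: distrib_left)
 also have "\<dots> = (LBINT x:{0..?X}. \<Delta> x * f2 x z) - ((LBINT x:{0..?X}. cnj (\<Delta> x) * f1 x z) + (LBINT x:{0..?X}. cnj (\<Delta> x) * E z x))"
 by (subst set_integral_diff(2)[OF i2 set_integral_add(1)[OF i1 i3]], subst set_integral_add(2)[OF i1 i3], rule refl)
 finally have L: "(LBINT x:{0..?X}. \<Delta> x * (?u x * ?u' x) - cnj (\<Delta> x) * (?v x * ?v' x)) = (LBINT x:{0..?X}. \<Delta> x * f2 x z) - ((LBINT x:{0..?X}. cnj (\<Delta> x) * f1 x z) + (LBINT x:{0..?X}. cnj (\<Delta> x) * E z x))" .
 have neg: "- (a - (b + c)) = - a + b + c" for a b c :: complex by simp
 have "a.schur_trunc ?X z - b.schur_trunc ?X z = - (LBINT x:{0..?X}. \<Delta> x * f2 x z) + I1 z + (LBINT x:{0..?X}. cnj (\<Delta> x) * E z x)"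
 unfolding W L I1_def by (rule neg)
 also have "- (LBINT x:{0..?X}. \<Delta> x * f2 x z) = I2 z"
 unfolding I2_def set_lebesgue_integral_def by (simp only: mult_minus_left scaleR_minus_right Bochner_Integration.integral_minus)
 finally have D: "a.schur_trunc ?X z - b.schur_trunc ?X z = I2 z + I1 z + (LBINT x:{0..?X}. cnj (\<Delta> x) * E z x)" .
 have Hz: "H z = (LBINT x:{0..?X}. cnj (\<Delta> x) * E z x) - I3 z"
 proof -
 have "integrable lborel (%x. (indicator S x *\<^sub>R cnj (\<Delta> x)) * E z x)" if "S \<in> sets borel" for S
 by (rule param_dom_integrable[OF pd1[OF that] z])
 note j = this[of "{0..?X}"] this[of "{?X<..}"]
 have "H z = (LBINT x. (indicator {0..?X} x *\<^sub>R cnj (\<Delta> x)) * E z x + (indicator {?X<..} x *\<^sub>R cnj (\<Delta> x)) * E z x)"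
 unfolding H_def by (intro LINT_cong refl) (auto simp: indicator_def \<Delta>0)
 also have "\<dots> = (LBINT x. (indicator {0..?X} x *\<^sub>R cnj (\<Delta> x)) * E z x) + (LBINT x. (indicator {?X<..} x *\<^sub>R cnj (\<Delta> x)) * E z x)"
 by (rule LINT_add) (use j in auto)
 also have "(LBINT x. (indicator {?X<..} x *\<^sub>R cnj (\<Delta> x)) * E z x) = - I3 z" unfolding I3_def by simp
 finally show ?thesis by (simp add: set_lebesgue_integral_def)
 qed
 have g2: "D - h = i1 + i2 + i3" if "D = i2 + i1 + c" "h = c - i3" for D h i1 i2 i3 c :: complex using that by simp
 show ?thesis unfolding F_def by (rule g2[OF D Hz])
 qed
 have N1: "ennreal (?N I1) <= (NN x. ennreal (indicator {0..?X} x * (cmod (cnj (\<Delta> x)) * (47/529 * exp (- 2 * A * x)))))"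
 unfolding I1_def[abs_def]
 proof (rule N_set[OF c\<Delta>i c1 h1])
 fix x assume x: "x \<in> {0..?X}"
 have p: "?N (%w. ?P x w - 1) <= 1/23" "?N (%w. ?P' x w - 1) <= 1/23"
 using a.PR_taylor_bounds(1)[OF A s small(1) X x] b.PR_taylor_bounds(1)[OF A s small(2) X x] .
 have hp: "(%w. ?P x w - 1) holomorphic_on upper" "(%w. ?P' x w - 1) holomorphic_on upper" by (intro holomorphic_intros hs[OF x])+
 have e: "(%w. ?P x w * ?P' x w - 1) = (%w. (?P x w - 1) * (?P' x w - 1) + ((?P x w - 1) + (?P' x w - 1)))" by (rule ext) (simp add: algebra_simps)
 have "?N (%w. ?P x w * ?P' x w - 1) <= ?N (%w. (?P x w - 1) * (?P' x w - 1)) + ?N (%w. (?P x w - 1) + (?P' x w - 1))"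
 unfolding e by (rule taylor_norm_add[OF TNset]) (intro holomorphic_on_mult holomorphic_on_add hp)+
 also have "\<dots> <= 1/23 * (1/23) + (1/23 + 1/23)"
 proof (rule add_mono)
 show "?N (%w. (?P x w - 1) * (?P' x w - 1)) <= 1/23 * (1/23)"
 by (rule order.trans[OF taylor_norm_mult[OF TNset hp]]) (intro mult_mono p taylor_norm_nonneg[OF TNset], simp)
 show "?N (%w. (?P x w - 1) + (?P' x w - 1)) <= 1/23 + 1/23"
 by (rule order.trans[OF taylor_norm_add[OF TNset hp]]) (intro add_mono p)
 qed
 finally have pp: "?N (%w. ?P x w * ?P' x w - 1) <= 47/529" by simp
 have "?N (f1 x) <= ?N (%w. ?P x w * ?P' x w - 1) * ?N (%w. E w x)"
 unfolding f1_def[abs_def] by (rule taylor_norm_mult[OF TNset]) (intro holomorphic_intros hs[OF x] Eh)+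
 also have "\<dots> <= 47/529 * exp (- 2 * A * x)"
 unfolding E_def using x by (intro mult_mono pp N_exp taylor_norm_nonneg[OF TNset]) auto
 finally show "?N (f1 x) <= 47/529 * exp (- 2 * A * x)" .
 qed
 have N2: "ennreal (?N I2) <= (NN x. ennreal (indicator {0..?X} x * (cmod (- \<Delta> x) * (16/529 * exp (- 2 * A * x)))))"
 unfolding I2_def[abs_def]
 proof (rule N_set[OF _ c2 h2])
 show "set_integrable lborel {0..?X} (%x. - \<Delta> x)" using \<Delta>i[of 0 ?X] by (simp add: set_integrable_def)
 fix x assume x: "x \<in> {0..?X}"
 have r: "?N (?R x) <= 4/23" "?N (?R' x) <= 4/23"
 using a.PR_taylor_bounds(2)[OF A s small(1) X x] b.PR_taylor_bounds(2)[OF A s small(2) X x] .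
 have "?N (%w. ?R x w * ?R' x w) <= 4/23 * (4/23)"
 by (rule order.trans[OF taylor_norm_mult[OF TNset hs(3,4)[OF x]]]) (intro mult_mono r taylor_norm_nonneg[OF TNset], simp)
 then have rr: "?N (%w. ?R x w * ?R' x w) <= 16/529" by simp
 have "?N (f2 x) <= ?N (%w. ?R x w * ?R' x w) * ?N (%w. E w x)"
 unfolding f2_def[abs_def] by (rule taylor_norm_mult[OF TNset]) (intro holomorphic_intros hs[OF x] Eh)+
 also have "\<dots> <= 16/529 * exp (- 2 * A * x)"
 unfolding E_def using x by (intro mult_mono rr N_exp taylor_norm_nonneg[OF TNset]) auto
 finally show "?N (f2 x) <= 16/529 * exp (- 2 * A * x)" .
 qed
 have pd3: "param_dom lborel upper (%x z. (indicator {?X<..} x *\<^sub>R (- 1 * cnj (\<Delta> x))) * E z x)" by (rule pd) simp_all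
 have N3: "ennreal (?N I3) <= (NN x. ennreal (indicator {?X<..} x * w x))"
 proof -
 have "ennreal (?N I3) <= (NN x. ennreal (?N (%z. (indicator {?X<..} x *\<^sub>R (- 1 * cnj (\<Delta> x))) * E z x)))"
 unfolding I3_def[abs_def] by (rule taylor_norm_integral[OF TNset pd3])
 also have "\<dots> <= (NN x. ennreal (indicator {?X<..} x * w x))"
 proof (intro nn_integral_mono ennreal_leI)
 fix x
 have "?N (%z. (indicator {?X<..} x *\<^sub>R (- 1 * cnj (\<Delta> x))) * E z x) = cmod (indicator {?X<..} x *\<^sub>R (- 1 * cnj (\<Delta> x))) * ?N (%z. E z x)"
 by (rule taylor_norm_cmult[OF TNset Eh])
 also have "\<dots> <= indicator {?X<..} x * w x"
 proof (cases "x \<in> {?X<..}")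
 case True
 then have "x >= 0" using X by auto
 then show ?thesis using True N_exp[of x K] by (simp add: w_def E_def mult_left_mono)
 qed simp
 finally show "?N (%z. (indicator {?X<..} x *\<^sub>R (- 1 * cnj (\<Delta> x))) * E z x) <= indicator {?X<..} x * w x" .
 qed
 finally show ?thesis .
 qed
 have ind_i: "integrable lborel (%x. indicator S x * w x)" if "S \<in> sets borel" for S
 using integrable_mult_indicator[OF _ wi, of S] that by simp
 have half: "(NN x. ennreal (indicator {0..?X} x * (cmod (\<Delta> x) * (c * exp (- 2 * A * x))))) <= ennreal (c * (LBINT x. w x))" if c: "c >= 0" for c
 proof -
 have "(NN x. ennreal (indicator {0..?X} x * (cmod (\<Delta> x) * (c * exp (- 2 * A * x))))) <= (NN x. ennreal (c * w x))"
 using c by (intro nn_integral_mono ennreal_leI) (auto simp: w_def indicator_def mult_ac)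
 also have "\<dots> = ennreal (LBINT x. c * w x)" using wi c w0 by (intro nn_integral_eq_integral) auto
 finally show ?thesis by simp
 qed
 have D0: "(LBINT x. w x) >= 0" by (rule LINT_nonneg) (rule w0)
 have le: "?N J <= c" if "ennreal (?N J) <= ennreal c" "c >= 0" for J c using that by (simp add: ennreal_le_iff)
 have b1: "?N I1 <= 47/529 * (LBINT x. w x)"
 proof (rule le)
 show "ennreal (?N I1) <= ennreal (47/529 * (LBINT x. w x))" by (rule order.trans[OF N1[unfolded complex_mod_cnj] half]) simp
 qed (use D0 in simp)
 have b2: "?N I2 <= 16/529 * (LBINT x. w x)"
 proof (rule le)
 show "ennreal (?N I2) <= ennreal (16/529 * (LBINT x. w x))" by (rule order.trans[OF N2[unfolded norm_minus_cancel] half]) simp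
 qed (use D0 in simp)
 have b3: "?N I3 <= tl n"
 proof (rule le)
 have "(NN x. ennreal (indicator {?X<..} x * w x)) = ennreal (tl n)"
 unfolding tl_def using w0 by (intro nn_integral_eq_integral ind_i) auto
 then show "ennreal (?N I3) <= ennreal (tl n)" using N3 by simp
 show "tl n >= 0" unfolding tl_def using w0 by (intro LINT_nonneg mult_nonneg_nonneg) auto
 qed
 have hI1: "I1 holomorphic_on upper"
 unfolding I1_def[abs_def] set_lebesgue_integral_def by (rule holomorphic_param_integral[OF param_dom_indefinite[OF c\<Delta>i open_upper_half_plane c1 h1] open_upper_half_plane])
 have hI2: "I2 holomorphic_on upper"
 proof -
 have "set_integrable lborel {0..?X} (%x. - \<Delta> x)" using \<Delta>i[of 0 ?X] by (simp add: set_integrable_def)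
 then show ?thesis
 unfolding I2_def[abs_def] set_lebesgue_integral_def by (rule holomorphic_param_integral[OF param_dom_indefinite[OF _ open_upper_half_plane c2 h2] open_upper_half_plane])
 qed
 have hI3: "I3 holomorphic_on upper" unfolding I3_def[abs_def] by (rule holomorphic_param_integral[OF pd3 open_upper_half_plane])
 have "?N (F n) = ?N (%z. I1 z + I2 z + I3 z)" by (rule taylor_norm_cong[OF TNset F_hol split])
 also have "\<dots> <= ?N (%z. I1 z + I2 z) + ?N I3" by (rule taylor_norm_add[OF TNset holomorphic_on_add[OF hI1 hI2] hI3])
 also have "\<dots> <= ?N I1 + ?N I2 + ?N I3" by (intro add_right_mono taylor_norm_add[OF TNset hI1 hI2])
 also have "\<dots> <= 47/529 * (LBINT x. w x) + 16/529 * (LBINT x. w x) + tl n" by (intro add_mono b1 b2 b3)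
 also have "\<dots> <= (LBINT x. w x) / 2 + tl n" using D0 by simp
 finally show ?thesis .
 qed
 have "tl \<leadsto> (LBINT (x::real). 0)"
 unfolding tl_def
 proof (rule integral_dominated_convergence[where w = w])
 show "AE x in lborel. (%n. indicator {real n<..} x * w x) \<leadsto> 0"
 proof (rule AE_I2)
 fix x
 have "\<forall>\<^sub>F n in sequentially. x <= real n" by real_asymp
 then have "\<forall>\<^sub>F n in sequentially. indicator {real n<..} x * w x = 0" by eventually_elim simp
 then show "(%n. indicator {real n<..} x * w x) \<leadsto> 0" by (rule tendsto_eventually)
 qed
 show "AE x in lborel. norm (indicator {real n<..} x * w x) <= w x" for n
 using w0 by (intro AE_I2) (simp add: indicator_def)
 qed (use wi in auto)
 from tendsto_add[OF tendsto_const this, of "(LBINT x. w x) / 2"]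
 have lim: "(%n. (LBINT x. w x) / 2 + tl n) \<leadsto> (LBINT x. w x) / 2" by simp
 have zi: "Im (Complex 0 (A + s)) > 0" using A s by simp
 let ?C = "cball (Complex 0 (A + s)) (Im (Complex 0 (A + s)) / 2)"
 have "uniform_limit ?C F (%z. a.schur z - b.schur z - H z) sequentially"
 unfolding F_def by (intro uniform_limit_intros a.schur_uniform(2) b.schur_uniform(2) zi)
 from taylor_norm_limit[OF TNset F_hol _ a.schur_uniform(1)[OF zi] this FN lim]
 have "?N (%z. a.schur z - b.schur z - H z) <= (LBINT x. w x) / 2" using zi by simp
 then show ?thesis unfolding H_def E_def w_def \<Delta>_def .
qed


section \<open>The two-sided estimate\<close>

lemma nontangential_value_eqI:
 assumes lim: "\<And>\<alpha>. \<alpha> > 0 ==> (f \<longlongrightarrow> w) (at (cof t) within stolz_angle \<alpha> t)"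
 shows "nontangential_value f t = w"
 unfolding nontangential_value_def
proof (rule the_equality)
 show "\<forall>\<alpha>>0. (f \<longlongrightarrow> w) (at (cof t) within stolz_angle \<alpha> t)" using lim by blast
 fix v assume v: "\<forall>\<alpha>>0. (f \<longlongrightarrow> v) (at (cof t) within stolz_angle \<alpha> t)"
 have "cof t islimpt stolz_angle 1 t" unfolding islimpt_approachable
 proof (intro allI impI)
 fix e :: real assume e: "e > 0"
 have "Complex t (e / 2) \<in> stolz_angle 1 t" using e by (simp add: stolz_angle_def)
 moreover have "Complex t (e / 2) - cof t = Complex 0 (e / 2)" by (simp add: complex_eq_iff)
 then have "dist (Complex t (e / 2)) (cof t) = e / 2" using e by (simp add: dist_norm cmod_def)
 ultimately show "\<exists>z\<in>stolz_angle 1 t. z \<noteq> cof t & dist z (cof t) < e"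
 using e by (intro bexI[of _ "Complex t (e / 2)"]) (auto simp: complex_eq_iff)
 qed
 then have "\<not> trivial_limit (at (cof t) within stolz_angle 1 t)" by (simp add: trivial_limit_within)
 then show "v = w" by (rule tendsto_unique) (use v lim[of 1] in auto)
qed

lemma (in L2_potential) schur_boundary_function:
 obtains b where "b \<in> borel_measurable borel" "integrable lborel (%s. (norm (b s))\<^sup>2)" "AE t in lborel. schur_boundary q t = b t"
 "\<And>z. Im z > 0 ==> (LBINT s. b s / (of_real s - z)) = 2 * pi * \<i> * schur z"
 "\<And>z. Im z > 0 ==> integrable lborel (%s. b s / (of_real s - z))"
proof -
 interpret hardy_function schur "2 * pi * energy"
 by unfold_locales (auto intro: schur_holomorphic schur_norm schur_H2 simp: energy_nonneg)
 obtain b where b: "b \<in> borel_measurable borel" "integrable lborel (%s. (norm (b s))\<^sup>2)"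
 "\<And>z. Im z > 0 ==> (LBINT s. b s / (of_real s - z)) = 2 * pi * \<i> * schur z"
 "\<And>z. Im z > 0 ==> integrable lborel (%s. b s / (of_real s - z))"
 and nt: "AE t in lebesgue. \<forall>\<alpha>>0. (schur \<longlongrightarrow> b t) (at (cof t) within stolz_angle \<alpha> t)"
 by (rule boundary_function) (rule that; (assumption | simp only:))
 have "schur_boundary q t = b t" if t: "\<forall>\<alpha>>0. (schur \<longlongrightarrow> b t) (at (cof t) within stolz_angle \<alpha> t)" for t
 unfolding schur_boundary_def
 proof (rule nontangential_value_eqI)
 fix \<alpha> :: real assume "\<alpha> > 0"
 with t have l: "(schur \<longlongrightarrow> b t) (at (cof t) within stolz_angle \<alpha> t)" by blast
 have "\<forall>\<^sub>F z in at (cof t) within stolz_angle \<alpha> t. schur z = schur_function q z"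
 unfolding eventually_at_filter by (rule always_eventually) (simp add: stolz_angle_def schur_function_eq')
 from Lim_transform_eventually[OF l this] show "(schur_function q \<longlongrightarrow> b t) (at (cof t) within stolz_angle \<alpha> t)" .
 qed
 then have "AE t in lborel. schur_boundary q t = b t" using nt unfolding AE_completion_iff by (auto elim: eventually_mono)
 from that[OF b(1,2) this b(3,4)] show thesis .
qed

text \<open>Each derivative of \<open>exp (\<i> z xi)\<close> at \<open>\<i> (A + s)\<close>, multiplied by \<open>s ^ j / fact j\<close>, is a Poisson weight times \<open>exp (- A xi)\<close>, up to a unimodular factor.\<close>
lemma taylor_norm_half_line:
 fixes k :: "real => complex"
 assumes km: "k \<in> borel_measurable borel" and k2: "(NN xi. ennreal ((norm (k xi))^2)) < \<infinity>"
 and supp: "\<And>xi. xi < 0 ==> k xi = 0" and A: "A > 0" and s: "s > 0"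
 shows "taylor_norm s K (Complex 0 (A + s)) (%z. LBINT xi. k xi * exp (\<i> * z * cof (1 * xi))) =
 (\<Sum>j\<le>K. norm (LBINT xi. (k xi * cof (exp (- A * xi))) * cof (poisson_weight j (s * xi))))"
 unfolding taylor_norm_def
proof (rule sum.cong[OF refl])
 fix j
 let ?z = "Complex 0 (A + s)"
 have z: "?z \<in> upper" using A s by simp
 have d: "(deriv ^^ j) (%w. c * exp (\<i> * w * cof x)) = (%w. c * (\<i> * cof x) ^ j * exp (\<i> * w * cof x))" for c x
 proof (induction j)
 case (Suc j)
 have "((%w. c * (\<i> * cof x) ^ j * exp (\<i> * w * cof x)) has_field_derivative c * (\<i> * cof x) ^ Suc j * exp (\<i> * w * cof x)) (at w)" for w
 by (auto intro!: derivative_eq_intros)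
 note D = DERIV_imp_deriv[OF this]
 show ?case by (rule ext) (simp only: funpow.simps(2) comp_def Suc.IH D)
 qed simp
 let ?I = "LBINT xi. (k xi * cof (exp (- A * xi))) * cof (poisson_weight j (s * xi))"
 have e: "cof (s ^ j / fact j) * (c * (\<i> * cof x) ^ j * exp (\<i> * ?z * cof x)) = \<i> ^ j * ((c * cof (exp (- A * x))) * cof (poisson_weight j (s * x)))" for c x
 proof -
 have "\<i> * ?z * cof x = cof (- A * x) + cof (- (s * x))" by (simp add: complex_eq_iff algebra_simps)
 then have "exp (\<i> * ?z * cof x) = cof (exp (- A * x)) * cof (exp (- (s * x)))" by (simp only: exp_add exp_of_real)
 moreover have "poisson_weight j (s * x) = exp (- (s * x)) * (s ^ j / fact j) * x ^ j" by (simp add: poisson_weight_def power_mult_distrib)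
 ultimately show ?thesis by (simp only: power_mult_distrib of_real_mult of_real_power mult_ac)
 qed
 have "cof (s ^ j / fact j) * (LBINT xi. k xi * (\<i> * cof xi) ^ j * exp (\<i> * ?z * cof xi)) = \<i> ^ j * ?I"
 by (simp only: integral_mult_right_zero[symmetric] e)
 then have n1: "norm (cof (s ^ j / fact j) * (LBINT xi. k xi * (\<i> * cof xi) ^ j * exp (\<i> * ?z * cof xi))) = norm ?I"
 by (simp only: norm_mult norm_power norm_ii power_one mult_1_left)
 have n2: "norm (cof (s ^ j / fact j)) = s ^ j / fact j" using s by (simp only: norm_of_real) simp
 define h where "h xi w = k xi * exp (\<i> * w * cof (1 * xi))" for xi w
 have hfun: "h xi = (%w. k xi * exp (\<i> * w * cof xi))" for xi by (rule ext) (simp add: h_def)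
 have pd: "param_dom lborel upper h" unfolding h_def[abs_def] by (rule param_dom_half_line[OF km k2 supp zero_less_one])
 have dh: "(deriv ^^ j) (h xi) ?z = k xi * (\<i> * cof xi) ^ j * exp (\<i> * ?z * cof xi)" for xi
 by (subst hfun) (rule fun_cong[OF d])
 have "(deriv ^^ j) (%z. LBINT xi. h xi z) ?z = (LBINT xi. (deriv ^^ j) (h xi) ?z)"
 by (rule higher_deriv_param_integral[OF pd open_upper_half_plane z])
 also have "\<dots> = (LBINT xi. k xi * (\<i> * cof xi) ^ j * exp (\<i> * ?z * cof xi))"
 by (rule LINT_cong[OF refl]) (rule dh)
 finally have n3: "(deriv ^^ j) (%z. LBINT xi. h xi z) ?z = (LBINT xi. k xi * (\<i> * cof xi) ^ j * exp (\<i> * ?z * cof xi))" .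
 have "s ^ j / fact j * cmod ((deriv ^^ j) (%z. LBINT xi. h xi z) ?z) = norm ?I"
 by (rule trans[OF _ n1], subst n3, subst norm_mult, subst n2, rule refl)
 then show "s ^ j / fact j * cmod ((deriv ^^ j) (%z. LBINT xi. k xi * exp (\<i> * z * cof (1 * xi))) ?z) = norm ?I"
 unfolding h_def .
qed

text \<open>Here \<open>g\<close> represents the Fourier transform of the boundary values, \<open>G\<close> is its normalized half-line part, and \<open>h\<close> is the density of the leading term after the substitution \<open>xi = 2 x\<close>.  Their difference \<open>k\<close> has weighted norm at most \<open>\<delta> / 2\<close>, while that of \<open>h\<close> is \<open>\<delta>\<close>.\<close>
theorem borel_estimate:
 fixes q q' :: "real => complex"
 assumes q: "L2_potential q" and q': "L2_potential q'" and supp: "\<And>x. x < 0 ==> q x = 0" "\<And>x. x < 0 ==> q' x = 0"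
 obtains g where "g \<in> borel_measurable borel"
 "\<And>A. W1_norm A (%t. schur_boundary q t - schur_boundary q' t) = (NN xi. ennreal (indicator {0..} xi * (cmod (g xi) * exp (- A * xi))))"
 "\<And>A. A > 0 ==> 12 * L2_potential.energy q <= A ==> 12 * L2_potential.energy q' <= A ==>
 ennreal (sqrt (pi / 2)) * (NN x. ennreal (cmod (q x - q' x) * exp (- (2 * A) * x))) <= W1_norm A (%t. schur_boundary q t - schur_boundary q' t) &
 W1_norm A (%t. schur_boundary q t - schur_boundary q' t) <= ennreal (2 * sqrt (2 * pi)) * (NN x. ennreal (cmod (q x - q' x) * exp (- (2 * A) * x)))"
proof -
 interpret a: L2_potential q by (rule q)
 interpret b: L2_potential q' by (rule q')
 let ?F = "%t. schur_boundary q t - schur_boundary q' t"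
 obtain u where u[measurable]: "u \<in> borel_measurable borel" and u2: "integrable lborel (%s. (norm (u s))\<^sup>2)" and uae: "AE t in lborel. schur_boundary q t = u t"
 and uc: "\<And>z. Im z > 0 ==> (LBINT s. u s / (of_real s - z)) = 2 * pi * \<i> * a.schur z" and ui: "\<And>z. Im z > 0 ==> integrable lborel (%s. u s / (of_real s - z))"
 by (rule a.schur_boundary_function) (rule that; (assumption | simp only:))
 obtain v where v[measurable]: "v \<in> borel_measurable borel" and v2: "integrable lborel (%s. (norm (v s))\<^sup>2)" and vae: "AE t in lborel. schur_boundary q' t = v t"
 and vc: "\<And>z. Im z > 0 ==> (LBINT s. v s / (of_real s - z)) = 2 * pi * \<i> * b.schur z" and vi: "\<And>z. Im z > 0 ==> integrable lborel (%s. v s / (of_real s - z))"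
 by (rule b.schur_boundary_function) (rule that; (assumption | simp only:))
 have dm: "(%t. u t - v t) \<in> borel_measurable borel" by measurable
 have L2d: "(NN x. ennreal ((norm (f x - h x))^2)) < \<infinity>" if [measurable]: "f \<in> borel_measurable borel" "h \<in> borel_measurable borel"
 and f: "(NN x. ennreal ((norm (f x))^2)) < \<infinity>" "(NN x. ennreal ((norm (h x))^2)) < \<infinity>" for f h :: "real => complex"
 proof -
 have "(NN x. ennreal ((norm (f x - h x))^2)) <= 2 * (NN x. ennreal ((norm (f x - 0))^2)) + 2 * (NN x. ennreal ((norm (0 - h x))^2))"
 by (rule nn_L2_triangle) measurable
 also have "\<dots> < \<infinity>" using f by (simp add: ennreal_mult_less_top)
 finally show ?thesis .
 qed
 have "(NN x. ennreal ((norm (u x - v x))^2)) < \<infinity>" using u2 v2 by (intro L2d u v) (simp_all add: integrable_iff_bounded)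
 then have d2: "integrable lborel (%x. (norm (u x - v x))\<^sup>2)" by (intro integrableI_nonneg) auto
 have dae: "AE t in lborel. ?F t = u t - v t" using uae vae by eventually_elim simp
 obtain g where g[measurable]: "g \<in> borel_measurable borel" and g2: "(NN xi. ennreal ((norm (g xi))^2)) < \<infinity>"
 and gae: "AE xi in lborel. fourier_L2 ?F xi = g xi"
 and gz: "\<And>z. Im z > 0 ==> (LBINT xi. g xi * (indicator {0..} xi *\<^sub>R exp (\<i> * z * cof xi))) = cof (1 / sqrt (2 * pi)) * (LBINT t. (u t - v t) * (1 / (\<i> * (cof t - z))))"
 by (rule fourier_L2_half_plane[OF dm d2 dae]) (rule that; (assumption | simp only:))
 have W: "W1_norm A ?F = (NN xi. ennreal (indicator {0..} xi * (cmod (g xi) * exp (- A * xi))))" for A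
 unfolding W1_norm_def by (subst nn_integral_restrict_space, simp, unfold nn_integral_completion, rule nn_integral_cong_AE)
 (rule eventually_mono[OF gae], simp add: indicator_def)
 define c where "c = sqrt (2 * pi)"
 have c: "c > 0" and c2: "c * c = 2 * pi" by (simp_all add: c_def)
 define \<Delta> where "\<Delta> x = q x - q' x" for x
 have \<Delta>m[measurable]: "\<Delta> \<in> borel_measurable borel" using a.q_meas b.q_meas unfolding \<Delta>_def[abs_def] by measurable
 have \<Delta>0: "\<Delta> x = 0" if "x < 0" for x using supp that by (simp add: \<Delta>_def)
 have \<Delta>2: "(NN x. ennreal ((norm (\<Delta> x))^2)) < \<infinity>"
 unfolding \<Delta>_def by (rule L2d) (simp_all add: a.nn_energy b.nn_energy)
 define G where "G xi = cof (indicator {0..} xi / c) * g xi" for xi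
 define h where "h xi = cnj (\<Delta> (xi / 2)) / 2" for xi
 define k where "k xi = G xi - h xi" for xi
 have Gm[measurable]: "G \<in> borel_measurable borel" unfolding G_def[abs_def] by measurable
 have hm[measurable]: "h \<in> borel_measurable borel"
 proof -
 have "cnj \<in> borel_measurable borel" by (rule borel_measurable_continuous_onI) (intro continuous_intros)
 from measurable_compose[OF _ this, of "%xi. \<Delta> (xi / 2)" borel] show ?thesis unfolding h_def[abs_def] by simp
 qed
 have h2x: "h (0 + 2 * x) = cnj (\<Delta> x) / 2" for x by (simp add: h_def)
 have km[measurable]: "k \<in> borel_measurable borel" unfolding k_def[abs_def] by measurable
 have G2: "(NN xi. ennreal ((norm (G xi))^2)) < \<infinity>"
 proof -
 have "ennreal ((norm (G xi))^2) <= ennreal ((1 / c)^2) * ennreal ((norm (g xi))^2)" for xi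
 proof -
 have "norm (G xi) <= 1 / c * norm (g xi)" unfolding G_def norm_mult norm_of_real using c by (intro mult_right_mono) (auto simp: indicator_def)
 then have "(norm (G xi))\<^sup>2 <= (1 / c * norm (g xi))\<^sup>2" by (rule power_mono) simp
 then show ?thesis by (subst ennreal_mult[symmetric]) (simp_all only: zero_le_power2 power_mult_distrib ennreal_leI)
 qed
 then have "(NN xi. ennreal ((norm (G xi))^2)) <= (NN xi. ennreal ((1 / c)^2) * ennreal ((norm (g xi))^2))" by (intro nn_integral_mono)
 also have "\<dots> < \<infinity>" using g2 by (subst nn_integral_cmult) (simp_all add: ennreal_mult_less_top)
 finally show ?thesis .
 qed
 have hL2: "(NN xi. ennreal ((norm (h xi))^2)) < \<infinity>"
 proof -
 have "(NN xi. ennreal ((norm (h xi))^2)) = ennreal \<bar>2\<bar> * (NN x. ennreal ((norm (h (0 + 2 * x)))^2))"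
 proof (rule nn_integral_real_affine)
 show "(%xi. ennreal ((norm (h xi))^2)) \<in> borel_measurable borel" by measurable
 qed simp
 also have "\<dots> <= ennreal \<bar>2\<bar> * (NN x. ennreal ((norm (\<Delta> x))^2))"
 unfolding h2x by (intro mult_left_mono nn_integral_mono ennreal_leI power_mono) (simp_all add: norm_divide)
 also have "\<dots> < \<infinity>" using \<Delta>2 by (simp add: ennreal_mult_less_top)
 finally show ?thesis .
 qed
 have k2: "(NN xi. ennreal ((norm (k xi))^2)) < \<infinity>" unfolding k_def by (rule L2d[OF Gm hm G2 hL2])
 have G0: "G xi = 0" and h0: "h xi = 0" and k0: "k xi = 0" if "xi < 0" for xi using that \<Delta>0[of "xi / 2"] by (simp_all add: G_def h_def k_def)
 have kD: "(LBINT xi. k xi * exp (\<i> * z * cof (1 * xi))) = a.schur z - b.schur z - (LBINT x. cnj (q x - q' x) * exp (2 * \<i> * z * cof x))" if z: "Im z > 0" for z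
 proof -
 have zu: "z \<in> upper" using z by simp
 let ?e = "%xi. exp (\<i> * z * cof (1 * xi))"
 have iG: "integrable lborel (%xi. G xi * ?e xi)" by (rule param_dom_integrable[OF param_dom_half_line[OF Gm G2 G0 zero_less_one] zu])
 have ih: "integrable lborel (%xi. h xi * ?e xi)" by (rule param_dom_integrable[OF param_dom_half_line[OF hm hL2 h0 zero_less_one] zu])
 have "(LBINT xi. G xi * ?e xi) = (LBINT xi. cof (1 / c) * (g xi * (indicator {0..} xi *\<^sub>R exp (\<i> * z * cof xi))))"
 unfolding G_def by (intro LINT_cong refl) (auto simp: indicator_def)
 also have "\<dots> = cof (1 / c) * (cof (1 / c) * (LBINT t. (u t - v t) * (1 / (\<i> * (cof t - z)))))"
 unfolding integral_mult_right_zero gz[OF z] c_def ..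
 also have "(LBINT t. (u t - v t) * (1 / (\<i> * (cof t - z)))) = (LBINT t. (1 / \<i>) * (u t / (of_real t - z) - v t / (of_real t - z)))"
 proof (rule LINT_cong[OF refl])
 have alg: "(a - b) * (1 / (i * w)) = (1 / i) * (a / w - b / w)" for a b i w :: complex
 proof -
 have "(1 / i) * (a / w - b / w) = (1 / i) * ((a - b) / w)" by (simp only: diff_divide_distrib)
 also have "\<dots> = (1 * (a - b)) / (i * w)" by (rule times_divide_times_eq)
 finally show ?thesis by simp
 qed
 show "(u t - v t) * (1 / (\<i> * (cof t - z))) = (1 / \<i>) * (u t / (of_real t - z) - v t / (of_real t - z))" for t by (rule alg)
 qed
 also have "\<dots> = (1 / \<i>) * (2 * pi * \<i> * a.schur z - 2 * pi * \<i> * b.schur z)"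
 by (simp only: integral_mult_right_zero LINT_diff[OF ui[OF z] vi[OF z]] uc[OF z] vc[OF z])
 also have "\<dots> = cof (c * c) * (a.schur z - b.schur z)" unfolding c2 by (simp add: algebra_simps)
 also have "cof (1 / c) * (cof (1 / c) * (cof (c * c) * (a.schur z - b.schur z))) = a.schur z - b.schur z"
 using c by simp
 finally have 1: "(LBINT xi. G xi * ?e xi) = a.schur z - b.schur z" .
 have "(LBINT xi. h xi * ?e xi) = \<bar>2\<bar> *\<^sub>R (LBINT x. h (0 + 2 * x) * ?e (0 + 2 * x))"
 by (rule lborel_integral_real_affine) simp
 also have "\<dots> = (LBINT x. 2 *\<^sub>R (h (0 + 2 * x) * ?e (0 + 2 * x)))" by simp
 also have "\<dots> = (LBINT x. cnj (q x - q' x) * exp (2 * \<i> * z * cof x))"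
 proof (rule LINT_cong[OF refl])
 fix x
 have "?e (0 + 2 * x) = exp (2 * \<i> * z * cof x)" by (rule arg_cong[where f = exp]) simp
 then show "2 *\<^sub>R (h (0 + 2 * x) * ?e (0 + 2 * x)) = cnj (q x - q' x) * exp (2 * \<i> * z * cof x)"
 unfolding h2x \<Delta>_def by (simp add: scaleR_conv_of_real)
 qed
 finally have 2: "(LBINT xi. h xi * ?e xi) = (LBINT x. cnj (q x - q' x) * exp (2 * \<i> * z * cof x))" .
 show ?thesis unfolding k_def left_diff_distrib LINT_diff[OF iG ih] 1 2 ..
 qed
 have main: "ennreal (sqrt (pi / 2)) * (NN x. ennreal (cmod (q x - q' x) * exp (- (2 * A) * x))) <= W1_norm A ?F &
 W1_norm A ?F <= ennreal (2 * sqrt (2 * pi)) * (NN x. ennreal (cmod (q x - q' x) * exp (- (2 * A) * x)))"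
 if A: "A > 0" and small: "12 * a.energy <= A" "12 * b.energy <= A" for A
 proof -
 define \<delta> where "\<delta> = (LBINT x. cmod (\<Delta> x) * exp (- 2 * A * x))"
 have wint: "integrable lborel (%xi. k xi * cof (exp (- a * xi)))" if [measurable]: "k \<in> borel_measurable borel"
 and kk: "(NN xi. ennreal ((norm (k xi))^2)) < \<infinity>" "\<And>xi. xi < 0 ==> k xi = 0" and a: "a > 0" for k :: "real => complex" and a
 proof -
 have "k xi * cof (indicator {0..} xi * exp (- a * xi)) = k xi * cof (exp (- a * xi))" for xi
 using kk(2)[of xi] by (cases "xi < 0") simp_all
 then show ?thesis using half_line_weight_integrable[OF \<open>k \<in> borel_measurable borel\<close> kk(1) a] by (simp only:)
 qed
 have wi: "integrable lborel (%x. cmod (\<Delta> x) * exp (- 2 * A * x))"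
 using integrable_norm[OF wint[OF \<Delta>m \<Delta>2 \<Delta>0, of "2 * A"]] A by (simp add: norm_mult)
 have \<delta>0: "\<delta> >= 0" unfolding \<delta>_def by (rule LINT_nonneg) simp
 have \<delta>nn: "(NN x. ennreal (cmod (q x - q' x) * exp (- (2 * A) * x))) = ennreal \<delta>"
 using nn_integral_eq_integral[OF wi] unfolding \<delta>_def \<Delta>_def by simp
 let ?w = "%f xi. f xi * cof (exp (- A * xi))"
 have wm: "(%xi. ennreal (norm (?w f xi))) \<in> borel_measurable lborel" if [measurable]: "f \<in> borel_measurable borel" for f by measurable
 have K: "(NN xi. ennreal (norm (?w k xi))) <= ennreal (\<delta> / 2)"
 proof (rule L1_norm_by_poisson_weights)
 show "integrable lborel (?w k)" by (rule wint[OF km k2 k0 A])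
 show "?w k xi = 0" if "xi < 0" for xi using k0[OF that] by simp
 fix s :: real and K assume s: "s > 0"
 let ?N = "taylor_norm s K (Complex 0 (A + s))"
 have "(\<Sum>j\<le>K. norm (LBINT xi. ?w k xi * cof (poisson_weight j (s * xi)))) = ?N (%z. LBINT xi. k xi * exp (\<i> * z * cof (1 * xi)))"
 by (rule taylor_norm_half_line[OF km k2 k0 A s, symmetric])
 also have "\<dots> = ?N (%z. a.schur z - b.schur z - (LBINT x. cnj (q x - q' x) * exp (2 * \<i> * z * cof x)))"
 proof (rule taylor_norm_cong[OF less_imp_le[OF s] open_upper_half_plane])
 show "(%z. LBINT xi. k xi * exp (\<i> * z * cof (1 * xi))) holomorphic_on upper"
 by (rule holomorphic_param_integral[OF param_dom_half_line[OF km k2 k0 zero_less_one] open_upper_half_plane])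
 qed (use A s kD in auto)
 also have "\<dots> <= (LBINT x. cmod (q x - q' x) * exp (- 2 * A * x)) / 2"
 by (rule schur_difference_taylor[OF q q' A s small]) (simp add: supp)
 finally show "(\<Sum>j\<le>K. norm (LBINT xi. ?w k xi * cof (poisson_weight j (s * xi)))) <= \<delta> / 2" unfolding \<delta>_def \<Delta>_def .
 qed
 have Hn: "(NN xi. ennreal (norm (?w h xi))) = ennreal \<delta>"
 proof -
 have "(NN xi. ennreal (norm (?w h xi))) = ennreal \<bar>2\<bar> * (NN x. ennreal (norm (?w h (0 + 2 * x))))"
 proof (rule nn_integral_real_affine)
 show "(%xi. ennreal (norm (?w h xi))) \<in> borel_measurable borel" by measurable
 qed simp
 also have "\<dots> = (NN x. ennreal \<bar>2\<bar> * ennreal (norm (?w h (0 + 2 * x))))"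
 by (rule nn_integral_cmult[symmetric]) measurable
 also have "\<dots> = (NN x. ennreal (cmod (q x - q' x) * exp (- (2 * A) * x)))"
 proof (rule nn_integral_cong)
 fix x
 have "\<bar>2\<bar> * norm (?w h (0 + 2 * x)) = cmod (q x - q' x) * exp (- (2 * A) * x)"
 unfolding h2x \<Delta>_def norm_mult norm_divide complex_mod_cnj norm_of_real by (simp add: mult.left_commute)
 then show "ennreal \<bar>2\<bar> * ennreal (norm (?w h (0 + 2 * x))) = ennreal (cmod (q x - q' x) * exp (- (2 * A) * x))"
 by (subst ennreal_mult[symmetric]) (simp_all only: abs_ge_zero norm_ge_zero)
 qed
 finally show ?thesis unfolding \<delta>nn .
 qed
 define g1 where "g1 = (LBINT xi. norm (?w G xi))"
 have Gi: "integrable lborel (?w G)" by (rule wint[OF Gm G2 G0 A])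
 have Gn: "(NN xi. ennreal (norm (?w G xi))) = ennreal g1"
 unfolding g1_def by (rule nn_integral_eq_integral[OF integrable_norm[OF Gi]]) simp
 have g10: "g1 >= 0" unfolding g1_def by (rule LINT_nonneg) simp
 have tri: "(NN xi. ennreal (norm (?w f1 xi))) <= (NN xi. ennreal (norm (?w f2 xi))) + (NN xi. ennreal (norm (?w k xi)))"
 if f2: "f2 \<in> borel_measurable borel" and n: "\<And>xi. norm (f1 xi) <= norm (f2 xi) + norm (k xi)" for f1 f2
 proof -
 have "ennreal (norm (?w f1 xi)) <= ennreal (norm (?w f2 xi)) + ennreal (norm (?w k xi))" for xi
 unfolding norm_mult ennreal_plus[OF mult_nonneg_nonneg[OF norm_ge_zero norm_ge_zero] mult_nonneg_nonneg[OF norm_ge_zero norm_ge_zero], symmetric] distrib_right[symmetric]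
 by (intro ennreal_leI mult_right_mono n norm_ge_zero)
 then have "(NN xi. ennreal (norm (?w f1 xi))) <= (NN xi. ennreal (norm (?w f2 xi)) + ennreal (norm (?w k xi)))" by (intro nn_integral_mono)
 then show ?thesis by (simp only: nn_integral_add[OF wm[OF f2] wm[OF km]])
 qed
 have gk: "norm (G xi) <= norm (h xi) + norm (k xi)" for xi using norm_triangle_ineq[of "h xi" "k xi"] by (simp add: k_def)
 have "ennreal g1 <= ennreal \<delta> + ennreal (\<delta> / 2)"
 unfolding Gn[symmetric] Hn[symmetric] by (rule order.trans[OF tri[OF hm gk] add_left_mono[OF K]])
 then have up: "g1 <= \<delta> + \<delta> / 2" using \<delta>0 by (simp add: ennreal_plus[symmetric] ennreal_le_iff del: ennreal_plus)
 have hk: "norm (h xi) <= norm (G xi) + norm (k xi)" for xi using norm_triangle_ineq4[of "G xi" "k xi"] by (simp add: k_def)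
 have "ennreal \<delta> <= ennreal g1 + ennreal (\<delta> / 2)"
 unfolding Gn[symmetric] Hn[symmetric] by (rule order.trans[OF tri[OF Gm hk] add_left_mono[OF K]])
 then have lo: "\<delta> <= g1 + \<delta> / 2" using \<delta>0 g10 by (simp add: ennreal_plus[symmetric] ennreal_le_iff del: ennreal_plus)
 have WA: "W1_norm A ?F = ennreal (c * g1)"
 proof -
 have "W1_norm A ?F = (NN xi. ennreal c * ennreal (norm (?w G xi)))" unfolding W
 proof (rule nn_integral_cong)
 fix xi
 have "indicator {0..} xi * (cmod (g xi) * exp (- A * xi)) = c * norm (?w G xi)"
 using c unfolding G_def norm_mult norm_of_real by (simp add: indicator_def)
 then show "ennreal (indicator {0..} xi * (cmod (g xi) * exp (- A * xi))) = ennreal c * ennreal (norm (?w G xi))"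
 using c by (subst ennreal_mult[symmetric]) auto
 qed
 also have "\<dots> = ennreal c * ennreal g1" unfolding Gn[symmetric] by (rule nn_integral_cmult[OF wm[OF Gm]])
 finally show ?thesis using c g10 by (simp add: ennreal_mult)
 qed
 have sq: "sqrt (pi / 2) = c / 2"
 proof -
 have "sqrt (pi / 2) = sqrt (2 * pi / 4)" by simp
 then show ?thesis unfolding c_def by (simp only: real_sqrt_divide real_sqrt_four)
 qed
 have "c / 2 * \<delta> <= c * g1" using mult_left_mono[of "\<delta> / 2" g1 c] lo c by simp
 moreover have "c * g1 <= 2 * c * \<delta>" using mult_left_mono[of g1 "2 * \<delta>" c] up c \<delta>0 by simp
 ultimately show ?thesis
 unfolding \<delta>nn WA sq c_def[symmetric] using c \<delta>0 by (simp add: ennreal_mult[symmetric] ennreal_leI)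
 qed
 show thesis by (rule that[OF g W main])
qed

text \<open>Lebesgue measurable potentials are replaced by Borel ones on the whole line, because the parameter integrals are taken over products of Borel spaces.\<close>
lemma L2_fun_representative:
 assumes q: "q \<in> L2_fun (lebesgue_on {0..})"
 obtains p where "L2_potential p" "\<And>x. x < 0 ==> p x = 0" "AE x in lebesgue_on {0..}. q x = p x"
 "L2_potential.energy p = (L2norm (lebesgue_on {0..}) q)^2" "schur_boundary q = schur_boundary p"
proof -
 have S: "{0::real..} \<inter> space lebesgue \<in> sets lebesgue" by simp
 have qm: "q \<in> borel_measurable (lebesgue_on {0..})" and qi: "integrable (lebesgue_on {0..}) (%x. (cmod (q x))\<^sup>2)" using q by (auto simp: L2_fun_def)
 have "(%x. indicator {0..} x *\<^sub>R q x) \<in> borel_measurable lebesgue" using qm unfolding borel_measurable_restrict_space_iff[OF S] .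
 from lebesgue_borel_representative[OF this] obtain r where r[measurable]: "r \<in> borel_measurable borel" and rae: "AE x in lborel. indicator {0..} x *\<^sub>R q x = r x" .
 define p where "p x = indicator {0..} x *\<^sub>R r x" for x
 have pm[measurable]: "p \<in> borel_measurable borel" unfolding p_def[abs_def] by measurable
 have pae: "AE x in lebesgue. x \<in> {0..} --> q x = p x" using AE_completion[OF rae] by (rule eventually_mono) (auto simp: p_def)
 have nn: "(NN x. ennreal ((cmod (p x))^2)) = (\<integral>\<^sup>+x. ennreal ((cmod (q x))^2) \<partial>lebesgue_on {0..})"
 proof -
 have "(NN x. ennreal ((cmod (p x))^2)) = (\<integral>\<^sup>+x. ennreal ((cmod (p x))^2) \<partial>lebesgue)" by (rule nn_integral_completion[symmetric])
 also have "\<dots> = (\<integral>\<^sup>+x. ennreal ((cmod (q x))^2) * indicator {0..} x \<partial>lebesgue)"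
 by (rule nn_integral_cong_AE, rule eventually_mono[OF pae]) (auto simp: p_def indicator_def)
 also have "\<dots> = (\<integral>\<^sup>+x. ennreal ((cmod (q x))^2) \<partial>lebesgue_on {0..})" by (rule nn_integral_restrict_space[OF S, symmetric])
 finally show ?thesis .
 qed
 have pi: "integrable lborel (%x. (cmod (p x))\<^sup>2)"
 by (rule integrableI_nonneg) (use nn qi in \<open>auto simp: integrable_iff_bounded\<close>)
 interpret L2_potential p by unfold_locales (fact pm, fact pi)
 have E: "energy = (LINT x|lebesgue_on {0..}. (cmod (q x))\<^sup>2)"
 proof -
 have "ennreal energy = ennreal (LINT x|lebesgue_on {0..}. (cmod (q x))\<^sup>2)"
 unfolding nn_energy[symmetric] nn by (rule nn_integral_eq_integral[OF qi]) simp
 then show ?thesis using energy_nonneg by (simp add: ennreal_inj LINT_nonneg)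
 qed
 have sb: "schur_boundary q = schur_boundary p"
 proof -
 have S': "{0::real<..} \<inter> space lebesgue \<in> sets lebesgue" by simp
 have "AE x in lebesgue_on {0<..}. q x = p x" unfolding AE_restrict_space_iff[OF S'] by (rule eventually_mono[OF pae]) simp
 then have "is_dirac_solution q = is_dirac_solution p" by (intro ext) (rule is_dirac_solution_cong_AE)
 then have "dirac_solution q = dirac_solution p" unfolding dirac_solution_def[abs_def] by (simp only:)
 then show ?thesis unfolding schur_boundary_def[abs_def] schur_function_def[abs_def] weyl_function_def[abs_def] by (simp only:)
 qed
 show thesis
 proof (rule that[OF L2_potential_axioms _ _ _ sb])
 show "p x = 0" if "x < 0" for x using that by (simp add: p_def)
 show "AE x in lebesgue_on {0..}. q x = p x" unfolding AE_restrict_space_iff[OF S] by (rule pae)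
 show "energy = (L2norm (lebesgue_on {0..}) q)^2" unfolding E L2norm_def by (simp add: LINT_nonneg)
 qed
qed

theorem theorem1p3:
  fixes q q' :: "real \<Rightarrow> complex" and A :: real
  assumes "q \<in> L2_fun (lebesgue_on {0..})"
    and "q' \<in> L2_fun (lebesgue_on {0..})"
    and "A \<ge> 12 * max ((L2norm (lebesgue_on {0..}) q)\<^sup>2) ((L2norm (lebesgue_on {0..}) q')\<^sup>2)"
  shows "ennreal (sqrt (pi / 2)) * L1_weighted_norm (2 * A) (\<lambda>x. q x - q' x)
           \<le> W1_norm A (\<lambda>t. schur_boundary q t - schur_boundary q' t)
       \<and> W1_norm A (\<lambda>t. schur_boundary q t - schur_boundary q' t)
           \<le> ennreal (2 * sqrt (2 * pi)) * L1_weighted_norm (2 * A) (\<lambda>x. q x - q' x)"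
proof -
 obtain p where p: "L2_potential p" "\<And>x. x < 0 ==> p x = 0" and pae: "AE x in lebesgue_on {0..}. q x = p x"
 and pE: "L2_potential.energy p = (L2norm (lebesgue_on {0..}) q)^2" and pb: "schur_boundary q = schur_boundary p"
 by (rule L2_fun_representative[OF assms(1)]) (rule that; (assumption | simp only:))
 obtain p' where p': "L2_potential p'" "\<And>x. x < 0 ==> p' x = 0" and pae': "AE x in lebesgue_on {0..}. q' x = p' x"
 and pE': "L2_potential.energy p' = (L2norm (lebesgue_on {0..}) q')^2" and pb': "schur_boundary q' = schur_boundary p'"
 by (rule L2_fun_representative[OF assms(2)]) (rule that; (assumption | simp only:))
 let ?W = "%A. W1_norm A (%t. schur_boundary p t - schur_boundary p' t)" and ?d = "%A. (NN x. ennreal (cmod (p x - p' x) * exp (- (2 * A) * x)))"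
 have [measurable]: "p \<in> borel_measurable borel" "p' \<in> borel_measurable borel" using p(1) p'(1) by (auto simp: L2_potential_def)
 obtain g where g[measurable]: "g \<in> borel_measurable borel"
 and W: "\<And>A. ?W A = (NN xi. ennreal (indicator {0..} xi * (cmod (g xi) * exp (- A * xi))))"
 and main: "\<And>A. A > 0 ==> 12 * L2_potential.energy p <= A ==> 12 * L2_potential.energy p' <= A ==> ennreal (sqrt (pi / 2)) * ?d A <= ?W A & ?W A <= ennreal (2 * sqrt (2 * pi)) * ?d A"
 by (rule borel_estimate[OF p(1) p'(1)]) (erule p(2), erule p'(2), (rule that; (assumption | simp only:)))
 have L: "L1_weighted_norm (2 * B) (%x. q x - q' x) = ?d B" for B
 proof -
 have S: "{0::real..} \<inter> space lebesgue \<in> sets lebesgue" by simp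
 have "L1_weighted_norm (2 * B) (%x. q x - q' x) = (\<integral>\<^sup>+x. ennreal (cmod (p x - p' x) * exp (- (2 * B) * x)) \<partial>lebesgue_on {0..})"
 unfolding L1_weighted_norm_def by (rule nn_integral_cong_AE) (use pae pae' in \<open>eventually_elim, simp\<close>)
 also have "\<dots> = ?d B" unfolding nn_integral_restrict_space[OF S] nn_integral_completion
 by (rule nn_integral_cong) (use p(2) p'(2) in \<open>auto simp: indicator_def\<close>)
 finally show ?thesis .
 qed
 have E: "0 <= L2_potential.energy p" "0 <= L2_potential.energy p'" by (simp_all add: pE pE')
 have A: "12 * L2_potential.energy p <= A" "12 * L2_potential.energy p' <= A" using assms(3) unfolding pE pE' by auto
 show ?thesis unfolding pb pb' L
 proof (cases "A > 0")
 case True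
 show "ennreal (sqrt (pi / 2)) * ?d A <= ?W A & ?W A <= ennreal (2 * sqrt (2 * pi)) * ?d A" by (rule main[OF True A])
 next
 case False
 then have z: "A = 0" "L2_potential.energy p = 0" "L2_potential.energy p' = 0" using A E by auto
 have zero: "AE x in lborel. r x = 0" if "L2_potential r" "L2_potential.energy r = 0" for r
 proof -
 interpret L2_potential r by (rule that(1))
 have m: "(%x. ennreal ((cmod (r x))^2)) \<in> borel_measurable lborel" by measurable
 have "(NN x. ennreal ((cmod (r x))^2)) = 0" using nn_energy that(2) by simp
 then have "AE x in lborel. ennreal ((cmod (r x))^2) = 0" unfolding nn_integral_0_iff_AE[OF m] .
 then show ?thesis by (rule eventually_mono) simp
 qed
 have d0: "?d B = 0" for B
 proof -
 have "?d B = (NN (x::real). 0)"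
 by (rule nn_integral_cong_AE) (use zero[OF p(1) z(2)] zero[OF p'(1) z(3)] in \<open>eventually_elim, simp\<close>)
 then show ?thesis by simp
 qed
 have "?W 1 <= ennreal (2 * sqrt (2 * pi)) * ?d 1" using main[of 1] z by simp
 then have "?W 1 = 0" unfolding d0 by simp
 moreover have gm: "(%xi. ennreal (indicator {0..} xi * (cmod (g xi) * exp (- B * xi)))) \<in> borel_measurable lborel" for B by measurable
 ultimately have "AE xi in lborel. ennreal (indicator {0..} xi * (cmod (g xi) * exp (- 1 * xi))) = 0"
 unfolding W nn_integral_0_iff_AE[OF gm] by blast
 then have "AE xi in lborel. ennreal (indicator {0..} xi * (cmod (g xi) * exp (- A * xi))) = 0"
 proof (rule eventually_mono)
 fix xi assume e: "ennreal (indicator {0..} xi * (cmod (g xi) * exp (- 1 * xi))) = 0"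
 show "ennreal (indicator {0..} xi * (cmod (g xi) * exp (- A * xi))) = 0"
 proof (cases "xi \<in> {0..}")
 case True
 then have "cmod (g xi) * exp (- 1 * xi) <= 0" using e by (simp add: ennreal_eq_0_iff)
 moreover have "exp (- 1 * xi) > 0" by simp
 ultimately have "cmod (g xi) <= 0" by (metis mult_pos_pos not_le)
 then show ?thesis by simp
 qed simp
 qed
 then have "?W A = 0" unfolding W nn_integral_0_iff_AE[OF gm] .
 then show "ennreal (sqrt (pi / 2)) * ?d A <= ?W A & ?W A <= ennreal (2 * sqrt (2 * pi)) * ?d A" unfolding d0 by simp
 qed
qed

end
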